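(* Let $M$ be a complete $C^1$ Finsler manifold modeled on a Banach space that admits a $C^1$ Lipschitz bump function. Let $H:[0,\infty)\times M\times\mathbb{R}\to\mathbb{R}$ be a continuous function satisfying condition (A) (defined in the context), let $h:M\to\mathbb{R}$ be $L$-Lipschitz and bounded, and consider the problem $$u_t+H(t,x,\|u_x\|_x)=0\quad(t>0),\qquad u(0,x)=h(x).\qquad(\ast)$$ Assume that there are constants $K_0,K_1\in\mathbb{R}$ such that $$K_0=\inf\{H(t,x,m):(t,x)\in(0,\infty)\times M,\ |m|\le L\},\qquad K_1=\sup\{H(t,x,m):(t,x)\in(0,\infty)\times M,\ |m|\le L\}.$$ Let $\mathcal{F}$ be the set of all $w:[0,\infty)\times M\to\mathbb{R}$ such that $w$ is a viscosity subsolution of $(\ast)$ and $-K_1t+h(x)\le w(t,x)\le-K_0t+h(x)$ for $(t,x)\in(0,\infty)\times M$, and let $u=\sup\mathcal{F}$. Then $u^*$ is a viscosity subsolution and $(u^* )_*$ is a viscosity supersolution of $(\ast)$. Moreover: (1) if $u^*$ is continuous, then $u^*=(u^* )_*$ and $u^*$ is a viscosity solution of $(\ast)$; (2) if $u^*$ is locally Lipschitz, then $u^*$ is the unique viscosity solution of $(\ast)$ which is bounded in $[0,T)\times M$ for every $T>0$.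
   Context: $C^1$ Finsler manifold (in the sense of Palais): a connected, paracompact $C^1$ Banach manifold $M$ modeled on a Banach space $(X,\|\cdot\|)$, with a continuous map $\|\cdot\|_M:TM\to[0,\infty)$ such that: (P1) for every $x\in M$ the restriction $\|\cdot\|_x$ of $\|\cdot\|_M$ to $T_xM$ is a norm such that for every chart $\varphi:U\to X$ with $x\in U$, the norm $v\in X\mapsto\|d\varphi^{-1}(\varphi(x))(v)\|_x$ is equivalent to $\|\cdot\|$; (P2) for every $x_0\in M$, $\varepsilon>0$ and chart $\varphi:U\to X$ with $x_0\in U$ there is an open neighborhood $W$ of $x_0$ such that for all $x\in W$, $v\in X$, $\frac{1}{1+\varepsilon}\|d\varphi^{-1}(\varphi(x_0))(v)\|_{x_0}\le\|d\varphi^{-1}(\varphi(x))(v)\|_x\le(1+\varepsilon)\|d\varphi^{-1}(\varphi(x_0))(v)\|_{x_0}$. Finsler metric: $d(p,q)$ is the infimum of the lengths $\ell(c)=\int_a^b\|c'(t)\|_{c(t)}\,dt$ over piecewise $C^1$ paths $c:[a,b]\to M$ connecting $p$ to $q$. $M$ is complete if $(M,d)$ is complete. $h$ is $L$-Lipschitz ($L\ge0$) with respect to $d$; on $[0,\infty)\times M$ the metric $|t-s|+d(x,y)$ is used. $C^1$ Lipschitz bump function on $X$: a $C^1$, Lipschitz function $b:X\to\mathbb{R}$ with bounded, non-empty support. Sub/superdifferential: for $(t,x)\in(0,\infty)\times M$, $D^-u(t,x)$ (resp. $D^+u(t,x)$) is the set of pairs $(\alpha,\Delta)\in\mathbb{R}\times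 T_xM^*$ representing $dg(t,x)$ (i.e. $\alpha=g_t(t,x)$, $\Delta=g_x(t,x)$), where $g:(0,\infty)\times M\to\mathbb{R}$ is $C^1$ and $u-g$ attains a local minimum (resp. local maximum) at $(t,x)$. For $\xi\in T_xM^*$, $\|\xi\|_x$ denotes the dual norm $\sup\{|\xi(v)|:v\in T_xM,\ \|v\|_x=1\}$. Viscosity subsolution of $(\ast)$: $u:[0,\infty)\times M\to\mathbb{R}$ upper semicontinuous, $\alpha+H(t,x,\|\Delta\|_x)\le0$ for every $(t,x)\in(0,\infty)\times M$ and $(\alpha,\Delta)\in D^+u(t,x)$, and $u(0,x)\le h(x)$ for every $x\in M$. Viscosity supersolution: $u$ lower semicontinuous, $\alpha+H(t,x,\|\Delta\|_x)\ge0$ for every $(t,x)\in(0,\infty)\times M$ and $(\alpha,\Delta)\in D^-u(t,x)$, and $u(0,x)\ge h(x)$ for every $x\in M$. Viscosity solution: both. Condition (A): there are a constant $C\ge0$ and a continuous function $\omega:[0,\infty)\times\mathbb{R}\times\mathbb{R}\to\mathbb{R}$ with $\omega(0,0,0)=0$ such that for all $t_1,t_2\in[0,\infty)$, $x_1,x_2\in M$, $r_1,r_2\in\mathbb{R}$, $|H(t_1,x_1,r_1)-H(t_2,x_2,r_2)|\le\omega(|t_1-t_2|,d(x_1,x_2),r_1-r_2)+C\max\{|r_1|,|r_2|\}(|t_1-t_2|+d(x_1,x_2))$. Envelopes on $[0,\infty)\times M$: $u^*(p)=\lim_{r\to0^+}\sup_{B(p,r)}u$ and $u_*(p)=\lim_{r\to0^+}\inf_{B(p,r)}u$,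 with $B(p,r)$ the open ball in $[0,\infty)\times M$. *)

theory Defs
  imports "HOL-Analysis.Analysis"
begin

section \<open>$C^1$ Banach manifolds\<close>

text \<open>Frechet $C^1$ maps on an open set: the derivative is continuous in the operator norm.\<close>

definition C1_on :: "'a::real_normed_vector set \<Rightarrow> ('a \<Rightarrow> 'b::real_normed_vector) \<Rightarrow> bool" where
  "C1_on S f \<longleftrightarrow> (\<exists>f' :: 'a \<Rightarrow> 'a \<Rightarrow>\<^sub>L 'b.
     (\<forall>x\<in>S. (f has_derivative blinfun_apply (f' x)) (at x)) \<and> continuous_on S f')"

text \<open>The manifold \<open>M\<close> is the whole type \<open>'m\<close>, the model space is \<open>'x\<close>. A chart
  \<open>\<phi> : U \<rightarrow> X\<close> is the pair \<open>(U, \<phi>)\<close>; the values of \<open>\<phi>\<close> outside \<open>U\<close> are irrelevant.\<close>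

type_synonym ('m, 'x) chart = "'m set \<times> ('m \<Rightarrow> 'x)"

abbreviation chart_dom :: "('m, 'x) chart \<Rightarrow> 'm set" where
  "chart_dom \<equiv> fst"

abbreviation chart_map :: "('m, 'x) chart \<Rightarrow> 'm \<Rightarrow> 'x" where
  "chart_map \<equiv> snd"

definition chart_inv :: "('m, 'x) chart \<Rightarrow> 'x \<Rightarrow> 'm" where
  "chart_inv \<kappa> = inv_into (chart_dom \<kappa>) (chart_map \<kappa>)"

definition is_chart :: "('m::topological_space, 'x::real_normed_vector) chart \<Rightarrow> bool" where
  "is_chart \<kappa> \<longleftrightarrow> open (chart_dom \<kappa>) \<and> open (chart_map \<kappa> ` chart_dom \<kappa>) \<and>
     homeomorphism (chart_dom \<kappa>) (chart_map \<kappa> ` chart_dom \<kappa>) (chart_map \<kappa>) (chart_inv \<kappa>)"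

definition transition :: "('m, 'x) chart \<Rightarrow> ('m, 'x) chart \<Rightarrow> 'x \<Rightarrow> 'x" where
  "transition \<kappa> \<kappa>' = chart_map \<kappa>' \<circ> chart_inv \<kappa>"

definition C1_compatible ::
    "('m, 'x::real_normed_vector) chart \<Rightarrow> ('m, 'x) chart \<Rightarrow> bool" where
  "C1_compatible \<kappa> \<kappa>' \<longleftrightarrow>
     C1_on (chart_map \<kappa> ` (chart_dom \<kappa> \<inter> chart_dom \<kappa>')) (transition \<kappa> \<kappa>') \<and>
     C1_on (chart_map \<kappa>' ` (chart_dom \<kappa> \<inter> chart_dom \<kappa>')) (transition \<kappa>' \<kappa>)"

text \<open>A $C^1$ structure is a maximal $C^1$ atlas, so that ``every chart of the manifold''
  means every element of \<open>\<A>\<close>.\<close>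

definition C1_structure ::
    "('m::topological_space, 'x::real_normed_vector) chart set \<Rightarrow> bool" where
  "C1_structure \<A> \<longleftrightarrow>
     (\<forall>\<kappa>\<in>\<A>. is_chart \<kappa>) \<and>
     (\<forall>x. \<exists>\<kappa>\<in>\<A>. x \<in> chart_dom \<kappa>) \<and>
     (\<forall>\<kappa>\<in>\<A>. \<forall>\<kappa>'\<in>\<A>. C1_compatible \<kappa> \<kappa>') \<and>
     (\<forall>\<kappa>. is_chart \<kappa> \<and> (\<forall>\<kappa>'\<in>\<A>. C1_compatible \<kappa> \<kappa>') \<longrightarrow> \<kappa> \<in> \<A>)"

definition paracompact_space :: "'a topology \<Rightarrow> bool" where
  "paracompact_space T \<longleftrightarrow>
     (\<forall>\<U>. (\<forall>U\<in>\<U>. openin T U) \<and> \<Union>\<U> = topspace T \<longrightarrow>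
        (\<exists>\<V>. (\<forall>V\<in>\<V>. openin T V) \<and> \<Union>\<V> = topspace T \<and>
             (\<forall>V\<in>\<V>. \<exists>U\<in>\<U>. V \<subseteq> U) \<and> locally_finite_in T \<V>))"


section \<open>Tangent spaces and Finsler structures\<close>

text \<open>A tangent vector at \<open>x\<close> is the family of its representatives in all charts around \<open>x\<close>,
  these being related by the derivatives of the transition maps. The family is \<open>0\<close> at charts
  not containing \<open>x\<close>, so that equality of families is equality of tangent vectors; the vector
  space operations are pointwise.\<close>

type_synonym ('m, 'x) tvec = "('m, 'x) chart \<Rightarrow> 'x"

definition tangent_space ::
    "('m, 'x::real_normed_vector) chart set \<Rightarrow> 'm \<Rightarrow> ('m, 'x) tvec set" where
  "tangent_space \<A> x = {V.
     (\<forall>\<kappa>. \<not> (\<kappa> \<in> \<A> \<and> x \<in> chart_dom \<kappa>) \<longrightarrow> V \<kappa> = 0) \<and>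
     (\<forall>\<kappa>\<in>\<A>. \<forall>\<kappa>'\<in>\<A>. x \<in> chart_dom \<kappa> \<inter> chart_dom \<kappa>' \<longrightarrow>
        V \<kappa>' = frechet_derivative (transition \<kappa> \<kappa>') (at (chart_map \<kappa> x)) (V \<kappa>))}"

text \<open>\<open>from_chart \<A> \<kappa> x v\<close> is the tangent vector $d\varphi^{-1}(\varphi(x))(v)$ at \<open>x\<close>, where
  $\varphi$ is the map of the chart \<open>\<kappa>\<close>.\<close>

definition from_chart ::
    "('m, 'x::real_normed_vector) chart set \<Rightarrow> ('m, 'x) chart \<Rightarrow> 'm \<Rightarrow> 'x \<Rightarrow> ('m, 'x) tvec" where
  "from_chart \<A> \<kappa> x v = (\<lambda>\<kappa>'.
     if \<kappa>' \<in> \<A> \<and> x \<in> chart_dom \<kappa>'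
     then frechet_derivative (transition \<kappa> \<kappa>') (at (chart_map \<kappa> x)) v else 0)"

definition norm_on_tangent_space ::
    "('m, 'x::real_normed_vector) chart set \<Rightarrow> 'm \<Rightarrow> (('m, 'x) tvec \<Rightarrow> real) \<Rightarrow> bool" where
  "norm_on_tangent_space \<A> x n \<longleftrightarrow>
     (\<forall>V\<in>tangent_space \<A> x. 0 \<le> n V \<and> (n V = 0 \<longleftrightarrow> V = (\<lambda>_. 0))) \<and>
     (\<forall>V\<in>tangent_space \<A> x. \<forall>a. n (\<lambda>\<kappa>. a *\<^sub>R V \<kappa>) = \<bar>a\<bar> * n V) \<and>
     (\<forall>V\<in>tangent_space \<A> x. \<forall>W\<in>tangent_space \<A> x. n (\<lambda>\<kappa>. V \<kappa> + W \<kappa>) \<le> n V + n W)"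

text \<open>\<open>N x V\<close> is $\|V\|_x$. Continuity of the Finsler structure on the tangent bundle is expressed
  in the bundle charts $(x,v) \mapsto d\varphi^{-1}(\varphi(x))(v)$ on $U \times X$. Paracompact spaces
  are Hausdorff by convention, whence the sort \<open>t2_space\<close>.\<close>

definition finsler_manifold ::
    "('m::t2_space, 'x::banach) chart set \<Rightarrow> ('m \<Rightarrow> ('m, 'x) tvec \<Rightarrow> real) \<Rightarrow> bool" where
  "finsler_manifold \<A> N \<longleftrightarrow>
     connected (UNIV :: 'm set) \<and> paracompact_space (euclidean :: 'm topology) \<and>
     C1_structure \<A> \<and>
     (\<forall>\<kappa>\<in>\<A>. continuous_on (chart_dom \<kappa> \<times> UNIV) (\<lambda>(x, v). N x (from_chart \<A> \<kappa> x v))) \<and>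
     (\<forall>x. norm_on_tangent_space \<A> x (N x) \<and>
        (\<forall>\<kappa>\<in>\<A>. x \<in> chart_dom \<kappa> \<longrightarrow> (\<exists>a>0. \<exists>b>0. \<forall>v.
           a * norm v \<le> N x (from_chart \<A> \<kappa> x v) \<and>
           N x (from_chart \<A> \<kappa> x v) \<le> b * norm v))) \<and>
     (\<forall>x\<^sub>0. \<forall>\<epsilon>>0. \<forall>\<kappa>\<in>\<A>. x\<^sub>0 \<in> chart_dom \<kappa> \<longrightarrow>
        (\<exists>W. open W \<and> x\<^sub>0 \<in> W \<and> W \<subseteq> chart_dom \<kappa> \<and> (\<forall>x\<in>W. \<forall>v.
           1 / (1 + \<epsilon>) * N x\<^sub>0 (from_chart \<A> \<kappa> x\<^sub>0 v) \<le> N x (from_chart \<A> \<kappa> x v) \<and>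
           N x (from_chart \<A> \<kappa> x v) \<le> (1 + \<epsilon>) * N x\<^sub>0 (from_chart \<A> \<kappa> x\<^sub>0 v))))"


section \<open>The Finsler metric\<close>

text \<open>The library's \<^const>\<open>piecewise_C1_differentiable_on\<close> does not require the derivative to have
  one-sided limits at the break points, so we ask for $C^1$ regularity, with one-sided derivatives
  at the end points, on each closed piece of a partition.\<close>

definition C1_path ::
    "('m::topological_space, 'x::real_normed_vector) chart set \<Rightarrow> real \<Rightarrow> real \<Rightarrow> (real \<Rightarrow> 'm) \<Rightarrow> bool" where
  "C1_path \<A> a b c \<longleftrightarrow> continuous_on {a..b} c \<and>
     (\<forall>\<kappa>\<in>\<A>. \<exists>f'.
        (\<forall>t\<in>{a..b} \<inter> c -` chart_dom \<kappa>.
           ((chart_map \<kappa> \<circ> c) has_vector_derivative f' t) (at t within {a..b})) \<and>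
        continuous_on ({a..b} \<inter> c -` chart_dom \<kappa>) f')"

definition piecewise_C1_path ::
    "('m::topological_space, 'x::real_normed_vector) chart set \<Rightarrow> real \<Rightarrow> real \<Rightarrow> (real \<Rightarrow> 'm) \<Rightarrow> bool" where
  "piecewise_C1_path \<A> a b c \<longleftrightarrow> a < b \<and>
     (\<exists>n (s :: nat \<Rightarrow> real). s 0 = a \<and> s n = b \<and>
        (\<forall>i<n. s i < s (Suc i) \<and> C1_path \<A> (s i) (s (Suc i)) c))"

definition velocity ::
    "('m, 'x::real_normed_vector) chart set \<Rightarrow> real \<Rightarrow> real \<Rightarrow> (real \<Rightarrow> 'm) \<Rightarrow> real \<Rightarrow> ('m, 'x) tvec" where
  "velocity \<A> a b c t = (\<lambda>\<kappa>.
     if \<kappa> \<in> \<A> \<and> c t \<in> chart_dom \<kappa>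
     then vector_derivative (chart_map \<kappa> \<circ> c) (at t within {a..b}) else 0)"

text \<open>At the finitely many break points the velocity need not exist; these do not affect the
  integral.\<close>

definition path_len ::
    "('m, 'x::real_normed_vector) chart set \<Rightarrow> ('m \<Rightarrow> ('m, 'x) tvec \<Rightarrow> real) \<Rightarrow>
     real \<Rightarrow> real \<Rightarrow> (real \<Rightarrow> 'm) \<Rightarrow> real" where
  "path_len \<A> N a b c = integral {a..b} (\<lambda>t. N (c t) (velocity \<A> a b c t))"

definition finsler_dist ::
    "('m::topological_space, 'x::real_normed_vector) chart set \<Rightarrow> ('m \<Rightarrow> ('m, 'x) tvec \<Rightarrow> real) \<Rightarrow>
     'm \<Rightarrow> 'm \<Rightarrow> real" where
  "finsler_dist \<A> N p q =
     Inf {path_len \<A> N a b c | a b c. piecewise_C1_path \<A> a b c \<and> c a = p \<and> c b = q}"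

definition complete_finsler_manifold ::
    "('m::t2_space, 'x::banach) chart set \<Rightarrow> ('m \<Rightarrow> ('m, 'x) tvec \<Rightarrow> real) \<Rightarrow> bool" where
  "complete_finsler_manifold \<A> N \<longleftrightarrow>
     finsler_manifold \<A> N \<and> Metric_space.mcomplete UNIV (finsler_dist \<A> N)"

definition C1_lipschitz_bump :: "('x::real_normed_vector \<Rightarrow> real) \<Rightarrow> bool" where
  "C1_lipschitz_bump b \<longleftrightarrow> C1_on UNIV b \<and> (\<exists>K. K-lipschitz_on UNIV b) \<and>
     bounded (closure {v. b v \<noteq> 0}) \<and> closure {v. b v \<noteq> 0} \<noteq> {}"


section \<open>Semicontinuity, envelopes and local Lipschitz functions on $[0,\infty) \times M$\<close>

text \<open>Functions on $[0,\infty) \times M$ are functions on the type \<open>real \<times> 'm\<close> whose values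
  at negative times are irrelevant.\<close>

abbreviation spacetime :: "(real \<times> 'm) set" where
  "spacetime \<equiv> {0..} \<times> UNIV"

definition usc_on :: "'a::topological_space set \<Rightarrow> ('a \<Rightarrow> real) \<Rightarrow> bool" where
  "usc_on S u \<longleftrightarrow> (\<forall>p\<in>S. \<forall>c. u p < c \<longrightarrow> (\<forall>\<^sub>F q in at p within S. u q < c))"

definition lsc_on :: "'a::topological_space set \<Rightarrow> ('a \<Rightarrow> real) \<Rightarrow> bool" where
  "lsc_on S u \<longleftrightarrow> (\<forall>p\<in>S. \<forall>c. c < u p \<longrightarrow> (\<forall>\<^sub>F q in at p within S. c < u q))"

definition spacetime_dist ::
    "('m::topological_space, 'x::real_normed_vector) chart set \<Rightarrow> ('m \<Rightarrow> ('m, 'x) tvec \<Rightarrow> real) \<Rightarrow>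
     real \<times> 'm \<Rightarrow> real \<times> 'm \<Rightarrow> real" where
  "spacetime_dist \<A> N p q = \<bar>fst p - fst q\<bar> + finsler_dist \<A> N (snd p) (snd q)"

definition spacetime_ball ::
    "('m::topological_space, 'x::real_normed_vector) chart set \<Rightarrow> ('m \<Rightarrow> ('m, 'x) tvec \<Rightarrow> real) \<Rightarrow>
     real \<times> 'm \<Rightarrow> real \<Rightarrow> (real \<times> 'm) set" where
  "spacetime_ball \<A> N p r = {q \<in> spacetime. spacetime_dist \<A> N p q < r}"

text \<open>The suprema and infima are taken in the reals, so the envelopes are meaningful for locally
  bounded \<open>u\<close> only.\<close>

definition upper_envelope ::
    "('m::topological_space, 'x::real_normed_vector) chart set \<Rightarrow> ('m \<Rightarrow> ('m, 'x) tvec \<Rightarrow> real) \<Rightarrow>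
     (real \<times> 'm \<Rightarrow> real) \<Rightarrow> real \<times> 'm \<Rightarrow> real" where
  "upper_envelope \<A> N u p = Lim (at_right 0) (\<lambda>r. SUP q\<in>spacetime_ball \<A> N p r. u q)"

definition lower_envelope ::
    "('m::topological_space, 'x::real_normed_vector) chart set \<Rightarrow> ('m \<Rightarrow> ('m, 'x) tvec \<Rightarrow> real) \<Rightarrow>
     (real \<times> 'm \<Rightarrow> real) \<Rightarrow> real \<times> 'm \<Rightarrow> real" where
  "lower_envelope \<A> N u p = Lim (at_right 0) (\<lambda>r. INF q\<in>spacetime_ball \<A> N p r. u q)"

definition locally_lipschitz ::
    "('m::topological_space, 'x::real_normed_vector) chart set \<Rightarrow> ('m \<Rightarrow> ('m, 'x) tvec \<Rightarrow> real) \<Rightarrow>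
     (real \<times> 'm \<Rightarrow> real) \<Rightarrow> bool" where
  "locally_lipschitz \<A> N u \<longleftrightarrow> (\<forall>p\<in>spacetime. \<exists>r>0. \<exists>K\<ge>0.
     \<forall>q\<in>spacetime_ball \<A> N p r. \<forall>q'\<in>spacetime_ball \<A> N p r.
       \<bar>u q - u q'\<bar> \<le> K * spacetime_dist \<A> N q q')"


section \<open>Sub- and superdifferentials\<close>

definition cotangent_space ::
    "('m, 'x::real_normed_vector) chart set \<Rightarrow> 'm \<Rightarrow> (('m, 'x) tvec \<Rightarrow> real) set" where
  "cotangent_space \<A> x = {\<xi> \<in> extensional (tangent_space \<A> x).
     \<forall>\<kappa>\<in>\<A>. x \<in> chart_dom \<kappa> \<longrightarrow> bounded_linear (\<lambda>v. \<xi> (from_chart \<A> \<kappa> x v))}"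

text \<open>Inserting \<open>0\<close> only matters for a trivial tangent space, where the supremum is over the
  empty set and the dual norm is \<open>0\<close>.\<close>

definition dual_norm ::
    "('m, 'x::real_normed_vector) chart set \<Rightarrow> ('m \<Rightarrow> ('m, 'x) tvec \<Rightarrow> real) \<Rightarrow> 'm \<Rightarrow>
     (('m, 'x) tvec \<Rightarrow> real) \<Rightarrow> real" where
  "dual_norm \<A> N x \<xi> = Sup (insert 0 {\<bar>\<xi> V\<bar> | V. V \<in> tangent_space \<A> x \<and> N x V = 1})"

definition local_rep :: "('m, 'x) chart \<Rightarrow> (real \<times> 'm \<Rightarrow> real) \<Rightarrow> real \<times> 'x \<Rightarrow> real" where
  "local_rep \<kappa> g = (\<lambda>(s, y). g (s, chart_inv \<kappa> y))"

definition C1_test_function ::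
    "('m, 'x::real_normed_vector) chart set \<Rightarrow> (real \<times> 'm \<Rightarrow> real) \<Rightarrow> bool" where
  "C1_test_function \<A> g \<longleftrightarrow>
     (\<forall>\<kappa>\<in>\<A>. C1_on ({0<..} \<times> chart_map \<kappa> ` chart_dom \<kappa>) (local_rep \<kappa> g))"

text \<open>\<open>(\<alpha>, \<Delta>)\<close> represents $dg(t,x)$, i.e. $\alpha = g_t(t,x)$ and $\Delta = g_x(t,x)$.\<close>

definition represents_differential ::
    "('m, 'x::real_normed_vector) chart set \<Rightarrow> (real \<times> 'm \<Rightarrow> real) \<Rightarrow> real \<Rightarrow> 'm \<Rightarrow>
     real \<Rightarrow> (('m, 'x) tvec \<Rightarrow> real) \<Rightarrow> bool" where
  "represents_differential \<A> g t x \<alpha> \<Delta> \<longleftrightarrow> \<Delta> \<in> cotangent_space \<A> x \<and>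
     (\<forall>\<kappa>\<in>\<A>. x \<in> chart_dom \<kappa> \<longrightarrow>
        (local_rep \<kappa> g has_derivative (\<lambda>(\<sigma>, v). \<alpha> * \<sigma> + \<Delta> (from_chart \<A> \<kappa> x v)))
          (at (t, chart_map \<kappa> x)))"

definition subdifferential ::
    "('m::topological_space, 'x::real_normed_vector) chart set \<Rightarrow> (real \<times> 'm \<Rightarrow> real) \<Rightarrow>
     real \<Rightarrow> 'm \<Rightarrow> (real \<times> (('m, 'x) tvec \<Rightarrow> real)) set" where
  "subdifferential \<A> u t x = {(\<alpha>, \<Delta>). \<exists>g. C1_test_function \<A> g \<and>
     (\<forall>\<^sub>F q in nhds (t, x). u (t, x) - g (t, x) \<le> u q - g q) \<and>
     represents_differential \<A> g t x \<alpha> \<Delta>}"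

definition superdifferential ::
    "('m::topological_space, 'x::real_normed_vector) chart set \<Rightarrow> (real \<times> 'm \<Rightarrow> real) \<Rightarrow>
     real \<Rightarrow> 'm \<Rightarrow> (real \<times> (('m, 'x) tvec \<Rightarrow> real)) set" where
  "superdifferential \<A> u t x = {(\<alpha>, \<Delta>). \<exists>g. C1_test_function \<A> g \<and>
     (\<forall>\<^sub>F q in nhds (t, x). u q - g q \<le> u (t, x) - g (t, x)) \<and>
     represents_differential \<A> g t x \<alpha> \<Delta>}"


section \<open>The Hamilton--Jacobi problem\<close>

definition viscosity_subsolution ::
    "('m::topological_space, 'x::real_normed_vector) chart set \<Rightarrow> ('m \<Rightarrow> ('m, 'x) tvec \<Rightarrow> real) \<Rightarrow>
     (real \<Rightarrow> 'm \<Rightarrow> real \<Rightarrow> real) \<Rightarrow> ('m \<Rightarrow> real) \<Rightarrow> (real \<times> 'm \<Rightarrow> real) \<Rightarrow> bool" where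
  "viscosity_subsolution \<A> N H h u \<longleftrightarrow> usc_on spacetime u \<and>
     (\<forall>t>0. \<forall>x. \<forall>(\<alpha>, \<Delta>)\<in>superdifferential \<A> u t x. \<alpha> + H t x (dual_norm \<A> N x \<Delta>) \<le> 0) \<and>
     (\<forall>x. u (0, x) \<le> h x)"

definition viscosity_supersolution ::
    "('m::topological_space, 'x::real_normed_vector) chart set \<Rightarrow> ('m \<Rightarrow> ('m, 'x) tvec \<Rightarrow> real) \<Rightarrow>
     (real \<Rightarrow> 'm \<Rightarrow> real \<Rightarrow> real) \<Rightarrow> ('m \<Rightarrow> real) \<Rightarrow> (real \<times> 'm \<Rightarrow> real) \<Rightarrow> bool" where
  "viscosity_supersolution \<A> N H h u \<longleftrightarrow> lsc_on spacetime u \<and>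
     (\<forall>t>0. \<forall>x. \<forall>(\<alpha>, \<Delta>)\<in>subdifferential \<A> u t x. \<alpha> + H t x (dual_norm \<A> N x \<Delta>) \<ge> 0) \<and>
     (\<forall>x. u (0, x) \<ge> h x)"

definition viscosity_solution ::
    "('m::topological_space, 'x::real_normed_vector) chart set \<Rightarrow> ('m \<Rightarrow> ('m, 'x) tvec \<Rightarrow> real) \<Rightarrow>
     (real \<Rightarrow> 'm \<Rightarrow> real \<Rightarrow> real) \<Rightarrow> ('m \<Rightarrow> real) \<Rightarrow> (real \<times> 'm \<Rightarrow> real) \<Rightarrow> bool" where
  "viscosity_solution \<A> N H h u \<longleftrightarrow>
     viscosity_subsolution \<A> N H h u \<and> viscosity_supersolution \<A> N H h u"

definition condition_A ::
    "('m::topological_space, 'x::real_normed_vector) chart set \<Rightarrow> ('m \<Rightarrow> ('m, 'x) tvec \<Rightarrow> real) \<Rightarrow>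
     (real \<Rightarrow> 'm \<Rightarrow> real \<Rightarrow> real) \<Rightarrow> bool" where
  "condition_A \<A> N H \<longleftrightarrow> (\<exists>C\<ge>0. \<exists>\<omega> :: real \<times> real \<times> real \<Rightarrow> real.
     continuous_on ({0..} \<times> UNIV) \<omega> \<and> \<omega> (0, 0, 0) = 0 \<and>
     (\<forall>t\<^sub>1\<ge>0. \<forall>t\<^sub>2\<ge>0. \<forall>x\<^sub>1 x\<^sub>2 r\<^sub>1 r\<^sub>2.
        \<bar>H t\<^sub>1 x\<^sub>1 r\<^sub>1 - H t\<^sub>2 x\<^sub>2 r\<^sub>2\<bar> \<le>
          \<omega> (\<bar>t\<^sub>1 - t\<^sub>2\<bar>, finsler_dist \<A> N x\<^sub>1 x\<^sub>2, r\<^sub>1 - r\<^sub>2) +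
          C * max \<bar>r\<^sub>1\<bar> \<bar>r\<^sub>2\<bar> * (\<bar>t\<^sub>1 - t\<^sub>2\<bar> + finsler_dist \<A> N x\<^sub>1 x\<^sub>2)))"

definition bounded_on_strips :: "(real \<times> 'm \<Rightarrow> real) \<Rightarrow> bool" where
  "bounded_on_strips v \<longleftrightarrow> (\<forall>T>0. bounded (v ` ({0..<T} \<times> UNIV)))"

end

theory Submission
  imports Defs
begin

text \<open>Sub- and superdifferentials are read in charts, where the cotangent variable is a covector of
  \<open>\<real> \<times> X\<close>, and the smooth variational principle of Deville, Godefroy and Zizler in \<open>\<real> \<times> X\<close> replaces the
  missing local compactness.

  Perron's method: \<open>-K\<^sub>1 t + h\<close> is a subsolution in \<open>\<F>\<close> and \<open>-K\<^sub>0 t + h\<close> bounds \<open>\<F>\<close> from above. If a test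
  function touches \<open>u\<^sup>*\<close> from above, the variational principle makes a slight perturbation of it touch some
  \<open>w \<in> \<F>\<close> nearby, so \<open>u\<^sup>*\<close> is a subsolution. If \<open>(u\<^sup>*)\<^sub>*\<close> failed to be a supersolution at some point, then
  raising \<open>u\<^sup>*\<close> there by a bump would give a larger element of \<open>\<F>\<close>; where \<open>(u\<^sup>*)\<^sub>*\<close> touches \<open>-K\<^sub>0 t + h\<close>, the
  choice of \<open>K\<^sub>0\<close> gives the inequality instead.

  Uniqueness: Ekeland's principle for the complete Finsler metric gives a point where the penalised
  difference of a supersolution and a subsolution is minimal up to a small slope. If one of the two functions is
  locally Lipschitz, doubling the variables in a single chart produces nearly equal, locally bounded
  gradients of both functions, and condition (A) gives a contradiction. No smoothness of the distance is used,
  only that it is locally comparable with the norm of a chart.\<close>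

section \<open>Calculus in Banach spaces\<close>

text \<open>Without local compactness a semicontinuous function need not attain its extrema on a
  ball, so each touching argument pays an error: the test function is perturbed by a C^1 function of
  small value and small gradient, which the continuity of the Hamiltonian has to absorb. The
  comparison is shaped by chart constants. The equivalence of a chart norm with the Finsler norm is
  not uniform over M, while the slope in Ekeland's principle is fixed before its point, and hence
  before any chart, is known. The slope error is therefore carried in the Finsler norm at that
  point, where its dual norm is a universal multiple of the slope; only errors chosen after the
  chart are measured in the chart norm. The last term of condition (A), max{|r1|, |r2|} times a
  distance, is small only if the gradients stay bounded while the distance shrinks. This is where
  local Lipschitz continuity enters: it bounds the gradients of one function, those of the other are
  nearly opposite, and the radius is chosen last.\<close>

definition C1d :: "'a::real_normed_vector set \<Rightarrow> ('a \<Rightarrow> 'b::real_normed_vector) \<Rightarrow> ('a \<Rightarrow> 'a \<Rightarrow>\<^sub>L 'b) \<Rightarrow> bool" where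
  "C1d S f f' \<longleftrightarrow> (\<forall>x\<in>S. (f has_derivative blinfun_apply (f' x)) (at x)) \<and> continuous_on S f'"

lemma C1_on_iff_C1d: "C1_on S f \<longleftrightarrow> (\<exists>f'. C1d S f f')"
  unfolding C1_on_def C1d_def by simp

lemma C1d_derivD: "C1d S f f' \<Longrightarrow> x \<in> S \<Longrightarrow> (f has_derivative blinfun_apply (f' x)) (at x)"
  and C1d_contD: "C1d S f f' \<Longrightarrow> continuous_on S f'"
  by (auto simp: C1d_def)

lemma C1d_subset: "C1d S f f' \<Longrightarrow> T \<subseteq> S \<Longrightarrow> C1d T f f'"
  by (auto simp: C1d_def intro: continuous_on_subset)

lemma C1d_continuous_on: "C1d S f f' \<Longrightarrow> continuous_on S f"
  by (meson C1d_derivD continuous_at_imp_continuous_on has_derivative_continuous)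

lemma C1d_const: "C1d S (\<lambda>x. c) (\<lambda>x. 0)"
  by (auto simp: C1d_def zero_blinfun.rep_eq)

lemma C1d_add:
  assumes "C1d S f f'" "C1d S g g'"
  shows "C1d S (\<lambda>x. f x + g x) (\<lambda>x. f' x + g' x)"
  using assms unfolding C1d_def
  by (auto simp: plus_blinfun.rep_eq intro!: derivative_eq_intros continuous_intros)

lemma C1d_scaleR:
  assumes "C1d S f f'"
  shows "C1d S (\<lambda>x. c *\<^sub>R f x) (\<lambda>x. c *\<^sub>R f' x)"
  using assms unfolding C1d_def
  by (auto simp: scaleR_blinfun.rep_eq intro!: derivative_eq_intros continuous_intros)

lemma C1d_minus:
  assumes "C1d S f f'"
  shows "C1d S (\<lambda>x. - f x) (\<lambda>x. - f' x)"
  using C1d_scaleR[OF assms, of "-1"] by simp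

lemma C1d_diff:
  assumes "C1d S f f'" "C1d S g g'"
  shows "C1d S (\<lambda>x. f x - g x) (\<lambda>x. f' x - g' x)"
  using C1d_add[OF assms(1) C1d_minus[OF assms(2)]] by simp

lemma C1d_cmult:
  fixes f :: "'a::real_normed_vector \<Rightarrow> real"
  assumes "C1d S f f'"
  shows "C1d S (\<lambda>x. c * f x) (\<lambda>x. c *\<^sub>R f' x)"
  using C1d_scaleR[OF assms] by simp

lemma C1d_mult:
  fixes f g :: "'a::real_normed_vector \<Rightarrow> real"
  assumes "C1d S f f'" "C1d S g g'"
  shows "C1d S (\<lambda>x. f x * g x) (\<lambda>x. f x *\<^sub>R g' x + g x *\<^sub>R f' x)"
  unfolding C1d_def
proof (intro conjI ballI)
  fix x assume "x \<in> S"
  note d = C1d_derivD[OF assms(1) this] C1d_derivD[OF assms(2) this]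
  show "((\<lambda>x. f x * g x) has_derivative blinfun_apply (f x *\<^sub>R g' x + g x *\<^sub>R f' x)) (at x)"
    using d by (auto simp: plus_blinfun.rep_eq scaleR_blinfun.rep_eq intro!: derivative_eq_intros)
next
  show "continuous_on S (\<lambda>x. f x *\<^sub>R g' x + g x *\<^sub>R f' x)"
    using assms[THEN C1d_contD] assms[THEN C1d_continuous_on] by (intro continuous_intros)
qed

lemma C1d_compose:
  assumes g: "C1d T g g'" and f: "C1d S f f'" and sub: "f ` S \<subseteq> T"
  shows "C1d S (\<lambda>x. g (f x)) (\<lambda>x. g' (f x) o\<^sub>L f' x)"
  unfolding C1d_def
proof (intro conjI ballI)
  fix x assume x: "x \<in> S"
  have "(g has_derivative blinfun_apply (g' (f x))) (at (f x))"
    using C1d_derivD[OF g] sub x by blast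
  from has_derivative_compose[OF C1d_derivD[OF f x] this]
  show "((\<lambda>x. g (f x)) has_derivative blinfun_apply (g' (f x) o\<^sub>L f' x)) (at x)"
    by (simp add: blinfun_compose.rep_eq o_def)
next
  show "continuous_on S (\<lambda>x. g' (f x) o\<^sub>L f' x)"
    by (intro bounded_bilinear.continuous_on[OF bounded_bilinear_blinfun_compose]
        continuous_on_compose2[OF C1d_contD[OF g] C1d_continuous_on[OF f]] sub C1d_contD[OF f])
qed

lemma C1d_real_compose:
  fixes f :: "'a::real_normed_vector \<Rightarrow> real"
  assumes th: "\<And>r. (\<theta> has_real_derivative \<theta>' r) (at r)" "continuous_on UNIV \<theta>'" and f: "C1d S f f'"
  shows "C1d S (\<lambda>x. \<theta> (f x)) (\<lambda>x. \<theta>' (f x) *\<^sub>R f' x)"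
  unfolding C1d_def
proof (intro conjI ballI)
  fix x assume x: "x \<in> S"
  show "((\<lambda>x. \<theta> (f x)) has_derivative blinfun_apply (\<theta>' (f x) *\<^sub>R f' x)) (at x)"
    using has_derivative_compose[OF C1d_derivD[OF f x] th(1)[unfolded has_field_derivative_def]]
    by (simp add: scaleR_blinfun.rep_eq)
next
  show "continuous_on S (\<lambda>x. \<theta>' (f x) *\<^sub>R f' x)"
    by (intro continuous_intros continuous_on_compose2[OF th(2) C1d_continuous_on[OF f]] C1d_contD[OF f]) auto
qed

lemma C1d_blinfun_affine: "C1d S (\<lambda>x. c + blinfun_apply A (x - d)) (\<lambda>x. A)"
  unfolding C1d_def
  by (auto intro!: derivative_eq_intros continuous_intros simp: blinfun.diff_right)

lemma C1d_homothety:
  "C1d S (\<lambda>x::'a::real_normed_vector. c *\<^sub>R (x - d)) (\<lambda>x. c *\<^sub>R id_blinfun)"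
  using C1d_blinfun_affine[of S 0 "c *\<^sub>R id_blinfun" d] by (simp add: scaleR_blinfun.rep_eq)

lemma C1d_cong_open:
  assumes "C1d S f f'" "open S" "\<And>x. x \<in> S \<Longrightarrow> f x = g x"
  shows "C1d S g f'"
  using assms unfolding C1d_def
  by (metis has_derivative_transform_within_open)

text \<open>Derivatives at a point are unique, so local derivatives agree on overlaps and a
  pointwise choice of derivative is automatically continuous. This is how functions pieced together
  from several charts are recognised as C^1.\<close>

lemma C1_on_local:
  fixes f :: "'a::real_normed_vector \<Rightarrow> 'b::real_normed_vector"
  assumes "\<And>x. x \<in> S \<Longrightarrow> \<exists>T. open T \<and> x \<in> T \<and> C1_on T f"
  shows "C1_on S f"
proof -
  define f' where "f' x = (SOME D. (f has_derivative blinfun_apply D) (at x))" for x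
  have f': "f' x = D" if "(f has_derivative blinfun_apply D) (at x)" for x D
  proof -
    have "(f has_derivative blinfun_apply (f' x)) (at x)" unfolding f'_def by (rule someI[where P = "\<lambda>D. (f has_derivative blinfun_apply D) (at x)", OF that])
    then show ?thesis using has_derivative_unique[OF _ that] by (auto intro: blinfun_eqI)
  qed
  have *: "(f has_derivative blinfun_apply (f' x)) (at x) \<and> isCont f' x" if "x \<in> S" for x
  proof -
    obtain T g where T: "open T" "x \<in> T" "C1d T f g"
      using assms[OF \<open>x \<in> S\<close>] by (auto simp: C1_on_iff_C1d)
    have eq: "f' y = g y" if "y \<in> T" for y using f' C1d_derivD[OF T(3) that] by blast
    have "continuous_on T f'" using C1d_contD[OF T(3)] eq by (simp cong: continuous_on_cong)
    then show ?thesis using T eq C1d_derivD continuous_on_eq_continuous_at by metis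
  qed
  show ?thesis unfolding C1_on_def
    using * continuous_at_imp_continuous_on by blast
qed

text \<open>One-sided both in \<open>s\<close> and in sign, because upper bounds on growth are all
  that a touching function provides; the bound for \<open>- v\<close> gives the opposite sign by
  linearity.\<close>

lemma has_derivative_directional_le:
  fixes f :: "'a::real_normed_vector \<Rightarrow> real"
  assumes d: "(f has_derivative p) (at x)"
    and le: "\<forall>\<^sub>F s in at_right 0. f (x + s *\<^sub>R v) - f x \<le> s * c"
  shows "p v \<le> c"
proof -
  interpret p: bounded_linear p using has_derivative_bounded_linear[OF d] .
  have "((\<lambda>s. x + s *\<^sub>R v) has_derivative (\<lambda>s. s *\<^sub>R v)) (at 0)"
    by (auto intro!: derivative_eq_intros)
  then have "((\<lambda>s. f (x + s *\<^sub>R v)) has_derivative (\<lambda>s. p (s *\<^sub>R v))) (at (0::real))"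
    using has_derivative_compose[of _ _ 0 UNIV f p] d by fastforce
  then have "((\<lambda>s. f (x + s *\<^sub>R v)) has_real_derivative p v) (at 0)"
    by (simp add: has_field_derivative_def p.scaleR mult_commute_abs)
  then have "((\<lambda>s. (f (x + s *\<^sub>R v) - f x) / s) \<longlongrightarrow> p v) (at 0)"
    by (simp add: DERIV_def)
  then have "((\<lambda>s. (f (x + s *\<^sub>R v) - f x) / s) \<longlongrightarrow> p v) (at_right 0)"
    by (rule filterlim_mono) (auto simp: at_le)
  moreover have "\<forall>\<^sub>F s in at_right 0. (f (x + s *\<^sub>R v) - f x) / s \<le> c"
    using le eventually_at_right_less[of 0]
    by eventually_elim (simp add: divide_le_eq mult.commute)
  ultimately show ?thesis
    using tendsto_upperbound[of _ "p v" "at_right (0::real)" c] by simp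
qed

lemma blinfun_norm_le_of_upper:
  fixes p :: "'a::real_normed_vector \<Rightarrow>\<^sub>L real"
  assumes "\<And>v. blinfun_apply p v \<le> R * norm v" "0 \<le> R"
  shows "norm p \<le> R"
proof (rule norm_blinfun_bound[OF assms(2)])
  fix v show "norm (blinfun_apply p v) \<le> R * norm v"
    using assms(1)[of v] assms(1)[of "-v"] by (simp add: blinfun.minus_right abs_le_iff)
qed

lemma lipschitz_derivative_bound:
  fixes f :: "'a::real_normed_vector \<Rightarrow> real"
  assumes d: "(f has_derivative blinfun_apply p) (at x)" and K: "K-lipschitz_on UNIV f"
  shows "norm p \<le> K"
proof (rule blinfun_norm_le_of_upper)
  show "0 \<le> K" using K lipschitz_on_nonneg by blast
  fix v
  show "blinfun_apply p v \<le> K * norm v"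
  proof (rule has_derivative_directional_le[OF d])
    show "\<forall>\<^sub>F s in at_right 0. f (x + s *\<^sub>R v) - f x \<le> s * (K * norm v)"
      using eventually_at_right_less[of 0]
    proof eventually_elim
      case (elim s)
      have "dist (f (x + s *\<^sub>R v)) (f x) \<le> K * dist (x + s *\<^sub>R v) x"
        using lipschitz_onD[OF K] by blast
      then show ?case using elim by (simp add: dist_norm algebra_simps)
    qed
  qed
qed

lemma continuous_nbhd_radius:
  fixes g :: "'c::metric_space \<Rightarrow> 'd::metric_space"
  assumes "continuous_on S g" "open S" "y \<in> S" "e > 0"
  shows "\<exists>r>0. \<forall>z. dist z y < r \<longrightarrow> z \<in> S \<and> dist (g z) (g y) < e"
proof -
  have "isCont g y" using assms(1-3) by (simp add: continuous_on_eq_continuous_at)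
  then obtain r1 where r1: "r1 > 0" "\<forall>z. dist z y < r1 \<longrightarrow> dist (g z) (g y) < e"
    using assms(4) unfolding continuous_at_eps_delta by blast
  obtain r2 where "r2 > 0" "\<forall>z. dist z y < r2 \<longrightarrow> z \<in> S" using assms(2,3) unfolding open_dist by blast
  then show ?thesis using r1 by (intro exI[of _ "min r1 r2"]) auto
qed

section \<open>Smooth bump functions\<close>

text \<open>A normalised bump. Being constantly 1 near the origin, it can cut off a test function
  without changing the derivative at the centre; with support in the unit ball, rescaling to radius
  \<open>r\<close> costs exactly a factor 1/r in the derivative bound \<open>K\<close>.\<close>

definition smooth_bump :: "('a::real_normed_vector \<Rightarrow> real) \<Rightarrow> ('a \<Rightarrow> 'a \<Rightarrow>\<^sub>L real) \<Rightarrow> real \<Rightarrow> bool" where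
  "smooth_bump \<beta> \<beta>' K \<longleftrightarrow> C1d UNIV \<beta> \<beta>' \<and> (\<forall>v. norm (\<beta>' v) \<le> K) \<and> (\<forall>v. 0 \<le> \<beta> v \<and> \<beta> v \<le> 1) \<and>
     (\<exists>\<rho>>0. \<forall>v. norm v < \<rho> \<longrightarrow> \<beta> v = 1) \<and> (\<forall>v. 1 \<le> norm v \<longrightarrow> \<beta> v = 0)"

text \<open>Squaring removes the kink of the positive part at 0; the real cut-off profiles below are
  built from this function.\<close>

lemma pospart_square_deriv: "((\<lambda>x::real. (max 0 x)\<^sup>2) has_real_derivative 2 * max 0 x) (at x)"
proof -
  consider "x > 0" | "x < 0" | "x = 0" by linarith
  then show ?thesis
  proof cases
    case 1
    have "((\<lambda>x::real. x\<^sup>2) has_real_derivative 2 * x) (at x)" by (auto intro!: derivative_eq_intros)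
    then show ?thesis using 1
      by (auto intro: has_field_derivative_transform_within_open[of "\<lambda>x. x\<^sup>2" "2 * x" x "{0<..}"])
  next
    case 2
    have "((\<lambda>x::real. 0) has_real_derivative 0) (at x)" by (auto intro!: derivative_eq_intros)
    then show ?thesis using 2
      by (auto intro: has_field_derivative_transform_within_open[of "\<lambda>x. 0" 0 x "{..<0}"])
  next
    case 3
    have "((\<lambda>h::real. (max 0 h)\<^sup>2 / h) \<longlongrightarrow> 0) (at 0)"
    proof (rule Lim_null_comparison)
      show "\<forall>\<^sub>F h in at 0. norm ((max 0 h)\<^sup>2 / h) \<le> \<bar>h\<bar>"
        by (rule always_eventually) (auto simp: max_def power2_eq_square)
      show "((\<lambda>h::real. \<bar>h\<bar>) \<longlongrightarrow> 0) (at 0)" by (auto intro!: tendsto_eq_intros)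
    qed
    then show ?thesis using 3 by (simp add: DERIV_def)
  qed
qed

text \<open>A C^1 profile with value 0 at 0 that is exactly 1 once \<open>2 * s\<^sup>2\<close>
  reaches 1. Composed with a bump normalised to 1 at its centre it yields a function that is
  constantly 1 near the centre and still vanishes wherever the bump does.\<close>

definition plateau :: "real \<Rightarrow> real" where "plateau s = 1 - (max 0 (1 - 2 * s\<^sup>2))\<^sup>2"

lemma plateau_deriv: "(plateau has_real_derivative 8 * s * max 0 (1 - 2 * s\<^sup>2)) (at s)"
proof -
  have "((\<lambda>s. (max 0 (1 - 2 * s\<^sup>2))\<^sup>2) has_real_derivative (2 * max 0 (1 - 2 * s\<^sup>2)) * (- 4 * s)) (at s)"
    by (rule DERIV_chain2[OF pospart_square_deriv]) (auto intro!: derivative_eq_intros)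
  from DERIV_diff[OF DERIV_const[of 1] this] show ?thesis
    unfolding plateau_def[abs_def] by (simp add: mult.commute mult.left_commute mult.assoc)
qed

lemma plateau_deriv_bound: "\<bar>8 * (s::real) * max 0 (1 - 2 * s\<^sup>2)\<bar> \<le> 8"
proof (cases "1 - 2 * s\<^sup>2 \<le> 0")
  case True then show ?thesis by simp
next
  case False
  then have "s\<^sup>2 \<le> 1" by simp
  then have "\<bar>s\<bar> \<le> 1" by (simp add: abs_square_le_1)
  moreover have "\<bar>max 0 (1 - 2 * s\<^sup>2)\<bar> \<le> 1" by (auto simp: max_def)
  ultimately have "\<bar>s\<bar> * \<bar>max 0 (1 - 2 * s\<^sup>2)\<bar> \<le> 1" by (simp add: mult_le_one)
  then show ?thesis by (simp add: abs_mult)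
qed

lemma plateau_simps: "plateau 0 = 0" "1 \<le> 2 * s\<^sup>2 \<Longrightarrow> plateau s = 1" "0 \<le> plateau s" "plateau s \<le> 1"
proof -
  have "(max 0 (1 - 2 * s\<^sup>2))\<^sup>2 \<le> 1" by (rule power_le_one) auto
  then show "0 \<le> plateau s" by (simp add: plateau_def)
qed (auto simp: plateau_def)

lemma smooth_bump_of_bump:
  fixes b :: "'a::real_normed_vector \<Rightarrow> real"
  assumes b: "C1d UNIV b b'" and K: "\<And>v. norm (b' v) \<le> K" and v0: "b v0 \<noteq> 0"
    and R: "\<And>v. b v \<noteq> 0 \<Longrightarrow> norm v \<le> R"
  shows "\<exists>\<beta> \<beta>' K. smooth_bump (\<beta> :: 'a \<Rightarrow> real) \<beta>' K"
proof -
  \<comment> \<open>With this scale, norm v >= 1 forces norm (v0 + l v) >= l - norm v0 = R + 1,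
    which is outside the support of \<open>b\<close>.\<close>
  define l where "l = R + norm v0 + 1"
  have R0: "0 \<le> R" using R[OF v0] norm_ge_zero order_trans by blast
  have lpos: "l > 0" using R0 by (auto simp: l_def add_nonneg_pos)
  \<comment> \<open>The shift makes l (v - w) equal to v0 + l v, so a point where \<open>b\<close>
    does not vanish is moved to the origin.\<close>
  define w where "w = - (1 / l) *\<^sub>R v0"
  define s where "s v = (1 / b v0) * b (l *\<^sub>R (v - w))" for v
  define s' where "s' v = (1 / b v0) *\<^sub>R (b' (l *\<^sub>R (v - w)) o\<^sub>L (l *\<^sub>R id_blinfun))" for v
  have arg: "l *\<^sub>R (v - w) = v0 + l *\<^sub>R v" for v using lpos by (simp add: w_def algebra_simps)
  have s: "C1d UNIV s s'" unfolding s_def s'_def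
    by (intro C1d_cmult C1d_compose[OF b] C1d_homothety) auto
  define \<beta> where "\<beta> v = plateau (s v)" for v
  define \<beta>' where "\<beta>' v = (8 * s v * max 0 (1 - 2 * (s v)\<^sup>2)) *\<^sub>R s' v" for v
  have "C1d UNIV \<beta> \<beta>'" unfolding \<beta>_def \<beta>'_def
    by (rule C1d_real_compose[OF plateau_deriv _ s]) (intro continuous_intros)
  moreover have "norm (\<beta>' v) \<le> 8 * ((1 / \<bar>b v0\<bar>) * (K * l))" for v
  proof -
    have "norm (b' (l *\<^sub>R (v - w)) o\<^sub>L (l *\<^sub>R id_blinfun)) \<le> norm (b' (l *\<^sub>R (v - w))) * norm (l *\<^sub>R (id_blinfun :: 'a \<Rightarrow>\<^sub>L 'a))"
      by (rule norm_blinfun_compose)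
    also have "\<dots> \<le> K * l"
    proof (rule mult_mono[OF K])
      have "norm (id_blinfun :: 'a \<Rightarrow>\<^sub>L 'a) \<le> 1" by (rule norm_blinfun_bound) auto
      then show "norm (l *\<^sub>R (id_blinfun :: 'a \<Rightarrow>\<^sub>L 'a)) \<le> l" using lpos by simp
      show "0 \<le> K" using K norm_ge_zero order_trans by blast
    qed auto
    finally have "norm (s' v) \<le> (1 / \<bar>b v0\<bar>) * (K * l)"
      using v0 by (simp add: s'_def divide_right_mono)
    then show ?thesis unfolding \<beta>'_def norm_scaleR
      using plateau_deriv_bound[of "s v"] by (intro mult_mono) auto
  qed
  moreover have "0 \<le> \<beta> v \<and> \<beta> v \<le> 1" for v by (simp add: \<beta>_def plateau_simps)
  moreover have "\<exists>\<rho>>0. \<forall>v. norm v < \<rho> \<longrightarrow> \<beta> v = 1"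
  proof -
    have s0: "s 0 = 1" using v0 arg[of 0] by (simp add: s_def)
    have "isCont (\<lambda>v. 2 * (s v)\<^sup>2) 0"
      using C1d_continuous_on[OF s] by (intro continuous_intros) (simp add: continuous_on_eq_continuous_at)
    then have "((\<lambda>v. 2 * (s v)\<^sup>2) \<longlongrightarrow> 2 * (s 0)\<^sup>2) (at 0)" by (simp add: isCont_def)
    then have "\<forall>\<^sub>F v in at 0. 1 < 2 * (s v)\<^sup>2" using s0 order_tendstoD(1)[of "\<lambda>v. 2 * (s v)\<^sup>2" 2 "at 0" 1] by simp
    then obtain \<rho> where "\<rho> > 0" "\<And>v. v \<noteq> 0 \<Longrightarrow> norm v < \<rho> \<Longrightarrow> 1 < 2 * (s v)\<^sup>2"
      by (auto simp: eventually_at dist_norm)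
    then have "\<forall>v. norm v < \<rho> \<longrightarrow> \<beta> v = 1" using s0
      by (metis \<beta>_def plateau_simps(2) less_eq_real_def mult.right_neutral one_le_numeral one_power2)
    then show ?thesis using \<open>\<rho> > 0\<close> by blast
  qed
  moreover have "\<beta> v = 0" if "1 \<le> norm v" for v
  proof -
    have "l \<le> l * norm v" using that lpos by simp
    moreover have "l * norm v - norm v0 \<le> norm (v0 + l *\<^sub>R v)"
      using norm_diff_ineq[of "l *\<^sub>R v" v0] lpos by (simp add: add.commute)
    ultimately have "norm (v0 + l *\<^sub>R v) > R" by (simp add: l_def)
    then have "s v = 0" using R arg by (fastforce simp: s_def)
    then show ?thesis by (simp add: \<beta>_def plateau_simps)
  qed
  ultimately show ?thesis unfolding smooth_bump_def by blast
qed

lemma smooth_bump_of_C1_lipschitz_bump: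
  fixes b :: "'a::real_normed_vector \<Rightarrow> real"
  assumes "C1_lipschitz_bump b"
  shows "\<exists>\<beta> \<beta>' K. smooth_bump (\<beta> :: 'a \<Rightarrow> real) \<beta>' K"
proof -
  obtain b' K where b: "C1d UNIV b b'" and K: "K-lipschitz_on UNIV b"
    using assms by (auto simp: C1_lipschitz_bump_def C1_on_iff_C1d)
  obtain v0 where "b v0 \<noteq> 0"
  proof -
    have "{v. b v \<noteq> 0} \<noteq> {}" using assms by (auto simp: C1_lipschitz_bump_def)
    then show ?thesis using that by blast
  qed
  obtain R where "\<And>v. v \<in> closure {v. b v \<noteq> 0} \<Longrightarrow> norm v \<le> R"
    using assms by (auto simp: C1_lipschitz_bump_def bounded_iff)
  then have "norm v \<le> R" if "b v \<noteq> 0" for v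
    using that closure_subset[of "{v. b v \<noteq> 0}"] by (simp add: subset_eq)
  moreover have "norm (b' v) \<le> K" for v
    using lipschitz_derivative_bound[OF C1d_derivD[OF b] K] by simp
  ultimately show ?thesis using smooth_bump_of_bump[OF b _ \<open>b v0 \<noteq> 0\<close>] by blast
qed

lemma smooth_bump_real: "\<exists>\<beta> \<beta>' K. smooth_bump (\<beta> :: real \<Rightarrow> real) \<beta>' K"
proof -
  define b :: "real \<Rightarrow> real" where "b t = (max 0 (1 - t\<^sup>2))\<^sup>2" for t
  define b' where "b' t = (- 4 * t * max 0 (1 - t\<^sup>2)) *\<^sub>R (id_blinfun :: real \<Rightarrow>\<^sub>L real)" for t
  have d: "(b has_real_derivative - 4 * t * max 0 (1 - t\<^sup>2)) (at t)" for t
  proof -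
    have "((\<lambda>t. (max 0 (1 - t\<^sup>2))\<^sup>2) has_real_derivative (2 * max 0 (1 - t\<^sup>2)) * (- 2 * t)) (at t)"
      by (rule DERIV_chain2[OF pospart_square_deriv]) (auto intro!: derivative_eq_intros)
    then show ?thesis unfolding b_def[abs_def] by (simp add: algebra_simps)
  qed
  have "C1d UNIV (\<lambda>x. b (0 + blinfun_apply id_blinfun (x - 0)))
     (\<lambda>x. (- 4 * (0 + blinfun_apply id_blinfun (x - 0)) * max 0 (1 - (0 + blinfun_apply id_blinfun (x - 0))\<^sup>2)) *\<^sub>R (id_blinfun::real \<Rightarrow>\<^sub>L real))"
    by (rule C1d_real_compose[OF d _ C1d_blinfun_affine]) (intro continuous_intros)
  then have "C1d UNIV b b'" by (simp add: b'_def[abs_def])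
  moreover have "norm (b' t) \<le> 4" for t
  proof -
    have "\<bar>t * max 0 (1 - t\<^sup>2)\<bar> \<le> 1"
    proof (cases "t\<^sup>2 \<le> 1")
      case True
      then have "\<bar>t\<bar> \<le> 1" by (simp add: abs_square_le_1)
      moreover have "\<bar>max 0 (1 - t\<^sup>2)\<bar> \<le> 1" by (auto simp: max_def)
      ultimately show ?thesis by (simp add: abs_mult mult_le_one)
    qed simp
    moreover have "norm (id_blinfun :: real \<Rightarrow>\<^sub>L real) \<le> 1" by (rule norm_blinfun_bound) auto
    ultimately have "\<bar>t * max 0 (1 - t\<^sup>2)\<bar> * norm (id_blinfun :: real \<Rightarrow>\<^sub>L real) \<le> 1" by (simp add: mult_le_one)
    then show ?thesis by (simp add: b'_def abs_mult)
  qed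
  moreover have "b 0 \<noteq> 0" by (simp add: b_def)
  moreover have "norm t \<le> 1" if "b t \<noteq> 0" for t
    using that by (auto simp: b_def max_def abs_square_le_1 split: if_splits)
  ultimately show ?thesis by (rule smooth_bump_of_bump)
qed

section \<open>Bump functions on product spaces\<close>

lemma norm_fst_blinfun_le: "norm (Blinfun fst :: ('a::real_normed_vector \<times> 'b::real_normed_vector) \<Rightarrow>\<^sub>L 'a) \<le> 1"
  by (rule norm_blinfun_bound) (auto simp: bounded_linear_Blinfun_apply bounded_linear_fst norm_fst_le)

lemma norm_snd_blinfun_le: "norm (Blinfun snd :: ('a::real_normed_vector \<times> 'b::real_normed_vector) \<Rightarrow>\<^sub>L 'b) \<le> 1"
  by (rule norm_blinfun_bound) (auto simp: bounded_linear_Blinfun_apply bounded_linear_snd norm_snd_le)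

lemma C1d_fst: "C1d S (\<lambda>x. f (fst x)) (\<lambda>x. f' (fst x) o\<^sub>L Blinfun fst)" if "C1d UNIV f f'"
proof -
  have "C1d S (\<lambda>x. 0 + blinfun_apply (Blinfun fst) (x - 0)) (\<lambda>x. Blinfun fst)" by (rule C1d_blinfun_affine)
  then have "C1d S fst (\<lambda>x. Blinfun fst)" by (simp add: bounded_linear_Blinfun_apply bounded_linear_fst)
  from C1d_compose[OF that this] show ?thesis by simp
qed

lemma C1d_snd: "C1d S (\<lambda>x. f (snd x)) (\<lambda>x. f' (snd x) o\<^sub>L Blinfun snd)" if "C1d UNIV f f'"
proof -
  have "C1d S (\<lambda>x. 0 + blinfun_apply (Blinfun snd) (x - 0)) (\<lambda>x. Blinfun snd)" by (rule C1d_blinfun_affine)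
  then have "C1d S snd (\<lambda>x. Blinfun snd)" by (simp add: bounded_linear_Blinfun_apply bounded_linear_snd)
  from C1d_compose[OF that this] show ?thesis by simp
qed

text \<open>The product of the two bumps lives in a product of unit balls, which only fits into the
  ball of radius 2 of the product norm; it is therefore treated as a raw bump and normalised
  again.\<close>

lemma smooth_bump_prod:
  fixes \<beta>\<^sub>1 :: "'a::real_normed_vector \<Rightarrow> real" and \<beta>\<^sub>2 :: "'b::real_normed_vector \<Rightarrow> real"
  assumes b1: "smooth_bump \<beta>\<^sub>1 \<beta>\<^sub>1' K\<^sub>1" and b2: "smooth_bump \<beta>\<^sub>2 \<beta>\<^sub>2' K\<^sub>2"
  shows "\<exists>\<beta> \<beta>' K. smooth_bump (\<beta> :: 'a \<times> 'b \<Rightarrow> real) \<beta>' K"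
proof -
  define F where "F = (\<lambda>x::'a\<times>'b. \<beta>\<^sub>1' (fst x) o\<^sub>L (Blinfun fst :: ('a\<times>'b) \<Rightarrow>\<^sub>L 'a))"
  define G where "G = (\<lambda>x::'a\<times>'b. \<beta>\<^sub>2' (snd x) o\<^sub>L (Blinfun snd :: ('a\<times>'b) \<Rightarrow>\<^sub>L 'b))"
  have F: "C1d UNIV (\<lambda>x::'a\<times>'b. \<beta>\<^sub>1 (fst x)) F" unfolding F_def using b1
    by (intro C1d_fst) (auto simp: smooth_bump_def)
  have G: "C1d UNIV (\<lambda>x::'a\<times>'b. \<beta>\<^sub>2 (snd x)) G" unfolding G_def using b2
    by (intro C1d_snd) (auto simp: smooth_bump_def)
  have "C1d UNIV (\<lambda>x::'a\<times>'b. \<beta>\<^sub>1 (fst x) * \<beta>\<^sub>2 (snd x)) (\<lambda>x. \<beta>\<^sub>1 (fst x) *\<^sub>R G x + \<beta>\<^sub>2 (snd x) *\<^sub>R F x)"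
    by (rule C1d_mult[OF F G])
  have K: "0 \<le> K\<^sub>1" "0 \<le> K\<^sub>2" using b1 b2 order_trans[OF norm_ge_zero[of "\<beta>\<^sub>1' 0"]] order_trans[OF norm_ge_zero[of "\<beta>\<^sub>2' 0"]]
    by (auto simp: smooth_bump_def)
  have nF: "norm (F x) \<le> K\<^sub>1" for x
  proof -
    have "norm (F x) \<le> norm (\<beta>\<^sub>1' (fst x)) * norm (Blinfun fst :: ('a\<times>'b) \<Rightarrow>\<^sub>L 'a)" unfolding F_def by (rule norm_blinfun_compose)
    also have "\<dots> \<le> K\<^sub>1 * 1" using b1 K norm_fst_blinfun_le by (intro mult_mono) (auto simp: smooth_bump_def)
    finally show ?thesis by simp
  qed
  have nG: "norm (G x) \<le> K\<^sub>2" for x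
  proof -
    have "norm (G x) \<le> norm (\<beta>\<^sub>2' (snd x)) * norm (Blinfun snd :: ('a\<times>'b) \<Rightarrow>\<^sub>L 'b)" unfolding G_def by (rule norm_blinfun_compose)
    also have "\<dots> \<le> K\<^sub>2 * 1" using b2 K norm_snd_blinfun_le by (intro mult_mono) (auto simp: smooth_bump_def)
    finally show ?thesis by simp
  qed
  have "norm (\<beta>\<^sub>1 (fst x) *\<^sub>R G x + \<beta>\<^sub>2 (snd x) *\<^sub>R F x) \<le> K\<^sub>1 + K\<^sub>2" for x
  proof -
    have "norm (\<beta>\<^sub>1 (fst x) *\<^sub>R G x + \<beta>\<^sub>2 (snd x) *\<^sub>R F x) \<le> \<bar>\<beta>\<^sub>1 (fst x)\<bar> * norm (G x) + \<bar>\<beta>\<^sub>2 (snd x)\<bar> * norm (F x)"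
    by (rule norm_triangle_le) simp
  also have "\<dots> \<le> 1 * K\<^sub>2 + 1 * K\<^sub>1"
    using nF nG b1 b2 K by (intro add_mono mult_mono) (auto simp: smooth_bump_def)
  finally show ?thesis by simp
  qed
  moreover have "\<beta>\<^sub>1 (fst 0) * \<beta>\<^sub>2 (snd 0) \<noteq> 0" using assms unfolding smooth_bump_def by fastforce
  moreover have "norm x \<le> 2" if "\<beta>\<^sub>1 (fst x) * \<beta>\<^sub>2 (snd x) \<noteq> 0" for x :: "'a \<times> 'b"
  proof -
  from that have "norm (fst x) \<le> 1" "norm (snd x) \<le> 1" using b1 b2 unfolding smooth_bump_def
    by (metis linorder_le_cases mult_zero_left, metis linorder_le_cases mult_zero_right)
  then show ?thesis using norm_Pair_le[of "fst x" "snd x"] by simp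
  qed
  ultimately show ?thesis by (intro smooth_bump_of_bump[OF C1d_mult[OF F G]])
qed

section \<open>Semicontinuous functions\<close>

lemma lsc_on_subset: "lsc_on S f \<Longrightarrow> T \<subseteq> S \<Longrightarrow> lsc_on T f"
  unfolding lsc_on_def by (meson eventually_at_filter filter_leD at_le subsetD)

text \<open>The point that the punctured filter of the definition leaves out satisfies the
  inequality anyway. Full neighbourhoods are the form that can be pulled back along charts and
  projections.\<close>

lemma lsc_on_nhds: "lsc_on S f \<Longrightarrow> p \<in> S \<Longrightarrow> c < f p \<Longrightarrow> \<forall>\<^sub>F q in nhds p. q \<in> S \<longrightarrow> c < f q"
  unfolding lsc_on_def eventually_at_filter by (fastforce elim: eventually_mono)

lemma usc_on_nhds: "usc_on S f \<Longrightarrow> p \<in> S \<Longrightarrow> f p < c \<Longrightarrow> \<forall>\<^sub>F q in nhds p. q \<in> S \<longrightarrow> f q < c"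
  unfolding usc_on_def eventually_at_filter by (fastforce elim: eventually_mono)

lemma lsc_onI_nhds: "(\<And>p c. p \<in> S \<Longrightarrow> c < f p \<Longrightarrow> \<forall>\<^sub>F q in nhds p. q \<in> S \<longrightarrow> c < f q) \<Longrightarrow> lsc_on S f"
  unfolding lsc_on_def eventually_at_filter by (fastforce elim: eventually_mono)

lemma usc_onI_nhds: "(\<And>p c. p \<in> S \<Longrightarrow> f p < c \<Longrightarrow> \<forall>\<^sub>F q in nhds p. q \<in> S \<longrightarrow> f q < c) \<Longrightarrow> usc_on S f"
  unfolding usc_on_def eventually_at_filter by (fastforce elim: eventually_mono)

lemma lsc_on_cong: "lsc_on S f \<Longrightarrow> (\<And>q. q \<in> S \<Longrightarrow> f q = g q) \<Longrightarrow> lsc_on S g"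
  using lsc_on_nhds[of S f] by (intro lsc_onI_nhds) (auto elim!: eventually_mono)

lemma usc_on_iff_lsc_on_minus: "usc_on S f \<longleftrightarrow> lsc_on S (\<lambda>x. - f x)"
proof -
  have "(\<forall>c. P c) \<longleftrightarrow> (\<forall>c. P (- c))" for P :: "real \<Rightarrow> bool" by (metis minus_minus)
  then show ?thesis unfolding usc_on_def lsc_on_def
    by (subst (2) \<open>\<And>P. (\<forall>c. P c) \<longleftrightarrow> (\<forall>c. P (- c))\<close>) simp
qed

lemma continuous_imp_usc_lsc:
  assumes "continuous_on S (f :: 'a::topological_space \<Rightarrow> real)" shows "usc_on S f" "lsc_on S f"
  using assms unfolding continuous_on_def usc_on_def lsc_on_def by (auto intro: order_tendstoD)

lemma lsc_on_add:
  fixes f k :: "'a::topological_space \<Rightarrow> real"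
  assumes f: "lsc_on S f" and k: "lsc_on S k"
  shows "lsc_on S (\<lambda>x. f x + k x)"
  unfolding lsc_on_def
proof (intro ballI allI impI)
  fix p c assume p: "p \<in> S" and c: "c < f p + k p"
  define e where "e = (f p + k p - c) / 2"
  have e: "e > 0" using c by (simp add: e_def)
  have "\<forall>\<^sub>F q in at p within S. f p - e < f q" "\<forall>\<^sub>F q in at p within S. k p - e < k q"
    using f k p e by (auto simp: lsc_on_def)
  then show "\<forall>\<^sub>F q in at p within S. c < f q + k q"
    by eventually_elim (simp add: e_def field_simps)
qed

lemma lsc_on_add_continuous:
  fixes f k :: "'a::topological_space \<Rightarrow> real"
  assumes "lsc_on S f" "continuous_on S k"
  shows "lsc_on S (\<lambda>x. f x + k x)"
  by (rule lsc_on_add[OF assms(1) continuous_imp_usc_lsc(2)[OF assms(2)]])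

text \<open>Formulated with majorants \<open>b\<close>, because along a minimising sequence only
  bounds for the values converge, not the values themselves.\<close>

lemma lsc_on_sequentially:
  assumes f: "lsc_on S f" and S: "\<And>n. \<sigma> n \<in> S" "x \<in> S" and lim: "\<sigma> \<longlonglongrightarrow> x"
    and b: "b \<longlonglongrightarrow> l" "\<And>n. f (\<sigma> n) \<le> b n"
  shows "f x \<le> l"
proof (rule ccontr)
  assume "\<not> f x \<le> l"
  then obtain c where c: "l < c" "c < f x" using dense not_le by blast
  have "\<forall>\<^sub>F q in at x within S. c < f q" using f S(2) c(2) by (auto simp: lsc_on_def)
  then have "\<forall>\<^sub>F q in nhds x. q \<noteq> x \<longrightarrow> q \<in> S \<longrightarrow> c < f q" by (simp add: eventually_at_filter)
  from eventually_compose_filterlim[OF this lim] have "\<forall>\<^sub>F n in sequentially. c < f (\<sigma> n)"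
    by eventually_elim (use S(1) c(2) in metis)
  then have "\<forall>\<^sub>F n in sequentially. c \<le> b n" by eventually_elim (use b(2) less_imp_le order_trans in metis)
  then have "c \<le> l" using tendsto_lowerbound[OF b(1)] by simp
  then show False using c by simp
qed

section \<open>Variational principles\<close>

text \<open>A common summable bound makes the series of derivatives converge uniformly in the
  operator norm; this gives both termwise differentiation and the continuity of the limit
  derivative.\<close>

lemma C1d_series:
  fixes f :: "nat \<Rightarrow> 'a::real_normed_vector \<Rightarrow> real"
  assumes d: "\<And>n. C1d UNIV (f n) (f' n)" and b: "\<And>n x. \<bar>f n x\<bar> \<le> a n" "\<And>n x. norm (f' n x) \<le> a n"
    and a: "summable a"
  shows "C1d UNIV (\<lambda>x. \<Sum>n. f n x) (\<lambda>x. \<Sum>n. f' n x)"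
    and "\<bar>\<Sum>n. f n x\<bar> \<le> suminf a" and "norm (\<Sum>n. f' n x) \<le> suminf a"
proof -
  have ul: "uniform_limit UNIV (\<lambda>n x. \<Sum>i<n. f' i x) (\<lambda>x. \<Sum>n. f' n x) sequentially"
    by (rule Weierstrass_m_test[OF _ a]) (use b in auto)
  have sf: "(\<lambda>n. f n x) sums (\<Sum>n. f n x)" for x
    by (rule summable_sums, rule summable_comparison_test'[OF a, of 0]) (use b in auto)
  have "\<exists>g. \<forall>x\<in>UNIV. (\<lambda>n. f n x) sums (g x) \<and> (g has_derivative blinfun_apply (\<Sum>n. f' n x)) (at x within UNIV)"
  proof (rule has_derivative_series[where f' = "\<lambda>n x. blinfun_apply (f' n x)" and x = 0, OF _ _ _ _ sf])
    show "(f n has_derivative blinfun_apply (f' n x)) (at x within UNIV)" for n x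
      using C1d_derivD[OF d] by auto
    fix e :: real assume "e > 0"
    from uniform_limitD[OF ul this]
    show "\<forall>\<^sub>F n in sequentially. \<forall>x\<in>UNIV. \<forall>h. norm ((\<Sum>i<n. blinfun_apply (f' i x) h) - blinfun_apply (\<Sum>n. f' n x) h) \<le> e * norm h"
    proof eventually_elim
      case (elim n)
      show ?case
      proof (intro ballI allI)
        fix x h
        have "(\<Sum>i<n. blinfun_apply (f' i x) h) - blinfun_apply (\<Sum>n. f' n x) h = blinfun_apply ((\<Sum>i<n. f' i x) - (\<Sum>n. f' n x)) h"
          by (simp add: blinfun.diff_left blinfun.sum_left)
        also have "norm \<dots> \<le> norm ((\<Sum>i<n. f' i x) - (\<Sum>n. f' n x)) * norm h" by (rule norm_blinfun)
        also have "\<dots> \<le> e * norm h" using elim by (intro mult_right_mono) (auto simp: dist_norm less_imp_le)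
        finally show "norm ((\<Sum>i<n. blinfun_apply (f' i x) h) - blinfun_apply (\<Sum>n. f' n x) h) \<le> e * norm h" .
      qed
    qed
  qed auto
  then obtain g where g: "\<And>x. (\<lambda>n. f n x) sums (g x)" "\<And>x. (g has_derivative blinfun_apply (\<Sum>n. f' n x)) (at x)" by auto
  have "g = (\<lambda>x. \<Sum>n. f n x)" using g(1) sf sums_unique2 by blast
  moreover have "continuous_on UNIV (\<lambda>x. \<Sum>n. f' n x)"
    by (rule uniform_limit_theorem[OF always_eventually ul]) (auto intro!: continuous_on_sum C1d_contD[OF d])
  ultimately show "C1d UNIV (\<lambda>x. \<Sum>n. f n x) (\<lambda>x. \<Sum>n. f' n x)" using g(2) by (auto simp: C1d_def)
  show "\<bar>\<Sum>n. f n x\<bar> \<le> suminf a" using norm_suminf_le[OF _ a, of "\<lambda>n. f n x"] b by simp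
  show "norm (\<Sum>n. f' n x) \<le> suminf a" using norm_suminf_le[OF _ a, of "\<lambda>n. f' n x"] b by simp
qed

section \<open>Rescaled bumps and the smooth variational principle\<close>

lemma C1d_bump_rescaled:
  fixes \<beta> :: "'a::real_normed_vector \<Rightarrow> real"
  assumes b: "smooth_bump \<beta> \<beta>' K" and r: "r > 0"
  shows "C1d S (\<lambda>x. \<beta> ((1 / r) *\<^sub>R (x - c))) (\<lambda>x. (1 / r) *\<^sub>R \<beta>' ((1 / r) *\<^sub>R (x - c)))"
    and "norm ((1 / r) *\<^sub>R \<beta>' ((1 / r) *\<^sub>R (x - c))) \<le> K / r"
    and "r \<le> norm (x - c) \<Longrightarrow> \<beta> ((1 / r) *\<^sub>R (x - c)) = 0"
    and "\<beta> ((1 / r) *\<^sub>R (c - c)) = 1"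
    and "0 \<le> \<beta> v" "\<beta> v \<le> 1" "0 \<le> K"
proof -
  have d: "C1d UNIV \<beta> \<beta>'" using b by (simp add: smooth_bump_def)
  have "\<beta>' y o\<^sub>L ((1 / r) *\<^sub>R id_blinfun) = (1 / r) *\<^sub>R \<beta>' y" for y
    by (rule blinfun_eqI) (simp add: scaleR_blinfun.rep_eq blinfun.scaleR_right)
  then show "C1d S (\<lambda>x. \<beta> ((1 / r) *\<^sub>R (x - c))) (\<lambda>x. (1 / r) *\<^sub>R \<beta>' ((1 / r) *\<^sub>R (x - c)))"
    using C1d_compose[OF d C1d_homothety[of S "1 / r" c]] by simp
  show "norm ((1 / r) *\<^sub>R \<beta>' ((1 / r) *\<^sub>R (x - c))) \<le> K / r"
    using b r by (simp add: smooth_bump_def divide_right_mono)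
  show "r \<le> norm (x - c) \<Longrightarrow> \<beta> ((1 / r) *\<^sub>R (x - c)) = 0" using b r by (simp add: smooth_bump_def)
  show "\<beta> ((1 / r) *\<^sub>R (c - c)) = 1" "0 \<le> \<beta> v" "\<beta> v \<le> 1" using b unfolding smooth_bump_def by auto
  show "0 \<le> K" using b order_trans[OF norm_ge_zero[of "\<beta>' 0"]] unfolding smooth_bump_def by blast
qed

text \<open>The Deville--Godefroy--Zizler principle. The \<open>n\<close>-th bump is centred at a point that almost
  minimises \<open>f\<close> minus the previous bumps, with an error smaller than the height of the bump, so
  that the next almost minimiser stays in its support.\<close>

theorem smooth_variational_principle:
  fixes f :: "'a::banach \<Rightarrow> real"
  assumes b: "smooth_bump (\<beta> :: 'a \<Rightarrow> real) \<beta>' K" and C: "closed C" "C \<noteq> {}"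
    and f: "lsc_on C f" "\<And>x. x \<in> C \<Longrightarrow> m \<le> f x" and \<epsilon>: "\<epsilon> > 0"
  shows "\<exists>\<gamma> \<gamma>' z. C1d UNIV \<gamma> \<gamma>' \<and> (\<forall>x. \<bar>\<gamma> x\<bar> \<le> \<epsilon> \<and> norm (\<gamma>' x) \<le> \<epsilon>) \<and> z \<in> C \<and> (\<forall>y\<in>C. f z + \<gamma> z \<le> f y + \<gamma> y)"
proof -
  have K: "0 \<le> K" using C1d_bump_rescaled(7)[OF b, of 1] by simp
  \<comment> \<open>The decay 1/4 per step beats the factor 2 per step that shrinking the radius
    costs in the derivative; the constant in front makes the values and the derivatives of the whole
    series sum to at most \<epsilon>.\<close>
  define a where "a n = (\<epsilon> / (2 * (K + 1))) * (1/4) ^ n" for n :: nat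
  have a0: "a n > 0" for n using \<epsilon> K by (auto simp: a_def)
  have aS: "a (Suc n) < a n" for n proof -
    have "a (Suc n) = a n / 4" by (simp add: a_def)
    then show ?thesis using a0[of n] by simp
  qed
  define B where "B n c x = a n * \<beta> ((1 / (1/2)^n) *\<^sub>R (x - c))" for n :: nat and c x
  define B' where "B' n c x = a n *\<^sub>R (1 / (1/2)^n) *\<^sub>R \<beta>' ((1 / (1/2)^n) *\<^sub>R (x - c))" for n :: nat and c x
  have BC1: "C1d UNIV (B n c) (B' n c)" for n c
    unfolding B_def[abs_def] B'_def[abs_def] by (intro C1d_cmult C1d_bump_rescaled(1)[OF b]) simp
  have Bb: "0 \<le> B n c x" "B n c x \<le> a n" "B n c c = a n" for n c x
    using a0[of n] C1d_bump_rescaled(4-6)[OF b, of "(1/2)^n"] by (auto simp: B_def mult_left_le)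
  have Bs: "B n c x = 0" if "(1/2)^n \<le> norm (x - c)" for n c x
    using C1d_bump_rescaled(3)[OF b _ that] by (simp add: B_def)
  have B'b: "norm (B' n c x) \<le> \<epsilon> / 2 * (1/2)^n" for n c x
  proof -
    have "norm (B' n c x) = a n * norm ((1 / (1/2)^n) *\<^sub>R \<beta>' ((1 / (1/2)^n) *\<^sub>R (x - c)))"
      unfolding B'_def using a0[of n] by simp
    also have "\<dots> \<le> a n * (K / (1/2)^n)"
      using C1d_bump_rescaled(2)[OF b, of "(1/2)^n"] a0[of n] by (intro mult_left_mono) (auto intro: less_imp_le)
    also have "\<dots> = (\<epsilon> / 2) * (K / (K + 1)) * ((1/4)^n / (1/2)^n)" using K by (simp add: a_def field_simps)
    also have "(1/4::real)^n / (1/2)^n = (1/2)^n" by (simp add: power_divide[symmetric])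
    also have "\<epsilon> / 2 * (K / (K + 1)) * (1 / 2) ^ n \<le> \<epsilon> / 2 * 1 * (1/2)^n"
      using \<epsilon> K by (intro mult_right_mono mult_left_mono) auto
    finally show ?thesis by simp
  qed
  have Bb': "\<bar>B n c x\<bar> \<le> \<epsilon> / 2 * (1/2)^n" for n c x
  proof -
    have "a n \<le> \<epsilon> / 2 * (1/2)^n" unfolding a_def
      using \<epsilon> K by (intro mult_mono power_mono) (auto simp: field_simps)
    then show ?thesis using Bb(1,2)[of n c x] by linarith
  qed
  \<comment> \<open>A state is a centre together with the sum of the bumps placed so far. The bound
    on that sum keeps the infimum of the perturbed function finite, and the centre misses this
    infimum by less than half the height of the bump about to be placed.\<close>
  define P where "P n s \<longleftrightarrow> fst s \<in> C \<and> (\<forall>x. 0 \<le> snd s x) \<and> (\<forall>x. snd s x \<le> (\<Sum>i<n. a i)) \<and>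
     f (fst s) - snd s (fst s) < (INF y\<in>C. f y - snd s y) + a n / 2" for n and s :: "'a \<times> ('a \<Rightarrow> real)"
  define Q where "Q n s s' \<longleftrightarrow> snd s' = (\<lambda>x. snd s x + B n (fst s) x)" for n and s s' :: "'a \<times> ('a \<Rightarrow> real)"
  have near: "\<exists>c\<in>C. f c - S c < (INF y\<in>C. f y - S y) + e"
    if "\<forall>x. S x \<le> M" "e > 0" for S M and e :: real
  proof -
    have bd: "bdd_below ((\<lambda>y. f y - S y) ` C)"
    proof (rule bdd_belowI2)
      show "m - M \<le> f y - S y" if "y \<in> C" for y using f(2)[OF that] \<open>\<forall>x. S x \<le> M\<close>[rule_format, of y] by linarith
    qed
    then show ?thesis using cINF_less_iff[OF C(2) bd, of "(INF y\<in>C. f y - S y) + e"] that by auto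
  qed
  have "\<exists>s. \<forall>n. P n (s n) \<and> Q n (s n) (s (Suc n))"
  proof (rule dependent_nat_choice)
    obtain c where "c \<in> C" "f c - 0 < (INF y\<in>C. f y - 0) + a 0 / 2"
      using near[of "\<lambda>x. 0" 0 "a 0 / 2"] a0[of 0] by auto
    then show "\<exists>s. P 0 s" by (intro exI[of _ "(c, \<lambda>x. 0)"]) (simp add: P_def)
    fix s n assume "P n s"
    let ?S = "\<lambda>x. snd s x + B n (fst s) x"
    have S: "\<forall>x. 0 \<le> ?S x" "\<forall>x. ?S x \<le> (\<Sum>i<Suc n. a i)" using \<open>P n s\<close> Bb unfolding P_def by (auto intro: add_mono)
    obtain c where "c \<in> C" "f c - ?S c < (INF y\<in>C. f y - ?S y) + a (Suc n) / 2"
      using near[OF S(2), of "a (Suc n) / 2"] a0[of "Suc n"] by auto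
    then show "\<exists>s'. P (Suc n) s' \<and> Q n s s'" using S by (intro exI[of _ "(c, ?S)"]) (auto simp: P_def Q_def)
  qed
  then obtain s where s: "\<And>n. P n (s n)" "\<And>n. Q n (s n) (s (Suc n))" by blast
  define x where "x n = fst (s n)" for n
  define S where "S n = snd (s n)" for n
  have xC: "x n \<in> C" for n using s(1)[of n] by (simp add: P_def x_def)
  have S_Suc: "S (Suc n) y = S n y + B n (x n) y" for n y using s(2)[of n] by (simp add: Q_def S_def x_def)
  have xS: "f (x n) - S n (x n) < (INF y\<in>C. f y - S n y) + a n / 2" for n using s(1)[of n] by (simp add: P_def x_def S_def)
  have Sb: "S n y \<le> (\<Sum>i<n. a i)" for n y using s(1)[of n] by (simp add: P_def S_def)
  have inf_le: "(INF y\<in>C. f y - S n y) \<le> f y - S n y" if "y \<in> C" for n y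
  proof (rule cINF_lower[OF _ that], rule bdd_belowI2)
    show "m - (\<Sum>i<n. a i) \<le> f y - S n y" if "y \<in> C" for y using f(2)[OF that] Sb[of n y] by linarith
  qed
  \<comment> \<open>The new bump lowers the value at \<open>x n\<close> by \<open>a n\<close>, hence
    more than \<open>a n / 2\<close> below the old infimum. This exceeds the tolerance
    \<open>a (Suc n) / 2\<close> of the next choice, so the next centre must also lie below the old
    infimum, which is impossible outside the support of the bump.\<close>
  have step: "norm (x (Suc n) - x n) < (1/2)^n" for n
  proof (rule ccontr)
    assume "\<not> ?thesis"
    then have "B n (x n) (x (Suc n)) = 0" by (intro Bs) simp
    then have 1: "f (x (Suc n)) - S (Suc n) (x (Suc n)) \<ge> (INF y\<in>C. f y - S n y)"
      using inf_le[OF xC] S_Suc by simp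
    have "f (x (Suc n)) - S (Suc n) (x (Suc n)) < f (x n) - S (Suc n) (x n) + a (Suc n) / 2"
      using xS[of "Suc n"] inf_le[OF xC, of "Suc n" n] by linarith
    also have "\<dots> = f (x n) - S n (x n) - a n + a (Suc n) / 2" using S_Suc[of n "x n"] Bb(3) by simp
    also have "\<dots> < (INF y\<in>C. f y - S n y)" using xS[of n] aS[of n] by linarith
    finally show False using 1 by simp
  qed
  have "summable (\<lambda>n. x (Suc n) - x n)"
    by (rule summable_comparison_test'[of "\<lambda>n. (1/2::real)^n" 0]) (use step less_imp_le in auto)
  then have "convergent (\<lambda>n. \<Sum>i<n. x (Suc i) - x i)" by (simp add: summable_iff_convergent)
  then have "convergent (\<lambda>n. x n - x 0)" by (simp add: sum_lessThan_telescope)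
  then obtain z0 where "(\<lambda>n. x n - x 0) \<longlonglongrightarrow> z0" by (auto simp: convergent_def)
  from tendsto_add[OF this tendsto_const[of "x 0"]] have xz: "x \<longlonglongrightarrow> z0 + x 0" by simp
  define z where "z = z0 + x 0"
  have zC: "z \<in> C" using closed_sequentially[OF C(1) xC xz] by (simp add: z_def)
  let ?c = "\<lambda>n. \<epsilon> / 2 * (1/2::real)^n"
  have sc: "summable ?c" by (intro summable_mult) simp
  have sum_c: "suminf ?c = \<epsilon>" by (subst suminf_mult) (auto simp: suminf_geometric)
  note series = C1d_series[of "\<lambda>n. B n (x n)" "\<lambda>n. B' n (x n)" ?c, OF BC1 Bb' B'b sc]
  define g where "g y = (\<Sum>n. B n (x n) y)" for y
  define g' where "g' y = (\<Sum>n. B' n (x n) y)" for y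
  have g: "C1d UNIV g g'" "\<bar>g y\<bar> \<le> \<epsilon>" "norm (g' y) \<le> \<epsilon>" for y
    unfolding g_def g'_def using series sum_c by auto
  have Sg: "S n y - S 0 y \<le> g y" "g y \<le> S n y - S 0 y + \<epsilon> * (1/2)^n" for n y
  proof -
    have s1: "summable (\<lambda>n. B n (x n) y)" by (rule summable_comparison_test'[OF sc, of 0]) (use Bb' in auto)
    have eq: "S n y - S 0 y = (\<Sum>i<n. B i (x i) y)" by (induction n) (auto simp: S_Suc)
    have gs: "g y = (\<Sum>k. B (k + n) (x (k + n)) y) + (S n y - S 0 y)"
      unfolding g_def eq by (rule suminf_split_initial_segment[OF s1])
    have s2: "summable (\<lambda>k. B (k + n) (x (k + n)) y)" using s1 by (rule summable_ignore_initial_segment)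
    have "0 \<le> (\<Sum>k. B (k + n) (x (k + n)) y)" by (rule suminf_nonneg[OF s2 Bb(1)])
    then show "S n y - S 0 y \<le> g y" using gs by simp
    have "(\<Sum>k. B (k + n) (x (k + n)) y) \<le> (\<Sum>k. (1/2)^n * ?c k)"
    proof (rule suminf_le[OF _ s2 summable_mult[OF sc]])
      fix k show "B (k + n) (x (k + n)) y \<le> (1/2)^n * ?c k"
        using Bb'[of "k+n" "x (k+n)" y] by (simp add: power_add algebra_simps)
    qed
    also have "\<dots> = \<epsilon> * (1/2)^n" by (subst suminf_mult[OF sc], subst sum_c) (rule mult.commute)
    finally show "g y \<le> S n y - S 0 y + \<epsilon> * (1/2)^n" using gs by simp
  qed
  \<comment> \<open>At \<open>n = 0\<close> the bound in \<open>P\<close> is an empty sum, so the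
    initial perturbation is squeezed to zero.\<close>
  have S0: "\<bar>S 0 y\<bar> = 0" for y using s(1)[of 0] by (simp add: P_def S_def order_antisym)
  have S0: "S 0 y = 0" for y using S0[of y] by simp
  \<comment> \<open>The centre \<open>x n\<close> almost minimises \<open>f - S n\<close>. Replacing
    \<open>S n\<close> by the full sum \<open>g\<close> helps at \<open>x n\<close> and costs at
    most a geometric tail at \<open>y\<close>; lower semicontinuity of \<open>f\<close> then passes
    to the limit.\<close>
  have "f z - g z \<le> f y - g y" if y: "y \<in> C" for y
  proof -
    let ?b = "\<lambda>n. f y - g y + a n / 2 + \<epsilon> * (1/2)^n + g (x n)"
    have "f z \<le> f y - g y + 0 / 2 + \<epsilon> * 0 + g z"
    proof (rule lsc_on_sequentially[OF f(1) xC zC])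
      show "x \<longlonglongrightarrow> z" using xz z_def by simp
      have "a \<longlonglongrightarrow> 0" unfolding a_def[abs_def]
        by (intro tendsto_mult_right_zero LIMSEQ_power_zero) simp
      moreover have "(\<lambda>n. (1/2::real)^n) \<longlonglongrightarrow> 0" by (rule LIMSEQ_power_zero) simp
      moreover have "(\<lambda>n. g (x n)) \<longlonglongrightarrow> g z"
        using isCont_tendsto_compose[OF _ \<open>x \<longlonglongrightarrow> z\<close>, of g] C1d_continuous_on[OF g(1)]
        by (simp add: continuous_on_eq_continuous_at)
      ultimately show "?b \<longlonglongrightarrow> f y - g y + 0 / 2 + \<epsilon> * 0 + g z" by (intro tendsto_intros) auto
      fix n
      have "f (x n) - S n (x n) \<le> f y - S n y + a n / 2" using xS[of n] inf_le[OF y, of n] by simp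
      moreover have "S n (x n) \<le> g (x n)" using Sg(1)[of n "x n"] S0 by simp
      moreover have "g y \<le> S n y + \<epsilon> * (1/2)^n" using Sg(2)[of y n] S0 by simp
      ultimately show "f (x n) \<le> ?b n" by linarith
    qed
    then show ?thesis by simp
  qed
  then have "\<forall>y\<in>C. f z + - g z \<le> f y + - g y" by simp
  moreover have "C1d UNIV (\<lambda>x. - g x) (\<lambda>x. - g' x)" using C1d_minus[OF g(1)] .
  ultimately show ?thesis using g(2,3) zC by (intro exI[of _ "\<lambda>x. - g x"] exI[of _ "\<lambda>x. - g' x"] exI[of _ z]) simp
qed

text \<open>Stated for a distance function \<open>D\<close> on a set, with completeness and lower
  semicontinuity along sequences, since it is applied to the Finsler metric on a closed time strip,
  which is not the metric of a type class. Each iterate nearly minimises \<open>f\<close> over the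
  set \<open>Sx\<close> of points that improve on the previous one by at least \<epsilon> times
  their distance from it. By the triangle inequality these sets are nested, and the total distance
  travelled is controlled by the decrease of \<open>f\<close>.\<close>

theorem ekeland:
  fixes D :: "'a \<Rightarrow> 'a \<Rightarrow> real"
  assumes D: "\<And>x y. x \<in> S \<Longrightarrow> y \<in> S \<Longrightarrow> 0 \<le> D x y" "\<And>x. x \<in> S \<Longrightarrow> D x x = 0" 
      "\<And>x y z. x \<in> S \<Longrightarrow> y \<in> S \<Longrightarrow> z \<in> S \<Longrightarrow> D x z \<le> D x y + D y z"
    and complete: "\<And>\<sigma>. (\<And>n. \<sigma> n \<in> S) \<Longrightarrow> (\<forall>e>0. \<exists>k. \<forall>m\<ge>k. \<forall>n\<ge>m. D (\<sigma> m) (\<sigma> n) < e) \<Longrightarrow> \<exists>x\<in>S. (\<lambda>n. D (\<sigma> n) x) \<longlonglongrightarrow> 0"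
    and lsc: "\<And>\<sigma> x l. (\<And>n. \<sigma> n \<in> S) \<Longrightarrow> x \<in> S \<Longrightarrow> (\<lambda>n. D (\<sigma> n) x) \<longlonglongrightarrow> 0 \<Longrightarrow> (\<lambda>n. f (\<sigma> n)) \<longlonglongrightarrow> l \<Longrightarrow> f x \<le> l"
    and bdd: "\<And>x. x \<in> S \<Longrightarrow> m \<le> (f x :: real)" and x0: "x\<^sub>0 \<in> S" and \<epsilon>: "\<epsilon> > 0"
  shows "\<exists>z\<in>S. f z \<le> f x\<^sub>0 \<and> (\<forall>y\<in>S. f z \<le> f y + \<epsilon> * D z y)"
proof -
  define Sx where "Sx x = {y \<in> S. f y + \<epsilon> * D x y \<le> f x}" for x
  have "\<exists>x. \<forall>n::nat. (x n \<in> S \<and> (n = 0 \<longrightarrow> x n = x\<^sub>0)) \<and> (x (Suc n) \<in> Sx (x n) \<and> f (x (Suc n)) < (INF y\<in>Sx (x n). f y) + (1/2)^n)"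
  proof (rule dependent_nat_choice)
    show "\<exists>x. x \<in> S \<and> ((0::nat) = 0 \<longrightarrow> x = x\<^sub>0)" using x0 by auto
    fix x and n :: nat assume "x \<in> S \<and> (n = 0 \<longrightarrow> x = x\<^sub>0)"
    then have "x \<in> Sx x" using D(2) by (simp add: Sx_def)
    moreover have "bdd_below (f ` Sx x)" using bdd by (intro bdd_belowI2[of _ m]) (auto simp: Sx_def)
    ultimately have "\<exists>y\<in>Sx x. f y < (INF y\<in>Sx x. f y) + (1/2)^n"
      using cINF_less_iff[of "Sx x" f "(INF y\<in>Sx x. f y) + (1/2)^n"] by auto
    then show "\<exists>y. (y \<in> S \<and> (Suc n = 0 \<longrightarrow> y = x\<^sub>0)) \<and> y \<in> Sx x \<and> f y < (INF y\<in>Sx x. f y) + (1/2)^n"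
      by (auto simp: Sx_def)
  qed
  then obtain x where x: "\<And>n. x n \<in> S" "x 0 = x\<^sub>0" "\<And>n. x (Suc n) \<in> Sx (x n)"
      "\<And>n. f (x (Suc n)) < (INF y\<in>Sx (x n). f y) + (1/2)^n" by blast
  have trans: "z \<in> Sx a" if "a \<in> S" "y \<in> Sx a" "z \<in> Sx y" for a y z
  proof -
    have "\<epsilon> * D a z \<le> \<epsilon> * (D a y + D y z)" using D(3)[of a y z] that \<epsilon> by (intro mult_left_mono) (auto simp: Sx_def)
    then show ?thesis using that by (auto simp: Sx_def algebra_simps)
  qed
  have mono: "x (n + k) \<in> Sx (x n)" for n k
  proof (induction k)
    case 0 show ?case using x(1)[of n] D(2) by (simp add: Sx_def)
  next
    case (Suc k) then show ?case using trans[OF x(1) Suc x(3)[of "n+k"]] by simp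
  qed
  have mono: "x k \<in> Sx (x n)" if "n \<le> k" for n k using mono[of n "k - n"] that by simp
  have dec: "decseq (\<lambda>n. f (x n))"
  proof (rule decseq_SucI)
    fix n show "f (x (Suc n)) \<le> f (x n)" using x(3)[of n] D(1)[OF x(1)[of n] x(1)[of "Suc n"]] \<epsilon>
      by (auto simp: Sx_def) (metis add_increasing2 less_imp_le mult_nonneg_nonneg order_trans order_refl)
  qed
  obtain l where l: "(\<lambda>n. f (x n)) \<longlonglongrightarrow> l" using decseq_convergent[OF dec] bdd[OF x(1)] by metis
  have Dle: "\<epsilon> * D (x n) (x k) \<le> f (x n) - f (x k)" if "n \<le> k" for n k using mono[OF that] by (auto simp: Sx_def)
  have "\<exists>z\<in>S. (\<lambda>n. D (x n) z) \<longlonglongrightarrow> 0"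
  proof (rule complete[OF x(1)], intro allI impI)
    fix e :: real assume "e > 0"
    have "Cauchy (\<lambda>n. f (x n))" using l LIMSEQ_imp_Cauchy by blast
    then obtain k where k: "\<forall>m\<ge>k. \<forall>n\<ge>k. \<bar>f (x m) - f (x n)\<bar> < \<epsilon> * e"
      using CauchyD[of "\<lambda>n. f (x n)" "\<epsilon> * e"] \<open>e > 0\<close> \<epsilon> by auto
    have "D (x m) (x n) < e" if "k \<le> m" "m \<le> n" for m n
    proof -
      have "\<epsilon> * D (x m) (x n) < \<epsilon> * e" using Dle[OF that(2)] k[rule_format, of m n] that by linarith
      then show ?thesis using \<epsilon> by simp
    qed
    then show "\<exists>k. \<forall>m\<ge>k. \<forall>n\<ge>m. D (x m) (x n) < e" by blast
  qed
  then obtain z where z: "z \<in> S" "(\<lambda>n. D (x n) z) \<longlonglongrightarrow> 0" by blast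
  have fz: "f z \<le> l" by (rule lsc[OF x(1) z l])
  have zS: "z \<in> Sx (x n)" for n
  proof -
    have "\<epsilon> * D (x n) z \<le> f (x n) - l"
    proof (rule tendsto_le[OF sequentially_bot])
      show "(\<lambda>k. f (x n) - f (x k) + \<epsilon> * D (x k) z) \<longlonglongrightarrow> f (x n) - l"
        using tendsto_add[OF tendsto_diff[OF tendsto_const l] tendsto_mult_right_zero[OF z(2)], of "f (x n)" \<epsilon>] by simp
      show "(\<lambda>k. \<epsilon> * D (x n) z) \<longlonglongrightarrow> \<epsilon> * D (x n) z" by simp
      show "\<forall>\<^sub>F k in sequentially. \<epsilon> * D (x n) z \<le> f (x n) - f (x k) + \<epsilon> * D (x k) z"
        using eventually_ge_at_top[of n]
      proof eventually_elim
        case (elim k)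
        have "\<epsilon> * D (x n) z \<le> \<epsilon> * (D (x n) (x k) + D (x k) z)" using D(3) x(1) z(1) \<epsilon> by (intro mult_left_mono) auto
        then show ?case using Dle[OF elim] by (simp add: algebra_simps)
      qed
    qed
    then show ?thesis using z(1) fz by (simp add: Sx_def)
  qed
  \<comment> \<open>A point violating the claim would belong to every \<open>Sx (x n)\<close>. Near
    minimality over these sets then bounds the limit of \<open>f (x n)\<close> by
    \<open>f y\<close>, while \<open>f z\<close> is at most that limit.\<close>
  have "f z \<le> f y + \<epsilon> * D z y" if y: "y \<in> S" for y
  proof (rule ccontr)
    assume neg: "\<not> ?thesis"
    then have "y \<in> Sx z" using y by (simp add: Sx_def)
    then have yS: "y \<in> Sx (x n)" for n using trans[OF x(1) zS] by blast
    have "f (x (Suc n)) \<le> f y + (1/2)^n" for n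
    proof -
      have "(INF y\<in>Sx (x n). f y) \<le> f y"
        using bdd by (intro cINF_lower[OF _ yS] bdd_belowI2[of _ m]) (auto simp: Sx_def)
      then show ?thesis using x(4)[of n] by linarith
    qed
    moreover have "(\<lambda>n. f (x (Suc n))) \<longlonglongrightarrow> l" using l by (rule LIMSEQ_Suc)
    moreover have "(\<lambda>n. f y + (1/2)^n) \<longlonglongrightarrow> f y"
      using tendsto_add[OF tendsto_const LIMSEQ_power_zero[of "1/2::real"], of "f y"] by simp
    ultimately have "l \<le> f y" using LIMSEQ_le by blast
    moreover have "0 \<le> \<epsilon> * D z y" using D(1) z(1) y \<epsilon> by simp
    ultimately show False using neg fz by linarith
  qed
  moreover have "f z \<le> f x\<^sub>0"
    using zS[of 0] x(2) D(1)[OF x0 z(1)] \<epsilon> by (auto simp: Sx_def) (metis add_increasing2 less_imp_le mult_nonneg_nonneg order_trans order_refl)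
  ultimately show ?thesis using z(1) by blast
qed

section \<open>Subdifferentials in Banach spaces\<close>

text \<open>The C^1 subdifferential in a Banach space. The touching function need only exist near
  \<open>y\<close>; the passage to test functions defined on the whole manifold is made once and for
  all by a cut-off.\<close>

definition C1_subgrad :: "('a::real_normed_vector \<Rightarrow> real) \<Rightarrow> 'a \<Rightarrow> ('a \<Rightarrow>\<^sub>L real) \<Rightarrow> bool" where
  "C1_subgrad f y p \<longleftrightarrow> (\<exists>S g g'. open S \<and> y \<in> S \<and> C1d S g g' \<and> g' y = p \<and> (\<forall>z\<in>S. f y - g y \<le> f z - g z))"

lemma C1_subgradI:
  assumes "open S" "y \<in> S" "C1d S g g'" "\<And>z. z \<in> S \<Longrightarrow> f y - g y \<le> f z - g z" "p = g' y"
  shows "C1_subgrad f y p"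
  using assms unfolding C1_subgrad_def by blast

lemma C1_subgrad_cong_nhds:
  assumes "\<forall>\<^sub>F z in nhds y. f z = f2 z" "C1_subgrad f y p"
  shows "C1_subgrad f2 y p"
proof -
  obtain S g g' where S: "open S" "y \<in> S" "C1d S g g'" "g' y = p" "\<forall>z\<in>S. f y - g y \<le> f z - g z"
    using assms(2) unfolding C1_subgrad_def by blast
  obtain T where T: "open T" "y \<in> T" "\<forall>z\<in>T. f z = f2 z" using assms(1) by (auto simp: eventually_nhds)
  show ?thesis
    by (rule C1_subgradI[of "S \<inter> T" _ g g']) (use S T in \<open>auto intro: C1d_subset\<close>)
qed

lemma C1_subgrad_add_C1:
  assumes "C1_subgrad (\<lambda>z. f z + k z) y p" and k: "C1d T k k'" "open T" "y \<in> T"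
  shows "C1_subgrad f y (p - k' y)"
proof -
  obtain S g g' where S: "open S" "y \<in> S" "C1d S g g'" "g' y = p" "\<forall>z\<in>S. f y + k y - g y \<le> f z + k z - g z"
    using assms(1) unfolding C1_subgrad_def by blast
  show ?thesis
  proof (rule C1_subgradI[of "S \<inter> T" _ "\<lambda>z. g z - k z" "\<lambda>z. g' z - k' z"])
    show "C1d (S \<inter> T) (\<lambda>z. g z - k z) (\<lambda>z. g' z - k' z)"
      by (intro C1d_diff C1d_subset[OF S(3)] C1d_subset[OF k(1)]) auto
    fix z assume "z \<in> S \<inter> T"
    then show "f y - (g y - k y) \<le> f z - (g z - k z)" using S(5) by fastforce
  qed (use S k in auto)
qed

text \<open>A function touching \<open>f\<close> from below grows no faster than \<open>f\<close>
  along a ray leaving the contact point, so any upper bound on the growth of \<open>f\<close> bounds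
  every subgradient.\<close>

lemma C1_subgrad_directional:
  assumes "C1_subgrad f y p" and le: "\<forall>\<^sub>F s in at_right 0. f (y + s *\<^sub>R v) - f y \<le> s * c"
  shows "blinfun_apply p v \<le> c"
proof -
  obtain S g g' where S: "open S" "y \<in> S" "C1d S g g'" "g' y = p" "\<forall>z\<in>S. f y - g y \<le> f z - g z"
    using assms(1) unfolding C1_subgrad_def by blast
  have "((\<lambda>s. y + s *\<^sub>R v) \<longlongrightarrow> y + 0 *\<^sub>R v) (at_right 0)" by (intro tendsto_intros)
  then have "\<forall>\<^sub>F s in at_right 0. y + s *\<^sub>R v \<in> S" using S(1,2) by (auto elim: topological_tendstoD)
  with le have "\<forall>\<^sub>F s in at_right 0. g (y + s *\<^sub>R v) - g y \<le> s * c"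
    by eventually_elim (use S(5) in force)
  then show ?thesis using has_derivative_directional_le[OF C1d_derivD[OF S(3,2)]] S(4) by simp
qed

lemma C1_subgrad_lipschitz:
  assumes p: "C1_subgrad f y p" and S: "open S" "y \<in> S" and R: "0 \<le> R"
    and lip: "\<And>z. z \<in> S \<Longrightarrow> f z - f y \<le> R * norm (z - y)"
  shows "norm p \<le> R"
proof (rule blinfun_norm_le_of_upper[OF _ R], rule C1_subgrad_directional[OF p])
  fix v
  have "((\<lambda>s. y + s *\<^sub>R v) \<longlongrightarrow> y + 0 *\<^sub>R v) (at_right 0)" by (intro tendsto_intros)
  then have "\<forall>\<^sub>F s in at_right 0. y + s *\<^sub>R v \<in> S" using S by (auto elim: topological_tendstoD)
  then show "\<forall>\<^sub>F s in at_right 0. f (y + s *\<^sub>R v) - f y \<le> s * (R * norm v)"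
    using eventually_at_right_less[of 0]
    by eventually_elim (use lip in \<open>force simp: algebra_simps\<close>)
qed

text \<open>Subtracting \<open>f\<close> leaves the zero function, which is Lipschitz with constant
  0 and so has no subgradient other than 0.\<close>

lemma C1_subgrad_of_C1:
  assumes p: "C1_subgrad f y p" and f: "C1d S f f'" "open S" "y \<in> S"
  shows "p = f' y"
proof -
  have "C1_subgrad (\<lambda>z. 0 + f z) y p" using p by simp
  from C1_subgrad_add_C1[OF this f] have "C1_subgrad (\<lambda>z. 0) y (p - f' y)" .
  then have "norm (p - f' y) \<le> 0" by (rule C1_subgrad_lipschitz[where S = UNIV]) auto
  then show ?thesis by simp
qed

text \<open>Used to pass from a maximum of two functions to the one that attains it, and from an
  envelope to a barrier at a contact point.\<close>

lemma C1_subgrad_touching: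
  assumes p: "C1_subgrad f y p" and ev: "\<forall>\<^sub>F z in nhds y. f z \<le> f2 z" and eq: "f y = f2 y"
  shows "C1_subgrad f2 y p"
proof -
  obtain S g g' where S: "open S" "y \<in> S" "C1d S g g'" "g' y = p" "\<forall>z\<in>S. f y - g y \<le> f z - g z"
    using p unfolding C1_subgrad_def by blast
  obtain T where T: "open T" "y \<in> T" "\<forall>z\<in>T. f z \<le> f2 z" using ev by (auto simp: eventually_nhds)
  show ?thesis
  proof (rule C1_subgradI[of "S \<inter> T" _ g g'])
    fix z assume "z \<in> S \<inter> T"
    then have "f y - g y \<le> f z - g z" "f z \<le> f2 z" using S T by auto
    then show "f2 y - g y \<le> f2 z - g z" using eq by simp
  qed (use S T in \<open>auto intro: C1d_subset\<close>)
qed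

text \<open>The difference \<open>y\<^sub>1 - y\<^sub>2\<close> is penalised by a steep bump, whose contributions to the two partial
  gradients cancel; a second, flat bump keeps \<open>y\<^sub>1\<close> near \<open>z\<close>.\<close>

theorem fuzzy_sum_rule:
  fixes f\<^sub>1 f\<^sub>2 :: "'a::banach \<Rightarrow> real"
  assumes bE: "smooth_bump (\<beta> :: 'a \<Rightarrow> real) \<beta>' K"
    and r: "r > 0" and lsc: "lsc_on (cball z r) f\<^sub>1" and R: "0 \<le> R"
    and lip: "\<And>x y. x \<in> cball z r \<Longrightarrow> y \<in> cball z r \<Longrightarrow> \<bar>f\<^sub>2 x - f\<^sub>2 y\<bar> \<le> R * norm (x - y)"
    and min: "\<And>x. x \<in> cball z r \<Longrightarrow> f\<^sub>1 z + f\<^sub>2 z \<le> f\<^sub>1 x + f\<^sub>2 x" and \<eta>: "\<eta> > 0"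
  shows "\<exists>y\<^sub>1 y\<^sub>2 p\<^sub>1 p\<^sub>2. norm (y\<^sub>1 - z) < r \<and> norm (y\<^sub>2 - z) < r \<and> C1_subgrad f\<^sub>1 y\<^sub>1 p\<^sub>1 \<and> C1_subgrad f\<^sub>2 y\<^sub>2 p\<^sub>2 \<and> norm (p\<^sub>1 + p\<^sub>2) < \<eta>"
proof -
  obtain \<beta>2 \<beta>2' K2 where b2: "smooth_bump (\<beta>2 :: 'a \<times> 'a \<Rightarrow> real) \<beta>2' K2" using smooth_bump_prod[OF bE bE] by blast
  note bump = C1d_bump_rescaled[OF bE]
  have K: "0 \<le> K" using bump(7)[of 1] by simp
  define k where "k = \<eta> * r / (8 * (K + 1))"
  have k: "k > 0" using \<eta> r K by (simp add: k_def)
  have kK: "k * (K / (r/2)) < \<eta> / 2"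
  proof -
    have "k * (K / (r/2)) = \<eta> / 4 * (K / (K + 1))" using r K by (simp add: k_def field_simps)
    also have "\<dots> \<le> \<eta> / 4 * 1" using K \<eta> by (intro mult_left_mono) auto
    finally show ?thesis using \<eta> by linarith
  qed
  \<comment> \<open>The steep penalty must exceed the oscillation \<open>2 * r * R\<close> of
    \<open>f\<^sub>2\<close> on the ball, so that no gain from separating the two variables can pay
    for it.\<close>
  define A where "A = 2 * r * R + 1"
  have A: "A \<ge> 1" using r R by (simp add: A_def)
  \<comment> \<open>Within distance \<open>d\<close>, exchanging the argument of
    \<open>f\<^sub>2\<close> costs at most k/4.\<close>
  define d where "d = min (r / 4) (k / (4 * (R + 1)))"
  have d: "d > 0" "d \<le> r / 4" using r k R unfolding d_def by (simp, intro min.cobounded1)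
  have dR: "R * d \<le> k / 4"
  proof -
    have "R * d \<le> R * (k / (4 * (R + 1)))" using R by (intro mult_left_mono) (auto simp: d_def)
    also have "\<dots> = k / 4 * (R / (R + 1))" using R by (simp add: field_simps)
    also have "\<dots> \<le> k / 4 * 1" using R k by (intro mult_left_mono) auto
    finally show ?thesis by simp
  qed
  define \<epsilon> where "\<epsilon> = min (k / 16) (min (\<eta> / 8) (1 / 4))"
  have \<epsilon>: "\<epsilon> > 0" "\<epsilon> \<le> k / 16" "\<epsilon> \<le> \<eta> / 8" "\<epsilon> \<le> 1 / 4" using k \<eta> by (auto simp: \<epsilon>_def)
  let ?L = "\<lambda>y. \<beta> ((1 / (r/2)) *\<^sub>R (y - z))"
  let ?P = "\<lambda>y. A * (1 - \<beta> ((1 / d) *\<^sub>R (y - 0)))\<^sup>2"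
  define \<Phi> where "\<Phi> w = f\<^sub>1 (fst w) + f\<^sub>2 (snd w) - k * ?L (fst w) + ?P (fst w - snd w)" for w
  have P0: "0 \<le> ?P y" for y using A by simp
  let ?C = "cball z r \<times> cball z r"
  have f2b: "\<bar>f\<^sub>2 x - f\<^sub>2 y\<bar> \<le> R * (2 * r)" if "x \<in> cball z r" "y \<in> cball z r" for x y
  proof -
    have "norm (x - y) \<le> 2 * r" using that dist_triangle2[of x y z] by (simp add: dist_norm norm_minus_commute)
    then show ?thesis using lip[OF that] R by (meson mult_left_mono order_trans)
  qed
  define m where "m = f\<^sub>1 z + f\<^sub>2 z"
  have low: "m - R * norm (x - y) \<le> f\<^sub>1 x + f\<^sub>2 y" "m - R * (2 * r) \<le> f\<^sub>1 x + f\<^sub>2 y"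
    if "x \<in> cball z r" "y \<in> cball z r" for x y
    using min[OF that(1)] lip[OF that] f2b[OF that] by (auto simp: m_def abs_le_iff)
  have lb: "m - R * (2 * r) - k \<le> \<Phi> w" if "w \<in> ?C" for w
  proof -
    have "k * ?L (fst w) \<le> k * 1" using bump(6)[of 1] k by (intro mult_left_mono) auto
    then show ?thesis using low(2)[of "fst w" "snd w"] that P0[of "fst w - snd w"] unfolding \<Phi>_def by force
  qed
  have cL: "continuous_on UNIV ?L" using C1d_continuous_on[OF bump(1)[of "r/2" UNIV z]] r by simp
  have PC1: "C1d UNIV ?P (\<lambda>y. A *\<^sub>R (2 * (1 - \<beta> ((1 / d) *\<^sub>R (y - 0)))) *\<^sub>R - ((1/d) *\<^sub>R \<beta>' ((1/d) *\<^sub>R (y - 0))))"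
  proof (rule C1d_cmult, rule C1d_real_compose[where \<theta> = "\<lambda>t. t\<^sup>2" and \<theta>' = "\<lambda>t. 2 * t"])
    show "C1d UNIV (\<lambda>x. 1 - \<beta> ((1 / d) *\<^sub>R (x - 0))) (\<lambda>x. - ((1 / d) *\<^sub>R \<beta>' ((1 / d) *\<^sub>R (x - 0))))"
      using C1d_diff[OF C1d_const bump(1)[OF d(1), of UNIV 0], of 1] by simp
  qed (auto intro!: derivative_eq_intros continuous_intros)
  define P' where "P' y = A *\<^sub>R (2 * (1 - \<beta> ((1 / d) *\<^sub>R (y - 0)))) *\<^sub>R - ((1/d) *\<^sub>R \<beta>' ((1/d) *\<^sub>R (y - 0)))" for y
  have PC1: "C1d UNIV ?P P'" using PC1 by (simp add: P'_def[abs_def])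
  have rest: "continuous_on ?C (\<lambda>w. f\<^sub>2 (snd w) - k * ?L (fst w) + ?P (fst w - snd w))"
  proof -
    have "R-lipschitz_on (cball z r) f\<^sub>2" using lip R by (intro lipschitz_onI) (auto simp: dist_norm)
    then have "continuous_on (cball z r) f\<^sub>2" by (rule lipschitz_on_continuous_on)
    then have 1: "continuous_on ?C (\<lambda>w. f\<^sub>2 (snd w))" by (rule continuous_on_compose2) (auto intro!: continuous_intros)
    have 2: "continuous_on ?C (\<lambda>w. ?L (fst w))" using continuous_on_compose2[OF cL continuous_on_fst[OF continuous_on_id], of ?C] by simp
    have 3: "continuous_on ?C (\<lambda>w. ?P (fst w - snd w))"
      by (rule continuous_on_compose2[OF C1d_continuous_on[OF PC1], of ?C "\<lambda>w. fst w - snd w"]) (auto intro!: continuous_intros)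
    show ?thesis by (intro continuous_on_add continuous_on_diff continuous_on_mult 1 2 3 continuous_on_const)
  qed
  have "lsc_on ?C (\<lambda>w. f\<^sub>1 (fst w))"
  proof (rule lsc_onI_nhds)
    fix w c assume w: "w \<in> ?C" "c < f\<^sub>1 (fst w)"
    have "\<forall>\<^sub>F q in nhds (fst w). q \<in> cball z r \<longrightarrow> c < f\<^sub>1 q"
      using w by (intro lsc_on_nhds[OF lsc]) (auto simp: mem_Times_iff)
    moreover have "filterlim fst (nhds (fst w)) (nhds w)" using tendsto_fst[OF filterlim_ident[of "nhds w"]] by simp
    ultimately have "\<forall>\<^sub>F q in nhds w. fst q \<in> cball z r \<longrightarrow> c < f\<^sub>1 (fst q)" by (rule eventually_compose_filterlim)
    then show "\<forall>\<^sub>F q in nhds w. q \<in> ?C \<longrightarrow> c < f\<^sub>1 (fst q)" by eventually_elim (simp add: mem_Times_iff)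
  qed
  from lsc_on_add_continuous[OF this rest] have lscP: "lsc_on ?C \<Phi>" by (simp add: \<Phi>_def[abs_def] algebra_simps)
  have "closed ?C" "?C \<noteq> {}" using r by (auto intro: closed_Times)
  from smooth_variational_principle[OF b2 this lscP lb \<epsilon>(1)] obtain \<gamma> \<gamma>' w where
    g: "C1d UNIV \<gamma> \<gamma>'" "\<And>x. \<bar>\<gamma> x\<bar> \<le> \<epsilon>" "\<And>x. norm (\<gamma>' x) \<le> \<epsilon>" and w: "w \<in> ?C"
    and wmin: "\<And>y. y \<in> ?C \<Longrightarrow> \<Phi> w + \<gamma> w \<le> \<Phi> y + \<gamma> y" by blast
  obtain y1 y2 where w_eq: "w = (y1, y2)" by force
  have y12: "y1 \<in> cball z r" "y2 \<in> cball z r" using w w_eq by auto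
  \<comment> \<open>The pair (z, z) pays no penalty and collects the whole flat bump, so the
    perturbed minimum has value at most m - k + 2 \<epsilon>. Variables that are far apart, or a
    first variable outside the half ball, would force a larger value.\<close>
  have "\<Phi> (z, z) = m - k" using bump(4)[of "r/2" z] bump(4)[of d 0] r d by (simp add: \<Phi>_def m_def)
  then have up: "\<Phi> w \<le> m - k + 2 * \<epsilon>" using wmin[of "(z,z)"] g(2)[of w] g(2)[of "(z,z)"] r by (simp add: abs_le_iff)
  have L01: "0 \<le> ?L y" "?L y \<le> 1" for y using bump(5,6)[of 1] by auto
  have near12: "norm (y1 - y2) < d"
  proof (rule ccontr)
    assume "\<not> ?thesis"
    then have z0: "\<beta> ((1 / d) *\<^sub>R (y1 - y2 - 0)) = 0" using bump(3)[OF d(1), of "y1 - y2" 0] by simp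
    have "?P (y1 - y2) = A" unfolding z0 by simp
    moreover have "k * ?L y1 \<le> k * 1" using L01 k by (intro mult_left_mono) auto
    ultimately have "m - R * (2 * r) - k + A \<le> \<Phi> w"
      using low(2)[OF y12] unfolding w_eq \<Phi>_def fst_conv snd_conv by linarith
    then show False using up \<epsilon> by (simp add: A_def)
  qed
  have near1: "norm (y1 - z) < r / 2"
  proof (rule ccontr)
    assume "\<not> ?thesis"
    then have "?L y1 = 0" using bump(3)[of "r/2" y1 z] r by simp
    moreover have "R * norm (y1 - y2) \<le> R * d" using near12 R by (intro mult_left_mono) auto
    ultimately have "m - k / 4 \<le> \<Phi> w" using low(1)[OF y12] P0[of "y1 - y2"] dR unfolding w_eq \<Phi>_def by simp
    then show False using up \<epsilon> k by linarith
  qed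
  have near2: "norm (y2 - z) < r"
  proof -
    have "norm (y2 - z) \<le> norm (y1 - y2) + norm (y1 - z)"
      using norm_triangle_ineq[of "y2 - y1" "y1 - z"] by (simp add: norm_minus_commute)
    then show ?thesis using near12 near1 d(2) r by linarith
  qed
  let ?L' = "\<lambda>y. (1 / (r/2)) *\<^sub>R \<beta>' ((1 / (r/2)) *\<^sub>R (y - z))"
  define J1 where "J1 = (Blinfun (\<lambda>v. (v, 0)) :: 'a \<Rightarrow>\<^sub>L ('a \<times> 'a))"
  define J2 where "J2 = (Blinfun (\<lambda>v. (0, v)) :: 'a \<Rightarrow>\<^sub>L ('a \<times> 'a))"
  have J: "blinfun_apply J1 v = (v, 0)" "blinfun_apply J2 v = (0, v)" for v
    by (auto simp: J1_def J2_def bounded_linear_Blinfun_apply bounded_linear_Pair bounded_linear_zero bounded_linear_ident)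
  have Jn: "norm J1 \<le> 1" "norm J2 \<le> 1" by (rule norm_blinfun_bound; simp add: J norm_Pair)+
  have g1: "C1d UNIV (\<lambda>y. \<gamma> (y, y2)) (\<lambda>y. \<gamma>' (y, y2) o\<^sub>L J1)"
    using C1d_compose[OF g(1) C1d_blinfun_affine[of UNIV "(0, y2)" J1 0]] by (simp add: J)
  have g2: "C1d UNIV (\<lambda>y. \<gamma> (y1, y)) (\<lambda>y. \<gamma>' (y1, y) o\<^sub>L J2)"
    using C1d_compose[OF g(1) C1d_blinfun_affine[of UNIV "(y1, 0)" J2 0]] by (simp add: J)
  have id1: "C1d UNIV (\<lambda>y. y - y2) (\<lambda>y. id_blinfun)" using C1d_blinfun_affine[of UNIV "0" id_blinfun y2] by simp
  have id2: "C1d UNIV (\<lambda>y. y1 - y) (\<lambda>y. - id_blinfun)" using C1d_blinfun_affine[of UNIV y1 "- id_blinfun" 0]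
    by (simp add: uminus_blinfun.rep_eq)
  have P1: "C1d UNIV (\<lambda>y. ?P (y - y2)) (\<lambda>y. P' (y - y2) o\<^sub>L id_blinfun)" by (rule C1d_compose[OF PC1 id1]) simp
  have P2: "C1d UNIV (\<lambda>y. ?P (y1 - y)) (\<lambda>y. P' (y1 - y) o\<^sub>L (- id_blinfun))" by (rule C1d_compose[OF PC1 id2]) simp
  have L1: "C1d UNIV ?L ?L'" using bump(1)[of "r/2" UNIV z] r by simp
  define G1 where "G1 y = k * ?L y - (?P (y - y2) + \<gamma> (y, y2))" for y
  define G1' where "G1' y = k *\<^sub>R ?L' y - ((P' (y - y2) o\<^sub>L id_blinfun) + (\<gamma>' (y, y2) o\<^sub>L J1))" for y
  define G2 where "G2 y = - (?P (y1 - y) + \<gamma> (y1, y))" for y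
  define G2' where "G2' y = - ((P' (y1 - y) o\<^sub>L (- id_blinfun)) + (\<gamma>' (y1, y) o\<^sub>L J2))" for y
  have G: "C1d UNIV G1 G1'" "C1d UNIV G2 G2'" unfolding G1_def[abs_def] G1'_def[abs_def] G2_def[abs_def] G2'_def[abs_def]
    by (intro C1d_diff C1d_cmult L1 C1d_add P1 g1 C1d_minus P2 g2)+
  have "C1_subgrad f\<^sub>1 y1 (G1' y1)"
  proof (rule C1_subgradI[of "ball z r" _ G1 G1'])
    show "y1 \<in> ball z r" using near1 r by (simp add: dist_norm norm_minus_commute)
    fix y assume "y \<in> ball z r"
    then show "f\<^sub>1 y1 - G1 y1 \<le> f\<^sub>1 y - G1 y"
      using wmin[of "(y, y2)"] y12 by (simp add: \<Phi>_def G1_def w_eq)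
  qed (auto intro: C1d_subset[OF G(1)])
  moreover have "C1_subgrad f\<^sub>2 y2 (G2' y2)"
  proof (rule C1_subgradI[of "ball z r" _ G2 G2'])
    show "y2 \<in> ball z r" using near2 by (simp add: dist_norm norm_minus_commute)
    fix y assume "y \<in> ball z r"
    then show "f\<^sub>2 y2 - G2 y2 \<le> f\<^sub>2 y - G2 y"
      using wmin[of "(y1, y)"] y12 by (simp add: \<Phi>_def G2_def w_eq)
  qed (auto intro: C1d_subset[OF G(2)])
  moreover have "norm (G1' y1 + G2' y2) < \<eta>"
  proof -
    have "P' (y1 - y2) o\<^sub>L id_blinfun = - (P' (y1 - y2) o\<^sub>L (- id_blinfun))"
      by (rule blinfun_eqI) (simp add: uminus_blinfun.rep_eq blinfun.minus_right)
    then have "G1' y1 + G2' y2 = k *\<^sub>R ?L' y1 - (\<gamma>' (y1, y2) o\<^sub>L J1) - (\<gamma>' (y1, y2) o\<^sub>L J2)"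
      by (simp add: G1'_def G2'_def)
    also have "norm \<dots> \<le> norm (k *\<^sub>R ?L' y1) + norm (\<gamma>' (y1, y2) o\<^sub>L J1) + norm (\<gamma>' (y1, y2) o\<^sub>L J2)"
      by (meson norm_triangle_ineq4 order_trans add_right_mono)
    also have "\<dots> \<le> k * (K / (r/2)) + \<epsilon> * 1 + \<epsilon> * 1"
    proof (intro add_mono)
      show "norm (k *\<^sub>R ?L' y1) \<le> k * (K / (r/2))" using bump(2)[of "r/2" y1 z] k r unfolding norm_scaleR
        by (intro mult_mono) auto
      show "norm (\<gamma>' (y1, y2) o\<^sub>L J1) \<le> \<epsilon> * 1"
        by (rule order_trans[OF norm_blinfun_compose mult_mono[OF g(3) Jn(1)]]) (use \<epsilon> in auto)
      show "norm (\<gamma>' (y1, y2) o\<^sub>L J2) \<le> \<epsilon> * 1"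
        by (rule order_trans[OF norm_blinfun_compose mult_mono[OF g(3) Jn(2)]]) (use \<epsilon> in auto)
    qed
    also have "\<dots> < \<eta>" using kK \<epsilon>(3) \<eta> by linarith
    finally show ?thesis .
  qed
  moreover have "norm (y1 - z) < r" using near1 r by linarith
  ultimately show ?thesis using near2 by blast
qed

text \<open>The rule for two functions is applied twice: first to \<open>f\<^sub>1\<close> and
  \<open>f\<^sub>2 + f\<^sub>3\<close>, then near the resulting point \<open>y'\<close> to
  \<open>f\<^sub>2 - g\<close> and \<open>f\<^sub>3\<close>, where \<open>g\<close> touches
  \<open>f\<^sub>2 + f\<^sub>3\<close> at \<open>y'\<close>. The second radius is small enough that
  the gradient of \<open>g\<close> hardly moves.\<close>

theorem fuzzy_sum_rule_3:
  fixes f\<^sub>1 f\<^sub>2 f\<^sub>3 :: "'a::banach \<Rightarrow> real"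
  assumes bE: "smooth_bump (\<beta> :: 'a \<Rightarrow> real) \<beta>' K"
    and r: "r > 0" and lsc: "lsc_on (cball z r) f\<^sub>1" and R2: "0 \<le> R\<^sub>2" and R3: "0 \<le> R\<^sub>3"
    and lip2: "\<And>x y. x \<in> cball z r \<Longrightarrow> y \<in> cball z r \<Longrightarrow> \<bar>f\<^sub>2 x - f\<^sub>2 y\<bar> \<le> R\<^sub>2 * norm (x - y)"
    and lip3: "\<And>x y. x \<in> cball z r \<Longrightarrow> y \<in> cball z r \<Longrightarrow> \<bar>f\<^sub>3 x - f\<^sub>3 y\<bar> \<le> R\<^sub>3 * norm (x - y)"
    and min: "\<And>x. x \<in> cball z r \<Longrightarrow> f\<^sub>1 z + f\<^sub>2 z + f\<^sub>3 z \<le> f\<^sub>1 x + f\<^sub>2 x + f\<^sub>3 x" and \<eta>: "\<eta> > 0"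
  shows "\<exists>y\<^sub>1 y\<^sub>2 y\<^sub>3 p\<^sub>1 p\<^sub>2 p\<^sub>3. norm (y\<^sub>1 - z) < r \<and> norm (y\<^sub>2 - z) < r \<and> norm (y\<^sub>3 - z) < r \<and>
     C1_subgrad f\<^sub>1 y\<^sub>1 p\<^sub>1 \<and> C1_subgrad f\<^sub>2 y\<^sub>2 p\<^sub>2 \<and> C1_subgrad f\<^sub>3 y\<^sub>3 p\<^sub>3 \<and> norm (p\<^sub>1 + p\<^sub>2 + p\<^sub>3) < \<eta>"
proof -
  let ?f23 = "\<lambda>y. f\<^sub>2 y + f\<^sub>3 y"
  have L23: "\<bar>?f23 x - ?f23 y\<bar> \<le> (R\<^sub>2 + R\<^sub>3) * norm (x - y)" if "x \<in> cball z r" "y \<in> cball z r" for x y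
    using lip2[OF that] lip3[OF that] by (simp add: distrib_right abs_le_iff)
  have M23: "f\<^sub>1 z + ?f23 z \<le> f\<^sub>1 x + ?f23 x" if "x \<in> cball z r" for x using min[OF that] by simp
  obtain y1 y' p1 p' where 1: "norm (y1 - z) < r" "norm (y' - z) < r" "C1_subgrad f\<^sub>1 y1 p1" "C1_subgrad ?f23 y' p'" "norm (p1 + p') < \<eta> / 2"
    using fuzzy_sum_rule[OF bE r lsc add_nonneg_nonneg[OF R2 R3] L23 M23, of "\<eta> / 2"] \<eta> by auto
  obtain S g g' where S: "open S" "y' \<in> S" "C1d S g g'" "g' y' = p'" "\<forall>y\<in>S. ?f23 y' - g y' \<le> ?f23 y - g y"
    using 1(4) unfolding C1_subgrad_def by blast
  have "isCont g' y'" using C1d_contD[OF S(3)] S(1,2) by (simp add: continuous_on_eq_continuous_at)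
  then obtain d where d: "d > 0" "\<forall>y. dist y y' < d \<longrightarrow> dist (g' y) (g' y') < \<eta> / 4"
    using iffD1[OF continuous_at_eps_delta \<open>isCont g' y'\<close>, rule_format, of "\<eta> / 4"] \<eta> by auto
  have "open (S \<inter> ball z r)" "y' \<in> S \<inter> ball z r" using S 1(2) by (auto simp: dist_norm norm_minus_commute)
  then obtain d' where d': "d' > 0" "cball y' d' \<subseteq> S \<inter> ball z r" using open_contains_cball by blast
  define \<rho> where "\<rho> = min d d'"
  have \<rho>: "\<rho> > 0" "\<rho> \<le> d" "cball y' \<rho> \<subseteq> S" "cball y' \<rho> \<subseteq> cball z r" using d d' by (auto simp: \<rho>_def)
  have "R\<^sub>2-lipschitz_on (cball y' \<rho>) f\<^sub>2" using lip2 R2 \<rho>(4) by (intro lipschitz_onI) (auto simp: dist_norm subset_eq)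
  then have "continuous_on (cball y' \<rho>) (\<lambda>y. f\<^sub>2 y - g y)"
    by (intro continuous_on_diff lipschitz_on_continuous_on continuous_on_subset[OF C1d_continuous_on[OF S(3)] \<rho>(3)])
  then have l: "lsc_on (cball y' \<rho>) (\<lambda>y. f\<^sub>2 y - g y)"
    unfolding continuous_on_def lsc_on_def by (auto intro: order_tendstoD)
  have lip3': "\<bar>f\<^sub>3 x - f\<^sub>3 y\<bar> \<le> R\<^sub>3 * norm (x - y)" if "x \<in> cball y' \<rho>" "y \<in> cball y' \<rho>" for x y
    using lip3 that \<rho>(4) by blast
  have min': "f\<^sub>2 y' - g y' + f\<^sub>3 y' \<le> f\<^sub>2 x - g x + f\<^sub>3 x" if "x \<in> cball y' \<rho>" for x using bspec[OF S(5), of x] that \<rho>(3) by auto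
  obtain y2 y3 p2 p3 where 2: "norm (y2 - y') < \<rho>" "norm (y3 - y') < \<rho>" "C1_subgrad (\<lambda>y. f\<^sub>2 y - g y) y2 p2" "C1_subgrad f\<^sub>3 y3 p3" "norm (p2 + p3) < \<eta> / 4"
    using fuzzy_sum_rule[OF bE \<rho>(1) l R3 lip3' min', of "\<eta> / 4"] \<eta> by auto
  have in_z: "norm (y - z) < r" if "norm (y - y') < \<rho>" for y
  proof -
    have "y \<in> cball y' d'" using that by (simp add: dist_norm norm_minus_commute \<rho>_def)
    then show ?thesis using d'(2) by (auto simp: dist_norm norm_minus_commute)
  qed
  have y2S: "y2 \<in> S" using 2(1) \<rho>(3) by (auto simp: dist_norm norm_minus_commute subset_eq)
  have "C1_subgrad (\<lambda>y. f\<^sub>2 y + - g y) y2 p2" using 2(3) by simp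
  from C1_subgrad_add_C1[OF this C1d_minus[OF S(3)] S(1) y2S] have b2: "C1_subgrad f\<^sub>2 y2 (p2 + g' y2)" by simp
  have "norm (g' y2 - p') < \<eta> / 4" using d(2) 2(1) \<rho>(2) S(4) by (simp add: dist_norm)
  moreover have "p1 + (p2 + g' y2) + p3 = (p1 + p') + (p2 + p3) + (g' y2 - p')" by simp
  then have "norm (p1 + (p2 + g' y2) + p3) \<le> norm (p1 + p') + norm (p2 + p3) + norm (g' y2 - p')"
    by (metis norm_triangle_ineq norm_triangle_mono order_refl)
  ultimately have "norm (p1 + (p2 + g' y2) + p3) < \<eta>" using 1(5) 2(5) by linarith
  then show ?thesis using 1(1,3) b2 2(4) in_z[OF 2(1)] in_z[OF 2(2)] by blast
qed

text \<open>A mean value inequality for a function that need not be differentiable: its local slope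
  at each point is at most \<open>g\<close>. It is applied to a truncated chart distance along a
  path, with the speed as \<open>g\<close>.\<close>

lemma increment_le_integral:
  fixes F g :: "real \<Rightarrow> real"
  assumes g: "continuous_on {a..b} g" and ab: "a \<le> b"
    and loc: "\<And>t e. t \<in> {a..b} \<Longrightarrow> e > 0 \<Longrightarrow> \<exists>\<delta>>0. \<forall>s\<in>{a..b}. \<bar>s - t\<bar> < \<delta> \<longrightarrow> \<bar>F s - F t\<bar> \<le> (g t + e) * \<bar>s - t\<bar>"
  shows "\<bar>F b - F a\<bar> \<le> integral {a..b} g"
proof (rule field_le_epsilon)
  fix e0 :: real assume e0: "e0 > 0"
  define e where "e = e0 / (b - a + 1)"
  have e: "e > 0" "e * (b - a) \<le> e0" using e0 ab by (auto simp: e_def field_simps)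
  \<comment> \<open>Additive over adjacent intervals and true on short ones, which is the form
    required for bisection. The extra slope \<open>e\<close> absorbs the local errors.\<close>
  define P where "P u v \<longleftrightarrow> (u \<le> v \<longrightarrow> {u..v} \<subseteq> {a..b} \<longrightarrow> \<bar>F v - F u\<bar> \<le> integral {u..v} g + e * (v - u))" for u v
  have "P a b"
  proof (rule Bolzano[where P = P, OF ab])
    fix u v w assume trans: "P u v" "P v w" "u \<le> v" "v \<le> w"
    show "P u w" unfolding P_def
    proof (intro impI)
      assume *: "u \<le> w" "{u..w} \<subseteq> {a..b}"
      have "g integrable_on {u..w}" by (intro integrable_continuous_interval continuous_on_subset[OF g] *)
      then have "integral {u..v} g + integral {v..w} g = integral {u..w} g"
        by (intro Henstock_Kurzweil_Integration.integral_combine) (use trans in auto)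
      moreover have "{u..v} \<subseteq> {a..b}" "{v..w} \<subseteq> {a..b}" using * trans(3,4) by auto
      ultimately show "\<bar>F w - F u\<bar> \<le> integral {u..w} g + e * (w - u)" using trans unfolding P_def by (auto simp: algebra_simps)
    qed
  next
    fix x assume "a \<le> x" "x \<le> b"
    then have x: "x \<in> {a..b}" by simp
    obtain d1 where d1: "d1 > 0" "\<And>s. s \<in> {a..b} \<Longrightarrow> \<bar>s - x\<bar> < d1 \<Longrightarrow> \<bar>F s - F x\<bar> \<le> (g x + e / 2) * \<bar>s - x\<bar>"
      using loc[OF x, of "e / 2"] e by auto
    obtain d2 where d2: "d2 > 0" "\<And>s. s \<in> {a..b} \<Longrightarrow> \<bar>s - x\<bar> < d2 \<Longrightarrow> \<bar>g s - g x\<bar> < e / 2"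
      using g x e unfolding continuous_on_iff dist_real_def by (meson half_gt_zero)
    show "\<exists>d>0. \<forall>u v. u \<le> x \<and> x \<le> v \<and> v - u < d \<longrightarrow> P u v" unfolding P_def
    proof (intro exI[of _ "min d1 d2"] conjI allI impI)
      fix u v assume *: "u \<le> x \<and> x \<le> v \<and> v - u < min d1 d2" "u \<le> v" "{u..v} \<subseteq> {a..b}"
      have uv: "u \<in> {a..b}" "v \<in> {a..b}" using * by auto
      have "\<bar>F v - F x\<bar> \<le> (g x + e / 2) * (v - x)" "\<bar>F u - F x\<bar> \<le> (g x + e / 2) * (x - u)"
        using d1(2)[OF uv(1)] d1(2)[OF uv(2)] * by auto
      moreover have "(g x + e / 2) * (v - x) + (g x + e / 2) * (x - u) = (g x + e / 2) * (v - u)" by (simp flip: distrib_left)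
      ultimately have 1: "\<bar>F v - F u\<bar> \<le> (g x + e / 2) * (v - u)" by linarith
      have "(g x - e / 2) * (v - u) = integral {u..v} (\<lambda>_. g x - e / 2)" using * by simp
      also have "\<dots> \<le> integral {u..v} g"
      proof (rule integral_le)
        show "g integrable_on {u..v}" by (intro integrable_continuous_interval continuous_on_subset[OF g] *)
        fix s assume "s \<in> {u..v}"
        then have "\<bar>g s - g x\<bar> < e / 2" using d2(2)[of s] * by auto
        then show "g x - e / 2 \<le> g s" by linarith
      qed (rule integrable_const_ivl)
      finally have "(g x - e / 2) * (v - u) \<le> integral {u..v} g" .
      moreover have "(g x + e / 2) * (v - u) = (g x - e / 2) * (v - u) + e * (v - u)" by (simp flip: distrib_right)
      ultimately show "\<bar>F v - F u\<bar> \<le> integral {u..v} g + e * (v - u)" using 1 by linarith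
    qed (use d1 d2 in auto)
  qed
  then have "\<bar>F b - F a\<bar> \<le> integral {a..b} g + e * (b - a)" using ab unfolding P_def by blast
  then show "\<bar>F b - F a\<bar> \<le> integral {a..b} g + e0" using e(2) by linarith
qed

section \<open>Charts and tangent norms\<close>

text \<open>The classical argument: cover the complement of \<open>U\<close> by open sets whose
  closures miss \<open>x\<close> and refine to a locally finite cover. For locally finite families
  the closure of the union is the union of the closures, so it misses \<open>x\<close> as
  well.\<close>

lemma paracompact_regular:
  fixes x :: "'m::t2_space"
  assumes pc: "paracompact_space (euclidean :: 'm topology)" and U: "open U" "x \<in> U"
  shows "\<exists>W. open W \<and> x \<in> W \<and> closure W \<subseteq> U"
proof -
  let ?\<U> = "insert U {V. open V \<and> x \<notin> closure V}"
  have "\<Union>?\<U> = UNIV"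
  proof -
    have "\<exists>V. open V \<and> x \<notin> closure V \<and> y \<in> V" if "y \<notin> U" for y
    proof -
      have "x \<noteq> y" using that U(2) by blast
      then obtain G V where "open G" "open V" "x \<in> G" "y \<in> V" "G \<inter> V = {}" using hausdorff[of x y] by auto
      then have "x \<notin> closure V" using open_Int_closure_eq_empty[of G V] by auto
      then show ?thesis using \<open>open V\<close> \<open>y \<in> V\<close> by blast
    qed
    then show ?thesis by blast
  qed
  then have cov: "(\<forall>V\<in>?\<U>. openin euclidean V) \<and> \<Union>?\<U> = topspace euclidean" using U(1) by (auto simp flip: open_openin)
  obtain \<V> where V: "\<forall>V\<in>\<V>. open V" "\<Union>\<V> = UNIV" "\<forall>V\<in>\<V>. \<exists>U\<in>?\<U>. V \<subseteq> U"
      "locally_finite_in euclidean \<V>"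
    using pc[unfolded paracompact_space_def, rule_format, OF cov] by (auto simp flip: open_openin)
  define \<V>' where "\<V>' = {V\<in>\<V>. x \<notin> closure V}"
  have lf: "locally_finite_in euclidean \<V>'" using V(4) by (rule locally_finite_in_subset) (auto simp: \<V>'_def)
  have "closure (\<Union>\<V>') = (\<Union>V\<in>\<V>'. closure V)"
    using closure_of_locally_finite_Union[OF lf] by (simp only: euclidean_closure_of)
  moreover have "x \<notin> closure V" if "V \<in> \<V>'" for V using that by (simp add: \<V>'_def)
  ultimately have x: "x \<notin> closure (\<Union>\<V>')" by blast
  have cover: "- U \<subseteq> \<Union>\<V>'"
  proof
    fix y assume y: "y \<in> - U"
    have "y \<in> \<Union>\<V>" using V(2) by simp
    then obtain V where "V \<in> \<V>" "y \<in> V" by (rule UnionE)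
    obtain V' where V': "V' \<in> ?\<U>" "V \<subseteq> V'" using bspec[OF V(3) \<open>V \<in> \<V>\<close>] by (rule bexE)
    have "V' \<noteq> U" using y \<open>y \<in> V\<close> V'(2) by auto
    then have "x \<notin> closure V'" using V'(1) by simp
    then show "y \<in> \<Union>\<V>'" using closure_mono[OF V'(2)] \<open>V \<in> \<V>\<close> \<open>y \<in> V\<close> by (auto simp: \<V>'_def)
  qed
  have "open (\<Union>\<V>')" using V(1) by (auto simp: \<V>'_def)
  then have "closure (- closure (\<Union>\<V>')) \<subseteq> - \<Union>\<V>'"
    by (intro closure_minimal) (use closure_subset[of "\<Union>\<V>'"] in auto)
  then have "closure (- closure (\<Union>\<V>')) \<subseteq> U" using cover by blast
  then show ?thesis using x by (intro exI[of _ "- closure (\<Union>\<V>')"] conjI open_Compl closed_closure) simp_all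
qed

locale finsler =
  fixes \<A> :: "('m::t2_space, 'x::banach) chart set" and N :: "'m \<Rightarrow> ('m, 'x) tvec \<Rightarrow> real"
  assumes finsler: "finsler_manifold \<A> N"
begin

section \<open>Charts, their images and coordinate changes\<close>

lemma C1_struct: "C1_structure \<A>"
  using finsler unfolding finsler_manifold_def by blast

lemma regular_nbhd: "open U \<Longrightarrow> x \<in> U \<Longrightarrow> \<exists>W. open W \<and> x \<in> W \<and> closure W \<subseteq> U" for x :: 'm
  by (rule paracompact_regular) (use finsler in \<open>auto simp: finsler_manifold_def\<close>)

lemma chart_exists: "\<exists>\<kappa>\<in>\<A>. x \<in> chart_dom \<kappa>"
  using C1_struct by (auto simp: C1_structure_def)

context
  fixes \<kappa> assumes \<kappa>: "\<kappa> \<in> \<A>"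
begin

lemma chart_open: "open (chart_dom \<kappa>)" "open (chart_map \<kappa> ` chart_dom \<kappa>)"
  using C1_struct \<kappa> by (auto simp: C1_structure_def is_chart_def)

lemma chart_homeo: "homeomorphism (chart_dom \<kappa>) (chart_map \<kappa> ` chart_dom \<kappa>) (chart_map \<kappa>) (chart_inv \<kappa>)"
  using C1_struct \<kappa> by (auto simp: C1_structure_def is_chart_def)

lemma chart_cont: "continuous_on (chart_dom \<kappa>) (chart_map \<kappa>)" 
    "continuous_on (chart_map \<kappa> ` chart_dom \<kappa>) (chart_inv \<kappa>)"
  using chart_homeo by (auto simp: homeomorphism_def)

lemma chart_inv_map: "x \<in> chart_dom \<kappa> \<Longrightarrow> chart_inv \<kappa> (chart_map \<kappa> x) = x"
  using chart_homeo by (auto simp: homeomorphism_def)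

lemma chart_map_inv: "y \<in> chart_map \<kappa> ` chart_dom \<kappa> \<Longrightarrow> chart_map \<kappa> (chart_inv \<kappa> y) = y"
  and chart_inv_dom: "y \<in> chart_map \<kappa> ` chart_dom \<kappa> \<Longrightarrow> chart_inv \<kappa> y \<in> chart_dom \<kappa>"
  using chart_inv_map by auto

lemma open_chart_image: "open W \<Longrightarrow> open (chart_map \<kappa> ` (chart_dom \<kappa> \<inter> W))"
proof -
  assume W: "open W"
  have "chart_map \<kappa> ` (chart_dom \<kappa> \<inter> W) = chart_map \<kappa> ` chart_dom \<kappa> \<inter> chart_inv \<kappa> -` W"
    using chart_inv_map by (force simp: image_iff)
  then show ?thesis using continuous_open_preimage[OF chart_cont(2) chart_open(2) W] by simp
qed

lemma open_chart_preimage: "open B \<Longrightarrow> open (chart_dom \<kappa> \<inter> chart_map \<kappa> -` B)"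
  by (rule continuous_open_preimage[OF chart_cont(1) chart_open(1)])

lemma chart_inv_image: "B \<subseteq> chart_map \<kappa> ` chart_dom \<kappa> \<Longrightarrow> chart_inv \<kappa> ` B = chart_dom \<kappa> \<inter> chart_map \<kappa> -` B"
  using chart_inv_map by (force simp: image_iff)

text \<open>In infinite dimensions, the preimage of a closed ball under a chart need not be closed in the
  manifold; small balls are fine by regularity.\<close>

lemma chart_closed_ball:
  assumes x: "x \<in> chart_dom \<kappa>" and W: "open W" "x \<in> W"
  shows "\<exists>r>0. cball (chart_map \<kappa> x) r \<subseteq> chart_map \<kappa> ` chart_dom \<kappa> \<and> chart_inv \<kappa> ` cball (chart_map \<kappa> x) r \<subseteq> W \<and>
     (\<forall>s\<le>r. closed (chart_inv \<kappa> ` cball (chart_map \<kappa> x) s))"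
proof -
  obtain V where V: "open V" "x \<in> V" "closure V \<subseteq> chart_dom \<kappa> \<inter> W"
    using regular_nbhd[of "chart_dom \<kappa> \<inter> W" x] chart_open(1) x W by auto
  have "chart_map \<kappa> x \<in> chart_map \<kappa> ` (chart_dom \<kappa> \<inter> V)" using x V by auto
  then obtain r where r: "r > 0" "cball (chart_map \<kappa> x) r \<subseteq> chart_map \<kappa> ` (chart_dom \<kappa> \<inter> V)"
    using open_chart_image[OF V(1)] open_contains_cball by blast
  have sub: "chart_inv \<kappa> ` cball (chart_map \<kappa> x) r \<subseteq> V" using r(2) chart_inv_map by fastforce
  have "closed (chart_inv \<kappa> ` cball (chart_map \<kappa> x) s)" if "s \<le> r" for s
  proof -
    have s: "cball (chart_map \<kappa> x) s \<subseteq> cball (chart_map \<kappa> x) r" using that by auto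
    then have "chart_inv \<kappa> ` cball (chart_map \<kappa> x) s = chart_dom \<kappa> \<inter> chart_map \<kappa> -` cball (chart_map \<kappa> x) s"
      using r(2) by (intro chart_inv_image) auto
    also have "\<dots> = closure V \<inter> chart_map \<kappa> -` cball (chart_map \<kappa> x) s"
    proof -
      have "z \<in> V" if "z \<in> chart_dom \<kappa>" "chart_map \<kappa> z \<in> cball (chart_map \<kappa> x) s" for z
        using sub that s chart_inv_map[OF that(1)] by (metis imageI subsetD)
      then show ?thesis using V(3) closure_subset[of V] by auto
    qed
    finally show ?thesis using V(3)
      by (auto intro!: continuous_closed_preimage continuous_on_subset[OF chart_cont(1)])
  qed
  moreover have "V \<subseteq> W" using V(3) closure_subset by auto
  ultimately show ?thesis using r sub by (intro exI[of _ r]) auto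
qed

lemma transition_deriv:
  assumes \<kappa>': "\<kappa>' \<in> \<A>" and x: "x \<in> chart_dom \<kappa>" "x \<in> chart_dom \<kappa>'"
  shows "(transition \<kappa> \<kappa>' has_derivative (\<lambda>v. from_chart \<A> \<kappa> x v \<kappa>')) (at (chart_map \<kappa> x))"
proof -
  have "C1_on (chart_map \<kappa> ` (chart_dom \<kappa> \<inter> chart_dom \<kappa>')) (transition \<kappa> \<kappa>')"
    using C1_struct \<kappa> \<kappa>' by (auto simp: C1_structure_def C1_compatible_def)
  then obtain D where "(transition \<kappa> \<kappa>' has_derivative D) (at (chart_map \<kappa> x))"
    using x unfolding C1_on_def by blast
  then show ?thesis using frechet_derivative_at[of "transition \<kappa> \<kappa>'" D] x \<kappa>' by (simp add: from_chart_def)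
qed

lemma transition_C1:
  assumes \<kappa>': "\<kappa>' \<in> \<A>"
  shows "\<exists>T. C1d (chart_map \<kappa> ` (chart_dom \<kappa> \<inter> chart_dom \<kappa>')) (transition \<kappa> \<kappa>') T \<and>
     (\<forall>x\<in>chart_dom \<kappa> \<inter> chart_dom \<kappa>'. \<forall>v. blinfun_apply (T (chart_map \<kappa> x)) v = from_chart \<A> \<kappa> x v \<kappa>')"
proof -
  have "C1_on (chart_map \<kappa> ` (chart_dom \<kappa> \<inter> chart_dom \<kappa>')) (transition \<kappa> \<kappa>')"
    using C1_struct \<kappa> \<kappa>' by (auto simp: C1_structure_def C1_compatible_def)
  then obtain T where T: "C1d (chart_map \<kappa> ` (chart_dom \<kappa> \<inter> chart_dom \<kappa>')) (transition \<kappa> \<kappa>') T"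
    by (auto simp: C1_on_iff_C1d)
  have "blinfun_apply (T (chart_map \<kappa> x)) v = from_chart \<A> \<kappa> x v \<kappa>'"
    if "x \<in> chart_dom \<kappa> \<inter> chart_dom \<kappa>'" for x v
  proof -
    have "chart_map \<kappa> x \<in> chart_map \<kappa> ` (chart_dom \<kappa> \<inter> chart_dom \<kappa>')" using that by auto
    from has_derivative_unique[OF C1d_derivD[OF T this] transition_deriv[OF \<kappa>']] that show ?thesis by (auto dest: fun_cong)
  qed
  then show ?thesis using T by blast
qed

lemma from_chart_self: "x \<in> chart_dom \<kappa> \<Longrightarrow> from_chart \<A> \<kappa> x v \<kappa> = v"
proof -
  assume x: "x \<in> chart_dom \<kappa>"
  have "((\<lambda>y. y) has_derivative (\<lambda>v. from_chart \<A> \<kappa> x v \<kappa>)) (at (chart_map \<kappa> x))"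
    by (rule has_derivative_transform_within_open[OF transition_deriv[OF \<kappa> x x] chart_open(2)])
       (use x in \<open>auto simp: transition_def chart_map_inv chart_inv_map\<close>)
  from has_derivative_unique[OF this has_derivative_ident] show ?thesis by metis
qed

lemma from_chart_linear: "x \<in> chart_dom \<kappa> \<Longrightarrow> bounded_linear (\<lambda>v. from_chart \<A> \<kappa> x v \<kappa>')"
proof (cases "\<kappa>' \<in> \<A> \<and> x \<in> chart_dom \<kappa>'")
  case True
  then show "x \<in> chart_dom \<kappa> \<Longrightarrow> ?thesis" using has_derivative_bounded_linear[OF transition_deriv] by blast
next
  case False then show ?thesis by (auto simp: from_chart_def[abs_def])
qed

lemma from_chart_add: "x \<in> chart_dom \<kappa> \<Longrightarrow> from_chart \<A> \<kappa> x (v + w) = (\<lambda>\<kappa>'. from_chart \<A> \<kappa> x v \<kappa>' + from_chart \<A> \<kappa> x w \<kappa>')"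
  using linear_add[OF bounded_linear.linear[OF from_chart_linear]] by (intro ext) blast

lemma from_chart_scaleR: "x \<in> chart_dom \<kappa> \<Longrightarrow> from_chart \<A> \<kappa> x (a *\<^sub>R v) = (\<lambda>\<kappa>'. a *\<^sub>R from_chart \<A> \<kappa> x v \<kappa>')"
  using linear_scale[OF bounded_linear.linear[OF from_chart_linear]] by (intro ext) blast

end

text \<open>The cocycle identity, from the chain rule for three charts. It shows that a vector in
  one chart and its image in another describe the same tangent vector.\<close>

lemma from_chart_trans:
  assumes \<kappa>: "\<kappa> \<in> \<A>" and \<kappa>': "\<kappa>' \<in> \<A>" and x: "x \<in> chart_dom \<kappa>" "x \<in> chart_dom \<kappa>'"
  shows "from_chart \<A> \<kappa>' x (from_chart \<A> \<kappa> x v \<kappa>') = from_chart \<A> \<kappa> x v"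
proof
  fix \<kappa>''
  show "from_chart \<A> \<kappa>' x (from_chart \<A> \<kappa> x v \<kappa>') \<kappa>'' = from_chart \<A> \<kappa> x v \<kappa>''"
  proof (cases "\<kappa>'' \<in> \<A> \<and> x \<in> chart_dom \<kappa>''")
    case True
    have eq: "transition \<kappa> \<kappa>' (chart_map \<kappa> x) = chart_map \<kappa>' x" using chart_inv_map[OF \<kappa> x(1)] by (simp add: transition_def)
    have "((\<lambda>y. transition \<kappa>' \<kappa>'' (transition \<kappa> \<kappa>' y)) has_derivative (\<lambda>v. from_chart \<A> \<kappa>' x (from_chart \<A> \<kappa> x v \<kappa>') \<kappa>'')) (at (chart_map \<kappa> x))"
      by (rule has_derivative_compose[OF transition_deriv[OF \<kappa> \<kappa>' x]]) (use transition_deriv[OF \<kappa>' _ x(2)] True eq in auto)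
    then have "(transition \<kappa> \<kappa>'' has_derivative (\<lambda>v. from_chart \<A> \<kappa>' x (from_chart \<A> \<kappa> x v \<kappa>') \<kappa>'')) (at (chart_map \<kappa> x))"
      by (rule has_derivative_transform_within_open[OF _ open_chart_image[OF \<kappa> chart_open(1)[OF \<kappa>']]])
         (use x in \<open>auto simp: transition_def chart_inv_map[OF \<kappa>] chart_inv_map[OF \<kappa>']\<close>)
    from has_derivative_unique[OF this transition_deriv[OF \<kappa>]] True x show ?thesis by metis
  next
    case False then show ?thesis by (auto simp: from_chart_def)
  qed
qed

lemma from_chart_tangent:
  assumes "\<kappa> \<in> \<A>" "x \<in> chart_dom \<kappa>" shows "from_chart \<A> \<kappa> x v \<in> tangent_space \<A> x"
proof -
  have "from_chart \<A> \<kappa> x v \<kappa>'' = frechet_derivative (transition \<kappa>' \<kappa>'') (at (chart_map \<kappa>' x)) (from_chart \<A> \<kappa> x v \<kappa>')"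
    if "\<kappa>' \<in> \<A>" "\<kappa>'' \<in> \<A>" "x \<in> chart_dom \<kappa>'" "x \<in> chart_dom \<kappa>''" for \<kappa>' \<kappa>''
  proof -
    have "from_chart \<A> \<kappa> x v \<kappa>'' = from_chart \<A> \<kappa>' x (from_chart \<A> \<kappa> x v \<kappa>') \<kappa>''"
      using from_chart_trans[OF assms(1) that(1) assms(2) that(3)] by simp
    then show ?thesis using that by (simp add: from_chart_def)
  qed
  moreover have "from_chart \<A> \<kappa> x v \<kappa>' = 0" if "\<not> (\<kappa>' \<in> \<A> \<and> x \<in> chart_dom \<kappa>')" for \<kappa>'
    using that by (auto simp: from_chart_def)
  ultimately show ?thesis unfolding tangent_space_def by (simp only: mem_Collect_eq Int_iff) blast
qed

lemma tangent_from_chart: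
  assumes V: "V \<in> tangent_space \<A> x" and \<kappa>: "\<kappa> \<in> \<A>" "x \<in> chart_dom \<kappa>"
  shows "from_chart \<A> \<kappa> x (V \<kappa>) = V"
proof
  fix \<kappa>'
  show "from_chart \<A> \<kappa> x (V \<kappa>) \<kappa>' = V \<kappa>'"
  proof (cases "\<kappa>' \<in> \<A> \<and> x \<in> chart_dom \<kappa>'")
    case True
    then have "V \<kappa>' = frechet_derivative (transition \<kappa> \<kappa>') (at (chart_map \<kappa> x)) (V \<kappa>)"
      using V \<kappa> unfolding tangent_space_def by blast
    then show ?thesis using True by (simp add: from_chart_def)
  next
    case False
    then have "V \<kappa>' = 0" using V unfolding tangent_space_def by blast
    then show ?thesis using False by (auto simp: from_chart_def)
  qed
qed

definition cnorm :: "('m, 'x) chart \<Rightarrow> 'm \<Rightarrow> 'x \<Rightarrow> real" where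
  "cnorm \<kappa> x v = N x (from_chart \<A> \<kappa> x v)"

lemma norm_tangent: "norm_on_tangent_space \<A> x (N x)"
  using finsler unfolding finsler_manifold_def by blast

context
  fixes \<kappa> x assumes \<kappa>: "\<kappa> \<in> \<A>" and x: "x \<in> chart_dom \<kappa>"
begin

lemma cnorm_nonneg: "0 \<le> cnorm \<kappa> x v"
  using norm_tangent from_chart_tangent[OF \<kappa> x] by (auto simp: norm_on_tangent_space_def cnorm_def)

lemma cnorm_scaleR: "cnorm \<kappa> x (a *\<^sub>R v) = \<bar>a\<bar> * cnorm \<kappa> x v"
  using norm_tangent from_chart_tangent[OF \<kappa> x] from_chart_scaleR[OF \<kappa> x]
  by (auto simp: norm_on_tangent_space_def cnorm_def)

lemma cnorm_zero: "cnorm \<kappa> x 0 = 0"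
  using cnorm_scaleR[of 0 0] by simp

lemma cnorm_minus: "cnorm \<kappa> x (- v) = cnorm \<kappa> x v"
  using cnorm_scaleR[of "-1" v] by simp

lemma cnorm_triangle: "cnorm \<kappa> x (v + w) \<le> cnorm \<kappa> x v + cnorm \<kappa> x w"
  using norm_tangent from_chart_tangent[OF \<kappa> x] from_chart_add[OF \<kappa> x]
  by (auto simp: norm_on_tangent_space_def cnorm_def)

lemma cnorm_equiv: "\<exists>a>0. \<exists>b>0. \<forall>v. a * norm v \<le> cnorm \<kappa> x v \<and> cnorm \<kappa> x v \<le> b * norm v"
  using finsler \<kappa> x unfolding finsler_manifold_def cnorm_def by blast

lemma cnorm_compare:
  assumes "\<epsilon> > 0"
  shows "\<exists>W. open W \<and> x \<in> W \<and> W \<subseteq> chart_dom \<kappa> \<and>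
     (\<forall>y\<in>W. \<forall>v. cnorm \<kappa> x v \<le> (1 + \<epsilon>) * cnorm \<kappa> y v \<and> cnorm \<kappa> y v \<le> (1 + \<epsilon>) * cnorm \<kappa> x v)"
proof -
  have "\<exists>W. open W \<and> x \<in> W \<and> W \<subseteq> chart_dom \<kappa> \<and>
     (\<forall>y\<in>W. \<forall>v. 1 / (1 + \<epsilon>) * cnorm \<kappa> x v \<le> cnorm \<kappa> y v \<and> cnorm \<kappa> y v \<le> (1 + \<epsilon>) * cnorm \<kappa> x v)"
    using finsler \<kappa> x assms unfolding finsler_manifold_def cnorm_def by blast
  moreover have "1 / (1 + \<epsilon>) * p \<le> q \<longleftrightarrow> p \<le> (1 + \<epsilon>) * q" for p q
    using assms by (simp add: field_simps)
  ultimately show ?thesis by simp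
qed

end

section \<open>Paths and the Finsler metric\<close>

lemma C1_path_local:
  assumes c: "C1_path \<A> a b c" and t: "t \<in> {a..b}" and W: "open W" "c t \<in> W"
  shows "\<exists>T. open T \<and> t \<in> T \<and> (\<forall>s\<in>T \<inter> {a..b}. c s \<in> W)"
  using c t W unfolding C1_path_def continuous_on_topological by fastforce

text \<open>The velocity is defined chart by chart; by the chain rule its representative in one
  chart determines all the others. Working within {a..b} covers the end points with one-sided
  derivatives.\<close>

lemma C1_path_velocity:
  assumes c: "C1_path \<A> a b c" and ab: "a < b" and \<kappa>: "\<kappa> \<in> \<A>"
  shows "\<exists>f'. continuous_on ({a..b} \<inter> c -` chart_dom \<kappa>) f' \<and> (\<forall>t\<in>{a..b} \<inter> c -` chart_dom \<kappa>.
     ((chart_map \<kappa> \<circ> c) has_vector_derivative f' t) (at t within {a..b}) \<and>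
     velocity \<A> a b c t = from_chart \<A> \<kappa> (c t) (f' t))"
proof -
  obtain f' where f': "\<And>t. t \<in> {a..b} \<inter> c -` chart_dom \<kappa> \<Longrightarrow> ((chart_map \<kappa> \<circ> c) has_vector_derivative f' t) (at t within {a..b})"
    "continuous_on ({a..b} \<inter> c -` chart_dom \<kappa>) f'" using c \<kappa> unfolding C1_path_def by blast
  have "velocity \<A> a b c t = from_chart \<A> \<kappa> (c t) (f' t)" if t: "t \<in> {a..b} \<inter> c -` chart_dom \<kappa>" for t
  proof
    fix \<kappa>'
    show "velocity \<A> a b c t \<kappa>' = from_chart \<A> \<kappa> (c t) (f' t) \<kappa>'"
    proof (cases "\<kappa>' \<in> \<A> \<and> c t \<in> chart_dom \<kappa>'")
      case True
      have ct: "c t \<in> chart_dom \<kappa>" "t \<in> {a..b}" using t by auto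
      have "(transition \<kappa> \<kappa>' has_derivative (\<lambda>v. from_chart \<A> \<kappa> (c t) v \<kappa>')) (at ((chart_map \<kappa> \<circ> c) t) within (chart_map \<kappa> \<circ> c) ` {a..b})"
        using has_derivative_at_withinI[OF transition_deriv[OF \<kappa> conjunct1[OF True] ct(1) conjunct2[OF True]]] by simp
      from vector_derivative_diff_chain_within[OF f'(1)[OF t] this]
      have 1: "((transition \<kappa> \<kappa>' \<circ> (chart_map \<kappa> \<circ> c)) has_vector_derivative from_chart \<A> \<kappa> (c t) (f' t) \<kappa>') (at t within {a..b})" .
      obtain T where T: "open T" "t \<in> T" "\<forall>s\<in>T \<inter> {a..b}. c s \<in> chart_dom \<kappa>"
        using C1_path_local[OF c ct(2) chart_open(1)[OF \<kappa>] ct(1)] by blast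
      have "\<forall>\<^sub>F s in nhds t. s \<in> {a..b} \<longrightarrow> (transition \<kappa> \<kappa>' \<circ> (chart_map \<kappa> \<circ> c)) s = (chart_map \<kappa>' \<circ> c) s"
        unfolding eventually_nhds using T chart_inv_map[OF \<kappa>] by (intro exI[of _ T]) (auto simp: transition_def)
      then have "((chart_map \<kappa>' \<circ> c) has_vector_derivative from_chart \<A> \<kappa> (c t) (f' t) \<kappa>') (at t within {a..b})"
        using 1 chart_inv_map[OF \<kappa> ct(1)] by (subst (asm) has_vector_derivative_cong_ev) (auto simp: transition_def)
      then have "vector_derivative (chart_map \<kappa>' \<circ> c) (at t within {a..b}) = from_chart \<A> \<kappa> (c t) (f' t) \<kappa>'"
        using ab ct(2) by (intro vector_derivative_within_cbox[OF ab, unfolded cbox_interval]) auto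
      then show ?thesis using True by (simp add: velocity_def)
    next
      case False then show ?thesis by (auto simp: velocity_def from_chart_def)
    qed
  qed
  then show ?thesis using f' by blast
qed

definition speed :: "real \<Rightarrow> real \<Rightarrow> (real \<Rightarrow> 'm) \<Rightarrow> real \<Rightarrow> real" where
  "speed a b c t = N (c t) (velocity \<A> a b c t)"

lemma path_len_speed: "path_len \<A> N a b c = integral {a..b} (speed a b c)"
  by (simp add: path_len_def speed_def[abs_def])

lemma speed_nonneg:
  assumes "C1_path \<A> a b c" "a < b" "t \<in> {a..b}" shows "0 \<le> speed a b c t"
proof -
  obtain \<kappa> where k: "\<kappa> \<in> \<A>" "c t \<in> chart_dom \<kappa>" using chart_exists by blast
  show ?thesis using C1_path_velocity[OF assms(1,2) k(1)] cnorm_nonneg[OF k] assms(3) k(2)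
    by (auto simp: speed_def cnorm_def)
qed

lemma speed_continuous:
  assumes c: "C1_path \<A> a b c" and ab: "a < b" shows "continuous_on {a..b} (speed a b c)"
  unfolding continuous_on_eq_continuous_within
proof
  fix t assume t: "t \<in> {a..b}"
  obtain \<kappa> where k: "\<kappa> \<in> \<A>" "c t \<in> chart_dom \<kappa>" using chart_exists by blast
  obtain f' where f': "continuous_on ({a..b} \<inter> c -` chart_dom \<kappa>) f'"
     "\<And>t. t\<in>{a..b} \<inter> c -` chart_dom \<kappa> \<Longrightarrow> velocity \<A> a b c t = from_chart \<A> \<kappa> (c t) (f' t)"
    using C1_path_velocity[OF c ab k(1)] by blast
  let ?S = "{a..b} \<inter> c -` chart_dom \<kappa>"
  have "continuous_on (chart_dom \<kappa> \<times> UNIV) (\<lambda>(x, v). N x (from_chart \<A> \<kappa> x v))"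
    using finsler k(1) unfolding finsler_manifold_def by blast
  moreover have "continuous_on ?S (\<lambda>t. (c t, f' t))"
    using c f'(1) unfolding C1_path_def by (intro continuous_on_Pair) (auto intro: continuous_on_subset)
  ultimately have "continuous_on ?S (\<lambda>t. (\<lambda>(x, v). N x (from_chart \<A> \<kappa> x v)) (c t, f' t))"
    by (rule continuous_on_compose2) auto
  moreover have "continuous_on ?S (speed a b c) \<longleftrightarrow> continuous_on ?S (\<lambda>t. (\<lambda>(x, v). N x (from_chart \<A> \<kappa> x v)) (c t, f' t))"
    by (rule continuous_on_cong) (auto simp: speed_def f'(2))
  ultimately have "continuous_on ?S (speed a b c)" by simp
  then have 1: "continuous (at t within ?S) (speed a b c)" using t k(2) by (auto simp: continuous_on_eq_continuous_within)
  obtain T where T: "open T" "t \<in> T" "\<forall>s\<in>T \<inter> {a..b}. c s \<in> chart_dom \<kappa>"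
    using C1_path_local[OF c t chart_open(1)[OF k(1)] k(2)] by blast
  have "at t within ?S = at t within {a..b}"
    by (rule at_within_nhd[OF T(2,1)]) (use T(3) in auto)
  then show "continuous (at t within {a..b}) (speed a b c)" using 1 by simp
qed

lemma path_len_has_integral:
  assumes "C1_path \<A> a b c" "a < b" shows "(speed a b c has_integral path_len \<A> N a b c) {a..b}"
  using integrable_continuous_interval[OF speed_continuous[OF assms]] by (simp add: path_len_speed integrable_integral)

lemma path_len_nonneg: "C1_path \<A> a b c \<Longrightarrow> a < b \<Longrightarrow> 0 \<le> path_len \<A> N a b c"
  by (rule has_integral_nonneg[OF path_len_has_integral]) (auto intro: speed_nonneg)

text \<open>Lengths of finite chains of C^1 arcs whose parameter intervals are unrelated.
  Concatenation is immediate for chains and reversal is done arc by arc, so the metric axioms need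
  no gluing of parametrisations.\<close>

inductive joined :: "'m \<Rightarrow> 'm \<Rightarrow> real \<Rightarrow> bool" where
  base: "C1_path \<A> a b c \<Longrightarrow> a < b \<Longrightarrow> joined (c a) (c b) (path_len \<A> N a b c)"
| snoc: "joined p q l \<Longrightarrow> C1_path \<A> a b c \<Longrightarrow> a < b \<Longrightarrow> c a = q \<Longrightarrow> joined p (c b) (l + path_len \<A> N a b c)"

lemma joined_nonneg: "joined p q l \<Longrightarrow> 0 \<le> l"
  by (induction rule: joined.induct) (auto simp: path_len_nonneg)

lemma joined_trans: "joined q r l' \<Longrightarrow> joined p q l \<Longrightarrow> joined p r (l + l')"
  by (induction rule: joined.induct) (auto simp: add.assoc[symmetric] intro: joined.intros)

text \<open>Time shift and time reversal in one statement: the velocity is multiplied by \<sigma>,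
  which has absolute value 1, so the speed is unchanged.\<close>

lemma C1_path_affine:
  assumes c: "C1_path \<A> a b c" and ab: "a < b" and \<sigma>: "\<sigma> = 1 \<or> \<sigma> = -1"
    and im: "(\<lambda>t. \<sigma> * t + h) ` {a'..b'} = {a..b}" and ab': "a' < b'"
  shows "C1_path \<A> a' b' (\<lambda>t. c (\<sigma> * t + h))" and "path_len \<A> N a' b' (\<lambda>t. c (\<sigma> * t + h)) = path_len \<A> N a b c"
proof -
  let ?c = "\<lambda>t. c (\<sigma> * t + h)"
  have inI: "\<sigma> * t + h \<in> {a..b}" if "t \<in> {a'..b'}" for t using im that by blast
  have main: "\<exists>f'. continuous_on ({a'..b'} \<inter> ?c -` chart_dom \<kappa>) f' \<and> (\<forall>t\<in>{a'..b'} \<inter> ?c -` chart_dom \<kappa>.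
     ((chart_map \<kappa> \<circ> ?c) has_vector_derivative f' t) (at t within {a'..b'}) \<and>
     from_chart \<A> \<kappa> (?c t) (f' t) = (\<lambda>\<kappa>'. \<sigma> *\<^sub>R velocity \<A> a b c (\<sigma> * t + h) \<kappa>'))" if \<kappa>: "\<kappa> \<in> \<A>" for \<kappa>
  proof -
    obtain f' where f': "continuous_on ({a..b} \<inter> c -` chart_dom \<kappa>) f'"
     "\<And>t. t\<in>{a..b} \<inter> c -` chart_dom \<kappa> \<Longrightarrow> ((chart_map \<kappa> \<circ> c) has_vector_derivative f' t) (at t within {a..b}) \<and>
        velocity \<A> a b c t = from_chart \<A> \<kappa> (c t) (f' t)"
      using C1_path_velocity[OF c ab \<kappa>] by blast
    let ?f = "\<lambda>t. \<sigma> *\<^sub>R f' (\<sigma> * t + h)"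
    have "continuous_on ({a'..b'} \<inter> ?c -` chart_dom \<kappa>) ?f"
      by (intro continuous_intros continuous_on_compose2[OF f'(1)]) (use inI in auto)
    moreover have "((chart_map \<kappa> \<circ> ?c) has_vector_derivative ?f t) (at t within {a'..b'})"
      if t: "t \<in> {a'..b'} \<inter> ?c -` chart_dom \<kappa>" for t
    proof -
      have "((\<lambda>t. \<sigma> * t + h) has_vector_derivative \<sigma>) (at t within {a'..b'})"
        by (auto intro!: derivative_eq_intros)
      moreover have "((chart_map \<kappa> \<circ> c) has_vector_derivative f' (\<sigma> * t + h)) (at (\<sigma> * t + h) within (\<lambda>t. \<sigma> * t + h) ` {a'..b'})"
        unfolding im using f'(2) inI t by auto
      ultimately have "((chart_map \<kappa> \<circ> c) \<circ> (\<lambda>t. \<sigma> * t + h) has_vector_derivative ?f t) (at t within {a'..b'})"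
        by (rule vector_diff_chain_within)
      then show ?thesis by (simp add: o_def)
    qed
    moreover have "from_chart \<A> \<kappa> (?c t) (?f t) = (\<lambda>\<kappa>'. \<sigma> *\<^sub>R velocity \<A> a b c (\<sigma> * t + h) \<kappa>')"
      if t: "t \<in> {a'..b'} \<inter> ?c -` chart_dom \<kappa>" for t
      using from_chart_scaleR[OF \<kappa>, of "?c t" \<sigma>] f'(2)[of "\<sigma> * t + h"] inI[of t] t by auto
    ultimately show ?thesis by blast
  qed
  have "continuous_on {a..b} c" using c by (simp add: C1_path_def)
  then have "continuous_on {a'..b'} ?c"
    by (rule continuous_on_compose2[where f = "\<lambda>t. \<sigma> * t + h"]) (auto simp: im intro!: continuous_intros)
  then show path: "C1_path \<A> a' b' ?c" using main unfolding C1_path_def by blast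
  have sp: "speed a' b' ?c t = speed a b c (\<sigma> * t + h)" if t: "t \<in> {a'..b'}" for t
  proof -
    obtain \<kappa> where k: "\<kappa> \<in> \<A>" "?c t \<in> chart_dom \<kappa>" using chart_exists by blast
    obtain f' where f': "\<And>t. t\<in>{a'..b'} \<inter> ?c -` chart_dom \<kappa> \<Longrightarrow> ((chart_map \<kappa> \<circ> ?c) has_vector_derivative f' t) (at t within {a'..b'}) \<and>
       from_chart \<A> \<kappa> (?c t) (f' t) = (\<lambda>\<kappa>'. \<sigma> *\<^sub>R velocity \<A> a b c (\<sigma> * t + h) \<kappa>')" using main[OF k(1)] by blast
    obtain g' where g': "\<And>t. t\<in>{a'..b'} \<inter> ?c -` chart_dom \<kappa> \<Longrightarrow> ((chart_map \<kappa> \<circ> ?c) has_vector_derivative g' t) (at t within {a'..b'}) \<and>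
       velocity \<A> a' b' ?c t = from_chart \<A> \<kappa> (?c t) (g' t)" using C1_path_velocity[OF path ab' k(1)] by blast
    have tt: "t\<in>{a'..b'} \<inter> ?c -` chart_dom \<kappa>" using t k by auto
    have "g' t = f' t" using f'[OF tt] g'[OF tt] t ab' vector_derivative_unique_within_closed_interval[of a' b' t] by auto
    then have v: "velocity \<A> a' b' ?c t = (\<lambda>\<kappa>'. \<sigma> *\<^sub>R velocity \<A> a b c (\<sigma> * t + h) \<kappa>')" using f'[OF tt] g'[OF tt] by simp
    have vt: "velocity \<A> a b c (\<sigma> * t + h) \<in> tangent_space \<A> (?c t)"
      using C1_path_velocity[OF c ab k(1)] from_chart_tangent[OF k] inI[OF t] k(2) by auto
    have "N (?c t) (\<lambda>\<kappa>'. \<sigma> *\<^sub>R velocity \<A> a b c (\<sigma> * t + h) \<kappa>') = \<bar>\<sigma>\<bar> * N (?c t) (velocity \<A> a b c (\<sigma> * t + h))"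
      using norm_tangent[of "?c t"] vt unfolding norm_on_tangent_space_def by blast
    then show ?thesis using \<sigma> by (auto simp: speed_def v)
  qed
  have im2: "(\<lambda>x. (1 / \<sigma>) *\<^sub>R x + - ((1 / \<sigma>) *\<^sub>R h)) ` cbox a b = {a'..b'}"
  proof -
    have "(\<lambda>x. (1 / \<sigma>) *\<^sub>R x + - ((1 / \<sigma>) *\<^sub>R h)) ` ((\<lambda>t. \<sigma> * t + h) ` {a'..b'}) = (\<lambda>t. t) ` {a'..b'}"
      unfolding image_image using \<sigma> by (intro image_cong) (auto simp: field_simps)
    then show ?thesis by (simp add: im)
  qed
  have "((\<lambda>t. speed a b c (\<sigma> *\<^sub>R t + h)) has_integral (1 / \<bar>\<sigma>\<bar> ^ DIM(real)) *\<^sub>R path_len \<A> N a b c) ((\<lambda>x. (1 / \<sigma>) *\<^sub>R x + - ((1 / \<sigma>) *\<^sub>R h)) ` cbox a b)"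
    by (rule has_integral_affinity) (use path_len_has_integral[OF c ab] \<sigma> in auto)
  then have "((\<lambda>t. speed a b c (\<sigma> * t + h)) has_integral path_len \<A> N a b c) {a'..b'}"
    unfolding im2 using \<sigma> by auto
  then have "(speed a' b' ?c has_integral path_len \<A> N a b c) {a'..b'}"
    by (rule has_integral_eq[rotated]) (simp add: sp)
  then show "path_len \<A> N a' b' ?c = path_len \<A> N a b c" by (simp add: path_len_speed integral_unique)
qed

lemma C1_path_reverse:
  assumes "C1_path \<A> a b c" "a < b"
  shows "C1_path \<A> (-b) (-a) (\<lambda>t. c (- t))" "path_len \<A> N (-b) (-a) (\<lambda>t. c (- t)) = path_len \<A> N a b c"
proof -
  have im: "(\<lambda>t. (-1) * t + 0) ` {-b..-a} = {a..b}" by (auto simp: image_iff intro: bexI[of _ "- _"])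
  show "C1_path \<A> (-b) (-a) (\<lambda>t. c (- t))" "path_len \<A> N (-b) (-a) (\<lambda>t. c (- t)) = path_len \<A> N a b c"
    using C1_path_affine[OF assms _ im] assms(2) by auto
qed

lemma C1_path_shift:
  assumes "C1_path \<A> a b c" "a < b"
  shows "C1_path \<A> (a+h) (b+h) (\<lambda>t. c (t - h))" "path_len \<A> N (a+h) (b+h) (\<lambda>t. c (t - h)) = path_len \<A> N a b c"
proof -
  have im: "(\<lambda>t. 1 * t + - h) ` {a+h..b+h} = {a..b}" by (auto simp: image_iff intro: bexI[of _ "_ + h"])
  show "C1_path \<A> (a+h) (b+h) (\<lambda>t. c (t - h))" "path_len \<A> N (a+h) (b+h) (\<lambda>t. c (t - h)) = path_len \<A> N a b c"
    using C1_path_affine[OF assms _ im] assms(2) by auto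
qed

lemma joined_sym: "joined p q l \<Longrightarrow> joined q p l"
proof (induction rule: joined.induct)
  case (base a b c)
  then show ?case using joined.base[OF C1_path_reverse(1)[OF base]] C1_path_reverse(2)[OF base] by simp
next
  case (snoc p q l a b c)
  have "joined (c b) q (path_len \<A> N a b c)"
    using joined.base[OF C1_path_reverse(1)[OF snoc.hyps(2,3)]] C1_path_reverse(2)[OF snoc.hyps(2,3)] snoc.hyps by simp
  from joined_trans[OF snoc.IH this] show ?case by (simp add: add.commute)
qed

lemma speed_restrict:
  assumes "a \<le> s" "s' \<le> b" "t \<in> {s<..<s'}" shows "speed a b c t = speed s s' c t"
proof -
  have "at t within {a..b} = at t" "at t within {s..s'} = at t" using assms by (auto intro: at_within_Icc_at)
  then show ?thesis unfolding speed_def velocity_def by presburger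
qed

lemma piecewise_has_integral:
  assumes "\<forall>i<n. (s i::real) < s (Suc i) \<and> C1_path \<A> (s i) (s (Suc i)) c" "a = s 0" "k \<le> n" "s n \<le> b"
  shows "s 0 \<le> s k \<and> (0 < k \<longrightarrow> s 0 < s k) \<and> (speed a b c has_integral (\<Sum>i<k. path_len \<A> N (s i) (s (Suc i)) c)) {a..s k} \<and>
     (0 < k \<longrightarrow> joined (c a) (c (s k)) (\<Sum>i<k. path_len \<A> N (s i) (s (Suc i)) c))"
  using assms(3)
proof (induction k)
  case 0 then show ?case using assms(2) by (simp add: has_integral_refl)
next
  case (Suc k)
  have k: "s k < s (Suc k)" "C1_path \<A> (s k) (s (Suc k)) c" using assms(1) Suc.prems by auto
  have mono: "s j \<le> s n" if "j \<le> n" for j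
    using that by (induction rule: inc_induct) (use assms(1) less_imp_le order_trans in fastforce)+
  \<comment> \<open>The velocity taken within the whole interval and the one taken within a piece
    can differ only at the two end points of the piece, and a finite set does not affect the
    integral.\<close>
  have "(speed a b c has_integral path_len \<A> N (s k) (s (Suc k)) c) {s k..s (Suc k)}"
    by (rule has_integral_spike_finite[OF _ _ path_len_has_integral[OF k(2,1)], of "{s k, s (Suc k)}"])
       (use Suc assms(2,4) mono[OF Suc.prems] in \<open>auto intro!: speed_restrict\<close>)
  then have "(speed a b c has_integral (\<Sum>i<k. path_len \<A> N (s i) (s (Suc i)) c) + path_len \<A> N (s k) (s (Suc k)) c) {a..s (Suc k)}"
    using Suc k assms(2) by (intro has_integral_combine[of a "s k"]) auto
  moreover have "joined (c a) (c (s (Suc k))) (\<Sum>i<Suc k. path_len \<A> N (s i) (s (Suc i)) c)"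
    using Suc k joined.base[OF k(2,1)] joined.snoc[OF _ k(2,1)] assms(2) by (cases k) auto
  ultimately show ?case using Suc k by auto
qed

lemma C1_path_cong:
  assumes "C1_path \<A> a b c" "a < b" "\<And>t. t \<in> {a..b} \<Longrightarrow> c' t = c t"
  shows "C1_path \<A> a b c'" "path_len \<A> N a b c' = path_len \<A> N a b c"
proof -
  have hv: "((chart_map \<kappa> \<circ> c') has_vector_derivative d) (at t within {a..b}) \<longleftrightarrow> ((chart_map \<kappa> \<circ> c) has_vector_derivative d) (at t within {a..b})"
    if "t \<in> {a..b}" for t \<kappa> d
    using that assms(3) by (intro has_vector_derivative_cong_ev) (auto intro!: always_eventually)
  have eq: "{a..b} \<inter> c' -` S = {a..b} \<inter> c -` S" for S using assms(3) by auto
  have "continuous_on {a..b} c" using assms(1) by (simp add: C1_path_def)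
  then have "continuous_on {a..b} c'" by (rule continuous_on_eq) (simp add: assms(3))
  moreover have "\<exists>f'. (\<forall>t\<in>{a..b} \<inter> c' -` chart_dom \<kappa>. ((chart_map \<kappa> \<circ> c') has_vector_derivative f' t) (at t within {a..b})) \<and>
      continuous_on ({a..b} \<inter> c' -` chart_dom \<kappa>) f'" if \<kappa>: "\<kappa> \<in> \<A>" for \<kappa>
  proof -
    obtain f' where "\<forall>t\<in>{a..b} \<inter> c -` chart_dom \<kappa>. ((chart_map \<kappa> \<circ> c) has_vector_derivative f' t) (at t within {a..b})"
      "continuous_on ({a..b} \<inter> c -` chart_dom \<kappa>) f'" using assms(1) \<kappa> unfolding C1_path_def by blast
    then show ?thesis unfolding eq by (intro exI[of _ f'] conjI ballI iffD2[OF hv]) auto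
  qed
  ultimately show "C1_path \<A> a b c'" unfolding C1_path_def by blast
  show "path_len \<A> N a b c' = path_len \<A> N a b c"
    unfolding path_len_speed
  proof (rule integral_cong)
    fix t assume t: "t \<in> {a..b}"
    have vd: "vector_derivative (chart_map \<kappa> \<circ> c') (at t within {a..b}) = vector_derivative (chart_map \<kappa> \<circ> c) (at t within {a..b})" for \<kappa>
      unfolding vector_derivative_def hv[OF t] ..
    show "speed a b c' t = speed a b c t" unfolding speed_def velocity_def vd assms(3)[OF t] ..
  qed
qed

lemma piecewise_of_joined:
  "joined p q l \<Longrightarrow> \<exists>n s c. (0::nat) < n \<and> (\<forall>i<n. (s i::real) < s (Suc i) \<and> C1_path \<A> (s i) (s (Suc i)) c) \<and>
     c (s 0) = p \<and> c (s n) = q \<and> l = (\<Sum>i<n. path_len \<A> N (s i) (s (Suc i)) c)"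
proof (induction rule: joined.induct)
  case (base a b c)
  then show ?case
    by (intro exI[of _ 1] exI[of _ "\<lambda>i::nat. if i = 0 then a else b"] exI[of _ c]) auto
next
  case (snoc p q l a b c)
  then obtain n s c1 where s: "(0::nat) < n" "\<forall>i<n. (s i::real) < s (Suc i) \<and> C1_path \<A> (s i) (s (Suc i)) c1"
     "c1 (s 0) = p" "c1 (s n) = q" "l = (\<Sum>i<n. path_len \<A> N (s i) (s (Suc i)) c1)" by blast
  \<comment> \<open>The new arc is shifted so that its parameter starts where the path glued so far
    ends.\<close>
  define h where "h = s n - a"
  define c2 where "c2 t = (if t \<le> s n then c1 t else c (t - h))" for t
  define s2 where "s2 i = (if i \<le> n then s i else b + h)" for i
  have mono: "s j \<le> s n" if "j \<le> n" for j
    using that by (induction rule: inc_induct) (use s(2) less_imp_le order_trans in fastforce)+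
  have 1: "s2 i < s2 (Suc i) \<and> C1_path \<A> (s2 i) (s2 (Suc i)) c2 \<and> path_len \<A> N (s2 i) (s2 (Suc i)) c2 = path_len \<A> N (s i) (s (Suc i)) c1"
    if "i < n" for i
  proof -
    have i: "s i < s (Suc i)" "C1_path \<A> (s i) (s (Suc i)) c1" using s(2) that by auto
    have "c2 t = c1 t" if "t \<in> {s i..s (Suc i)}" for t using that mono[of "Suc i"] \<open>i < n\<close> by (auto simp: c2_def)
    from C1_path_cong[OF i(2,1) this] show ?thesis using i that by (simp add: s2_def)
  qed
  have 2: "s2 n < s2 (Suc n) \<and> C1_path \<A> (s2 n) (s2 (Suc n)) c2 \<and> path_len \<A> N (s2 n) (s2 (Suc n)) c2 = path_len \<A> N a b c"
  proof -
    have "c2 t = c (t - h)" if "t \<in> {a + h..b + h}" for t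
      using that snoc.hyps(4) s(4) by (cases "t = s n") (auto simp: c2_def h_def)
    note C1_path_cong[OF C1_path_shift(1)[OF snoc.hyps(2,3)] _ this]
    moreover have "s2 n = a + h" "s2 (Suc n) = b + h" by (auto simp: s2_def h_def)
    ultimately show ?thesis using snoc.hyps(3) C1_path_shift(2)[OF snoc.hyps(2,3), of h] by simp
  qed
  have "\<forall>i<Suc n. s2 i < s2 (Suc i) \<and> C1_path \<A> (s2 i) (s2 (Suc i)) c2" using 1 2 less_Suc_eq by auto
  moreover have "c2 (s2 0) = p" using s(3) mono[of 0] by (simp add: c2_def s2_def)
  moreover have "c2 (s2 (Suc n)) = c b" using snoc.hyps(3) by (auto simp: c2_def s2_def h_def)
  moreover have "l + path_len \<A> N a b c = (\<Sum>i<Suc n. path_len \<A> N (s2 i) (s2 (Suc i)) c2)" using 1 2 s(5) by simp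
  ultimately show ?case by (intro exI[of _ "Suc n"] exI[of _ s2] exI[of _ c2]) auto
qed

lemma finsler_dist_joined: "finsler_dist \<A> N p q = Inf {l. joined p q l}"
proof -
  have "{path_len \<A> N a b c | a b c. piecewise_C1_path \<A> a b c \<and> c a = p \<and> c b = q} = {l. joined p q l}"
  proof (intro equalityI subsetI)
    fix l assume "l \<in> {path_len \<A> N a b c | a b c. piecewise_C1_path \<A> a b c \<and> c a = p \<and> c b = q}"
    then obtain a b c n s where l: "l = path_len \<A> N a b c" "c a = p" "c b = q" "a < b" "s 0 = a" "s (n::nat) = b"
      "\<forall>i<n. s i < s (Suc i) \<and> C1_path \<A> (s i) (s (Suc i)) c" unfolding piecewise_C1_path_def by blast
    have "0 < n" using l(4-6) by (cases n) auto
    then show "l \<in> {l. joined p q l}"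
      using piecewise_has_integral[OF l(7), of a n b] l by (auto simp: path_len_speed integral_unique)
  next
    fix l assume "l \<in> {l. joined p q l}"
    then obtain n s c where s: "(0::nat) < n" "\<forall>i<n. (s i::real) < s (Suc i) \<and> C1_path \<A> (s i) (s (Suc i)) c"
     "c (s 0) = p" "c (s n) = q" "l = (\<Sum>i<n. path_len \<A> N (s i) (s (Suc i)) c)" using piecewise_of_joined by blast
    have "path_len \<A> N (s 0) (s n) c = l" "s 0 < s n" using piecewise_has_integral[OF s(2), of "s 0" n "s n"] s
      by (auto simp: path_len_speed integral_unique)
    moreover have "piecewise_C1_path \<A> (s 0) (s n) c" using s(2) \<open>s 0 < s n\<close> unfolding piecewise_C1_path_def by blast
    ultimately show "l \<in> {path_len \<A> N a b c | a b c. piecewise_C1_path \<A> a b c \<and> c a = p \<and> c b = q}" using s by blast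
  qed
  then show ?thesis by (simp add: finsler_dist_def)
qed

section \<open>The Finsler distance compared with chart norms\<close>

abbreviation fdist :: "'m \<Rightarrow> 'm \<Rightarrow> real" where "fdist \<equiv> finsler_dist \<A> N"

text \<open>The straight segment in the chart is a C^1 path with constant chart velocity
  \<open>y' - y\<close>, so a bound for the Finsler norm of this one vector along the segment bounds
  its length.\<close>

lemma joined_segment:
  assumes \<kappa>: "\<kappa> \<in> \<A>" and B: "convex B" "B \<subseteq> chart_map \<kappa> ` chart_dom \<kappa>" and y: "y \<in> B" "y' \<in> B"
    and M: "\<And>z. z \<in> B \<Longrightarrow> cnorm \<kappa> (chart_inv \<kappa> z) (y' - y) \<le> M"
  shows "\<exists>l\<le>M. joined (chart_inv \<kappa> y) (chart_inv \<kappa> y') l"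
proof -
  define ln where "ln \<tau> = y + \<tau> *\<^sub>R (y' - y)" for \<tau> :: real
  define c where "c \<tau> = chart_inv \<kappa> (ln \<tau>)" for \<tau>
  have lnB: "ln \<tau> \<in> B" if "\<tau> \<in> {0..1}" for \<tau>
  proof -
    have "ln \<tau> = (1 - \<tau>) *\<^sub>R y + \<tau> *\<^sub>R y'" by (simp add: ln_def algebra_simps)
    then show ?thesis using convexD_alt[OF B(1) y] that by simp
  qed
  have phi_c: "chart_map \<kappa> (c \<tau>) = ln \<tau>" "c \<tau> \<in> chart_dom \<kappa>" if "\<tau> \<in> {0..1}" for \<tau>
    using chart_map_inv[OF \<kappa>] chart_inv_dom[OF \<kappa>] lnB[OF that] B(2) by (auto simp: c_def)
  have ln_cont: "continuous_on S ln" for S unfolding ln_def by (intro continuous_intros)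
  have ln_deriv: "(ln has_vector_derivative (y' - y)) (at \<tau> within S)" for \<tau> S
    unfolding ln_def by (auto intro!: derivative_eq_intros)
  have c_cont: "continuous_on {0..1} c" unfolding c_def
    by (rule continuous_on_compose2[OF chart_cont(2)[OF \<kappa>] ln_cont]) (use lnB B in auto)
  have path: "C1_path \<A> 0 1 c" unfolding C1_path_def
  proof (intro conjI ballI c_cont)
    fix \<kappa>' assume \<kappa>': "\<kappa>' \<in> \<A>"
    obtain T where T: "C1d (chart_map \<kappa> ` (chart_dom \<kappa> \<inter> chart_dom \<kappa>')) (transition \<kappa> \<kappa>') T"
      using transition_C1[OF \<kappa> \<kappa>'] by blast
    let ?S = "{0..1} \<inter> c -` chart_dom \<kappa>'"
    have ln_in: "ln \<tau> \<in> chart_map \<kappa> ` (chart_dom \<kappa> \<inter> chart_dom \<kappa>')" if "\<tau> \<in> ?S" for \<tau>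
      using phi_c[of \<tau>] that by (metis IntE IntI imageI vimageD)
    have c1: "continuous_on ?S (\<lambda>\<tau>. blinfun_apply (T (ln \<tau>)) (y' - y))"
      by (intro blinfun.continuous_on continuous_on_compose2[OF C1d_contD[OF T] ln_cont] image_subsetI ln_in continuous_on_const)
    have d1: "((chart_map \<kappa>' \<circ> c) has_vector_derivative blinfun_apply (T (ln \<tau>)) (y' - y)) (at \<tau> within {0..1})"
      if "\<tau> \<in> ?S" for \<tau>
    proof -
      have "(transition \<kappa> \<kappa>' has_derivative blinfun_apply (T (ln \<tau>))) (at (ln \<tau>) within ln ` {0..1})"
        by (rule has_derivative_at_withinI[OF C1d_derivD[OF T ln_in[OF that]]])
      from vector_derivative_diff_chain_within[OF ln_deriv this]
      show ?thesis by (simp add: transition_def o_def c_def)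
    qed
    show "\<exists>f'. (\<forall>t\<in>?S. ((chart_map \<kappa>' \<circ> c) has_vector_derivative f' t) (at t within {0..1})) \<and> continuous_on ?S f'"
      by (intro exI[of _ "\<lambda>\<tau>. blinfun_apply (T (ln \<tau>)) (y' - y)"] conjI ballI d1 c1)
  qed
  have sp: "speed 0 1 c \<tau> \<le> M" if t: "\<tau> \<in> {0..1}" for \<tau>
  proof -
    obtain g' where g': "\<And>t. t\<in>{0..1} \<inter> c -` chart_dom \<kappa> \<Longrightarrow> ((chart_map \<kappa> \<circ> c) has_vector_derivative g' t) (at t within {0..1}) \<and>
       velocity \<A> 0 1 c t = from_chart \<A> \<kappa> (c t) (g' t)" using C1_path_velocity[OF path zero_less_one \<kappa>] by blast
    have tt: "\<tau> \<in> {0..1} \<inter> c -` chart_dom \<kappa>" using t phi_c by auto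
    have "((chart_map \<kappa> \<circ> c) has_vector_derivative (y' - y)) (at \<tau> within {0..1})"
      by (rule has_vector_derivative_transform[OF t _ ln_deriv]) (simp add: phi_c)
    then have "g' \<tau> = y' - y" using g'[OF tt] t vector_derivative_unique_within_closed_interval[of 0 1 \<tau>] by auto
    then show ?thesis using g'[OF tt] M[OF lnB[OF t]] by (simp add: speed_def cnorm_def c_def)
  qed
  have "path_len \<A> N 0 1 c \<le> integral {0..1} (\<lambda>_::real. M)"
    unfolding path_len_speed
    by (rule integral_le[OF integrable_continuous_interval[OF speed_continuous[OF path]]]) (use sp in auto)
  then have "path_len \<A> N 0 1 c \<le> M" by simp
  moreover have "joined (c 0) (c 1) (path_len \<A> N 0 1 c)" by (rule joined.base[OF path]) simp
  ultimately show ?thesis by (auto simp: c_def ln_def)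
qed

lemma chart_ball_in:
  assumes \<kappa>: "\<kappa> \<in> \<A>" and x: "x \<in> chart_dom \<kappa>" and W: "open W" "x \<in> W"
  shows "\<exists>r>0. ball (chart_map \<kappa> x) r \<subseteq> chart_map \<kappa> ` chart_dom \<kappa> \<and> (\<forall>y\<in>ball (chart_map \<kappa> x) r. chart_inv \<kappa> y \<in> W)"
proof -
  obtain r where r: "r > 0" "cball (chart_map \<kappa> x) r \<subseteq> chart_map \<kappa> ` chart_dom \<kappa>"
    "chart_inv \<kappa> ` cball (chart_map \<kappa> x) r \<subseteq> W" using chart_closed_ball[OF \<kappa> x W] by blast
  have "ball (chart_map \<kappa> x) r \<subseteq> cball (chart_map \<kappa> x) r" by (rule ball_subset_cball)
  then show ?thesis using r by blast
qed

lemma joined_chart: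
  assumes \<kappa>: "\<kappa> \<in> \<A>" and x: "x \<in> chart_dom \<kappa>" and \<epsilon>: "\<epsilon> > 0"
  shows "\<exists>r>0. ball (chart_map \<kappa> x) r \<subseteq> chart_map \<kappa> ` chart_dom \<kappa> \<and>
     (\<forall>y\<in>ball (chart_map \<kappa> x) r. \<forall>y'\<in>ball (chart_map \<kappa> x) r.
        \<exists>l\<le>(1 + \<epsilon>) * cnorm \<kappa> x (y' - y). joined (chart_inv \<kappa> y) (chart_inv \<kappa> y') l)"
proof -
  obtain W where W: "open W" "x \<in> W" "\<And>y v. y \<in> W \<Longrightarrow> cnorm \<kappa> y v \<le> (1 + \<epsilon>) * cnorm \<kappa> x v"
    using cnorm_compare[OF \<kappa> x \<epsilon>] by blast
  obtain r where r: "r > 0" "ball (chart_map \<kappa> x) r \<subseteq> chart_map \<kappa> ` chart_dom \<kappa>"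
    "\<forall>y\<in>ball (chart_map \<kappa> x) r. chart_inv \<kappa> y \<in> W" using chart_ball_in[OF \<kappa> x W(1,2)] by blast
  have "\<exists>l\<le>(1 + \<epsilon>) * cnorm \<kappa> x (y' - y). joined (chart_inv \<kappa> y) (chart_inv \<kappa> y') l"
    if "y \<in> ball (chart_map \<kappa> x) r" "y' \<in> ball (chart_map \<kappa> x) r" for y y'
    by (rule joined_segment[OF \<kappa> convex_ball r(2) that]) (use r(3) W(3) in blast)
  then show ?thesis using r by blast
qed

text \<open>Arcs have nondegenerate parameter intervals, so a path from \<open>p\<close> to itself
  of length 0 has to be produced: it is a segment with equal end points in a chart.\<close>

lemma joined_refl: "joined p p 0"
proof -
  obtain \<kappa> where k: "\<kappa> \<in> \<A>" "p \<in> chart_dom \<kappa>" using chart_exists by blast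
  obtain r where "r > 0" "\<forall>y\<in>ball (chart_map \<kappa> p) r. \<forall>y'\<in>ball (chart_map \<kappa> p) r.
        \<exists>l\<le>(1 + 1) * cnorm \<kappa> p (y' - y). joined (chart_inv \<kappa> y) (chart_inv \<kappa> y') l"
    using joined_chart[OF k, of 1] by auto
  then have "\<exists>l\<le>(1 + 1) * cnorm \<kappa> p (chart_map \<kappa> p - chart_map \<kappa> p). joined (chart_inv \<kappa> (chart_map \<kappa> p)) (chart_inv \<kappa> (chart_map \<kappa> p)) l"
    by (meson centre_in_ball)
  then obtain l where "l \<le> 0" "joined p p l" by (auto simp: cnorm_zero[OF k] chart_inv_map[OF k])
  then show ?thesis using joined_nonneg[of p p l] by simp
qed

lemma joined_nbhd: "\<exists>W. open W \<and> x \<in> W \<and> (\<forall>y\<in>W. \<exists>l. joined x y l)"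
proof -
  obtain \<kappa> where k: "\<kappa> \<in> \<A>" "x \<in> chart_dom \<kappa>" using chart_exists by blast
  obtain r where r: "r > 0" "\<forall>y\<in>ball (chart_map \<kappa> x) r. \<forall>y'\<in>ball (chart_map \<kappa> x) r.
        \<exists>l\<le>(1 + 1) * cnorm \<kappa> x (y' - y). joined (chart_inv \<kappa> y) (chart_inv \<kappa> y') l"
    using joined_chart[OF k, of 1] by auto
  let ?W = "chart_dom \<kappa> \<inter> chart_map \<kappa> -` ball (chart_map \<kappa> x) r"
  have "\<exists>l. joined x y l" if "y \<in> ?W" for y
  proof -
    have "\<exists>l. joined (chart_inv \<kappa> (chart_map \<kappa> x)) (chart_inv \<kappa> (chart_map \<kappa> y)) l"
      using r that by (meson IntD2 centre_in_ball vimageD)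
    then show ?thesis using that k chart_inv_map[OF k(1)] by auto
  qed
  then show ?thesis using open_chart_preimage[OF k(1) open_ball] r(1) k(2) by (intro exI[of _ ?W]) auto
qed

text \<open>Reachability from \<open>p\<close> is an open condition and so is unreachability,
  because nearby points are joined by chart segments; connectedness does the rest. Without it the
  infimum defining the distance would be over an empty set.\<close>

lemma joined_exists: "\<exists>l. joined p q l"
proof -
  let ?S = "{q. \<exists>l. joined p q l}"
  have tr: "\<exists>l. joined a c l" if "\<exists>l. joined a b l" "\<exists>l. joined b c l" for a b c using joined_trans that by blast
  have "open ?S"
  proof (subst open_subopen, intro ballI)
    fix x assume x: "x \<in> ?S"
    obtain W where "open W" "x \<in> W" "\<forall>y\<in>W. \<exists>l. joined x y l" using joined_nbhd by blast
    then show "\<exists>T. open T \<and> x \<in> T \<and> T \<subseteq> ?S" using tr[of p x] x by (intro exI[of _ W]) blast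
  qed
  moreover have "open (- ?S)"
  proof (subst open_subopen, intro ballI)
    fix x assume x: "x \<in> - ?S"
    obtain W where W: "open W" "x \<in> W" "\<forall>y\<in>W. \<exists>l. joined x y l" using joined_nbhd by blast
    have "y \<in> - ?S" if "y \<in> W" for y using tr[of p y x] x W(3) that joined_sym by blast
    then show "\<exists>T. open T \<and> x \<in> T \<and> T \<subseteq> - ?S" using W by (intro exI[of _ W]) blast
  qed
  moreover have "connected (UNIV :: 'm set)" using finsler unfolding finsler_manifold_def by blast
  ultimately have "?S \<inter> UNIV = {} \<or> - ?S \<inter> UNIV = {}" by (intro connectedD) auto
  moreover have "p \<in> ?S" using joined_refl by blast
  ultimately show ?thesis by blast
qed

lemma fdist_le: "joined p q l \<Longrightarrow> fdist p q \<le> l"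
  unfolding finsler_dist_joined by (intro cInf_lower) (auto intro: joined_nonneg)

lemma fdist_lessD: "fdist p q < e \<Longrightarrow> \<exists>l<e. joined p q l"
  unfolding finsler_dist_joined using cInf_lessD[of "{l. joined p q l}"] joined_exists by blast

lemma fdist_ge: "(\<And>l. joined p q l \<Longrightarrow> e \<le> l) \<Longrightarrow> e \<le> fdist p q"
  unfolding finsler_dist_joined using joined_exists by (intro cInf_greatest) auto

lemma fdist_nonneg: "0 \<le> fdist p q"
  by (rule fdist_ge) (rule joined_nonneg)

lemma fdist_refl: "fdist p p = 0"
  using fdist_le[OF joined_refl] fdist_nonneg order_antisym by blast

lemma fdist_sym: "fdist p q = fdist q p"
proof -
  have "{l. joined p q l} = {l. joined q p l}" using joined_sym by blast
  then show ?thesis by (simp add: finsler_dist_joined)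
qed

lemma fdist_triangle: "fdist p r \<le> fdist p q + fdist q r"
proof (rule field_le_epsilon)
  fix e :: real assume "e > 0"
  obtain l where l: "l < fdist p q + e / 2" "joined p q l" using fdist_lessD[of p q "fdist p q + e / 2"] \<open>e > 0\<close> by auto
  obtain k where k: "k < fdist q r + e / 2" "joined q r k" using fdist_lessD[of q r "fdist q r + e / 2"] \<open>e > 0\<close> by auto
  show "fdist p r \<le> fdist p q + fdist q r + e" using fdist_le[OF joined_trans[OF k(2) l(2)]] l(1) k(1) by linarith
qed

lemma fdist_chart:
  assumes \<kappa>: "\<kappa> \<in> \<A>" and x: "x \<in> chart_dom \<kappa>" and \<epsilon>: "\<epsilon> > 0"
  shows "\<exists>r>0. ball (chart_map \<kappa> x) r \<subseteq> chart_map \<kappa> ` chart_dom \<kappa> \<and>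
     (\<forall>y\<in>ball (chart_map \<kappa> x) r. \<forall>y'\<in>ball (chart_map \<kappa> x) r. fdist (chart_inv \<kappa> y) (chart_inv \<kappa> y') \<le> (1 + \<epsilon>) * cnorm \<kappa> x (y' - y))"
  using joined_chart[OF assms] fdist_le by (meson order_trans)

text \<open>The lower bound for the length of a path leaving a neighbourhood: the distance to the centre in a
  chart, cut off at the radius \<open>r\<close>, varies along a path by at most a constant times its length.\<close>

lemma fdist_small:
  assumes W: "open W" "x \<in> W"
  shows "\<exists>\<delta>>0. \<forall>y. fdist x y < \<delta> \<longrightarrow> y \<in> W"
proof -
  obtain \<kappa> where \<kappa>: "\<kappa> \<in> \<A>" "x \<in> chart_dom \<kappa>" using chart_exists by blast
  obtain V where V: "open V" "x \<in> V" "V \<subseteq> chart_dom \<kappa>" "\<And>y v. y \<in> V \<Longrightarrow> cnorm \<kappa> x v \<le> (1 + 1) * cnorm \<kappa> y v"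
    using cnorm_compare[OF \<kappa>, of 1] by auto
  obtain \<alpha> where a: "\<alpha> > 0" "\<And>v. \<alpha> * norm v \<le> cnorm \<kappa> x v" using cnorm_equiv[OF \<kappa>] by blast
  have lower: "\<alpha> / 2 * norm v \<le> cnorm \<kappa> y v" if "y \<in> V" for y v using V(4)[OF that, of v] a(2)[of v] by simp
  obtain V1 where V1: "open V1" "x \<in> V1" "closure V1 \<subseteq> V \<inter> W" using regular_nbhd[of "V \<inter> W" x] V W by auto
  obtain r where r: "r > 0" "ball (chart_map \<kappa> x) r \<subseteq> chart_map \<kappa> ` chart_dom \<kappa>"
    "\<forall>y\<in>ball (chart_map \<kappa> x) r. chart_inv \<kappa> y \<in> V1" using chart_ball_in[OF \<kappa> V1(1,2)] by blast
  \<comment> \<open>The value outside \<open>V\<close> has to fit continuously along paths. This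
    holds because the ball of radius \<open>r\<close> is inside \<open>V1\<close>, whose closure
    lies in \<open>V\<close>: on \<open>V\<close> but off that closure the truncation has already
    reached \<open>r\<close>.\<close>
  define \<rho> where "\<rho> y = (if y \<in> V then min r (norm (chart_map \<kappa> y - chart_map \<kappa> x)) else r)" for y
  have far: "\<rho> y = r" if "y \<notin> closure V1" for y
  proof (cases "y \<in> V")
    case True
    have "chart_map \<kappa> y \<notin> ball (chart_map \<kappa> x) r"
    proof
      assume "chart_map \<kappa> y \<in> ball (chart_map \<kappa> x) r"
      then have "y \<in> V1" using r(3) chart_inv_map[OF \<kappa>(1)] True V(3) by (metis subsetD)
      then show False using that closure_subset by blast
    qed
    then show ?thesis using True by (simp add: \<rho>_def dist_norm norm_minus_commute)
  qed (simp add: \<rho>_def)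
  \<comment> \<open>In \<open>V\<close> the chart velocity is at most 2/\<alpha> times the speed. A
    path point outside \<open>V\<close> has a neighbourhood off the closure of \<open>V1\<close>,
    where \<rho> is constant.\<close>
  have step: "\<bar>\<alpha> / 2 * \<rho> (c b) - \<alpha> / 2 * \<rho> (c a)\<bar> \<le> path_len \<A> N a b c" if c: "C1_path \<A> a b c" and ab: "a < b" for a b c
    unfolding path_len_speed
  proof (rule increment_le_integral[OF speed_continuous[OF c ab]])
    fix t e :: real assume t: "t \<in> {a..b}" and e: "e > 0"
    show "\<exists>\<delta>>0. \<forall>s\<in>{a..b}. \<bar>s - t\<bar> < \<delta> \<longrightarrow> \<bar>\<alpha> / 2 * \<rho> (c s) - \<alpha> / 2 * \<rho> (c t)\<bar> \<le> (speed a b c t + e) * \<bar>s - t\<bar>"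
    proof (cases "c t \<in> V")
      case True
      obtain T where T: "open T" "t \<in> T" "\<forall>s\<in>T \<inter> {a..b}. c s \<in> V" using C1_path_local[OF c t V(1) True] by blast
      obtain d1 where d1: "d1 > 0" "\<And>s. \<bar>s - t\<bar> < d1 \<Longrightarrow> s \<in> T"
        using T(1,2) by (auto simp: open_dist dist_real_def)
      obtain g' where g': "((chart_map \<kappa> \<circ> c) has_vector_derivative g') (at t within {a..b})"
       "velocity \<A> a b c t = from_chart \<A> \<kappa> (c t) g'" using C1_path_velocity[OF c ab \<kappa>(1)] t True V(3) by blast
      have sp: "\<alpha> / 2 * norm g' \<le> speed a b c t" using lower[OF True, of g'] g'(2) by (simp add: speed_def cnorm_def)
      have "e / \<alpha> > 0" using e a by simp
      then obtain d2 where d2: "d2 > 0" "\<And>s. s \<in> {a..b} \<Longrightarrow> \<bar>s - t\<bar> < d2 \<Longrightarrow>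
          norm ((chart_map \<kappa> \<circ> c) s - (chart_map \<kappa> \<circ> c) t - (s - t) *\<^sub>R g') \<le> e / \<alpha> * \<bar>s - t\<bar>"
        using g'(1) unfolding has_vector_derivative_def has_derivative_within_alt by (fastforce simp: dist_real_def)
      show ?thesis
      proof (intro exI[of _ "min d1 d2"] conjI ballI impI)
        fix s assume s: "s \<in> {a..b}" "\<bar>s - t\<bar> < min d1 d2"
        let ?d = "(chart_map \<kappa> \<circ> c) s - (chart_map \<kappa> \<circ> c) t"
        have csV: "c s \<in> V" using T(3) d1(2)[of s] s by auto
        have "norm ?d \<le> norm (?d - (s - t) *\<^sub>R g') + norm ((s - t) *\<^sub>R g')" by (metis diff_add_cancel norm_triangle_ineq)
        also have "\<dots> \<le> e / \<alpha> * \<bar>s - t\<bar> + \<bar>s - t\<bar> * norm g'" using d2(2)[of s] s by simp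
        finally have nd: "norm ?d \<le> (e / \<alpha> + norm g') * \<bar>s - t\<bar>" by (simp add: algebra_simps)
        have "\<bar>norm (chart_map \<kappa> (c s) - chart_map \<kappa> x) - norm (chart_map \<kappa> (c t) - chart_map \<kappa> x)\<bar> \<le> norm ?d"
          using norm_triangle_ineq3[of "chart_map \<kappa> (c s) - chart_map \<kappa> x" "chart_map \<kappa> (c t) - chart_map \<kappa> x"] by simp
        then have "\<bar>\<rho> (c s) - \<rho> (c t)\<bar> \<le> norm ?d" using csV True by (auto simp: \<rho>_def)
        then have "\<alpha> / 2 * \<bar>\<rho> (c s) - \<rho> (c t)\<bar> \<le> \<alpha> / 2 * ((e / \<alpha> + norm g') * \<bar>s - t\<bar>)"
          using nd a(1) by (intro mult_left_mono) auto
        also have "\<dots> = (e / 2 + \<alpha> / 2 * norm g') * \<bar>s - t\<bar>" using a(1) by (simp add: field_simps)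
        also have "\<dots> \<le> (speed a b c t + e) * \<bar>s - t\<bar>" using sp e by (intro mult_right_mono) auto
        finally show "\<bar>\<alpha> / 2 * \<rho> (c s) - \<alpha> / 2 * \<rho> (c t)\<bar> \<le> (speed a b c t + e) * \<bar>s - t\<bar>"
          unfolding right_diff_distrib[symmetric] abs_mult using a(1) by simp
      qed (use d1 d2 in auto)
    next
      case False
      then have ct: "c t \<in> - closure V1" using V1(3) by auto
      obtain T where T: "open T" "t \<in> T" "\<forall>s\<in>T \<inter> {a..b}. c s \<in> - closure V1"
        using C1_path_local[OF c t _ ct] by auto
      obtain d1 where d1: "d1 > 0" "\<And>s. \<bar>s - t\<bar> < d1 \<Longrightarrow> s \<in> T"
        using T(1,2) by (auto simp: open_dist dist_real_def)
      show ?thesis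
      proof (intro exI[of _ d1] conjI ballI impI)
        fix s assume s: "s \<in> {a..b}" "\<bar>s - t\<bar> < d1"
        then have "\<rho> (c s) = r" "\<rho> (c t) = r" using far T(3) d1(2)[of s] ct by auto
        then show "\<bar>\<alpha> / 2 * \<rho> (c s) - \<alpha> / 2 * \<rho> (c t)\<bar> \<le> (speed a b c t + e) * \<bar>s - t\<bar>"
          using speed_nonneg[OF c ab t] e by simp
      qed (rule d1)
    qed
  qed (use ab in simp)
  have len: "\<bar>\<alpha> / 2 * \<rho> q - \<alpha> / 2 * \<rho> p\<bar> \<le> l" if "joined p q l" for p q l
    using that
  proof (induction rule: joined.induct)
    case (base a b c) then show ?case by (rule step)
  next
    case (snoc p q l a b c) then show ?case using step[OF snoc.hyps(2,3)] by simp
  qed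
  have "y \<in> W" if d: "fdist x y < \<alpha> / 2 * r" for y
  proof (rule ccontr)
    assume "y \<notin> W"
    then have "\<rho> y = r" using far V1(3) by blast
    moreover have "\<rho> x = 0" using V(2) r(1) by (simp add: \<rho>_def)
    ultimately have "\<alpha> / 2 * r \<le> l" if "joined x y l" for l using len[OF that] by simp
    then show False using fdist_ge[of x y "\<alpha> / 2 * r"] d by auto
  qed
  then show ?thesis using a(1) r(1) by (intro exI[of _ "\<alpha> / 2 * r"]) auto
qed

section \<open>The Finsler distance as a metric inducing the manifold topology\<close>

lemma fdist_eq_0: "fdist x y = 0 \<longleftrightarrow> x = y"
proof
  assume d: "fdist x y = 0"
  show "x = y"
  proof (rule ccontr)
    assume "x \<noteq> y"
    then obtain \<delta> where "\<delta> > 0" "\<forall>z. fdist x z < \<delta> \<longrightarrow> z \<in> - {y}" using fdist_small[of "- {y}" x] by auto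
    then have "y \<in> - {y}" using d by metis
    then show False by simp
  qed
qed (simp add: fdist_refl)

lemma fdist_continuous: "e > 0 \<Longrightarrow> \<exists>W. open W \<and> x \<in> W \<and> (\<forall>y\<in>W. fdist x y < e)"
proof -
  assume e: "e > 0"
  obtain \<kappa> where k: "\<kappa> \<in> \<A>" "x \<in> chart_dom \<kappa>" using chart_exists by blast
  obtain r where r: "r > 0" "\<forall>y\<in>ball (chart_map \<kappa> x) r. \<forall>y'\<in>ball (chart_map \<kappa> x) r.
        fdist (chart_inv \<kappa> y) (chart_inv \<kappa> y') \<le> (1 + 1) * cnorm \<kappa> x (y' - y)"
    using fdist_chart[OF k, of 1] by auto
  obtain b where b: "b > 0" "\<And>v. cnorm \<kappa> x v \<le> b * norm v" using cnorm_equiv[OF k] by blast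
  let ?r = "min r (e / (2 * b))"
  let ?W = "chart_dom \<kappa> \<inter> chart_map \<kappa> -` ball (chart_map \<kappa> x) ?r"
  have "fdist x y < e" if y: "y \<in> ?W" for y
  proof -
    have "fdist (chart_inv \<kappa> (chart_map \<kappa> x)) (chart_inv \<kappa> (chart_map \<kappa> y)) \<le> (1 + 1) * cnorm \<kappa> x (chart_map \<kappa> y - chart_map \<kappa> x)"
      using r y by auto
    also have "\<dots> \<le> (1 + 1) * (b * norm (chart_map \<kappa> y - chart_map \<kappa> x))" using b(2) by (intro mult_left_mono) auto
    also have "\<dots> < (1 + 1) * (b * (e / (2 * b)))" using y b(1) by (intro mult_strict_left_mono) (auto simp: dist_norm norm_minus_commute)
    also have "\<dots> = e" using b(1) by simp
    finally show ?thesis using chart_inv_map[OF k(1)] k(2) y by simp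
  qed
  then show ?thesis using open_chart_preimage[OF k(1) open_ball] r(1) b(1) e k(2) by (intro exI[of _ ?W]) auto
qed

lemma Metric_space_fdist: "Metric_space UNIV fdist"
  by unfold_locales (auto simp: fdist_nonneg fdist_eq_0 fdist_triangle intro: fdist_sym)

lemma tendsto_of_fdist:
  assumes "(\<lambda>n. fdist (\<sigma> n) x) \<longlonglongrightarrow> 0" shows "\<sigma> \<longlonglongrightarrow> x"
proof (rule topological_tendstoI)
  fix W assume "open W" "x \<in> W"
  then obtain \<delta> where d: "\<delta> > 0" "\<forall>y. fdist x y < \<delta> \<longrightarrow> y \<in> W" using fdist_small by blast
  from order_tendstoD(2)[OF assms d(1)] show "\<forall>\<^sub>F n in sequentially. \<sigma> n \<in> W"
    by eventually_elim (use d(2) fdist_sym in metis)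
qed

lemma fdist_complete:
  assumes "Metric_space.mcomplete UNIV fdist" and C: "\<forall>e>0. \<exists>k. \<forall>m\<ge>k. \<forall>n\<ge>m. fdist (\<sigma> m) (\<sigma> n) < e"
  shows "\<exists>x. (\<lambda>n. fdist (\<sigma> n) x) \<longlonglongrightarrow> 0"
proof -
  interpret M: Metric_space UNIV fdist by (rule Metric_space_fdist)
  have "M.MCauchy \<sigma>" unfolding M.MCauchy_def
  proof (intro conjI allI impI)
    fix e :: real assume "e > 0"
    then obtain k where k: "\<forall>m\<ge>k. \<forall>n\<ge>m. fdist (\<sigma> m) (\<sigma> n) < e" using C by blast
    have "fdist (\<sigma> n) (\<sigma> n') < e" if "k \<le> n" "k \<le> n'" for n n'
      using k that by (metis fdist_sym le_cases)
    then show "\<exists>N. \<forall>n n'. N \<le> n \<longrightarrow> N \<le> n' \<longrightarrow> fdist (\<sigma> n) (\<sigma> n') < e" by blast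
  qed simp
  then obtain x where "limitin M.mtopology \<sigma> x sequentially" using assms(1) unfolding M.mcomplete_def by blast
  then have "\<forall>e>0. \<forall>\<^sub>F n in sequentially. fdist (\<sigma> n) x < e" by (simp add: M.limitin_metric)
  then have "(\<lambda>n. fdist (\<sigma> n) x) \<longlonglongrightarrow> 0"
    by (auto simp: tendsto_iff dist_real_def fdist_nonneg)
  then show ?thesis by blast
qed

end

section \<open>Sub- and superdifferentials in charts\<close>

lemma blinfun_pair_split:
  fixes p :: "(real \<times> 'a::real_normed_vector) \<Rightarrow>\<^sub>L real"
  shows "blinfun_apply p (\<sigma>, v) = blinfun_apply p (1, 0) * \<sigma> + blinfun_apply p (0, v)"
proof -
  have "(\<sigma>, v) = \<sigma> *\<^sub>R (1, 0) + (0, v)" by simp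
  then show ?thesis by (simp only: blinfun.add_right blinfun.scaleR_right) simp
qed

lemma abs_blinfun_snd_le:
  fixes p :: "(real \<times> 'a::real_normed_vector) \<Rightarrow>\<^sub>L real"
  shows "\<bar>blinfun_apply p (0, v)\<bar> \<le> norm p * norm v"
  using norm_blinfun[of p "(0, v)"] by (simp add: norm_Pair)

context finsler
begin

text \<open>\<open>codual \<kappa> x p\<close> is the dual norm at \<open>x\<close> of the spatial part of the covector \<open>p\<close>, read in the chart \<open>\<kappa>\<close>.\<close>

definition codual :: "('m, 'x) chart \<Rightarrow> 'm \<Rightarrow> ((real \<times> 'x) \<Rightarrow>\<^sub>L real) \<Rightarrow> real" where
  "codual \<kappa> x p = Sup (insert 0 {\<bar>blinfun_apply p (0, v)\<bar> | v. cnorm \<kappa> x v = 1})"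

context
  fixes \<kappa> x assumes \<kappa>: "\<kappa> \<in> \<A>" and x: "x \<in> chart_dom \<kappa>"
begin

lemma codual_bdd:
  fixes p :: "(real \<times> 'x) \<Rightarrow>\<^sub>L real"
  shows "bdd_above (insert 0 {\<bar>blinfun_apply p (0, v)\<bar> | v. cnorm \<kappa> x v = 1})"
proof -
  obtain a where a: "a > 0" "\<And>v. a * norm v \<le> cnorm \<kappa> x v" using cnorm_equiv[OF \<kappa> x] by blast
  have "\<bar>blinfun_apply p (0, v)\<bar> \<le> norm p * (1 / a)" if "cnorm \<kappa> x v = 1" for v
  proof -
    have "norm v \<le> 1 / a" using a(2)[of v] that a(1) by (simp add: field_simps)
    then show ?thesis using abs_blinfun_snd_le[of p v] by (meson mult_left_mono norm_ge_zero order_trans)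
  qed
  moreover have "0 \<le> norm p * (1 / a)" using a by simp
  ultimately show ?thesis by (intro bdd_aboveI[of _ "norm p * (1 / a)"]) blast
qed

lemma codual_nonneg: "0 \<le> codual \<kappa> x p"
  unfolding codual_def by (rule cSup_upper[OF _ codual_bdd]) simp

lemma codual_bound: "\<bar>blinfun_apply p (0, v)\<bar> \<le> codual \<kappa> x p * cnorm \<kappa> x v"
proof (cases "cnorm \<kappa> x v = 0")
  case True
  obtain a where a: "a > 0" "\<And>v. a * norm v \<le> cnorm \<kappa> x v" using cnorm_equiv[OF \<kappa> x] by blast
  have "v = 0" using a(1) a(2)[of v] True by (simp add: mult_le_0_iff)
  then have "(0, v) = (0 :: real \<times> 'x)" by (simp add: zero_prod_def)
  then show ?thesis using True by (simp add: blinfun.zero_right)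
next
  case False
  then have pos: "cnorm \<kappa> x v > 0" using cnorm_nonneg[OF \<kappa> x, of v] by linarith
  let ?w = "(1 / cnorm \<kappa> x v) *\<^sub>R v"
  have "cnorm \<kappa> x ?w = 1" using cnorm_scaleR[OF \<kappa> x] pos by simp
  then have "\<bar>blinfun_apply p (0, ?w)\<bar> \<le> codual \<kappa> x p"
    unfolding codual_def by (intro cSup_upper[OF _ codual_bdd]) blast
  moreover have "(0, ?w) = (1 / cnorm \<kappa> x v) *\<^sub>R (0 :: real, v)" by simp
  then have "blinfun_apply p (0, ?w) = (1 / cnorm \<kappa> x v) * blinfun_apply p (0, v)"
    by (simp only: blinfun.scaleR_right) simp
  ultimately show ?thesis using pos by (simp add: abs_mult field_simps)
qed

lemma codual_le:
  assumes "0 \<le> c" "\<And>v. \<bar>blinfun_apply p (0, v)\<bar> \<le> c * cnorm \<kappa> x v" shows "codual \<kappa> x p \<le> c"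
  unfolding codual_def
proof (rule cSup_least)
  fix z assume "z \<in> insert 0 {\<bar>blinfun_apply p (0, v)\<bar> | v. cnorm \<kappa> x v = 1}"
  then consider "z = 0" | v where "z = \<bar>blinfun_apply p (0, v)\<bar>" "cnorm \<kappa> x v = 1" by blast
  then show "z \<le> c" using assms by cases (auto, metis mult.right_neutral)
qed simp

lemma codual_minus: "codual \<kappa> x (- p) = codual \<kappa> x p"
  by (simp add: codual_def uminus_blinfun.rep_eq)

lemma codual_triangle: 
  assumes "\<And>v. \<bar>blinfun_apply (p - q) (0, v)\<bar> \<le> e * cnorm \<kappa> x v" "0 \<le> e"
  shows "codual \<kappa> x p \<le> codual \<kappa> x q + e"
proof (rule codual_le)
  show "0 \<le> codual \<kappa> x q + e" using codual_nonneg assms(2) by simp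
  fix v
  have "blinfun_apply p (0, v) = blinfun_apply q (0, v) + blinfun_apply (p - q) (0, v)" by (simp add: minus_blinfun.rep_eq)
  then show "\<bar>blinfun_apply p (0, v)\<bar> \<le> (codual \<kappa> x q + e) * cnorm \<kappa> x v"
    using codual_bound[of q v] assms(1)[of v] by (simp add: distrib_right)
qed

lemma dual_norm_codual:
  assumes "\<And>v. \<Delta> (from_chart \<A> \<kappa> x v) = blinfun_apply p (0, v)"
  shows "dual_norm \<A> N x \<Delta> = codual \<kappa> x p"
proof -
  have "{\<bar>\<Delta> V\<bar> | V. V \<in> tangent_space \<A> x \<and> N x V = 1} = {\<bar>blinfun_apply p (0, v)\<bar> | v. cnorm \<kappa> x v = 1}"
  proof (intro equalityI subsetI)
    fix z assume "z \<in> {\<bar>\<Delta> V\<bar> | V. V \<in> tangent_space \<A> x \<and> N x V = 1}"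
    then obtain V where V: "z = \<bar>\<Delta> V\<bar>" "V \<in> tangent_space \<A> x" "N x V = 1" by blast
    have "from_chart \<A> \<kappa> x (V \<kappa>) = V" by (rule tangent_from_chart[OF V(2) \<kappa> x])
    then have "z = \<bar>blinfun_apply p (0, V \<kappa>)\<bar> \<and> cnorm \<kappa> x (V \<kappa>) = 1" using V assms[of "V \<kappa>"] by (simp add: cnorm_def)
    then show "z \<in> {\<bar>blinfun_apply p (0, v)\<bar> | v. cnorm \<kappa> x v = 1}" by blast
  next
    fix z assume "z \<in> {\<bar>blinfun_apply p (0, v)\<bar> | v. cnorm \<kappa> x v = 1}"
    then obtain v where "z = \<bar>blinfun_apply p (0, v)\<bar>" "cnorm \<kappa> x v = 1" by blast
    then have "z = \<bar>\<Delta> (from_chart \<A> \<kappa> x v)\<bar> \<and> from_chart \<A> \<kappa> x v \<in> tangent_space \<A> x \<and> N x (from_chart \<A> \<kappa> x v) = 1"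
      using assms from_chart_tangent[OF \<kappa> x] by (simp add: cnorm_def)
    then show "z \<in> {\<bar>\<Delta> V\<bar> | V. V \<in> tangent_space \<A> x \<and> N x V = 1}" by blast
  qed
  then show ?thesis by (simp add: dual_norm_def codual_def)
qed

end

text \<open>Joint continuity of the dual norm in the point and the covector. Moving the point is
  controlled by the factor 1 + \<epsilon> of (P2); moving the covector is controlled by its operator
  norm, through the lower constant \<open>a\<close> of the chart norm.\<close>

lemma codual_near:
  assumes \<kappa>: "\<kappa> \<in> \<A>" and x: "x \<in> chart_dom \<kappa>" and e: "e > 0"
  shows "\<exists>\<delta>>0. \<forall>y p. norm (y - chart_map \<kappa> x) < \<delta> \<longrightarrow> norm (p - p0) < \<delta> \<longrightarrow>
     y \<in> chart_map \<kappa> ` chart_dom \<kappa> \<and> \<bar>codual \<kappa> (chart_inv \<kappa> y) p - codual \<kappa> x p0\<bar> < e"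
proof -
  let ?c = "codual \<kappa> x p0"
  \<comment> \<open>Both one-sided estimates below have an error of at most \<epsilon> (2 c + 4),
    with \<open>c\<close> the dual norm at the base point, as soon as \<epsilon> is at most
    1.\<close>
  define m where "m = 2 * ?c + 4"
  define \<epsilon> where "\<epsilon> = min 1 (e / (2 * m))"
  have c0: "0 \<le> ?c" by (rule codual_nonneg[OF \<kappa> x])
  have m: "m > 0" using c0 by (simp add: m_def)
  have \<epsilon>: "\<epsilon> > 0" "\<epsilon> \<le> 1" using e m by (auto simp: \<epsilon>_def)
  have "\<epsilon> * m \<le> e / (2 * m) * m" using m by (intro mult_right_mono) (auto simp: \<epsilon>_def)
  also have "\<dots> = e / 2" using m by simp
  finally have \<epsilon>e: "\<epsilon> * (2 * ?c + 4) < e" using e unfolding m_def by linarith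
  obtain a where a: "a > 0" "\<And>v. a * norm v \<le> cnorm \<kappa> x v" using cnorm_equiv[OF \<kappa> x] by blast
  obtain W where W: "open W" "x \<in> W" "\<And>y v. y \<in> W \<Longrightarrow> cnorm \<kappa> x v \<le> (1 + \<epsilon>) * cnorm \<kappa> y v \<and> cnorm \<kappa> y v \<le> (1 + \<epsilon>) * cnorm \<kappa> x v"
    using cnorm_compare[OF \<kappa> x \<epsilon>(1)] by blast
  obtain r where r: "r > 0" "ball (chart_map \<kappa> x) r \<subseteq> chart_map \<kappa> ` chart_dom \<kappa>"
    "\<forall>y\<in>ball (chart_map \<kappa> x) r. chart_inv \<kappa> y \<in> W" using chart_ball_in[OF \<kappa> x W(1,2)] by blast
  show ?thesis
  proof (intro exI[of _ "min r (\<epsilon> * a)"] conjI allI impI)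
    fix y p assume y: "norm (y - chart_map \<kappa> x) < min r (\<epsilon> * a)" and p: "norm (p - p0) < min r (\<epsilon> * a)"
    have yb: "y \<in> ball (chart_map \<kappa> x) r" using y by (simp add: dist_norm norm_minus_commute)
    then show yi: "y \<in> chart_map \<kappa> ` chart_dom \<kappa>" using r(2) by blast
    let ?z = "chart_inv \<kappa> y"
    let ?c' = "codual \<kappa> ?z p"
    have z: "?z \<in> W" "?z \<in> chart_dom \<kappa>" using r(3) yb chart_inv_dom[OF \<kappa> yi] by auto
    have diff: "\<bar>blinfun_apply p (0, v) - blinfun_apply p0 (0, v)\<bar> \<le> \<epsilon> * cnorm \<kappa> x v" for v
    proof -
      have "\<bar>blinfun_apply p (0, v) - blinfun_apply p0 (0, v)\<bar> \<le> norm (p - p0) * norm v"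
        using abs_blinfun_snd_le[of "p - p0" v] by (simp add: minus_blinfun.rep_eq)
      also have "\<dots> \<le> (\<epsilon> * a) * norm v" using p by (intro mult_right_mono) auto
      also have "\<dots> \<le> \<epsilon> * cnorm \<kappa> x v" using a(2)[of v] \<epsilon>(1) by (simp add: mult.assoc)
      finally show ?thesis .
    qed
    have c'0: "0 \<le> ?c'" by (rule codual_nonneg[OF \<kappa> z(2)])
    have le1: "?c' \<le> (?c + \<epsilon>) * (1 + \<epsilon>)"
    proof (rule codual_le[OF \<kappa> z(2)])
      show "0 \<le> (?c + \<epsilon>) * (1 + \<epsilon>)" using c0 \<epsilon> by simp
      fix v
      have "\<bar>blinfun_apply p (0, v)\<bar> \<le> (?c + \<epsilon>) * cnorm \<kappa> x v"
        using diff[of v] codual_bound[OF \<kappa> x, of p0 v] by (simp add: distrib_right)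
      also have "\<dots> \<le> (?c + \<epsilon>) * ((1 + \<epsilon>) * cnorm \<kappa> ?z v)" using W(3)[OF z(1)] c0 \<epsilon> by (intro mult_left_mono) auto
      finally show "\<bar>blinfun_apply p (0, v)\<bar> \<le> (?c + \<epsilon>) * (1 + \<epsilon>) * cnorm \<kappa> ?z v" by (simp only: mult.assoc)
    qed
    have le2: "?c \<le> ?c' * (1 + \<epsilon>) + \<epsilon>"
    proof (rule codual_le[OF \<kappa> x])
      show "0 \<le> ?c' * (1 + \<epsilon>) + \<epsilon>" using c'0 \<epsilon> by simp
      fix v
      have "?c' * cnorm \<kappa> ?z v \<le> ?c' * ((1 + \<epsilon>) * cnorm \<kappa> x v)" using W(3)[OF z(1)] c'0 by (intro mult_left_mono) auto
      then show "\<bar>blinfun_apply p0 (0, v)\<bar> \<le> (?c' * (1 + \<epsilon>) + \<epsilon>) * cnorm \<kappa> x v"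
        using diff[of v] codual_bound[OF \<kappa> z(2), of p v] by (simp add: distrib_right mult.assoc)
    qed
    have "?c' \<le> ?c + \<epsilon> * (?c + 1 + \<epsilon>)" using le1 by (simp add: algebra_simps)
    moreover have "\<epsilon> * (?c + 1 + \<epsilon>) \<le> \<epsilon> * (2 * ?c + 4)" using \<epsilon> c0 by (intro mult_left_mono) auto
    ultimately have u1: "?c' - ?c < e" using \<epsilon>e by linarith
    have "(?c + \<epsilon>) * (1 + \<epsilon>) \<le> (?c + 1) * 2" using \<epsilon> c0 by (intro mult_mono) auto
    then have "\<epsilon> * ?c' \<le> \<epsilon> * (2 * ?c + 2)" using le1 \<epsilon>(1) by (intro mult_left_mono) auto
    moreover have "\<epsilon> * (2 * ?c + 4) = \<epsilon> * (2 * ?c + 2) + 2 * \<epsilon>" by (simp add: algebra_simps)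
    moreover have "?c \<le> ?c' + \<epsilon> * ?c' + \<epsilon>" using le2 by (simp add: algebra_simps)
    ultimately have "?c - ?c' < e" using \<epsilon>e \<epsilon>(1) by linarith
    then show "\<bar>?c' - ?c\<bar> < e" using u1 by (simp add: abs_less_iff)
  qed (use r a \<epsilon> in auto)
qed

section \<open>Transport of neighbourhoods and functions between space-time and a chart\<close>

lemma tendsto_chart_map:
  assumes \<kappa>: "\<kappa> \<in> \<A>" and x: "x \<in> chart_dom \<kappa>"
  shows "(chart_map \<kappa> \<longlongrightarrow> chart_map \<kappa> x) (nhds x)" "(chart_inv \<kappa> \<longlongrightarrow> x) (nhds (chart_map \<kappa> x))"
proof -
  have "isCont (chart_map \<kappa>) x"
    using chart_cont(1)[OF \<kappa>] chart_open(1)[OF \<kappa>] x by (simp add: continuous_on_eq_continuous_at)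
  then show "(chart_map \<kappa> \<longlongrightarrow> chart_map \<kappa> x) (nhds x)" by (simp add: isCont_def tendsto_at_iff_tendsto_nhds)
  have "isCont (chart_inv \<kappa>) (chart_map \<kappa> x)"
    using chart_cont(2)[OF \<kappa>] chart_open(2)[OF \<kappa>] x by (simp add: continuous_on_eq_continuous_at)
  then have "(chart_inv \<kappa> \<longlongrightarrow> chart_inv \<kappa> (chart_map \<kappa> x)) (nhds (chart_map \<kappa> x))"
    by (simp add: isCont_def tendsto_at_iff_tendsto_nhds)
  then show "(chart_inv \<kappa> \<longlongrightarrow> x) (nhds (chart_map \<kappa> x))" using chart_inv_map[OF \<kappa> x] by simp
qed

lemma tendsto_spacetime_chart:
  assumes \<kappa>: "\<kappa> \<in> \<A>" and x: "x \<in> chart_dom \<kappa>"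
  shows "((\<lambda>q. (fst q, chart_map \<kappa> (snd q))) \<longlongrightarrow> (t, chart_map \<kappa> x)) (nhds (t :: real, x))"
    "((\<lambda>y. (fst y, chart_inv \<kappa> (snd y))) \<longlongrightarrow> (t, x)) (nhds (t :: real, chart_map \<kappa> x))"
proof -
  have f: "filterlim fst (nhds t) (nhds (t, y))" "filterlim snd (nhds y) (nhds (t, y))" for y :: "'z::topological_space"
    using tendsto_fst[OF filterlim_ident] tendsto_snd[OF filterlim_ident] by fastforce+
  have g: "filterlim fst (nhds t) (nhds (t, y))" "filterlim snd (nhds y) (nhds (t, y))" for y :: 'x
    using tendsto_fst[OF filterlim_ident] tendsto_snd[OF filterlim_ident] by fastforce+
  show "((\<lambda>q. (fst q, chart_map \<kappa> (snd q))) \<longlongrightarrow> (t, chart_map \<kappa> x)) (nhds (t, x))"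
    by (intro tendsto_Pair f filterlim_compose[OF tendsto_chart_map(1)[OF \<kappa> x] f(2)])
  show "((\<lambda>y. (fst y, chart_inv \<kappa> (snd y))) \<longlongrightarrow> (t, x)) (nhds (t, chart_map \<kappa> x))"
    by (intro tendsto_Pair g filterlim_compose[OF tendsto_chart_map(2)[OF \<kappa> x] g(2)])
qed

lemma eventually_spacetime_chart_dom:
  assumes \<kappa>: "\<kappa> \<in> \<A>" and x: "x \<in> chart_dom \<kappa>"
  shows "\<forall>\<^sub>F q in nhds (t :: real, x). snd q \<in> chart_dom \<kappa>"
    and "\<forall>\<^sub>F y in nhds (t :: real, chart_map \<kappa> x). snd y \<in> chart_map \<kappa> ` chart_dom \<kappa>"
proof -
  have "open (UNIV \<times> chart_dom \<kappa>)" "open (UNIV \<times> chart_map \<kappa> ` chart_dom \<kappa>)" using chart_open[OF \<kappa>] by (auto intro: open_Times)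
  then show "\<forall>\<^sub>F q in nhds (t :: real, x). snd q \<in> chart_dom \<kappa>"
    "\<forall>\<^sub>F y in nhds (t :: real, chart_map \<kappa> x). snd y \<in> chart_map \<kappa> ` chart_dom \<kappa>"
    unfolding eventually_nhds using x by (force intro!: exI[of _ "UNIV \<times> _"])+
qed

lemma eventually_chart_iff:
  assumes \<kappa>: "\<kappa> \<in> \<A>" and x: "x \<in> chart_dom \<kappa>"
  shows "(\<forall>\<^sub>F q in nhds (t :: real, x). P q) \<longleftrightarrow> (\<forall>\<^sub>F y in nhds (t, chart_map \<kappa> x). P (fst y, chart_inv \<kappa> (snd y)))"
proof
  assume "\<forall>\<^sub>F q in nhds (t, x). P q"
  then show "\<forall>\<^sub>F y in nhds (t, chart_map \<kappa> x). P (fst y, chart_inv \<kappa> (snd y))"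
    using tendsto_spacetime_chart(2)[OF \<kappa> x] by (rule eventually_compose_filterlim)
next
  assume "\<forall>\<^sub>F y in nhds (t, chart_map \<kappa> x). P (fst y, chart_inv \<kappa> (snd y))"
  from eventually_compose_filterlim[OF this tendsto_spacetime_chart(1)[OF \<kappa> x]]
    eventually_spacetime_chart_dom(1)[OF \<kappa> x]
  show "\<forall>\<^sub>F q in nhds (t, x). P q" by eventually_elim (use chart_inv_map[OF \<kappa>] in simp)
qed

lemma open_chart_box:
  assumes \<kappa>: "\<kappa> \<in> \<A>" and B: "open B"
  shows "open {q :: real \<times> 'm. snd q \<in> chart_dom \<kappa> \<and> (fst q, chart_map \<kappa> (snd q)) \<in> B}"
proof -
  have "continuous_on (UNIV \<times> chart_dom \<kappa>) (\<lambda>q :: real \<times> 'm. (fst q, chart_map \<kappa> (snd q)))"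
    by (intro continuous_intros continuous_on_compose2[OF chart_cont(1)[OF \<kappa>]]) auto
  then have "open ((UNIV \<times> chart_dom \<kappa>) \<inter> (\<lambda>q :: real \<times> 'm. (fst q, chart_map \<kappa> (snd q))) -` B)"
    by (rule continuous_open_preimage) (use chart_open[OF \<kappa>] B in \<open>auto intro: open_Times\<close>)
  moreover have "(UNIV \<times> chart_dom \<kappa>) \<inter> (\<lambda>q :: real \<times> 'm. (fst q, chart_map \<kappa> (snd q))) -` B =
    {q. snd q \<in> chart_dom \<kappa> \<and> (fst q, chart_map \<kappa> (snd q)) \<in> B}" by auto
  ultimately show ?thesis by simp
qed

text \<open>Closed in the whole of space-time and not merely in the domain of the chart, which is
  where the closed chart balls obtained from regularity enter.\<close>

lemma closed_chart_box:
  assumes \<kappa>: "\<kappa> \<in> \<A>" and r: "cball y r \<subseteq> chart_map \<kappa> ` chart_dom \<kappa>" and cl: "closed (chart_inv \<kappa> ` cball y r)"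
    and y0: "snd y0 = y"
  shows "closed {q :: real \<times> 'm. snd q \<in> chart_dom \<kappa> \<and> (fst q, chart_map \<kappa> (snd q)) \<in> cball y0 r}"
proof -
  let ?K = "chart_inv \<kappa> ` cball y r"
  have K: "?K \<subseteq> chart_dom \<kappa>" using chart_inv_dom[OF \<kappa>] r by auto
  have "continuous_on (UNIV \<times> ?K) (\<lambda>q :: real \<times> 'm. (fst q, chart_map \<kappa> (snd q)))"
    by (intro continuous_intros continuous_on_compose2[OF chart_cont(1)[OF \<kappa>]]) (use K in auto)
  then have "closed ((UNIV \<times> ?K) \<inter> (\<lambda>q :: real \<times> 'm. (fst q, chart_map \<kappa> (snd q))) -` cball y0 r)"
    by (rule continuous_closed_preimage) (use cl in \<open>auto intro: closed_Times\<close>)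
  moreover have "(UNIV \<times> ?K) \<inter> (\<lambda>q :: real \<times> 'm. (fst q, chart_map \<kappa> (snd q))) -` cball y0 r =
    {q. snd q \<in> chart_dom \<kappa> \<and> (fst q, chart_map \<kappa> (snd q)) \<in> cball y0 r}"
  proof -
    have "snd q \<in> ?K" if "snd q \<in> chart_dom \<kappa>" "(fst q, chart_map \<kappa> (snd q)) \<in> cball y0 r" for q
    proof -
      have "chart_map \<kappa> (snd q) \<in> cball y r"
        using that(2) y0 dist_snd_le[of y0 "(fst q, chart_map \<kappa> (snd q))"] by auto
      then show ?thesis using chart_inv_image[OF \<kappa> r] that(1) by auto
    qed
    then show ?thesis using K by auto
  qed
  ultimately show ?thesis by simp
qed

lemma transition_spacetime_C1:
  assumes \<kappa>: "\<kappa> \<in> \<A>" and \<kappa>': "\<kappa>' \<in> \<A>"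
  shows "\<exists>T. C1d (UNIV \<times> chart_map \<kappa>' ` (chart_dom \<kappa>' \<inter> chart_dom \<kappa>))
       (\<lambda>w :: real \<times> 'x. (fst w, transition \<kappa>' \<kappa> (snd w))) T \<and>
     (\<forall>w. \<forall>x\<in>chart_dom \<kappa>' \<inter> chart_dom \<kappa>. snd w = chart_map \<kappa>' x \<longrightarrow>
        (\<forall>\<sigma> v. blinfun_apply (T w) (\<sigma>, v) = (\<sigma>, from_chart \<A> \<kappa>' x v \<kappa>)))"
proof -
  let ?S = "chart_map \<kappa>' ` (chart_dom \<kappa>' \<inter> chart_dom \<kappa>)"
  obtain T where T: "C1d ?S (transition \<kappa>' \<kappa>) T"
      "\<And>x v. x\<in>chart_dom \<kappa>' \<inter> chart_dom \<kappa> \<Longrightarrow> blinfun_apply (T (chart_map \<kappa>' x)) v = from_chart \<A> \<kappa>' x v \<kappa>"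
    using transition_C1[OF \<kappa>' \<kappa>] by blast
  define J1 where "J1 = (Blinfun (\<lambda>v. (v, 0)) :: real \<Rightarrow>\<^sub>L (real \<times> 'x))"
  define J2 where "J2 = (Blinfun (\<lambda>v. (0, v)) :: 'x \<Rightarrow>\<^sub>L (real \<times> 'x))"
  have J: "blinfun_apply J1 a = (a, 0)" "blinfun_apply J2 v = (0, v)" for a v
    by (auto simp: J1_def J2_def bounded_linear_Blinfun_apply bounded_linear_Pair bounded_linear_zero bounded_linear_ident)
  have fs: "blinfun_apply (Blinfun fst :: (real \<times> 'x) \<Rightarrow>\<^sub>L real) w = fst w" "blinfun_apply (Blinfun snd :: (real \<times> 'x) \<Rightarrow>\<^sub>L 'x) w = snd w" for w
    by (simp_all add: bounded_linear_Blinfun_apply bounded_linear_fst bounded_linear_snd)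
  have f1: "C1d S (\<lambda>w :: real \<times> 'x. fst w) (\<lambda>w. Blinfun fst)" and f2: "C1d S (\<lambda>w :: real \<times> 'x. snd w) (\<lambda>w. Blinfun snd)" for S
    using C1d_blinfun_affine[of S 0 "Blinfun fst" 0] C1d_blinfun_affine[of S 0 "Blinfun snd" 0] by (simp_all add: fs)
  have j1: "C1d S (\<lambda>a. (a, 0 :: 'x)) (\<lambda>a. J1)" and j2: "C1d S' (\<lambda>v. (0 :: real, v)) (\<lambda>v. J2)" for S S'
    using C1d_blinfun_affine[of S 0 J1 0] C1d_blinfun_affine[of S' 0 J2 0] by (simp_all add: J)
  have a: "C1d (UNIV \<times> ?S) (\<lambda>w. (fst w, 0 :: 'x)) (\<lambda>w. J1 o\<^sub>L Blinfun fst)"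
    using C1d_compose[OF j1[of UNIV] f1[of "UNIV \<times> ?S"]] by simp
  have b: "C1d (UNIV \<times> ?S) (\<lambda>w :: real \<times> 'x. transition \<kappa>' \<kappa> (snd w)) (\<lambda>w. T (snd w) o\<^sub>L Blinfun snd)"
    by (rule C1d_compose[OF T(1) f2]) auto
  have c: "C1d (UNIV \<times> ?S) (\<lambda>w :: real \<times> 'x. (0 :: real, transition \<kappa>' \<kappa> (snd w))) (\<lambda>w. J2 o\<^sub>L (T (snd w) o\<^sub>L Blinfun snd))"
    using C1d_compose[OF j2[of UNIV] b] by simp
  have "C1d (UNIV \<times> ?S) (\<lambda>w. (fst w, transition \<kappa>' \<kappa> (snd w))) (\<lambda>w. (J1 o\<^sub>L Blinfun fst) + (J2 o\<^sub>L (T (snd w) o\<^sub>L Blinfun snd)))"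
    using C1d_add[OF a c] by simp
  moreover have "blinfun_apply ((J1 o\<^sub>L Blinfun fst) + (J2 o\<^sub>L (T (snd w) o\<^sub>L Blinfun snd))) (\<sigma>, v) = (\<sigma>, from_chart \<A> \<kappa>' x v \<kappa>)"
    if "x\<in>chart_dom \<kappa>' \<inter> chart_dom \<kappa>" "snd w = chart_map \<kappa>' x" for w :: "real \<times> 'x" and x \<sigma> v
    using T(2)[OF that(1)] that(2) by (simp add: plus_blinfun.rep_eq J fs)
  ultimately show ?thesis by (intro exI[of _ "\<lambda>w. (J1 o\<^sub>L Blinfun fst) + (J2 o\<^sub>L (T (snd w) o\<^sub>L Blinfun snd))"] conjI allI ballI impI)
qed

lemma represents_differential_chart:
  assumes \<kappa>: "\<kappa> \<in> \<A>" and x: "x \<in> chart_dom \<kappa>" and t: "t > 0"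
    and G: "C1_test_function \<A> G" and rep: "represents_differential \<A> G t x \<alpha> \<Delta>"
  shows "\<exists>g'. C1d ({0<..} \<times> chart_map \<kappa> ` chart_dom \<kappa>) (local_rep \<kappa> G) g' \<and>
     blinfun_apply (g' (t, chart_map \<kappa> x)) (1, 0) = \<alpha> \<and> dual_norm \<A> N x \<Delta> = codual \<kappa> x (g' (t, chart_map \<kappa> x))"
proof -
  obtain g' where g': "C1d ({0<..} \<times> chart_map \<kappa> ` chart_dom \<kappa>) (local_rep \<kappa> G) g'"
    using G \<kappa> unfolding C1_test_function_def C1_on_iff_C1d by blast
  have "(local_rep \<kappa> G has_derivative (\<lambda>(\<sigma>, v). \<alpha> * \<sigma> + \<Delta> (from_chart \<A> \<kappa> x v))) (at (t, chart_map \<kappa> x))"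
    using rep \<kappa> x unfolding represents_differential_def by blast
  then have eq: "blinfun_apply (g' (t, chart_map \<kappa> x)) = (\<lambda>(\<sigma>, v). \<alpha> * \<sigma> + \<Delta> (from_chart \<A> \<kappa> x v))"
    using has_derivative_unique[OF C1d_derivD[OF g', of "(t, chart_map \<kappa> x)"]] x t by blast
  have "bounded_linear (\<lambda>v. \<Delta> (from_chart \<A> \<kappa> x v))"
    using rep \<kappa> x unfolding represents_differential_def cotangent_space_def by blast
  then have "\<Delta> (from_chart \<A> \<kappa> x 0) = 0" by (rule linear_simps(3))
  then show ?thesis using g' eq dual_norm_codual[OF \<kappa> x, of \<Delta> "g' (t, chart_map \<kappa> x)"] by (intro exI[of _ g']) auto
qed

lemma local_rep_chart: "\<kappa> \<in> \<A> \<Longrightarrow> x \<in> chart_dom \<kappa> \<Longrightarrow> local_rep \<kappa> u (t, chart_map \<kappa> x) = u (t, x)"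
  by (simp add: local_rep_def chart_inv_map)

lemma local_rep_pair: "local_rep \<kappa> u y = u (fst y, chart_inv \<kappa> (snd y))"
  by (simp add: local_rep_def case_prod_unfold)

text \<open>Continuity of the left-hand side of the equation in the chart point and the covector
  together, since the variational principle moves both the contact point and the gradient.\<close>

lemma tendsto_hamiltonian:
  fixes H :: "real \<Rightarrow> 'm \<Rightarrow> real \<Rightarrow> real"
  assumes H: "continuous_on ({0..} \<times> UNIV \<times> UNIV) (\<lambda>(t, x, r). H t x r)"
    and \<kappa>: "\<kappa> \<in> \<A>" and x: "x \<in> chart_dom \<kappa>" and t: "t > 0"
  shows "((\<lambda>(y, p). blinfun_apply p (1, 0) + H (fst y) (chart_inv \<kappa> (snd y)) (codual \<kappa> (chart_inv \<kappa> (snd y)) p))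
     \<longlongrightarrow> blinfun_apply p\<^sub>0 (1, 0) + H t x (codual \<kappa> x p\<^sub>0)) (nhds ((t, chart_map \<kappa> x), p\<^sub>0))"
proof -
  let ?F = "nhds ((t, chart_map \<kappa> x), p\<^sub>0)"
  have f: "((\<lambda>w. fst w) \<longlongrightarrow> (t, chart_map \<kappa> x)) ?F" and s: "((\<lambda>w. snd w) \<longlongrightarrow> p\<^sub>0) ?F"
    using tendsto_fst[OF filterlim_ident[of ?F]] tendsto_snd[OF filterlim_ident[of ?F]] by auto
  have f1: "((\<lambda>w. fst (fst w)) \<longlongrightarrow> t) ?F" and f2: "((\<lambda>w. snd (fst w)) \<longlongrightarrow> chart_map \<kappa> x) ?F"
    using tendsto_fst[OF f] tendsto_snd[OF f] by auto
  have inv: "((\<lambda>w. chart_inv \<kappa> (snd (fst w))) \<longlongrightarrow> x) ?F" by (rule filterlim_compose[OF tendsto_chart_map(2)[OF \<kappa> x] f2])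
  have cd: "((\<lambda>w. codual \<kappa> (chart_inv \<kappa> (snd (fst w))) (snd w)) \<longlongrightarrow> codual \<kappa> x p\<^sub>0) ?F"
  proof (rule tendstoI)
    fix e :: real assume "e > 0"
    then obtain \<delta> where \<delta>: "\<delta> > 0" "\<And>y p. norm (y - chart_map \<kappa> x) < \<delta> \<Longrightarrow> norm (p - p\<^sub>0) < \<delta> \<Longrightarrow>
      \<bar>codual \<kappa> (chart_inv \<kappa> y) p - codual \<kappa> x p\<^sub>0\<bar> < e" using codual_near[OF \<kappa> x] by blast
    from tendstoD[OF f2 \<delta>(1)] tendstoD[OF s \<delta>(1)]
    show "\<forall>\<^sub>F w in ?F. dist (codual \<kappa> (chart_inv \<kappa> (snd (fst w))) (snd w)) (codual \<kappa> x p\<^sub>0) < e"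
      by eventually_elim (simp add: dist_norm \<delta>(2))
  qed
  have "((\<lambda>w. (\<lambda>(t, x, r). H t x r) (fst (fst w), chart_inv \<kappa> (snd (fst w)), codual \<kappa> (chart_inv \<kappa> (snd (fst w))) (snd w)))
     \<longlongrightarrow> (\<lambda>(t, x, r). H t x r) (t, x, codual \<kappa> x p\<^sub>0)) ?F"
  proof (rule continuous_on_tendsto_compose[OF H])
    show "((\<lambda>w. (fst (fst w), chart_inv \<kappa> (snd (fst w)), codual \<kappa> (chart_inv \<kappa> (snd (fst w))) (snd w))) \<longlongrightarrow> (t, x, codual \<kappa> x p\<^sub>0)) ?F"
      by (intro tendsto_Pair f1 inv cd)
    show "\<forall>\<^sub>F w in ?F. (fst (fst w), chart_inv \<kappa> (snd (fst w)), codual \<kappa> (chart_inv \<kappa> (snd (fst w))) (snd w)) \<in> {0..} \<times> UNIV \<times> UNIV"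
      using order_tendstoD(1)[OF f1 t] by eventually_elim auto
  qed (use t in auto)
  moreover have "((\<lambda>w. blinfun_apply (snd w) (1, 0)) \<longlongrightarrow> blinfun_apply p\<^sub>0 (1, 0)) ?F" by (intro tendsto_intros s)
  ultimately show ?thesis unfolding case_prod_unfold fst_conv snd_conv by (intro tendsto_add)
qed

text \<open>In contrast to \<open>codual_near\<close>, the error is relative to the size of the
  covector and hence uniform over bounded sets of covectors. The comparison needs this because the
  radius is fixed before the gradients are found.\<close>

lemma codual_compare:
  assumes \<kappa>: "\<kappa> \<in> \<A>" and x: "x \<in> chart_dom \<kappa>" "y \<in> chart_dom \<kappa>" and \<epsilon>: "0 < \<epsilon>" "\<epsilon> \<le> 1"
    and cmp: "\<And>v. cnorm \<kappa> x v \<le> (1 + \<epsilon>) * cnorm \<kappa> y v \<and> cnorm \<kappa> y v \<le> (1 + \<epsilon>) * cnorm \<kappa> x v"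
  shows "\<bar>codual \<kappa> y a - codual \<kappa> x a\<bar> \<le> 2 * \<epsilon> * codual \<kappa> x a"
proof -
  note n = codual_nonneg[OF \<kappa> x(1), of a] codual_nonneg[OF \<kappa> x(2), of a]
  have 1: "codual \<kappa> y a \<le> codual \<kappa> x a * (1 + \<epsilon>)"
  proof (rule codual_le[OF \<kappa> x(2)])
    fix v
    have "codual \<kappa> x a * cnorm \<kappa> x v \<le> codual \<kappa> x a * ((1 + \<epsilon>) * cnorm \<kappa> y v)" using cmp n by (intro mult_left_mono) auto
    then show "\<bar>blinfun_apply a (0, v)\<bar> \<le> codual \<kappa> x a * (1 + \<epsilon>) * cnorm \<kappa> y v"
      using codual_bound[OF \<kappa> x(1), of a v] by (simp add: mult.assoc)
  qed (use n \<epsilon> in simp)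
  have 2: "codual \<kappa> x a \<le> codual \<kappa> y a * (1 + \<epsilon>)"
  proof (rule codual_le[OF \<kappa> x(1)])
    fix v
    have "codual \<kappa> y a * cnorm \<kappa> y v \<le> codual \<kappa> y a * ((1 + \<epsilon>) * cnorm \<kappa> x v)" using cmp n by (intro mult_left_mono) auto
    then show "\<bar>blinfun_apply a (0, v)\<bar> \<le> codual \<kappa> y a * (1 + \<epsilon>) * cnorm \<kappa> x v"
      using codual_bound[OF \<kappa> x(2), of a v] by (simp add: mult.assoc)
  qed (use n \<epsilon> in simp)
  have "codual \<kappa> x a * (1 + \<epsilon>) \<le> codual \<kappa> x a * 2" using \<epsilon> n by (intro mult_left_mono) auto
  then have "\<epsilon> * codual \<kappa> y a \<le> \<epsilon> * (2 * codual \<kappa> x a)" using 1 \<epsilon>(1) by (intro mult_left_mono) auto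
  moreover have "0 \<le> \<epsilon> * codual \<kappa> x a" using \<epsilon>(1) n by simp
  ultimately show ?thesis using 1 2 by (simp add: abs_le_iff algebra_simps)
qed

lemma lsc_local_rep:
  assumes \<kappa>: "\<kappa> \<in> \<A>" and u: "lsc_on spacetime u"
  shows "lsc_on ({0..} \<times> chart_map \<kappa> ` chart_dom \<kappa>) (local_rep \<kappa> u)"
proof (rule lsc_onI_nhds)
  fix y c assume y: "y \<in> {0..} \<times> chart_map \<kappa> ` chart_dom \<kappa>" and c: "c < local_rep \<kappa> u y"
  obtain x where x: "x \<in> chart_dom \<kappa>" "y = (fst y, chart_map \<kappa> x)" using y by (metis imageE mem_Times_iff prod.collapse)
  have "c < u (fst y, x)" using c x local_rep_chart[OF \<kappa> x(1), of u "fst y"] by simp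
  then have "\<forall>\<^sub>F q in nhds (fst y, x). q \<in> spacetime \<longrightarrow> c < u q"
    using y by (intro lsc_on_nhds[OF u]) auto
  from eventually_compose_filterlim[OF this tendsto_spacetime_chart(2)[OF \<kappa> x(1)]]
  have "\<forall>\<^sub>F z in nhds (fst y, chart_map \<kappa> x). z \<in> {0..} \<times> chart_map \<kappa> ` chart_dom \<kappa> \<longrightarrow> c < local_rep \<kappa> u z"
    by eventually_elim (auto simp: local_rep_pair)
  then show "\<forall>\<^sub>F z in nhds y. z \<in> {0..} \<times> chart_map \<kappa> ` chart_dom \<kappa> \<longrightarrow> c < local_rep \<kappa> u z"
    using x(2) by simp
qed

lemma chart_cball:
  assumes \<kappa>: "\<kappa> \<in> \<A>" and x: "x \<in> chart_dom \<kappa>" and t: "(t :: real) > 0" and S: "open S" "(t, chart_map \<kappa> x) \<in> S"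
  shows "\<exists>r>0. \<forall>y\<in>cball (t, chart_map \<kappa> x) r. y \<in> S \<and> 0 < fst y \<and> snd y \<in> chart_map \<kappa> ` chart_dom \<kappa>"
proof -
  have "open (S \<inter> ({0 :: real<..} \<times> chart_map \<kappa> ` chart_dom \<kappa>))" using S chart_open[OF \<kappa>] by (intro open_Int open_Times) auto
  moreover have "(t, chart_map \<kappa> x) \<in> S \<inter> ({0<..} \<times> chart_map \<kappa> ` chart_dom \<kappa>)" using S x t by auto
  ultimately obtain r where "r > 0" "cball (t, chart_map \<kappa> x) r \<subseteq> S \<inter> ({0<..} \<times> chart_map \<kappa> ` chart_dom \<kappa>)"
    using open_contains_cball by blast
  then show ?thesis by (intro exI[of _ r]) (auto simp: subset_eq mem_Times_iff simp del: mem_cball)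
qed

end

locale finsler_bump = finsler \<A> N
  for \<A> :: "('m::t2_space, 'x::banach) chart set" and N :: "'m \<Rightarrow> ('m, 'x) tvec \<Rightarrow> real" +
  fixes \<beta> :: "real \<times> 'x \<Rightarrow> real" and \<beta>' :: "real \<times> 'x \<Rightarrow> (real \<times> 'x) \<Rightarrow>\<^sub>L real" and K\<^sub>\<beta> :: real
  assumes bump: "smooth_bump \<beta> \<beta>' K\<^sub>\<beta>"
begin

text \<open>The product is C^1 on \<open>S\<close> and vanishes off the closed ball; these two open
  sets cover the space.\<close>

lemma C1_cutoff:
  assumes g: "C1d S g g'" and S: "open S" "cball y0 r \<subseteq> S" and r: "r > 0"
  shows "\<exists>k'. C1d UNIV (\<lambda>y. \<beta> ((1 / r) *\<^sub>R (y - y0)) * g y) k'"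
proof -
  let ?k = "\<lambda>y. \<beta> ((1 / r) *\<^sub>R (y - y0)) * g y"
  have "C1_on UNIV ?k"
  proof (rule C1_on_local)
    fix y :: "real \<times> 'x"
    have "C1_on S ?k" using C1d_mult[OF C1d_bump_rescaled(1)[OF bump r, of S y0] g] unfolding C1_on_iff_C1d by blast
    moreover have "C1_on (- cball y0 r) ?k"
    proof -
      have "C1d (- cball y0 r) ?k (\<lambda>_. 0)"
      proof (rule C1d_cong_open[OF C1d_const[of _ 0]])
        fix y assume "y \<in> - cball y0 r"
        then have "r \<le> norm (y - y0)" by (simp add: dist_norm norm_minus_commute)
        then show "0 = ?k y" using C1d_bump_rescaled(3)[OF bump r] by simp
      qed auto
      then show ?thesis unfolding C1_on_iff_C1d by blast
    qed
    moreover have "y \<in> S \<or> y \<in> - cball y0 r" using S(2) by blast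
    ultimately show "\<exists>T. open T \<and> y \<in> T \<and> C1_on T ?k" using S(1) by blast
  qed
  then show ?thesis unfolding C1_on_iff_C1d .
qed

text \<open>Test functions must be \<open>C\<^sup>1\<close> on all of \<open>(0,\<infinity>) \<times> M\<close>, so a function that is \<open>C\<^sup>1\<close> near a point of a
  chart is cut off by a bump.\<close>

lemma extend_test_function:
  assumes \<kappa>: "\<kappa> \<in> \<A>" and x: "x \<in> chart_dom \<kappa>" and t: "t > 0"
    and g: "C1d S g g'" and S: "open S" "(t, chart_map \<kappa> x) \<in> S"
  shows "\<exists>G. C1_test_function \<A> G \<and> (\<forall>\<^sub>F q in nhds (t, x). G q = g (fst q, chart_map \<kappa> (snd q))) \<and>
     represents_differential \<A> G t x (blinfun_apply (g' (t, chart_map \<kappa> x)) (1, 0))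
       (restrict (\<lambda>V. blinfun_apply (g' (t, chart_map \<kappa> x)) (0, V \<kappa>)) (tangent_space \<A> x))"
proof -
  define y0 where "y0 = (t, chart_map \<kappa> x)"
  define p where "p = g' y0"
  obtain r0 where r0: "r0 > 0" "cball (chart_map \<kappa> x) r0 \<subseteq> chart_map \<kappa> ` chart_dom \<kappa>"
     "\<And>s. s \<le> r0 \<Longrightarrow> closed (chart_inv \<kappa> ` cball (chart_map \<kappa> x) s)"
    using chart_closed_ball[OF \<kappa> x open_UNIV] by auto
  obtain r1 where r1: "r1 > 0" "cball y0 r1 \<subseteq> S" using S open_contains_cball y0_def by blast
  define r where "r = min r0 r1"
  have r: "r > 0" "r \<le> r0" "cball y0 r \<subseteq> S" using r0 r1 by (auto simp: r_def)
  let ?k = "\<lambda>y. \<beta> ((1 / r) *\<^sub>R (y - y0)) * g y"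
  obtain k' where k': "C1d UNIV ?k k'" using C1_cutoff[OF g S(1) r(3,1)] by blast
  define G where "G q = (if snd q \<in> chart_dom \<kappa> then ?k (fst q, chart_map \<kappa> (snd q)) else 0)" for q
  \<comment> \<open>The support of \<open>G\<close> in space lies in \<open>K\<close>. That
    \<open>K\<close> is closed in the manifold makes \<open>G\<close> vanish identically near every
    point outside the chart domain, so no discontinuity arises at the edge of the chart.\<close>
  define K where "K = chart_inv \<kappa> ` cball (chart_map \<kappa> x) r"
  have K: "closed K" using r0(3) r(2) by (simp add: K_def)
  have Kout: "G q = 0" if "snd q \<notin> K" for q
  proof (cases "snd q \<in> chart_dom \<kappa>")
    case True
    have "chart_map \<kappa> (snd q) \<notin> cball (chart_map \<kappa> x) r"
      using that chart_inv_map[OF \<kappa> True] unfolding K_def by (metis imageI)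
    then have "r \<le> dist (chart_map \<kappa> x) (chart_map \<kappa> (snd q))" by simp
    also have "\<dots> \<le> dist (fst q, chart_map \<kappa> (snd q)) y0"
      using dist_snd_le[of y0 "(fst q, chart_map \<kappa> (snd q))"] by (simp add: y0_def dist_commute)
    also have "\<dots> = norm ((fst q, chart_map \<kappa> (snd q)) - y0)" by (rule dist_norm)
    finally show ?thesis using C1d_bump_rescaled(3)[OF bump r(1)] True by (simp add: G_def)
  qed (simp add: G_def)
  have chart_rep: "local_rep \<kappa>' G y = ?k (fst y, transition \<kappa>' \<kappa> (snd y))"
    if "\<kappa>' \<in> \<A>" "snd y \<in> chart_map \<kappa>' ` (chart_dom \<kappa>' \<inter> chart_dom \<kappa>)" for \<kappa>' y
  proof -
    have "chart_inv \<kappa>' (snd y) \<in> chart_dom \<kappa>" using that chart_inv_map[OF that(1)] by auto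
    then show ?thesis by (simp add: local_rep_def G_def transition_def case_prod_unfold)
  qed
  have test: "C1_test_function \<A> G" unfolding C1_test_function_def
  proof
    fix \<kappa>' assume \<kappa>': "\<kappa>' \<in> \<A>"
    show "C1_on ({0<..} \<times> chart_map \<kappa>' ` chart_dom \<kappa>') (local_rep \<kappa>' G)"
    proof (rule C1_on_local)
      fix y :: "real \<times> 'x" assume y: "y \<in> {0<..} \<times> chart_map \<kappa>' ` chart_dom \<kappa>'"
      let ?z = "chart_inv \<kappa>' (snd y)"
      have z: "?z \<in> chart_dom \<kappa>'" "snd y = chart_map \<kappa>' ?z"
        using y chart_inv_dom[OF \<kappa>'] chart_map_inv[OF \<kappa>'] by (auto simp: mem_Times_iff)
      show "\<exists>T. open T \<and> y \<in> T \<and> C1_on T (local_rep \<kappa>' G)"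
      proof (cases "?z \<in> chart_dom \<kappa>")
        case True
        let ?T = "UNIV \<times> chart_map \<kappa>' ` (chart_dom \<kappa>' \<inter> chart_dom \<kappa>)"
        have oT: "open ?T" using open_chart_image[OF \<kappa>' chart_open(1)[OF \<kappa>]] by (intro open_Times) auto
        obtain D where "C1d ?T (\<lambda>w :: real \<times> 'x. (fst w, transition \<kappa>' \<kappa> (snd w))) D"
          using transition_spacetime_C1[OF \<kappa> \<kappa>'] by blast
        from C1d_compose[OF k' this] have "C1d ?T (\<lambda>w. ?k (fst w, transition \<kappa>' \<kappa> (snd w))) (\<lambda>w. k' (fst w, transition \<kappa>' \<kappa> (snd w)) o\<^sub>L D w)"
          by simp
        then have "C1d ?T (local_rep \<kappa>' G) (\<lambda>w. k' (fst w, transition \<kappa>' \<kappa> (snd w)) o\<^sub>L D w)"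
          by (rule C1d_cong_open[OF _ oT]) (use chart_rep[OF \<kappa>'] in auto)
        moreover have "snd y \<in> chart_map \<kappa>' ` (chart_dom \<kappa>' \<inter> chart_dom \<kappa>)" using z True by (metis IntI imageI)
        then have "y \<in> ?T" by (simp add: mem_Times_iff)
        ultimately show ?thesis using oT unfolding C1_on_iff_C1d by blast
      next
        case False
        let ?T = "UNIV \<times> chart_map \<kappa>' ` (chart_dom \<kappa>' \<inter> - K)"
        have oT: "open (?T :: (real \<times> 'x) set)" using open_chart_image[OF \<kappa>' open_Compl[OF K]] by (intro open_Times) auto
        have "cball (chart_map \<kappa> x) r \<subseteq> chart_map \<kappa> ` chart_dom \<kappa>" using r0(2) r(2) subset_cball by blast
        then have "K \<subseteq> chart_dom \<kappa>" unfolding K_def using chart_inv_dom[OF \<kappa>] by blast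
        then have "?z \<notin> K" using False by blast
        then have "snd y \<in> chart_map \<kappa>' ` (chart_dom \<kappa>' \<inter> - K)" using z by (metis IntI imageI ComplI)
        then have yT: "y \<in> ?T" by (simp add: mem_Times_iff)
        have "C1d ?T (local_rep \<kappa>' G) (\<lambda>_. 0)"
        proof (rule C1d_cong_open[OF C1d_const[of _ 0] oT])
          fix w :: "real \<times> 'x" assume "w \<in> ?T"
          then have "chart_inv \<kappa>' (snd w) \<notin> K" using chart_inv_map[OF \<kappa>'] by auto
          then show "0 = local_rep \<kappa>' G w" using Kout by (simp add: local_rep_def case_prod_unfold)
        qed
        then show ?thesis using oT yT unfolding C1_on_iff_C1d by blast
      qed
    qed
  qed
  obtain \<rho> where \<rho>: "\<rho> > 0" "\<And>v. norm v < \<rho> \<Longrightarrow> \<beta> v = 1" using bump unfolding smooth_bump_def by blast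
  have keq: "?k y = g y" if "y \<in> ball y0 (\<rho> * r)" for y
  proof -
    have "norm (y - y0) / r < \<rho>" using that r(1) by (simp add: dist_norm norm_minus_commute pos_divide_less_eq)
    then have "norm ((1 / r) *\<^sub>R (y - y0)) < \<rho>" unfolding norm_scaleR using r(1) by simp
    then show ?thesis using \<rho>(2) by simp
  qed
  have near: "\<forall>\<^sub>F q in nhds (t, x). G q = g (fst q, chart_map \<kappa> (snd q))"
  proof -
    have "\<forall>\<^sub>F y in nhds y0. y \<in> ball y0 (\<rho> * r)" using \<rho>(1) r(1) by (intro eventually_nhds_in_open) auto
    from eventually_compose_filterlim[OF this tendsto_spacetime_chart(1)[OF \<kappa> x, of t, folded y0_def]]
      eventually_spacetime_chart_dom(1)[OF \<kappa> x]
    show ?thesis by eventually_elim (simp add: G_def keq del: mem_ball)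
  qed
  \<comment> \<open>Cotangent vectors are extensional functions on the tangent space, hence the
    restriction; on tangent vectors only the component in the chart \<kappa> is read.\<close>
  let ?\<Delta> = "restrict (\<lambda>V. blinfun_apply p (0, V \<kappa>)) (tangent_space \<A> x)"
  have \<Delta>: "?\<Delta> (from_chart \<A> \<kappa>' x v) = blinfun_apply p (0, from_chart \<A> \<kappa>' x v \<kappa>)"
    if "\<kappa>' \<in> \<A>" "x \<in> chart_dom \<kappa>'" for \<kappa>' v using from_chart_tangent[OF that] by simp
  have kd: "(?k has_derivative blinfun_apply p) (at y0)"
  proof -
    have "(g has_derivative blinfun_apply p) (at y0)" using C1d_derivD[OF g] S(2) by (simp add: p_def y0_def)
    then show ?thesis by (rule has_derivative_transform_within_open[of _ _ _ _ "ball y0 (\<rho> * r)"]) (use \<rho>(1) r(1) keq in auto)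
  qed
  have rep: "represents_differential \<A> G t x (blinfun_apply p (1, 0)) ?\<Delta>"
    unfolding represents_differential_def
  proof (intro conjI ballI impI)
    show "?\<Delta> \<in> cotangent_space \<A> x" unfolding cotangent_space_def
    proof (intro CollectI conjI ballI impI)
      fix \<kappa>' assume k: "\<kappa>' \<in> \<A>" "x \<in> chart_dom \<kappa>'"
      have "bounded_linear (\<lambda>v. blinfun_apply p (0, from_chart \<A> \<kappa>' x v \<kappa>))"
        by (intro bounded_linear_compose[OF blinfun.bounded_linear_right] bounded_linear_Pair bounded_linear_zero from_chart_linear[OF k])
      then show "bounded_linear (\<lambda>v. ?\<Delta> (from_chart \<A> \<kappa>' x v))" by (simp only: \<Delta>[OF k])
    qed simp
    fix \<kappa>' assume k: "\<kappa>' \<in> \<A>" "x \<in> chart_dom \<kappa>'"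
    let ?T = "UNIV \<times> chart_map \<kappa>' ` (chart_dom \<kappa>' \<inter> chart_dom \<kappa>)"
    have oT: "open (?T :: (real \<times> 'x) set)" using open_chart_image[OF k(1) chart_open(1)[OF \<kappa>]] by (intro open_Times) auto
    obtain D where D: "C1d ?T (\<lambda>w :: real \<times> 'x. (fst w, transition \<kappa>' \<kappa> (snd w))) D"
      "\<And>w x \<sigma> v. x\<in>chart_dom \<kappa>' \<inter> chart_dom \<kappa> \<Longrightarrow> snd w = chart_map \<kappa>' x \<Longrightarrow> blinfun_apply (D w) (\<sigma>, v) = (\<sigma>, from_chart \<A> \<kappa>' x v \<kappa>)"
      using transition_spacetime_C1[OF \<kappa> k(1)] by blast
    let ?y = "(t, chart_map \<kappa>' x)"
    have yT: "?y \<in> ?T" using k x by auto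
    have tr: "transition \<kappa>' \<kappa> (chart_map \<kappa>' x) = chart_map \<kappa> x" using chart_inv_map[OF k] by (simp add: transition_def)
    have "((\<lambda>w. ?k (fst w, transition \<kappa>' \<kappa> (snd w))) has_derivative (\<lambda>v. blinfun_apply p (blinfun_apply (D ?y) v))) (at ?y)"
      by (rule has_derivative_compose[OF C1d_derivD[OF D(1) yT]]) (use kd tr in \<open>simp add: y0_def\<close>)
    then have "(local_rep \<kappa>' G has_derivative (\<lambda>v. blinfun_apply p (blinfun_apply (D ?y) v))) (at ?y)"
      by (rule has_derivative_transform_within_open[OF _ oT yT]) (use chart_rep[OF k(1)] in auto)
    moreover have "blinfun_apply p (blinfun_apply (D ?y) w) = (\<lambda>(\<sigma>, v). blinfun_apply p (1, 0) * \<sigma> + ?\<Delta> (from_chart \<A> \<kappa>' x v)) w" for w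
      using D(2)[of x ?y "fst w" "snd w"] k x blinfun_pair_split[of p "fst w"] by (simp only: \<Delta>[OF k] case_prod_unfold) simp
    ultimately show "(local_rep \<kappa>' G has_derivative (\<lambda>(\<sigma>, v). blinfun_apply p (1, 0) * \<sigma> + ?\<Delta> (from_chart \<A> \<kappa>' x v))) (at ?y)"
      by simp
  qed
  show ?thesis using test near rep unfolding p_def y0_def by blast
qed

text \<open>Test functions on the manifold and touching functions in one chart impose the same
  conditions: the former are restricted to the chart, the latter extended by the cut-off.
  \<open>P\<close> is abstract because the equation sees only the time derivative and the dual norm,
  and because both inequalities are needed.\<close>

lemma subdifferential_iff:
  assumes \<kappa>: "\<kappa> \<in> \<A>" and x: "x \<in> chart_dom \<kappa>" and t: "t > 0"
  shows "(\<forall>(\<alpha>, \<Delta>)\<in>subdifferential \<A> u t x. P \<alpha> (dual_norm \<A> N x \<Delta>)) \<longleftrightarrow>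
    (\<forall>p. C1_subgrad (local_rep \<kappa> u) (t, chart_map \<kappa> x) p \<longrightarrow> P (blinfun_apply p (1, 0)) (codual \<kappa> x p))"
proof (intro iffI allI impI)
  fix p assume L: "\<forall>(\<alpha>, \<Delta>)\<in>subdifferential \<A> u t x. P \<alpha> (dual_norm \<A> N x \<Delta>)"
    and p: "C1_subgrad (local_rep \<kappa> u) (t, chart_map \<kappa> x) p"
  let ?y = "(t, chart_map \<kappa> x)"
  obtain S g g' where S: "open S" "?y \<in> S" "C1d S g g'" "g' ?y = p"
    "\<forall>z\<in>S. local_rep \<kappa> u ?y - g ?y \<le> local_rep \<kappa> u z - g z" using p unfolding C1_subgrad_def by blast
  let ?\<Delta> = "restrict (\<lambda>V. blinfun_apply p (0, V \<kappa>)) (tangent_space \<A> x)"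
  obtain G where G: "C1_test_function \<A> G" "\<forall>\<^sub>F q in nhds (t, x). G q = g (fst q, chart_map \<kappa> (snd q))"
    "represents_differential \<A> G t x (blinfun_apply p (1, 0)) ?\<Delta>"
    using extend_test_function[OF \<kappa> x t S(3,1,2)] S(4) by auto
  have ev: "\<forall>\<^sub>F q in nhds (t, x). (fst q, chart_map \<kappa> (snd q)) \<in> S"
    by (rule topological_tendstoD[OF tendsto_spacetime_chart(1)[OF \<kappa> x] S(1,2)])
  have G0: "G (t, x) = g ?y" using eventually_nhds_x_imp_x[OF G(2)] by simp
  from G(2) ev eventually_spacetime_chart_dom(1)[OF \<kappa> x]
  have "\<forall>\<^sub>F q in nhds (t, x). u (t, x) - G (t, x) \<le> u q - G q"
  proof eventually_elim
    case (elim q)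
    have "local_rep \<kappa> u ?y - g ?y \<le> local_rep \<kappa> u (fst q, chart_map \<kappa> (snd q)) - g (fst q, chart_map \<kappa> (snd q))"
      using S(5) elim by blast
    then show ?case using elim G0 by (simp add: local_rep_chart[OF \<kappa>] x)
  qed
  then have "(blinfun_apply p (1, 0), ?\<Delta>) \<in> subdifferential \<A> u t x" using G unfolding subdifferential_def by blast
  then have "P (blinfun_apply p (1, 0)) (dual_norm \<A> N x ?\<Delta>)" using L by blast
  moreover have "dual_norm \<A> N x ?\<Delta> = codual \<kappa> x p"
    by (rule dual_norm_codual[OF \<kappa> x]) (simp add: from_chart_tangent[OF \<kappa> x] from_chart_self[OF \<kappa> x])
  ultimately show "P (blinfun_apply p (1, 0)) (codual \<kappa> x p)" by simp
next
  assume R: "\<forall>p. C1_subgrad (local_rep \<kappa> u) (t, chart_map \<kappa> x) p \<longrightarrow> P (blinfun_apply p (1, 0)) (codual \<kappa> x p)"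
  show "\<forall>(\<alpha>, \<Delta>)\<in>subdifferential \<A> u t x. P \<alpha> (dual_norm \<A> N x \<Delta>)"
  proof (clarify)
    fix \<alpha> \<Delta> assume "(\<alpha>, \<Delta>) \<in> subdifferential \<A> u t x"
    then obtain G where G: "C1_test_function \<A> G" "\<forall>\<^sub>F q in nhds (t, x). u (t, x) - G (t, x) \<le> u q - G q"
      "represents_differential \<A> G t x \<alpha> \<Delta>" unfolding subdifferential_def by blast
    let ?y = "(t, chart_map \<kappa> x)"
    let ?S = "{0 :: real<..} \<times> chart_map \<kappa> ` chart_dom \<kappa>"
    obtain g' where g': "C1d ?S (local_rep \<kappa> G) g'" "blinfun_apply (g' ?y) (1, 0) = \<alpha>" "dual_norm \<A> N x \<Delta> = codual \<kappa> x (g' ?y)"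
      using represents_differential_chart[OF \<kappa> x t G(1,3)] by blast
    obtain T where T: "open T" "?y \<in> T" "\<forall>y\<in>T. u (t, x) - G (t, x) \<le> u (fst y, chart_inv \<kappa> (snd y)) - G (fst y, chart_inv \<kappa> (snd y))"
      using iffD1[OF eventually_chart_iff[OF \<kappa> x] G(2)] unfolding eventually_nhds by (elim exE conjE)
    have oS: "open ?S" using chart_open[OF \<kappa>] by (intro open_Times) auto
    have "C1_subgrad (local_rep \<kappa> u) ?y (g' ?y)"
    proof (rule C1_subgradI[of "T \<inter> ?S" _ "local_rep \<kappa> G" g'])
      show "C1d (T \<inter> ?S) (local_rep \<kappa> G) g'" by (rule C1d_subset[OF g'(1)]) auto
      fix y assume "y \<in> T \<inter> ?S"
      then show "local_rep \<kappa> u ?y - local_rep \<kappa> G ?y \<le> local_rep \<kappa> u y - local_rep \<kappa> G y"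
        using bspec[OF T(3), of y] by (simp add: local_rep_pair chart_inv_map[OF \<kappa> x])
    qed (use oS T x t in auto)
    from R[rule_format, OF this] show "P \<alpha> (dual_norm \<A> N x \<Delta>)" using g'(2,3) by simp
  qed
qed

text \<open>The superdifferential of \<open>u\<close> is treated as minus the subdifferential of
  \<open>- u\<close>: the time derivative changes sign while the dual norm is even. All one-sided
  calculus is thus needed for lower semicontinuous functions only.\<close>

lemma superdifferential_iff:
  assumes \<kappa>: "\<kappa> \<in> \<A>" and x: "x \<in> chart_dom \<kappa>" and t: "t > 0"
  shows "(\<forall>(\<alpha>, \<Delta>)\<in>superdifferential \<A> u t x. P \<alpha> (dual_norm \<A> N x \<Delta>)) \<longleftrightarrow>
    (\<forall>p. C1_subgrad (\<lambda>y. - local_rep \<kappa> u y) (t, chart_map \<kappa> x) p \<longrightarrow> P (- blinfun_apply p (1, 0)) (codual \<kappa> x p))"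
proof (intro iffI allI impI)
  fix p assume L: "\<forall>(\<alpha>, \<Delta>)\<in>superdifferential \<A> u t x. P \<alpha> (dual_norm \<A> N x \<Delta>)"
    and p: "C1_subgrad (\<lambda>y. - local_rep \<kappa> u y) (t, chart_map \<kappa> x) p"
  let ?y = "(t, chart_map \<kappa> x)"
  obtain S g g' where S: "open S" "?y \<in> S" "C1d S g g'" "g' ?y = p"
    "\<forall>z\<in>S. - local_rep \<kappa> u ?y - g ?y \<le> - local_rep \<kappa> u z - g z" using p unfolding C1_subgrad_def by blast
  let ?\<Delta> = "restrict (\<lambda>V. blinfun_apply (- p) (0, V \<kappa>)) (tangent_space \<A> x)"
  obtain G where G: "C1_test_function \<A> G" "\<forall>\<^sub>F q in nhds (t, x). G q = - g (fst q, chart_map \<kappa> (snd q))"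
    "represents_differential \<A> G t x (blinfun_apply (- p) (1, 0)) ?\<Delta>"
    using extend_test_function[OF \<kappa> x t C1d_minus[OF S(3)] S(1,2)] S(4) by auto
  have ev: "\<forall>\<^sub>F q in nhds (t, x). (fst q, chart_map \<kappa> (snd q)) \<in> S"
    by (rule topological_tendstoD[OF tendsto_spacetime_chart(1)[OF \<kappa> x] S(1,2)])
  have G0: "G (t, x) = - g ?y" using eventually_nhds_x_imp_x[OF G(2)] by simp
  from G(2) ev eventually_spacetime_chart_dom(1)[OF \<kappa> x]
  have "\<forall>\<^sub>F q in nhds (t, x). u q - G q \<le> u (t, x) - G (t, x)"
  proof eventually_elim
    case (elim q)
    have "- local_rep \<kappa> u ?y - g ?y \<le> - local_rep \<kappa> u (fst q, chart_map \<kappa> (snd q)) - g (fst q, chart_map \<kappa> (snd q))"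
      using S(5) elim by blast
    then show ?case using elim G0 by (simp add: local_rep_chart[OF \<kappa>] x)
  qed
  then have "(blinfun_apply (- p) (1, 0), ?\<Delta>) \<in> superdifferential \<A> u t x" using G unfolding superdifferential_def by blast
  then have "P (blinfun_apply (- p) (1, 0)) (dual_norm \<A> N x ?\<Delta>)" using L by blast
  moreover have "dual_norm \<A> N x ?\<Delta> = codual \<kappa> x (- p)"
    by (rule dual_norm_codual[OF \<kappa> x]) (simp add: from_chart_tangent[OF \<kappa> x] from_chart_self[OF \<kappa> x])
  ultimately show "P (- blinfun_apply p (1, 0)) (codual \<kappa> x p)" by (simp add: codual_minus[OF \<kappa> x] uminus_blinfun.rep_eq)
next
  assume R: "\<forall>p. C1_subgrad (\<lambda>y. - local_rep \<kappa> u y) (t, chart_map \<kappa> x) p \<longrightarrow> P (- blinfun_apply p (1, 0)) (codual \<kappa> x p)"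
  show "\<forall>(\<alpha>, \<Delta>)\<in>superdifferential \<A> u t x. P \<alpha> (dual_norm \<A> N x \<Delta>)"
  proof (clarify)
    fix \<alpha> \<Delta> assume "(\<alpha>, \<Delta>) \<in> superdifferential \<A> u t x"
    then obtain G where G: "C1_test_function \<A> G" "\<forall>\<^sub>F q in nhds (t, x). u q - G q \<le> u (t, x) - G (t, x)"
      "represents_differential \<A> G t x \<alpha> \<Delta>" unfolding superdifferential_def by blast
    let ?y = "(t, chart_map \<kappa> x)"
    let ?S = "{0 :: real<..} \<times> chart_map \<kappa> ` chart_dom \<kappa>"
    obtain g' where g': "C1d ?S (local_rep \<kappa> G) g'" "blinfun_apply (g' ?y) (1, 0) = \<alpha>" "dual_norm \<A> N x \<Delta> = codual \<kappa> x (g' ?y)"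
      using represents_differential_chart[OF \<kappa> x t G(1,3)] by blast
    obtain T where T: "open T" "?y \<in> T" "\<forall>y\<in>T. u (fst y, chart_inv \<kappa> (snd y)) - G (fst y, chart_inv \<kappa> (snd y)) \<le> u (t, x) - G (t, x)"
      using iffD1[OF eventually_chart_iff[OF \<kappa> x] G(2)] unfolding eventually_nhds by (elim exE conjE)
    have oS: "open ?S" using chart_open[OF \<kappa>] by (intro open_Times) auto
    have "C1_subgrad (\<lambda>y. - local_rep \<kappa> u y) ?y (- g' ?y)"
    proof (rule C1_subgradI[of "T \<inter> ?S" _ "\<lambda>y. - local_rep \<kappa> G y" "\<lambda>y. - g' y"])
      show "C1d (T \<inter> ?S) (\<lambda>y. - local_rep \<kappa> G y) (\<lambda>y. - g' y)" by (rule C1d_subset[OF C1d_minus[OF g'(1)]]) auto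
      fix y assume "y \<in> T \<inter> ?S"
      then show "- local_rep \<kappa> u ?y - - local_rep \<kappa> G ?y \<le> - local_rep \<kappa> u y - - local_rep \<kappa> G y"
        using bspec[OF T(3), of y] by (simp add: local_rep_pair chart_inv_map[OF \<kappa> x])
    qed (use oS T x t in auto)
    from R[rule_format, OF this] have "P (- blinfun_apply (- g' ?y) (1, 0)) (codual \<kappa> x (- g' ?y))" .
    then show "P \<alpha> (dual_norm \<A> N x \<Delta>)" using g' by (simp add: codual_minus[OF \<kappa> x] uminus_blinfun.rep_eq)
  qed
qed

end

context finsler
begin
section \<open>Perron's method\<close>

abbreviation sball :: "real \<times> 'm \<Rightarrow> real \<Rightarrow> (real \<times> 'm) set" where "sball \<equiv> spacetime_ball \<A> N"

lemma sball_simps: "q \<in> sball p r \<longleftrightarrow> 0 \<le> fst q \<and> \<bar>fst p - fst q\<bar> + fdist (snd p) (snd q) < r"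
  by (auto simp: spacetime_ball_def spacetime_dist_def mem_Times_iff)

lemma sball_centre: "p \<in> spacetime \<Longrightarrow> r > 0 \<Longrightarrow> p \<in> sball p r"
  by (auto simp: sball_simps fdist_refl)

lemma sball_triangle: "q \<in> sball p r \<Longrightarrow> q' \<in> sball q r' \<Longrightarrow> q' \<in> sball p (r + r')"
  using fdist_triangle[of "snd p" "snd q'" "snd q"] by (auto simp: sball_simps)

lemma sball_mono: "r \<le> r' \<Longrightarrow> sball p r \<subseteq> sball p r'"
  by (auto simp: sball_simps)

text \<open>Together with \<open>nhds_sball\<close> this says that, at points of nonnegative time,
  the metric balls defining the envelopes and the product topology describe the same neighbourhoods
  in [0,\<infinity>) x M.\<close>

lemma sball_nhds: assumes "r > 0" shows "\<forall>\<^sub>F q in nhds p. q \<in> spacetime \<longrightarrow> q \<in> sball p r"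
proof -
  obtain W where W: "open W" "snd p \<in> W" "\<forall>y\<in>W. fdist (snd p) y < r / 2" using fdist_continuous[of "r / 2" "snd p"] assms by auto
  have "open (ball (fst p) (r/2) \<times> W)" using W by (intro open_Times) auto
  moreover have "p \<in> ball (fst p) (r/2) \<times> W" using W assms by (simp add: mem_Times_iff)
  ultimately have "\<forall>\<^sub>F q in nhds p. q \<in> ball (fst p) (r/2) \<times> W" by (rule eventually_nhds_in_open)
  then show ?thesis
  proof eventually_elim
    case (elim q)
    then have "fdist (snd p) (snd q) < r / 2" "\<bar>fst p - fst q\<bar> < r / 2" using W(3) by (auto simp: mem_Times_iff dist_real_def)
    then show ?case by (auto simp: sball_simps mem_Times_iff)
  qed
qed

lemma nhds_sball: assumes "\<forall>\<^sub>F q in nhds p. P q" shows "\<exists>r>0. \<forall>q\<in>sball p r. P q"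
proof -
  obtain T where T: "open T" "p \<in> T" "\<forall>q\<in>T. P q" using assms unfolding eventually_nhds by (elim exE conjE)
  obtain A B where AB: "open A" "open B" "fst p \<in> A" "snd p \<in> B" "A \<times> B \<subseteq> T"
    using open_prod_elim[OF T(1,2)] by (metis mem_Times_iff)
  obtain d1 where d1: "d1 > 0" "ball (fst p) d1 \<subseteq> A" using AB open_contains_ball by blast
  obtain d2 where d2: "d2 > 0" "\<forall>y. fdist (snd p) y < d2 \<longrightarrow> y \<in> B" using fdist_small[OF AB(2,4)] by blast
  have "P q" if "q \<in> sball p (min d1 d2)" for q
  proof -
    have "\<bar>fst p - fst q\<bar> < d1" "fdist (snd p) (snd q) < d2"
      using that fdist_nonneg[of "snd p" "snd q"] by (auto simp: sball_simps)
    then have "fst q \<in> A" "snd q \<in> B" using d1(2) d2(2) by (auto simp: subset_eq dist_real_def)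
    then have "q \<in> T" using AB(5) by (metis mem_Times_iff subsetD)
    then show ?thesis using T(3) by blast
  qed
  then show ?thesis using d1 d2 by (intro exI[of _ "min d1 d2"]) auto
qed

text \<open>Only radii up to \<open>r0\<close>, where \<open>f\<close> is bounded above, have
  meaningful real suprema. These are monotone in the radius and bounded below by \<open>f p\<close>,
  so their limit at 0 exists and is their infimum; the last two clauses unfold this.\<close>

lemma upper_envelope_char:
  assumes p: "p \<in> spacetime" and r0: "r0 > 0" and bd: "\<And>q. q \<in> sball p r0 \<Longrightarrow> f q \<le> M"
  shows "((\<lambda>r. SUP q\<in>sball p r. f q) \<longlongrightarrow> upper_envelope \<A> N f p) (at_right 0)"
    and "upper_envelope \<A> N f p < c \<Longrightarrow> \<exists>r>0. \<forall>q\<in>sball p r. f q < c"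
    and "c < upper_envelope \<A> N f p \<Longrightarrow> r > 0 \<Longrightarrow> \<exists>q\<in>sball p r. c < f q"
proof -
  let ?S = "\<lambda>r. SUP q\<in>sball p r. f q"
  have bda: "bdd_above (f ` sball p r)" if "r \<le> r0" for r
    using bd sball_mono[OF that, of p] by (intro bdd_aboveI2[of _ _ M]) auto
  have mono: "?S r \<le> ?S r'" if "0 < r" "r \<le> r'" "r' \<le> r0" for r r'
    by (rule cSUP_subset_mono[OF _ bda[OF that(3)] sball_mono[OF that(2)]]) (use sball_centre[OF p that(1)] in auto)
  have ge: "f p \<le> ?S r" if "0 < r" "r \<le> r0" for r by (rule cSUP_upper[OF sball_centre[OF p that(1)] bda[OF that(2)]])
  define Lm where "Lm = Inf (?S ` {0<..r0})"
  have bb: "bdd_below (?S ` {0<..r0})" using ge by (intro bdd_belowI2[of _ "f p"]) auto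
  have low: "Lm \<le> ?S r" if "0 < r" "r \<le> r0" for r unfolding Lm_def by (rule cInf_lower[OF _ bb]) (use that in auto)
  have up: "\<exists>r. 0 < r \<and> r \<le> r0 \<and> ?S r < c" if "Lm < c" for c
    using cInf_lessD[of "?S ` {0<..r0}" c] that r0 by (auto simp: Lm_def)
  have lim: "(?S \<longlongrightarrow> Lm) (at_right 0)"
  proof (rule order_tendstoI)
    fix a assume "a < Lm"
    have "\<forall>\<^sub>F r in at_right 0. r \<in> {0<..<r0}" using r0 by (rule eventually_at_right_real)
    then show "\<forall>\<^sub>F r in at_right 0. a < ?S r" by eventually_elim (use low \<open>a < Lm\<close> in force)
  next
    fix a assume "Lm < a"
    then obtain r1 where r1: "0 < r1" "r1 \<le> r0" "?S r1 < a" using up by blast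
    have "\<forall>\<^sub>F r in at_right 0. r \<in> {0<..<r1}" using r1(1) by (rule eventually_at_right_real)
    then show "\<forall>\<^sub>F r in at_right 0. ?S r < a" by eventually_elim (use mono[of _ r1] r1 in force)
  qed
  have eq: "upper_envelope \<A> N f p = Lm" unfolding upper_envelope_def by (rule tendsto_Lim[OF _ lim]) simp
  show "(?S \<longlongrightarrow> upper_envelope \<A> N f p) (at_right 0)" using lim eq by simp
  show "\<exists>r>0. \<forall>q\<in>sball p r. f q < c" if c: "upper_envelope \<A> N f p < c"
  proof -
    obtain r where r: "0 < r" "r \<le> r0" "?S r < c" using up c eq by auto
    have "f q < c" if "q \<in> sball p r" for q using cSUP_upper[OF that bda[OF r(2)]] r(3) by linarith
    then show ?thesis using r(1) by blast
  qed
  show "\<exists>q\<in>sball p r. c < f q" if c: "c < upper_envelope \<A> N f p" and r: "r > 0"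
  proof -
    define r' where "r' = min r r0"
    have r': "0 < r'" "r' \<le> r" "r' \<le> r0" using r r0 by (auto simp: r'_def)
    have "c < ?S r'" using c eq low[of r'] r' by simp
    moreover have "sball p r' \<noteq> {}" using sball_centre[OF p r'(1)] by blast
    ultimately obtain q where "q \<in> sball p r'" "c < f q"
      using less_cSUP_iff[OF _ bda[OF r'(3)]] by blast
    then show ?thesis using sball_mono[OF r'(2)] by blast
  qed
qed

lemma lower_envelope_uminus:
  assumes p: "p \<in> spacetime" and r0: "r0 > 0" and bd: "\<And>q. q \<in> sball p r0 \<Longrightarrow> M \<le> f q"
  shows "lower_envelope \<A> N f p = - upper_envelope \<A> N (\<lambda>q. - f q) p"
proof -
  have "((\<lambda>r. SUP q\<in>sball p r. - f q) \<longlongrightarrow> upper_envelope \<A> N (\<lambda>q. - f q) p) (at_right 0)"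
    by (rule upper_envelope_char(1)[OF p r0, of _ "- M"]) (use bd in auto)
  then have "((\<lambda>r. - (SUP q\<in>sball p r. - f q)) \<longlongrightarrow> - upper_envelope \<A> N (\<lambda>q. - f q) p) (at_right 0)"
    by (rule tendsto_minus)
  moreover have "- (SUP q\<in>sball p r. - f q) = (INF q\<in>sball p r. f q)" for r
    by (simp add: Inf_real_def image_image)
  ultimately show ?thesis unfolding lower_envelope_def by (intro tendsto_Lim) simp_all
qed

lemma usc_upper_envelope:
  assumes bd: "\<And>p. p \<in> spacetime \<Longrightarrow> \<exists>r>0. \<exists>M. \<forall>q\<in>sball p r. f q \<le> M"
  shows "usc_on spacetime (upper_envelope \<A> N f)"
proof (rule usc_onI_nhds)
  fix p c assume p: "p \<in> spacetime" and c: "upper_envelope \<A> N f p < c"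
  then obtain c' where c': "upper_envelope \<A> N f p < c'" "c' < c" using dense by blast
  obtain r0 M where r0: "r0 > 0" "\<And>q. q \<in> sball p r0 \<Longrightarrow> f q \<le> M" using bd[OF p] by blast
  obtain r where r: "r > 0" "\<forall>q\<in>sball p r. f q < c'" using upper_envelope_char(2)[OF p r0 c'(1)] by blast
  \<comment> \<open>A ball of radius r/2 about \<open>q\<close> stays inside the ball of radius
    \<open>r\<close> about \<open>p\<close>. The limit only gives a weak inequality, hence the
    intermediate value \<open>c'\<close>.\<close>
  have "upper_envelope \<A> N f q \<le> c'" if q: "q \<in> sball p (r / 2)" for q
  proof (rule ccontr)
    assume "\<not> ?thesis"
    then have gt: "c' < upper_envelope \<A> N f q" by simp
    have qs: "q \<in> spacetime" using q by (auto simp: sball_simps mem_Times_iff)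
    obtain r1 M1 where r1: "r1 > 0" "\<And>q'. q' \<in> sball q r1 \<Longrightarrow> f q' \<le> M1" using bd[OF qs] by blast
    obtain q' where "q' \<in> sball q (r / 2)" "c' < f q'" using upper_envelope_char(3)[OF qs r1 gt, of "r / 2"] r(1) by auto
    then show False using sball_triangle[OF q, of q' "r / 2"] r(2) by force
  qed
  moreover have "\<forall>\<^sub>F q in nhds p. q \<in> spacetime \<longrightarrow> q \<in> sball p (r / 2)" using r(1) by (intro sball_nhds) simp
  ultimately show "\<forall>\<^sub>F q in nhds p. q \<in> spacetime \<longrightarrow> upper_envelope \<A> N f q < c"
    by (auto elim!: eventually_mono) (use c'(2) in force)
qed

lemma upper_envelope_ge:
  assumes p: "p \<in> spacetime" and r0: "r0 > 0" and bd: "\<And>q. q \<in> sball p r0 \<Longrightarrow> f q \<le> M"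
  shows "f p \<le> upper_envelope \<A> N f p"
proof (rule ccontr)
  assume "\<not> ?thesis"
  then have lt: "upper_envelope \<A> N f p < f p" by simp
  obtain r where "r > 0" "\<forall>q\<in>sball p r. f q < f p" using upper_envelope_char(2)[OF p r0 bd lt] by blast
  then show False using sball_centre[OF p] by fastforce
qed

lemma upper_envelope_le:
  assumes p: "p \<in> spacetime" and b: "usc_on spacetime b" and le: "\<And>q. q \<in> spacetime \<Longrightarrow> f q \<le> b q"
  shows "upper_envelope \<A> N f p \<le> b p"
proof (rule ccontr)
  assume "\<not> ?thesis"
  then have "b p < upper_envelope \<A> N f p" by simp
  then obtain c where c: "b p < c" "c < upper_envelope \<A> N f p" using dense by blast
  obtain r where r: "r > 0" "\<forall>q\<in>sball p r. q \<in> spacetime \<longrightarrow> b q < c"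
    using nhds_sball[OF usc_on_nhds[OF b p c(1)]] by blast
  have lt: "f q < c" if "q \<in> sball p r" for q
  proof -
    have "q \<in> spacetime" using that by (auto simp: sball_simps mem_Times_iff)
    then show ?thesis using le[of q] r(2) that by force
  qed
  obtain q where "q \<in> sball p r" "c < f q" using upper_envelope_char(3)[OF p r(1) less_imp_le[OF lt] c(2) r(1)] by blast
  then show False using lt[of q] by simp
qed

text \<open>Near \<open>x\<close> the Finsler distance is at most twice the norm at \<open>x\<close>
  of the chart difference, so only the upper comparison of the distance with the chart norm is
  involved. The outcome bounds the subgradients of \<open>w\<close> and of \<open>- w\<close> in the
  chart.\<close>

lemma lipschitz_local_rep:
  assumes w: "locally_lipschitz \<A> N w" and \<kappa>: "\<kappa> \<in> \<A>" and x: "x \<in> chart_dom \<kappa>" and t: "t > 0"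
  shows "\<exists>R\<ge>0. \<exists>r>0. \<forall>y\<in>cball (t, chart_map \<kappa> x) r. \<forall>y'\<in>cball (t, chart_map \<kappa> x) r.
     \<bar>local_rep \<kappa> w y - local_rep \<kappa> w y'\<bar> \<le> R * norm (y - y')"
proof -
  let ?y0 = "(t, chart_map \<kappa> x)"
  have "(t, x) \<in> spacetime" using t by simp
  then obtain \<rho> K where \<rho>: "\<rho> > 0" "K \<ge> 0" "\<forall>q\<in>sball (t, x) \<rho>. \<forall>q'\<in>sball (t, x) \<rho>. \<bar>w q - w q'\<bar> \<le> K * spacetime_dist \<A> N q q'"
    using w unfolding locally_lipschitz_def by blast
  obtain S where S: "open S" "?y0 \<in> S"
    "\<forall>y\<in>S. (fst y, chart_inv \<kappa> (snd y)) \<in> spacetime \<longrightarrow> (fst y, chart_inv \<kappa> (snd y)) \<in> sball (t, x) \<rho>"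
    using iffD1[OF eventually_chart_iff[OF \<kappa> x] sball_nhds[OF \<rho>(1), of "(t, x)"]] unfolding eventually_nhds by (elim exE conjE)
  obtain r1 where r1: "r1 > 0" "\<forall>y\<in>cball ?y0 r1. y \<in> S \<and> 0 < fst y \<and> snd y \<in> chart_map \<kappa> ` chart_dom \<kappa>"
    using chart_cball[OF \<kappa> x t S(1,2)] by blast
  obtain rd where rd: "rd > 0" "\<forall>y\<in>ball (chart_map \<kappa> x) rd. \<forall>y'\<in>ball (chart_map \<kappa> x) rd.
        fdist (chart_inv \<kappa> y) (chart_inv \<kappa> y') \<le> (1 + 1) * cnorm \<kappa> x (y' - y)"
    using fdist_chart[OF \<kappa> x, of 1] by auto
  obtain b where b: "b > 0" "\<And>v. cnorm \<kappa> x v \<le> b * norm v" using cnorm_equiv[OF \<kappa> x] by blast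
  define r where "r = min r1 (rd / 2)"
  have r: "r > 0" using r1(1) rd(1) by (simp add: r_def)
  have in1: "(fst y, chart_inv \<kappa> (snd y)) \<in> sball (t, x) \<rho>" "snd y \<in> ball (chart_map \<kappa> x) rd" if "y \<in> cball ?y0 r" for y
  proof -
    have "y \<in> cball ?y0 r1" using that by (auto simp: r_def)
    then have "y \<in> S" "0 < fst y" using r1(2) by auto
    then show "(fst y, chart_inv \<kappa> (snd y)) \<in> sball (t, x) \<rho>" using S(3) by simp
    have "dist (chart_map \<kappa> x) (snd y) \<le> dist ?y0 y" using dist_snd_le[of ?y0 y] by simp
    then show "snd y \<in> ball (chart_map \<kappa> x) rd" using that rd(1) by (auto simp: r_def)
  qed
  have "\<bar>local_rep \<kappa> w y - local_rep \<kappa> w y'\<bar> \<le> (K * (1 + 2 * b)) * norm (y - y')" if y: "y \<in> cball ?y0 r" "y' \<in> cball ?y0 r" for y y'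
  proof -
    have nf: "\<bar>fst y - fst y'\<bar> \<le> norm (y - y')" and ns: "norm (snd y' - snd y) \<le> norm (y - y')"
      using dist_fst_le[of y y'] dist_snd_le[of y' y] by (auto simp: dist_norm norm_minus_commute)
    have "\<bar>local_rep \<kappa> w y - local_rep \<kappa> w y'\<bar> \<le> K * spacetime_dist \<A> N (fst y, chart_inv \<kappa> (snd y)) (fst y', chart_inv \<kappa> (snd y'))"
      unfolding local_rep_pair using \<rho>(3) in1(1) y by blast
    also have "\<dots> \<le> K * ((1 + 2 * b) * norm (y - y'))"
    proof (rule mult_left_mono[OF _ \<rho>(2)])
      have "fdist (chart_inv \<kappa> (snd y)) (chart_inv \<kappa> (snd y')) \<le> (1 + 1) * cnorm \<kappa> x (snd y' - snd y)"
        using rd(2) in1(2) y by blast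
      also have "\<dots> \<le> (1 + 1) * (b * norm (y - y'))"
        using b ns by (intro mult_left_mono order_trans[OF b(2)]) auto
      finally show "spacetime_dist \<A> N (fst y, chart_inv \<kappa> (snd y)) (fst y', chart_inv \<kappa> (snd y')) \<le> (1 + 2 * b) * norm (y - y')"
        using nf by (simp add: spacetime_dist_def algebra_simps)
    qed
    finally show ?thesis by (simp only: mult.assoc)
  qed
  moreover have "0 \<le> K * (1 + 2 * b)" using \<rho>(2) b(1) by simp
  ultimately show ?thesis using r by blast
qed

section \<open>Completeness of closed time strips and continuity of locally Lipschitz
  functions\<close>

lemma spacetime_complete:
  assumes complete: "Metric_space.mcomplete UNIV fdist" and \<sigma>: "\<And>n. \<sigma> n \<in> {0..T} \<times> UNIV"
    and C: "\<forall>e>0. \<exists>k. \<forall>m\<ge>k. \<forall>n\<ge>m. spacetime_dist \<A> N (\<sigma> m) (\<sigma> n) < e"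
  shows "\<exists>z\<in>{0..T} \<times> UNIV. (\<lambda>n. spacetime_dist \<A> N (\<sigma> n) z) \<longlonglongrightarrow> 0"
proof -
  have le: "\<bar>fst p - fst q\<bar> \<le> spacetime_dist \<A> N p q" "fdist (snd p) (snd q) \<le> spacetime_dist \<A> N p q" for p q
    using fdist_nonneg[of "snd p" "snd q"] by (auto simp: spacetime_dist_def)
  have "\<forall>e>0. \<exists>k. \<forall>m\<ge>k. \<forall>n\<ge>m. fdist (snd (\<sigma> m)) (snd (\<sigma> n)) < e"
    using C le(2) by (meson le_less_trans)
  from fdist_complete[OF complete this] obtain x where x: "(\<lambda>n. fdist (snd (\<sigma> n)) x) \<longlonglongrightarrow> 0" by blast
  have "Cauchy (\<lambda>n. fst (\<sigma> n))"
  proof (rule metric_CauchyI)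
    fix e :: real assume "e > 0"
    then obtain k where k: "\<forall>m\<ge>k. \<forall>n\<ge>m. spacetime_dist \<A> N (\<sigma> m) (\<sigma> n) < e" using C by blast
    have "dist (fst (\<sigma> m)) (fst (\<sigma> n)) < e" if "k \<le> m" "k \<le> n" for m n
    proof (cases "m \<le> n")
      case True
      then have "spacetime_dist \<A> N (\<sigma> m) (\<sigma> n) < e" using k that by blast
      then show ?thesis using le(1)[of "\<sigma> m" "\<sigma> n"] by (simp add: dist_real_def)
    next
      case False
      then have "spacetime_dist \<A> N (\<sigma> n) (\<sigma> m) < e" using k that by simp
      then show ?thesis using le(1)[of "\<sigma> n" "\<sigma> m"] by (simp add: dist_real_def abs_minus_commute)
    qed
    then show "\<exists>M. \<forall>m\<ge>M. \<forall>n\<ge>M. dist (fst (\<sigma> m)) (fst (\<sigma> n)) < e" by blast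
  qed
  then obtain t where t: "(\<lambda>n. fst (\<sigma> n)) \<longlonglongrightarrow> t" using Cauchy_convergent_iff convergent_def by blast
  have "t \<in> {0..T}" by (rule closed_sequentially[OF closed_atLeastAtMost _ t]) (use \<sigma> in \<open>auto simp: mem_Times_iff\<close>)
  moreover have "(\<lambda>n. \<bar>fst (\<sigma> n) - t\<bar> + fdist (snd (\<sigma> n)) x) \<longlonglongrightarrow> 0"
    using tendsto_add[OF tendsto_rabs_zero[OF LIM_zero[OF t]] x] by simp
  ultimately show ?thesis by (intro bexI[of _ "(t, x)"]) (auto simp: spacetime_dist_def)
qed

lemma spacetime_dist_tendsto:
  assumes "(\<lambda>n. spacetime_dist \<A> N (\<sigma> n) z) \<longlonglongrightarrow> 0" shows "\<sigma> \<longlonglongrightarrow> z"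
proof -
  have "(\<lambda>n. fdist (snd (\<sigma> n)) (snd z)) \<longlonglongrightarrow> 0"
    by (rule Lim_null_comparison[OF _ assms]) (auto simp: spacetime_dist_def fdist_nonneg)
  then have s: "(\<lambda>n. snd (\<sigma> n)) \<longlonglongrightarrow> snd z" by (rule tendsto_of_fdist)
  have "(\<lambda>n. fst (\<sigma> n) - fst z) \<longlonglongrightarrow> 0"
    by (rule Lim_null_comparison[OF _ assms]) (auto simp: spacetime_dist_def fdist_nonneg)
  then have "(\<lambda>n. fst (\<sigma> n)) \<longlonglongrightarrow> fst z" by (rule LIM_zero_cancel)
  from tendsto_Pair[OF this s] show ?thesis by simp
qed

lemma locally_lipschitz_continuous:
  assumes "locally_lipschitz \<A> N w" shows "continuous_on spacetime w"
  unfolding continuous_on_def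
proof
  fix p :: "real \<times> 'm" assume p: "p \<in> spacetime"
  then obtain r K where r: "r > 0" "K \<ge> 0" "\<forall>q\<in>sball p r. \<forall>q'\<in>sball p r. \<bar>w q - w q'\<bar> \<le> K * spacetime_dist \<A> N q q'"
    using assms unfolding locally_lipschitz_def by blast
  show "(w \<longlongrightarrow> w p) (at p within spacetime)"
  proof (rule tendstoI)
    fix e :: real assume e: "e > 0"
    define d where "d = min r (e / (K + 1))"
    have d: "d > 0" "d \<le> r" "d \<le> e / (K + 1)" unfolding d_def using e r by (simp, intro min.cobounded1, intro min.cobounded2)
    have "dist (w q) (w p) < e" if q: "q \<in> sball p d" for q
    proof -
      have qr: "q \<in> sball p r" "p \<in> sball p r" using q sball_mono[OF d(2)] sball_centre[OF p r(1)] by blast+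
      have "\<bar>w p - w q\<bar> \<le> K * spacetime_dist \<A> N p q" using r(3) qr by blast
      also have "\<dots> \<le> K * (e / (K + 1))"
        using q d(3) r(2) by (intro mult_left_mono) (auto simp: sball_simps spacetime_dist_def)
      also have "\<dots> < e" using e r(2) by (simp add: field_simps)
      finally show ?thesis by (simp add: dist_real_def abs_minus_commute)
    qed
    then show "\<forall>\<^sub>F q in at p within spacetime. dist (w q) (w p) < e"
      using sball_nhds[OF d(1), of p] unfolding eventually_at_filter by (auto elim: eventually_mono)
  qed
qed

lemma eventually_positive_time:
  assumes t: "t > 0" shows "\<forall>\<^sub>F y in nhds (t :: real, z :: 'z::topological_space). 0 \<le> fst y"
proof -
  have "\<forall>\<^sub>F y in nhds (t, z). y \<in> {0<..} \<times> UNIV" using t by (intro eventually_nhds_in_open open_Times) auto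
  then show ?thesis by eventually_elim (auto simp: mem_Times_iff)
qed

end

locale hamilton_jacobi = finsler_bump \<A> N \<beta> \<beta>' K\<^sub>\<beta>
  for \<A> :: "('m::t2_space, 'x::banach) chart set" and N :: "'m \<Rightarrow> ('m, 'x) tvec \<Rightarrow> real"
    and \<beta> :: "real \<times> 'x \<Rightarrow> real" and \<beta>' :: "real \<times> 'x \<Rightarrow> (real \<times> 'x) \<Rightarrow>\<^sub>L real" and K\<^sub>\<beta> :: real +
  fixes H :: "real \<Rightarrow> 'm \<Rightarrow> real \<Rightarrow> real" and h :: "'m \<Rightarrow> real" and L K\<^sub>0 K\<^sub>1 :: real
  assumes H_cont: "continuous_on ({0..} \<times> UNIV \<times> UNIV) (\<lambda>(t, x, r). H t x r)"
    and L: "L \<ge> 0" and h_lipschitz: "\<bar>h x - h y\<bar> \<le> L * finsler_dist \<A> N x y"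
    and H_bounds: "t > 0 \<Longrightarrow> \<bar>m\<bar> \<le> L \<Longrightarrow> K\<^sub>0 \<le> H t x m \<and> H t x m \<le> K\<^sub>1"
begin

section \<open>Lipschitz initial data and the barriers\<close>

lemma tendsto_h: "(h \<longlongrightarrow> h x) (nhds x)"
proof (rule tendstoI)
  fix e :: real assume e: "e > 0"
  obtain W where W: "open W" "x \<in> W" "\<forall>y\<in>W. fdist x y < e / (L + 1)"
    using fdist_continuous[of "e / (L + 1)" x] e L by auto
  have "dist (h y) (h x) < e" if "y \<in> W" for y
  proof -
    have "\<bar>h x - h y\<bar> \<le> L * fdist x y" by (rule h_lipschitz)
    also have "\<dots> \<le> L * (e / (L + 1))" using W(3) that L by (intro mult_left_mono) (auto intro: less_imp_le)
    also have "\<dots> < e" using e L by (simp add: field_simps)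
    finally show ?thesis by (simp add: dist_real_def abs_minus_commute)
  qed
  then show "\<forall>\<^sub>F y in nhds x. dist (h y) (h x) < e" using W unfolding eventually_nhds by blast
qed

lemma h_continuous: "continuous_on S h"
proof -
  have "isCont h x" for x using tendsto_h[of x] by (simp add: isCont_def tendsto_at_iff_tendsto_nhds)
  then show ?thesis by (simp add: continuous_at_imp_continuous_on)
qed

definition barrier :: "real \<Rightarrow> real \<times> 'm \<Rightarrow> real" where "barrier K q = - K * fst q + h (snd q)"

lemma barrier_continuous: "continuous_on S (barrier K)"
  unfolding barrier_def[abs_def] by (intro continuous_intros continuous_on_compose2[OF h_continuous[of UNIV]]) auto

text \<open>The sign \<sigma> covers sub- and superdifferentials at once. The dual norm is bounded
  by exactly \<open>L\<close>, the range in which the constants \<open>K\<^sub>0\<close> and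
  \<open>K\<^sub>1\<close> control the Hamiltonian: by (P2) the distance near \<open>x\<close> is at
  most 1 + \<epsilon> times the norm at \<open>x\<close>, for every \<epsilon>.\<close>

lemma barrier_differential:
  assumes \<kappa>: "\<kappa> \<in> \<A>" and x: "x \<in> chart_dom \<kappa>" and \<sigma>: "\<sigma> = 1 \<or> \<sigma> = -1"
    and p: "C1_subgrad (\<lambda>y. \<sigma> * local_rep \<kappa> (barrier K) y) (t, chart_map \<kappa> x) p"
  shows "blinfun_apply p (1, 0) = - \<sigma> * K" and "codual \<kappa> x p \<le> L"
proof -
  have "blinfun_apply p (1, 0) \<le> - \<sigma> * K"
    by (rule C1_subgrad_directional[OF p]) (simp add: local_rep_pair barrier_def algebra_simps)
  moreover have "blinfun_apply p (-1, 0) \<le> \<sigma> * K"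
    by (rule C1_subgrad_directional[OF p]) (simp add: local_rep_pair barrier_def algebra_simps)
  moreover have "blinfun_apply p (-1, 0) = - blinfun_apply p (1, 0)"
    using blinfun.minus_right[of p "(1, 0)"] by simp
  ultimately show "blinfun_apply p (1, 0) = - \<sigma> * K" by simp
  show "codual \<kappa> x p \<le> L"
  proof (rule field_le_mult_one_interval)
    fix z :: real assume z: "0 < z" "z < 1"
    \<comment> \<open>Chosen so that z (1 + \<epsilon>) = 1, which cancels the loss in the
      comparison of the distance with the norm.\<close>
    define \<epsilon> where "\<epsilon> = 1 / z - 1"
    have \<epsilon>: "\<epsilon> > 0" using z by (simp add: \<epsilon>_def)
    obtain r where r: "r > 0" "\<forall>y\<in>ball (chart_map \<kappa> x) r. \<forall>y'\<in>ball (chart_map \<kappa> x) r.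
        fdist (chart_inv \<kappa> y) (chart_inv \<kappa> y') \<le> (1 + \<epsilon>) * cnorm \<kappa> x (y' - y)"
      using fdist_chart[OF \<kappa> x \<epsilon>] by blast
    have dir: "blinfun_apply p (0, v) \<le> (L * (1 + \<epsilon>)) * cnorm \<kappa> x v" for v
    proof (rule C1_subgrad_directional[OF p])
      have "((\<lambda>s. chart_map \<kappa> x + s *\<^sub>R v) \<longlongrightarrow> chart_map \<kappa> x + 0 *\<^sub>R v) (at_right 0)" by (intro tendsto_intros)
      then have "\<forall>\<^sub>F s in at_right 0. chart_map \<kappa> x + s *\<^sub>R v \<in> ball (chart_map \<kappa> x) r"
        using topological_tendstoD[OF _ open_ball, of _ "chart_map \<kappa> x" "at_right 0" "chart_map \<kappa> x" r] r(1) by simp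
      then show "\<forall>\<^sub>F s in at_right 0. \<sigma> * local_rep \<kappa> (barrier K) ((t, chart_map \<kappa> x) + s *\<^sub>R (0, v)) -
           \<sigma> * local_rep \<kappa> (barrier K) (t, chart_map \<kappa> x) \<le> s * (L * (1 + \<epsilon>) * cnorm \<kappa> x v)"
        using eventually_at_right_less[of 0]
      proof eventually_elim
        case (elim s)
        let ?y = "chart_map \<kappa> x + s *\<^sub>R v"
        have "\<sigma> * local_rep \<kappa> (barrier K) ((t, chart_map \<kappa> x) + s *\<^sub>R (0, v)) - \<sigma> * local_rep \<kappa> (barrier K) (t, chart_map \<kappa> x)
           \<le> \<bar>h (chart_inv \<kappa> ?y) - h (chart_inv \<kappa> (chart_map \<kappa> x))\<bar>"
          using \<sigma> by (auto simp: local_rep_pair barrier_def)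
        also have "\<dots> \<le> L * fdist (chart_inv \<kappa> ?y) (chart_inv \<kappa> (chart_map \<kappa> x))" by (rule h_lipschitz)
        also have "\<dots> \<le> L * ((1 + \<epsilon>) * cnorm \<kappa> x (chart_map \<kappa> x - ?y))"
          using bspec[OF bspec[OF r(2) elim(1)], of "chart_map \<kappa> x"] r(1) L by (intro mult_left_mono) auto
        also have "cnorm \<kappa> x (chart_map \<kappa> x - ?y) = s * cnorm \<kappa> x v"
          using cnorm_scaleR[OF \<kappa> x, of "-s" v] elim by simp
        finally show ?case by (simp add: mult_ac)
      qed
    qed
    have "codual \<kappa> x p \<le> L * (1 + \<epsilon>)"
    proof (rule codual_le[OF \<kappa> x])
      show "0 \<le> L * (1 + \<epsilon>)" using L \<epsilon> by simp
      fix v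
      have "blinfun_apply p (0, - v) = - blinfun_apply p (0, v)" using blinfun.minus_right[of p "(0, v)"] by simp
      then show "\<bar>blinfun_apply p (0, v)\<bar> \<le> L * (1 + \<epsilon>) * cnorm \<kappa> x v"
        using dir[of v] dir[of "- v"] cnorm_minus[OF \<kappa> x, of v] by (simp add: abs_le_iff)
    qed
    then have "z * codual \<kappa> x p \<le> z * (L * (1 + \<epsilon>))" using z by (intro mult_left_mono) auto
    also have "\<dots> = L" using z by (simp add: \<epsilon>_def)
    finally show "z * codual \<kappa> x p \<le> L" .
  qed
qed

text \<open>The differential inequality alone, apart from semicontinuity and initial values: it is
  local, whereas the other two conditions come from comparison with the barriers or from general
  properties of envelopes.\<close>

definition sub_ineq :: "(real \<times> 'm \<Rightarrow> real) \<Rightarrow> bool" where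
  "sub_ineq u \<longleftrightarrow> (\<forall>t>0. \<forall>x. \<forall>(\<alpha>, \<Delta>)\<in>superdifferential \<A> u t x. \<alpha> + H t x (dual_norm \<A> N x \<Delta>) \<le> 0)"

definition super_ineq :: "(real \<times> 'm \<Rightarrow> real) \<Rightarrow> bool" where
  "super_ineq u \<longleftrightarrow> (\<forall>t>0. \<forall>x. \<forall>(\<alpha>, \<Delta>)\<in>subdifferential \<A> u t x. \<alpha> + H t x (dual_norm \<A> N x \<Delta>) \<ge> 0)"

lemma sub_ineq_at: "sub_ineq u \<Longrightarrow> t > 0 \<Longrightarrow> \<forall>(\<alpha>, \<Delta>)\<in>superdifferential \<A> u t x. \<alpha> + H t x (dual_norm \<A> N x \<Delta>) \<le> 0"
  and super_ineq_at: "super_ineq u \<Longrightarrow> t > 0 \<Longrightarrow> \<forall>(\<alpha>, \<Delta>)\<in>subdifferential \<A> u t x. \<alpha> + H t x (dual_norm \<A> N x \<Delta>) \<ge> 0"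
  unfolding sub_ineq_def super_ineq_def by simp_all

text \<open>The inequality does not depend on the chart, so it may be verified in one convenient
  chart at each point, whereas \<open>sub_ineqD\<close> makes it available in every chart.\<close>

lemma sub_ineq_iff:
  "sub_ineq u \<longleftrightarrow> (\<forall>t>0. \<forall>x. \<exists>\<kappa>\<in>\<A>. x \<in> chart_dom \<kappa> \<and>
     (\<forall>p. C1_subgrad (\<lambda>y. - local_rep \<kappa> u y) (t, chart_map \<kappa> x) p \<longrightarrow> - blinfun_apply p (1, 0) + H t x (codual \<kappa> x p) \<le> 0))"
proof
  assume L: "sub_ineq u"
  show "\<forall>t>0. \<forall>x. \<exists>\<kappa>\<in>\<A>. x \<in> chart_dom \<kappa> \<and>
     (\<forall>p. C1_subgrad (\<lambda>y. - local_rep \<kappa> u y) (t, chart_map \<kappa> x) p \<longrightarrow> - blinfun_apply p (1, 0) + H t x (codual \<kappa> x p) \<le> 0)"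
  proof (intro allI impI)
    fix t :: real and x assume t: "t > 0"
    obtain \<kappa> where k: "\<kappa> \<in> \<A>" "x \<in> chart_dom \<kappa>" using chart_exists by blast
    show "\<exists>\<kappa>\<in>\<A>. x \<in> chart_dom \<kappa> \<and>
     (\<forall>p. C1_subgrad (\<lambda>y. - local_rep \<kappa> u y) (t, chart_map \<kappa> x) p \<longrightarrow> - blinfun_apply p (1, 0) + H t x (codual \<kappa> x p) \<le> 0)"
      using iffD1[OF superdifferential_iff[OF k t, where P = "\<lambda>a r. a + H t x r \<le> 0"] sub_ineq_at[OF L t]] k by blast
  qed
next
  assume R: "\<forall>t>0. \<forall>x. \<exists>\<kappa>\<in>\<A>. x \<in> chart_dom \<kappa> \<and>
     (\<forall>p. C1_subgrad (\<lambda>y. - local_rep \<kappa> u y) (t, chart_map \<kappa> x) p \<longrightarrow> - blinfun_apply p (1, 0) + H t x (codual \<kappa> x p) \<le> 0)"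
  show "sub_ineq u" unfolding sub_ineq_def
  proof (intro allI impI)
    fix t :: real and x assume t: "t > 0"
    then obtain \<kappa> where k: "\<kappa> \<in> \<A>" "x \<in> chart_dom \<kappa>"
      "\<forall>p. C1_subgrad (\<lambda>y. - local_rep \<kappa> u y) (t, chart_map \<kappa> x) p \<longrightarrow> - blinfun_apply p (1, 0) + H t x (codual \<kappa> x p) \<le> 0"
      using R by blast
    show "\<forall>(\<alpha>, \<Delta>)\<in>superdifferential \<A> u t x. \<alpha> + H t x (dual_norm \<A> N x \<Delta>) \<le> 0"
      by (rule iffD2[OF superdifferential_iff[OF k(1,2) t, where P = "\<lambda>a r. a + H t x r \<le> 0"] k(3)])
  qed
qed

lemma sub_ineqD:
  assumes "sub_ineq u" "\<kappa> \<in> \<A>" "x \<in> chart_dom \<kappa>" "t > 0" "C1_subgrad (\<lambda>y. - local_rep \<kappa> u y) (t, chart_map \<kappa> x) p"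
  shows "- blinfun_apply p (1, 0) + H t x (codual \<kappa> x p) \<le> 0"
  using iffD1[OF superdifferential_iff[OF assms(2-4), where P = "\<lambda>a r. a + H t x r \<le> 0"] sub_ineq_at[OF assms(1,4)]]
    assms(5) by blast

lemma super_ineqD:
  assumes "super_ineq u" "\<kappa> \<in> \<A>" "x \<in> chart_dom \<kappa>" "t > 0" "C1_subgrad (local_rep \<kappa> u) (t, chart_map \<kappa> x) p"
  shows "blinfun_apply p (1, 0) + H t x (codual \<kappa> x p) \<ge> 0"
  using iffD1[OF subdifferential_iff[OF assms(2-4), where P = "\<lambda>a r. a + H t x r \<ge> 0"] super_ineq_at[OF assms(1,4)]]
    assms(5) by blast

lemma super_ineqI:
  assumes "\<And>t x. t > 0 \<Longrightarrow> \<exists>\<kappa>\<in>\<A>. x \<in> chart_dom \<kappa> \<and>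
     (\<forall>p. C1_subgrad (local_rep \<kappa> u) (t, chart_map \<kappa> x) p \<longrightarrow> blinfun_apply p (1, 0) + H t x (codual \<kappa> x p) \<ge> 0)"
  shows "super_ineq u"
  unfolding super_ineq_def
proof (intro allI impI)
  fix t :: real and x assume t: "t > 0"
  obtain \<kappa> where k: "\<kappa> \<in> \<A>" "x \<in> chart_dom \<kappa>"
    "\<forall>p. C1_subgrad (local_rep \<kappa> u) (t, chart_map \<kappa> x) p \<longrightarrow> blinfun_apply p (1, 0) + H t x (codual \<kappa> x p) \<ge> 0"
    using assms[OF t] by blast
  show "\<forall>(\<alpha>, \<Delta>)\<in>subdifferential \<A> u t x. \<alpha> + H t x (dual_norm \<A> N x \<Delta>) \<ge> 0"
    by (rule iffD2[OF subdifferential_iff[OF k(1,2) t, where P = "\<lambda>a r. a + H t x r \<ge> 0"] k(3)])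
qed

lemma barrier_sub_ineq: "sub_ineq (barrier K\<^sub>1)"
  unfolding sub_ineq_iff
proof (intro allI impI)
  fix t :: real and x assume t: "t > 0"
  obtain \<kappa> where k: "\<kappa> \<in> \<A>" "x \<in> chart_dom \<kappa>" using chart_exists by blast
  have "- blinfun_apply p (1, 0) + H t x (codual \<kappa> x p) \<le> 0"
    if "C1_subgrad (\<lambda>y. - local_rep \<kappa> (barrier K\<^sub>1) y) (t, chart_map \<kappa> x) p" for p
  proof -
    have p: "C1_subgrad (\<lambda>y. (-1) * local_rep \<kappa> (barrier K\<^sub>1) y) (t, chart_map \<kappa> x) p" using that by simp
    have "H t x (codual \<kappa> x p) \<le> K\<^sub>1"
      using barrier_differential(2)[OF k _ p] codual_nonneg[OF k, of p] H_bounds[OF t] by simp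
    then show ?thesis using barrier_differential(1)[OF k _ p] by simp
  qed
  then show "\<exists>\<kappa>\<in>\<A>. x \<in> chart_dom \<kappa> \<and> (\<forall>p. C1_subgrad (\<lambda>y. - local_rep \<kappa> (barrier K\<^sub>1) y) (t, chart_map \<kappa> x) p \<longrightarrow>
      - blinfun_apply p (1, 0) + H t x (codual \<kappa> x p) \<le> 0)" using k by blast
qed

lemma hamiltonian_nbhd:
  assumes \<kappa>: "\<kappa> \<in> \<A>" and x: "x \<in> chart_dom \<kappa>" and t: "t > 0" and U: "open U" "blinfun_apply p\<^sub>0 (1, 0) + H t x (codual \<kappa> x p\<^sub>0) \<in> U"
  shows "\<exists>\<delta>>0. \<forall>y p. norm (y - (t, chart_map \<kappa> x)) < \<delta> \<longrightarrow> norm (p - p\<^sub>0) < \<delta> \<longrightarrow>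
     blinfun_apply p (1, 0) + H (fst y) (chart_inv \<kappa> (snd y)) (codual \<kappa> (chart_inv \<kappa> (snd y)) p) \<in> U"
proof -
  have "\<forall>\<^sub>F w in nhds ((t, chart_map \<kappa> x), p\<^sub>0). (case w of (y, p) \<Rightarrow>
      blinfun_apply p (1, 0) + H (fst y) (chart_inv \<kappa> (snd y)) (codual \<kappa> (chart_inv \<kappa> (snd y)) p)) \<in> U"
    by (rule topological_tendstoD[OF tendsto_hamiltonian[OF H_cont \<kappa> x t] U])
  then obtain d where d: "d > 0" "\<And>w. dist w ((t, chart_map \<kappa> x), p\<^sub>0) < d \<Longrightarrow> (case w of (y, p) \<Rightarrow>
      blinfun_apply p (1, 0) + H (fst y) (chart_inv \<kappa> (snd y)) (codual \<kappa> (chart_inv \<kappa> (snd y)) p)) \<in> U"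
    unfolding eventually_nhds_metric by blast
  have "blinfun_apply p (1, 0) + H (fst y) (chart_inv \<kappa> (snd y)) (codual \<kappa> (chart_inv \<kappa> (snd y)) p) \<in> U"
    if "norm (y - (t, chart_map \<kappa> x)) < d / 2" "norm (p - p\<^sub>0) < d / 2" for y p
  proof -
    have "dist (y, p) ((t, chart_map \<kappa> x), p\<^sub>0) \<le> norm (y - (t, chart_map \<kappa> x)) + norm (p - p\<^sub>0)"
      unfolding dist_norm using norm_Pair_le[of "y - (t, chart_map \<kappa> x)" "p - p\<^sub>0"] by simp
    then have "dist (y, p) ((t, chart_map \<kappa> x), p\<^sub>0) < d" using that by linarith
    from d(2)[OF this] show ?thesis by simp
  qed
  then show ?thesis using d(1) by (intro exI[of _ "d / 2"]) auto
qed

text \<open>At a point where \<open>U\<close> is touched from above, some \<open>w \<in> \<W>\<close> almost touches as well; a flat bump and the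
  smooth variational principle turn this into a touching point for \<open>w\<close> with nearly the same gradient.\<close>

lemma perron_sub_ineq:
  assumes W: "\<And>w. w \<in> \<W> \<Longrightarrow> usc_on spacetime w \<and> sub_ineq w"
    and le: "\<And>w q. w \<in> \<W> \<Longrightarrow> q \<in> spacetime \<Longrightarrow> w q \<le> U q"
    and approx: "\<And>p c V. p \<in> spacetime \<Longrightarrow> c < U p \<Longrightarrow> open V \<Longrightarrow> p \<in> V \<Longrightarrow> \<exists>q\<in>V \<inter> spacetime. \<exists>w\<in>\<W>. c < w q"
  shows "sub_ineq U"
  unfolding sub_ineq_iff
proof (intro allI impI)
  fix t :: real and x assume t: "t > 0"
  obtain \<kappa> where \<kappa>: "\<kappa> \<in> \<A>" and x: "x \<in> chart_dom \<kappa>" using chart_exists by blast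
  define y0 where "y0 = (t, chart_map \<kappa> x)"
  have "- blinfun_apply p (1, 0) + H t x (codual \<kappa> x p) \<le> 0"
    if p: "C1_subgrad (\<lambda>y. - local_rep \<kappa> U y) y0 p" for p
  proof (rule ccontr)
    assume "\<not> ?thesis"
    then have pos: "blinfun_apply (- p) (1, 0) + H t x (codual \<kappa> x (- p)) \<in> {0<..}"
      by (simp add: codual_minus[OF \<kappa> x] uminus_blinfun.rep_eq)
    obtain \<delta> where \<delta>: "\<delta> > 0" "\<And>y q. norm (y - y0) < \<delta> \<Longrightarrow> norm (q - - p) < \<delta> \<Longrightarrow>
       0 < blinfun_apply q (1, 0) + H (fst y) (chart_inv \<kappa> (snd y)) (codual \<kappa> (chart_inv \<kappa> (snd y)) q)"
      using hamiltonian_nbhd[OF \<kappa> x t _ pos] unfolding y0_def by auto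
    obtain S g g' where S: "open S" "y0 \<in> S" "C1d S g g'" "g' y0 = p"
      "\<forall>z\<in>S. - local_rep \<kappa> U y0 - g y0 \<le> - local_rep \<kappa> U z - g z" using p unfolding C1_subgrad_def by blast
    obtain r1 where r1: "r1 > 0" "\<forall>z. dist z y0 < r1 \<longrightarrow> z \<in> S \<and> dist (g' z) (g' y0) < \<delta> / 3"
      using continuous_nbhd_radius[OF C1d_contD[OF S(3)] S(1,2), of "\<delta> / 3"] \<delta>(1) by auto
    obtain r2 where r2: "r2 > 0" "\<forall>y\<in>cball y0 r2. y \<in> S \<and> 0 < fst y \<and> snd y \<in> chart_map \<kappa> ` chart_dom \<kappa>"
      using chart_cball[OF \<kappa> x t S(1) S(2)[unfolded y0_def]] unfolding y0_def by blast
    define r where "r = min r2 (min r1 \<delta> / 2)"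
    have r: "r > 0" "r \<le> r2" "r < r1" "r < \<delta>" using r1(1) r2(1) \<delta>(1) by (auto simp: r_def min_def)
    let ?C = "cball y0 r"
    have C: "y \<in> S" "0 < fst y" "snd y \<in> chart_map \<kappa> ` chart_dom \<kappa>" "norm (g' y - p) < \<delta> / 3" if "y \<in> ?C" for y
    proof -
      have d: "dist y y0 < r1" "y \<in> cball y0 r2" using that r by (auto simp: dist_commute)
      then show "y \<in> S" "0 < fst y" "snd y \<in> chart_map \<kappa> ` chart_dom \<kappa>" "norm (g' y - p) < \<delta> / 3"
        using r1(2)[rule_format, OF d(1)] bspec[OF r2(2) d(2)] S(4) by (simp_all add: dist_norm)
    qed
    note bmp = C1d_bump_rescaled[OF bump r(1)]
    have Kb: "0 \<le> K\<^sub>\<beta>" by (rule bmp(7))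
    \<comment> \<open>A bump of height \<open>k\<close> and radius \<open>r\<close> has gradient at
      most k K_\<beta> / r, which this choice keeps below \<delta>/3.\<close>
    define k where "k = \<delta> * r / (6 * (K\<^sub>\<beta> + 1))"
    have k: "k > 0" using \<delta>(1) r(1) Kb by (simp add: k_def)
    have kK: "k * (K\<^sub>\<beta> / r) < \<delta> / 3"
    proof -
      have "k * (K\<^sub>\<beta> / r) = \<delta> / 6 * (K\<^sub>\<beta> / (K\<^sub>\<beta> + 1))" using r(1) Kb by (simp add: k_def field_simps)
      also have "\<dots> \<le> \<delta> / 6 * 1" using Kb \<delta>(1) by (intro mult_left_mono) auto
      finally show ?thesis using \<delta>(1) by linarith
    qed
    let ?B = "\<lambda>y. \<beta> ((1 / r) *\<^sub>R (y - y0))"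
    let ?B' = "\<lambda>y. (1 / r) *\<^sub>R \<beta>' ((1 / r) *\<^sub>R (y - y0))"
    \<comment> \<open>The bump at \<open>y0\<close> breaks ties. Near \<open>y0\<close> it lowers
      \<open>f\<close> by about \<open>k\<close>, and the almost contact point \<open>y1\<close>
      keeps at least half of this; outside the support of the bump \<open>f\<close> is at least
      \<open>m\<close>. The perturbed minimum is therefore interior.\<close>
    define G where "G y = g y + k * ?B y" for y
    define G' where "G' y = g' y + k *\<^sub>R ?B' y" for y
    have GC1: "C1d S G G'" unfolding G_def[abs_def] G'_def[abs_def] by (intro C1d_add S(3) C1d_cmult bmp(1))
    obtain r3 where r3: "r3 > 0" "\<forall>z. dist z y0 < r3 \<longrightarrow> z \<in> S \<and> dist (G z) (G y0) < k / 4"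
      using continuous_nbhd_radius[OF C1d_continuous_on[OF GC1] S(1,2), of "k / 4"] k by auto
    let ?V = "{q. snd q \<in> chart_dom \<kappa> \<and> (fst q, chart_map \<kappa> (snd q)) \<in> ball y0 (min r r3)}"
    have "open ?V" by (rule open_chart_box[OF \<kappa> open_ball])
    moreover have "(t, x) \<in> ?V" using x r(1) r3(1) by (simp add: y0_def)
    moreover have "U (t, x) - k / 4 < U (t, x)" using k by simp
    moreover have "(t, x) \<in> spacetime" using t by simp
    ultimately obtain q w where q: "q \<in> ?V" "w \<in> \<W>" "U (t, x) - k / 4 < w q" using approx[of "(t, x)" "U (t, x) - k / 4" ?V] by blast
    define y1 where "y1 = (fst q, chart_map \<kappa> (snd q))"
    have y1: "y1 \<in> ball y0 (min r r3)" "local_rep \<kappa> w y1 = w q"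
      using q(1) by (auto simp: y1_def local_rep_pair chart_inv_map[OF \<kappa>])
    have y0U: "local_rep \<kappa> U y0 = U (t, x)" using local_rep_chart[OF \<kappa> x] by (simp add: y0_def)
    define m where "m = - local_rep \<kappa> U y0 - g y0"
    define f where "f y = - local_rep \<kappa> w y + - G y" for y
    have wU: "local_rep \<kappa> w y \<le> local_rep \<kappa> U y" if "y \<in> ?C" for y
      using le[OF q(2)] C(2)[OF that] by (simp add: local_rep_pair)
    have low: "m - k * ?B y \<le> f y" if "y \<in> ?C" for y
      using bspec[OF S(5) C(1)[OF that]] wU[OF that] by (simp add: m_def f_def G_def)
    have low': "m - k \<le> f y" if "y \<in> ?C" for y
    proof -
      have "k * ?B y \<le> k * 1" using bmp(6) k by (intro mult_left_mono) auto
      then show ?thesis using low[OF that] by simp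
    qed
    have lscw: "lsc_on spacetime (\<lambda>q. - w q)" using W[OF q(2)] usc_on_iff_lsc_on_minus by blast
    have "lsc_on ?C (\<lambda>y. - local_rep \<kappa> w y)"
    proof (rule lsc_on_subset)
      show "lsc_on ({0..} \<times> chart_map \<kappa> ` chart_dom \<kappa>) (\<lambda>y. - local_rep \<kappa> w y)"
        using lsc_local_rep[OF \<kappa> lscw] by (simp add: local_rep_def case_prod_unfold)
      show "?C \<subseteq> {0..} \<times> chart_map \<kappa> ` chart_dom \<kappa>" using C(2,3) by (auto simp: mem_Times_iff less_imp_le simp del: mem_cball)
    qed
    moreover have "continuous_on ?C (\<lambda>y. - G y)"
      using C(1) by (intro continuous_on_minus continuous_on_subset[OF C1d_continuous_on[OF GC1]]) auto
    ultimately have lscf: "lsc_on ?C f" unfolding f_def[abs_def] by (rule lsc_on_add_continuous)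
    define \<epsilon> where "\<epsilon> = min (k / 16) (\<delta> / 6)"
    have \<epsilon>: "\<epsilon> > 0" "\<epsilon> \<le> k / 16" "\<epsilon> \<le> \<delta> / 6" using k \<delta>(1) by (auto simp: \<epsilon>_def)
    have "?C \<noteq> {}" using r(1) by simp
    from smooth_variational_principle[OF bump closed_cball this lscf low' \<epsilon>(1)]
    obtain \<gamma> \<gamma>' z where \<gamma>: "C1d UNIV \<gamma> \<gamma>'" "\<forall>x. \<bar>\<gamma> x\<bar> \<le> \<epsilon> \<and> norm (\<gamma>' x) \<le> \<epsilon>" and z: "z \<in> ?C" "\<forall>y\<in>?C. f z + \<gamma> z \<le> f y + \<gamma> y"
      by blast
    have y1C: "y1 \<in> ?C" using y1(1) by auto
    have G0: "G y0 = g y0 + k" using bmp(4)[of y0] by (simp add: G_def)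
    have "\<bar>G y1 - G y0\<bar> < k / 4" using r3(2)[rule_format, of y1] y1(1) by (simp add: dist_commute dist_real_def abs_minus_commute)
    then have "f y1 < m - k / 2" unfolding f_def m_def using y1(2) q(3) y0U G0 by linarith
    moreover have "f z + \<gamma> z \<le> f y1 + \<gamma> y1" using z(2) y1C by blast
    moreover have "\<bar>\<gamma> z\<bar> \<le> \<epsilon>" "\<bar>\<gamma> y1\<bar> \<le> \<epsilon>" using \<gamma>(2) by blast+
    ultimately have "f z < m - k / 4" using \<epsilon>(2) k by (simp add: abs_le_iff)
    then have "?B z \<noteq> 0" using low[OF z(1)] k by auto
    then have zr: "norm (z - y0) < r" using bmp(3)[of z y0] by (meson not_le)
    define q' where "q' = G' z - \<gamma>' z"
    have sub: "C1_subgrad (\<lambda>y. - local_rep \<kappa> w y) z q'"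
    proof (rule C1_subgradI[of "ball y0 r" _ "\<lambda>y. G y - \<gamma> y" "\<lambda>y. G' y - \<gamma>' y"])
      show "z \<in> ball y0 r" using zr by (simp add: dist_norm norm_minus_commute)
      show "C1d (ball y0 r) (\<lambda>y. G y - \<gamma> y) (\<lambda>y. G' y - \<gamma>' y)"
        using C(1) by (intro C1d_diff C1d_subset[OF GC1] C1d_subset[OF \<gamma>(1)]) auto
      fix y assume "y \<in> ball y0 r"
      then show "- local_rep \<kappa> w z - (G z - \<gamma> z) \<le> - local_rep \<kappa> w y - (G y - \<gamma> y)"
        using bspec[OF z(2), of y] by (simp add: f_def)
    qed (auto simp: q'_def)
    \<comment> \<open>The budget \<delta> is shared by the variation of g' on the ball, the gradient
      of the bump and the gradient of the perturbation \<gamma>.\<close>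
    have "norm (- q' - - p) < \<delta>"
    proof -
      have "- q' - - p = - ((g' z - p) + k *\<^sub>R ?B' z - \<gamma>' z)" by (simp add: q'_def G'_def)
      then have "norm (- q' - - p) = norm ((g' z - p) + k *\<^sub>R ?B' z - \<gamma>' z)" by (simp only: norm_minus_cancel)
      also have "\<dots> \<le> norm (g' z - p) + norm (k *\<^sub>R ?B' z) + norm (\<gamma>' z)"
        using norm_triangle_ineq4[of "g' z - p + k *\<^sub>R ?B' z" "\<gamma>' z"] norm_triangle_ineq[of "g' z - p" "k *\<^sub>R ?B' z"] by linarith
      also have "norm (k *\<^sub>R ?B' z) \<le> k * (K\<^sub>\<beta> / r)" unfolding norm_scaleR[of k] using bmp(2)[of z y0] k by (intro mult_mono) auto
      finally show ?thesis using C(4)[OF z(1)] kK \<gamma>(2)[rule_format, of z] \<epsilon>(3) \<delta>(1) by linarith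
    qed
    then have lt: "0 < blinfun_apply (- q') (1, 0) + H (fst z) (chart_inv \<kappa> (snd z)) (codual \<kappa> (chart_inv \<kappa> (snd z)) (- q'))"
      using \<delta>(2)[of z "- q'"] zr r(4) by simp
    let ?x = "chart_inv \<kappa> (snd z)"
    have zx: "?x \<in> chart_dom \<kappa>" "(fst z, chart_map \<kappa> ?x) = z"
      using chart_inv_dom[OF \<kappa> C(3)[OF z(1)]] chart_map_inv[OF \<kappa> C(3)[OF z(1)]] by auto
    have "- blinfun_apply q' (1, 0) + H (fst z) ?x (codual \<kappa> ?x q') \<le> 0"
      by (rule sub_ineqD[OF _ \<kappa> zx(1) C(2)[OF z(1)]]) (use W[OF q(2)] sub zx(2) in auto)
    then show False using lt codual_minus[OF \<kappa> zx(1), of q'] by (simp add: uminus_blinfun.rep_eq)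
  qed
  then show "\<exists>\<kappa>\<in>\<A>. x \<in> chart_dom \<kappa> \<and>
     (\<forall>p. C1_subgrad (\<lambda>y. - local_rep \<kappa> U y) (t, chart_map \<kappa> x) p \<longrightarrow> - blinfun_apply p (1, 0) + H t x (codual \<kappa> x p) \<le> 0)"
    using \<kappa> x unfolding y0_def by blast
qed

text \<open>If \<open>l\<close> failed the supersolution inequality at a point, then \<open>U\<close> could be raised there to its maximum
  with a bumped test function and remain a subsolution below the barrier.\<close>

lemma perron_super_ineq:
  assumes U: "usc_on spacetime U" "sub_ineq U"
    and lU: "\<And>q. q \<in> spacetime \<Longrightarrow> l q \<le> U q" and Ub: "\<And>q. q \<in> spacetime \<Longrightarrow> U q \<le> barrier K\<^sub>0 q"
    and approx: "\<And>p c V. p \<in> spacetime \<Longrightarrow> l p < c \<Longrightarrow> open V \<Longrightarrow> p \<in> V \<Longrightarrow> \<exists>q\<in>V \<inter> spacetime. U q < c"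
    and max: "\<And>w q. usc_on spacetime w \<Longrightarrow> sub_ineq w \<Longrightarrow> (\<And>q. q \<in> spacetime \<Longrightarrow> U q \<le> w q \<and> w q \<le> barrier K\<^sub>0 q) \<Longrightarrow>
       q \<in> spacetime \<Longrightarrow> w q \<le> U q"
  shows "super_ineq l"
proof (rule super_ineqI)
  fix t :: real and x assume t: "t > 0"
  obtain \<kappa> where \<kappa>: "\<kappa> \<in> \<A>" and x: "x \<in> chart_dom \<kappa>" using chart_exists by blast
  define y0 where "y0 = (t, chart_map \<kappa> x)"
  define \<Phi> where "\<Phi> q = (fst q, chart_map \<kappa> (snd q))" for q :: "real \<times> 'm"
  have "blinfun_apply p (1, 0) + H t x (codual \<kappa> x p) \<ge> 0" if p: "C1_subgrad (local_rep \<kappa> l) y0 p" for p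
  proof (rule ccontr)
    assume "\<not> ?thesis"
    then have neg: "blinfun_apply p (1, 0) + H t x (codual \<kappa> x p) \<in> {..<0}" by simp
    have y0l: "local_rep \<kappa> l y0 = l (t, x)" and y0b: "local_rep \<kappa> (barrier K\<^sub>0) y0 = barrier K\<^sub>0 (t, x)"
      using local_rep_chart[OF \<kappa> x] by (simp_all add: y0_def)
    have lb: "l (t, x) \<noteq> barrier K\<^sub>0 (t, x)"
    proof
      assume eq: "l (t, x) = barrier K\<^sub>0 (t, x)"
      obtain r where r: "r > 0" "\<forall>y\<in>cball y0 r. 0 < fst y" using chart_cball[OF \<kappa> x t open_UNIV] unfolding y0_def by auto
      have "C1_subgrad (local_rep \<kappa> (barrier K\<^sub>0)) y0 p"
      proof (rule C1_subgrad_touching[OF p])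
        have "\<forall>\<^sub>F y in nhds y0. y \<in> ball y0 r" using r(1) by (intro eventually_nhds_in_open) auto
        then show "\<forall>\<^sub>F y in nhds y0. local_rep \<kappa> l y \<le> local_rep \<kappa> (barrier K\<^sub>0) y"
        proof eventually_elim
          case (elim y)
          then have "0 < fst y" using r(2) by auto
          then have "(fst y, chart_inv \<kappa> (snd y)) \<in> spacetime" by simp
          then show ?case using lU Ub order_trans unfolding local_rep_pair by blast
        qed
      qed (use eq y0l y0b in simp)
      then have p1: "C1_subgrad (\<lambda>y. 1 * local_rep \<kappa> (barrier K\<^sub>0) y) (t, chart_map \<kappa> x) p" by (simp add: y0_def)
      have "K\<^sub>0 \<le> H t x (codual \<kappa> x p)"
        using barrier_differential(2)[OF \<kappa> x _ p1] codual_nonneg[OF \<kappa> x, of p] H_bounds[OF t] by simp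
      then show False using neg barrier_differential(1)[OF \<kappa> x _ p1] by simp
    qed
    \<comment> \<open>The room below the upper barrier. A quarter each is reserved for the variation
      of \<open>g\<close>, for the height of the bump and for the variation of the barrier, so the
      raised function still fits under it.\<close>
    define e where "e = barrier K\<^sub>0 (t, x) - l (t, x)"
    have e: "e > 0" using lb lU[of "(t,x)"] Ub[of "(t,x)"] t by (simp add: e_def less_le)
    obtain \<delta> where \<delta>: "\<delta> > 0" "\<And>y q. norm (y - y0) < \<delta> \<Longrightarrow> norm (q - p) < \<delta> \<Longrightarrow>
       blinfun_apply q (1, 0) + H (fst y) (chart_inv \<kappa> (snd y)) (codual \<kappa> (chart_inv \<kappa> (snd y)) q) < 0"
      using hamiltonian_nbhd[OF \<kappa> x t _ neg] unfolding y0_def by auto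
    obtain S g g' where S: "open S" "y0 \<in> S" "C1d S g g'" "g' y0 = p"
      "\<forall>z\<in>S. local_rep \<kappa> l y0 - g y0 \<le> local_rep \<kappa> l z - g z" using p unfolding C1_subgrad_def by blast
    obtain r1 where r1: "r1 > 0" "\<forall>z. dist z y0 < r1 \<longrightarrow> z \<in> S \<and> dist (g' z) (g' y0) < \<delta> / 2"
      using continuous_nbhd_radius[OF C1d_contD[OF S(3)] S(1,2), of "\<delta> / 2"] \<delta>(1) by auto
    obtain r2 where r2: "r2 > 0" "\<forall>y\<in>cball y0 r2. y \<in> S \<and> 0 < fst y \<and> snd y \<in> chart_map \<kappa> ` chart_dom \<kappa>"
      using chart_cball[OF \<kappa> x t S(1) S(2)[unfolded y0_def]] unfolding y0_def by blast
    obtain r3 where r3: "r3 > 0" "\<forall>z. dist z y0 < r3 \<longrightarrow> z \<in> S \<and> dist (g z) (g y0) < e / 4"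
      using continuous_nbhd_radius[OF C1d_continuous_on[OF S(3)] S(1,2), of "e / 4"] e by auto
    have "continuous_on (UNIV \<times> chart_map \<kappa> ` chart_dom \<kappa>) (local_rep \<kappa> (barrier K\<^sub>0))"
    proof -
      have "continuous_on (UNIV \<times> chart_map \<kappa> ` chart_dom \<kappa>) (\<lambda>y. barrier K\<^sub>0 (fst y, chart_inv \<kappa> (snd y)))"
        by (intro continuous_on_compose2[OF barrier_continuous[of UNIV]] continuous_intros continuous_on_compose2[OF chart_cont(2)[OF \<kappa>]]) auto
      then show ?thesis by (simp add: local_rep_def[abs_def] case_prod_unfold)
    qed
    moreover have "open (UNIV \<times> chart_map \<kappa> ` chart_dom \<kappa> :: (real \<times> 'x) set)" using chart_open[OF \<kappa>] by (intro open_Times) auto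
    moreover have "y0 \<in> UNIV \<times> chart_map \<kappa> ` chart_dom \<kappa>" using x by (simp add: y0_def)
    ultimately obtain r4 where r4: "r4 > 0" "\<forall>z. dist z y0 < r4 \<longrightarrow> z \<in> UNIV \<times> chart_map \<kappa> ` chart_dom \<kappa> \<and>
        dist (local_rep \<kappa> (barrier K\<^sub>0) z) (local_rep \<kappa> (barrier K\<^sub>0) y0) < e / 4"
      using continuous_nbhd_radius[of _ "local_rep \<kappa> (barrier K\<^sub>0)" y0 "e / 4"] e by (metis zero_less_divide_iff zero_less_numeral)
    obtain r5 where r5: "r5 > 0" "cball (chart_map \<kappa> x) r5 \<subseteq> chart_map \<kappa> ` chart_dom \<kappa>"
      "\<forall>s\<le>r5. closed (chart_inv \<kappa> ` cball (chart_map \<kappa> x) s)" using chart_closed_ball[OF \<kappa> x open_UNIV] by auto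
    define R where "R = min (min r1 r2) (min (min r3 r4) (min r5 \<delta>))"
    have R: "R > 0" "R \<le> r1" "R \<le> r2" "R \<le> r3" "R \<le> r4" "R \<le> r5" "R \<le> \<delta>"
      using r1(1) r2(1) r3(1) r4(1) r5(1) \<delta>(1) by (auto simp: R_def)
    define r where "r = R / 2"
    have r: "r > 0" "r < R" using R(1) by (auto simp: r_def)
    have C: "y \<in> S" "0 < fst y" "snd y \<in> chart_map \<kappa> ` chart_dom \<kappa>" "norm (g' y - p) < \<delta> / 2" "\<bar>g y - g y0\<bar> < e / 4"
       "\<bar>local_rep \<kappa> (barrier K\<^sub>0) y - barrier K\<^sub>0 (t, x)\<bar> < e / 4" "norm (y - y0) < \<delta>" if "y \<in> ball y0 R" for y
    proof -
      have d: "dist y y0 < r1" "dist y y0 < r3" "dist y y0 < r4" "dist y y0 < \<delta>" "y \<in> cball y0 r2" using that R by (auto simp: dist_commute)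
      show "y \<in> S" "norm (g' y - p) < \<delta> / 2" using r1(2)[rule_format, OF d(1)] S(4) by (simp_all add: dist_norm)
      show "0 < fst y" "snd y \<in> chart_map \<kappa> ` chart_dom \<kappa>" using bspec[OF r2(2) d(5)] by simp_all
      show "\<bar>g y - g y0\<bar> < e / 4" using r3(2)[rule_format, OF d(2)] by (simp add: dist_real_def)
      show "\<bar>local_rep \<kappa> (barrier K\<^sub>0) y - barrier K\<^sub>0 (t, x)\<bar> < e / 4" using r4(2)[rule_format, OF d(3)] y0b by (simp add: dist_real_def)
      show "norm (y - y0) < \<delta>" using d(4) by (simp add: dist_norm)
    qed
    note bmp = C1d_bump_rescaled[OF bump r(1)]
    have Kb: "0 \<le> K\<^sub>\<beta>" by (rule bmp(7))
    define k where "k = min (e / 4) (\<delta> * r / (4 * (K\<^sub>\<beta> + 1)))"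
    have k: "k > 0" using \<delta>(1) r(1) Kb e by (simp add: k_def)
    have ke: "k \<le> e / 4" unfolding k_def by (rule min.cobounded1)
    have kK: "k * (K\<^sub>\<beta> / r) < \<delta> / 2"
    proof -
      have "k * (K\<^sub>\<beta> / r) \<le> \<delta> * r / (4 * (K\<^sub>\<beta> + 1)) * (K\<^sub>\<beta> / r)" using Kb r(1) by (intro mult_right_mono) (auto simp: k_def)
      also have "\<dots> = \<delta> / 4 * (K\<^sub>\<beta> / (K\<^sub>\<beta> + 1))" using r(1) Kb by (simp add: field_simps)
      also have "\<dots> \<le> \<delta> / 4 * 1" using Kb \<delta>(1) by (intro mult_left_mono) auto
      finally show ?thesis using \<delta>(1) by linarith
    qed
    let ?B = "\<lambda>y. \<beta> ((1 / r) *\<^sub>R (y - y0))"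
    let ?B' = "\<lambda>y. (1 / r) *\<^sub>R \<beta>' ((1 / r) *\<^sub>R (y - y0))"
    define c where "c = l (t, x) - g y0"
    \<comment> \<open>The constant \<open>c\<close> makes \<open>c + g\<close> touch
      \<open>l\<close> from below at the base point. Since \<open>l\<close> is below
      \<open>U\<close>, only the bump can lift \<psi> above \<open>U\<close>, and it does so at most
      inside \<open>K\<close>.\<close>
    define \<psi> where "\<psi> y = (c + g y) + k * ?B y" for y
    define \<psi>' where "\<psi>' y = (0 + g' y) + k *\<^sub>R ?B' y" for y
    have \<psi>C1: "C1d S \<psi> \<psi>'" unfolding \<psi>_def[abs_def] \<psi>'_def[abs_def] by (intro C1d_add S(3) C1d_cmult bmp(1) C1d_const)
    \<comment> \<open>Both \<open>Ob\<close> and the complement of \<open>K\<close> are open and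
      they cover space-time. On the first, \<open>w\<close> is a maximum of \<open>U\<close> and a
      continuous function; on the second it is \<open>U\<close>. All local properties of
      \<open>w\<close> are checked on these two sets.\<close>
    define Ob where "Ob = {q. snd q \<in> chart_dom \<kappa> \<and> \<Phi> q \<in> ball y0 R}"
    define K where "K = {q. snd q \<in> chart_dom \<kappa> \<and> \<Phi> q \<in> cball y0 r}"
    have oO: "open Ob" unfolding Ob_def \<Phi>_def by (rule open_chart_box[OF \<kappa> open_ball])
    have "cball (chart_map \<kappa> x) r \<subseteq> chart_map \<kappa> ` chart_dom \<kappa>" using r5(2) subset_cball[of r r5] r(2) R(6) by fastforce
    then have cK: "closed K" unfolding K_def \<Phi>_def using r5(3) r(2) R(6) by (intro closed_chart_box[OF \<kappa>]) (auto simp: y0_def)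
    have KO: "K \<subseteq> Ob" using r(2) by (auto simp: K_def Ob_def)
    define w where "w q = (if q \<in> Ob then max (U q) (\<psi> (\<Phi> q)) else U q)" for q
    have OC: "\<Phi> q \<in> ball y0 R" "snd q \<in> chart_dom \<kappa>" "0 < fst q" "q \<in> spacetime" if "q \<in> Ob" for q
      using that C(2)[of "\<Phi> q"] by (auto simp: Ob_def \<Phi>_def mem_Times_iff less_imp_le simp del: mem_ball)
    have rep: "local_rep \<kappa> v (\<Phi> q) = v q" if "snd q \<in> chart_dom \<kappa>" for v and q :: "real \<times> 'm"
      using that by (simp add: local_rep_pair \<Phi>_def chart_inv_map[OF \<kappa>])
    have off: "w q = U q" if "q \<notin> K" for q
    proof (cases "q \<in> Ob")
      case True
      then have "r \<le> norm (\<Phi> q - y0)" using that OC(2)[OF True] by (auto simp: K_def dist_norm norm_minus_commute)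
      then have "?B (\<Phi> q) = 0" by (rule bmp(3))
      moreover have "l (t, x) - g y0 \<le> l q - g (\<Phi> q)"
        using bspec[OF S(5) C(1)[OF OC(1)[OF True]]] rep[OF OC(2)[OF True], of l] y0l by simp
      ultimately have "\<psi> (\<Phi> q) \<le> U q" using lU[OF OC(4)[OF True]] by (simp add: \<psi>_def c_def)
      then show ?thesis using True by (simp add: w_def)
    qed (simp add: w_def)
    have Uw: "U q \<le> w q" for q by (simp add: w_def)
    have wb: "w q \<le> barrier K\<^sub>0 q" if q: "q \<in> spacetime" for q
    proof (cases "q \<in> Ob")
      case True
      have "k * ?B (\<Phi> q) \<le> k * 1" using bmp(6) k by (intro mult_left_mono) auto
      then have "\<psi> (\<Phi> q) \<le> l (t, x) + e / 2" using C(5)[OF OC(1)[OF True]] ke unfolding \<psi>_def c_def by linarith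
      also have "\<dots> \<le> barrier K\<^sub>0 q"
      proof -
        have "\<bar>barrier K\<^sub>0 q - barrier K\<^sub>0 (t, x)\<bar> < e / 4"
          using C(6)[OF OC(1)[OF True]] unfolding rep[OF OC(2)[OF True]] .
        then have "barrier K\<^sub>0 (t, x) - e / 4 < barrier K\<^sub>0 q" by linarith
        moreover have "barrier K\<^sub>0 (t, x) = l (t, x) + e" by (simp add: e_def)
        ultimately show ?thesis using e by linarith
      qed
      finally show ?thesis using Ub[OF q] True by (simp add: w_def)
    qed (use Ub[OF q] in \<open>simp add: w_def\<close>)
    have \<Phi>_cont: "((\<lambda>q. \<psi> (\<Phi> q)) \<longlongrightarrow> \<psi> (\<Phi> q0)) (nhds q0)" if "q0 \<in> Ob" for q0
    proof -
      have "isCont \<psi> (\<Phi> q0)" using C1d_continuous_on[OF \<psi>C1] S(1) C(1)[OF OC(1)[OF that]] by (simp add: continuous_on_eq_continuous_at)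
      then have "(\<psi> \<longlongrightarrow> \<psi> (\<Phi> q0)) (nhds (\<Phi> q0))" by (simp add: isCont_def tendsto_at_iff_tendsto_nhds)
      moreover have "(\<Phi> \<longlongrightarrow> \<Phi> q0) (nhds q0)"
        using tendsto_spacetime_chart(1)[OF \<kappa> OC(2)[OF that], of "fst q0"] by (simp add: \<Phi>_def[abs_def])
      ultimately show ?thesis by (rule filterlim_compose)
    qed
    have usc_w: "usc_on spacetime w"
    proof (rule usc_onI_nhds)
      fix q0 a assume q0: "q0 \<in> spacetime" and a: "w q0 < a"
      have 1: "\<forall>\<^sub>F q in nhds q0. q \<in> spacetime \<longrightarrow> U q < a" using usc_on_nhds[OF U(1) q0] Uw[of q0] a by simp
      show "\<forall>\<^sub>F q in nhds q0. q \<in> spacetime \<longrightarrow> w q < a"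
      proof (cases "q0 \<in> Ob")
        case True
        have "\<psi> (\<Phi> q0) < a" using a True by (simp add: w_def)
        from order_tendstoD(2)[OF \<Phi>_cont[OF True] this] 1 show ?thesis
          by eventually_elim (simp add: w_def)
      next
        case False
        then have "q0 \<in> - K" using KO by blast
        then have "\<forall>\<^sub>F q in nhds q0. q \<in> - K" using cK by (intro eventually_nhds_in_open) auto
        with 1 show ?thesis by eventually_elim (simp add: off)
      qed
    qed
    have sub_w: "sub_ineq w" unfolding sub_ineq_iff
    proof (intro allI impI)
      fix s :: real and z assume s: "s > 0"
      show "\<exists>\<kappa>\<in>\<A>. z \<in> chart_dom \<kappa> \<and>
        (\<forall>p. C1_subgrad (\<lambda>y. - local_rep \<kappa> w y) (s, chart_map \<kappa> z) p \<longrightarrow> - blinfun_apply p (1, 0) + H s z (codual \<kappa> z p) \<le> 0)"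
      proof (cases "(s, z) \<in> Ob")
        case False
        then have "(s, z) \<in> - K" using KO by blast
        then have "\<forall>\<^sub>F q in nhds (s, z). q \<in> - K" using cK by (intro eventually_nhds_in_open) auto
        then have ev: "\<forall>\<^sub>F q in nhds (s, z). - w q = - U q" by eventually_elim (simp add: off)
        obtain \<kappa>2 where k2: "\<kappa>2 \<in> \<A>" "z \<in> chart_dom \<kappa>2" using chart_exists by blast
        have ev2: "\<forall>\<^sub>F y in nhds (s, chart_map \<kappa>2 z). - local_rep \<kappa>2 w y = - local_rep \<kappa>2 U y"
          using iffD1[OF eventually_chart_iff[OF k2] ev] by (simp add: local_rep_pair)
        have "- blinfun_apply p (1, 0) + H s z (codual \<kappa>2 z p) \<le> 0" if "C1_subgrad (\<lambda>y. - local_rep \<kappa>2 w y) (s, chart_map \<kappa>2 z) p" for p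
          by (rule sub_ineqD[OF U(2) k2 s C1_subgrad_cong_nhds[OF ev2 that]])
        then show ?thesis using k2 by blast
      next
        case True
        have zz: "z \<in> chart_dom \<kappa>" "\<Phi> (s, z) = (s, chart_map \<kappa> z)" "(s, chart_map \<kappa> z) \<in> ball y0 R"
          using OC[OF True] by (simp_all add: \<Phi>_def)
        have evO: "\<forall>\<^sub>F y in nhds (s, chart_map \<kappa> z). y \<in> ball y0 R" by (rule eventually_nhds_in_open[OF open_ball zz(3)])
        have wy: "local_rep \<kappa> w y = max (local_rep \<kappa> U y) (\<psi> y)" if "y \<in> ball y0 R" for y
        proof -
          have "snd y \<in> chart_map \<kappa> ` chart_dom \<kappa>" by (rule C(3)[OF that])
          then have "(fst y, chart_inv \<kappa> (snd y)) \<in> Ob" "\<Phi> (fst y, chart_inv \<kappa> (snd y)) = y"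
            using that chart_inv_dom[OF \<kappa>] chart_map_inv[OF \<kappa>] by (auto simp: Ob_def \<Phi>_def simp del: mem_ball)
          then show ?thesis by (simp add: local_rep_pair w_def)
        qed
        \<comment> \<open>If \<open>U\<close> attains the maximum, the gradient is one for
          \<open>U\<close>. Otherwise it must be the gradient of the C^1 function \<psi>, which is
          within \<delta> of \<open>p\<close>, where the strict inequality still holds.\<close>
        have "- blinfun_apply q (1, 0) + H s z (codual \<kappa> z q) \<le> 0" if q: "C1_subgrad (\<lambda>y. - local_rep \<kappa> w y) (s, chart_map \<kappa> z) q" for q
        proof (cases "\<psi> (s, chart_map \<kappa> z) \<le> local_rep \<kappa> U (s, chart_map \<kappa> z)")
          case True
          have "C1_subgrad (\<lambda>y. - local_rep \<kappa> U y) (s, chart_map \<kappa> z) q"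
          proof (rule C1_subgrad_touching[OF q])
            show "\<forall>\<^sub>F y in nhds (s, chart_map \<kappa> z). - local_rep \<kappa> w y \<le> - local_rep \<kappa> U y" using evO by eventually_elim (simp add: wy del: mem_ball)
            show "- local_rep \<kappa> w (s, chart_map \<kappa> z) = - local_rep \<kappa> U (s, chart_map \<kappa> z)" using wy[OF zz(3)] True by simp
          qed
          then show ?thesis by (rule sub_ineqD[OF U(2) \<kappa> zz(1) s])
        next
          case False
          have "C1_subgrad (\<lambda>y. - \<psi> y) (s, chart_map \<kappa> z) q"
          proof (rule C1_subgrad_touching[OF q])
            show "\<forall>\<^sub>F y in nhds (s, chart_map \<kappa> z). - local_rep \<kappa> w y \<le> - \<psi> y" using evO by eventually_elim (simp add: wy del: mem_ball)
            show "- local_rep \<kappa> w (s, chart_map \<kappa> z) = - \<psi> (s, chart_map \<kappa> z)" using wy[OF zz(3)] False by simp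
          qed
          from C1_subgrad_of_C1[OF this C1d_minus[OF \<psi>C1] S(1) C(1)[OF zz(3)]] have qe: "q = - \<psi>' (s, chart_map \<kappa> z)" .
          have "norm (\<psi>' (s, chart_map \<kappa> z) - p) < \<delta>"
          proof -
            let ?y = "(s, chart_map \<kappa> z)"
            have "\<psi>' ?y - p = (g' ?y - p) + k *\<^sub>R ?B' ?y" by (simp add: \<psi>'_def)
            then have "norm (\<psi>' ?y - p) \<le> norm (g' ?y - p) + norm (k *\<^sub>R ?B' ?y)" by (simp only: norm_triangle_ineq)
            also have "norm (k *\<^sub>R ?B' ?y) \<le> k * (K\<^sub>\<beta> / r)" unfolding norm_scaleR[of k] using bmp(2)[of ?y y0] k by (intro mult_mono) auto
            finally show ?thesis using C(4)[OF zz(3)] kK by linarith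
          qed
          from \<delta>(2)[OF C(7)[OF zz(3)] this] show ?thesis
            by (simp add: qe codual_minus[OF \<kappa> zz(1)] uminus_blinfun.rep_eq chart_inv_map[OF \<kappa> zz(1)])
        qed
        then show ?thesis using \<kappa> zz(1) by blast
      qed
    qed
    have tx: "(t, x) \<in> Ob" using x R(1) by (simp add: Ob_def \<Phi>_def y0_def)
    have psi0: "\<psi> (\<Phi> (t, x)) = l (t, x) + k" using bmp(4)[of y0] by (simp add: \<psi>_def c_def \<Phi>_def y0_def)
    \<comment> \<open>Near the base point \<psi> stays above l + k/2, while \<open>approx\<close>
      provides nearby points where \<open>U\<close> is below that value. There \<open>w\<close>
      exceeds \<open>U\<close>, against maximality.\<close>
    have "\<forall>\<^sub>F q in nhds (t, x). l (t, x) + k / 2 < \<psi> (\<Phi> q)"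
      by (rule order_tendstoD(1)[OF \<Phi>_cont[OF tx]]) (use psi0 k in simp)
    then obtain T where T: "open T" "(t, x) \<in> T" "\<forall>q\<in>T. l (t, x) + k / 2 < \<psi> (\<Phi> q)" unfolding eventually_nhds by (elim exE conjE)
    have "open (T \<inter> Ob)" "(t, x) \<in> T \<inter> Ob" using T oO tx by auto
    then obtain q where q: "q \<in> T \<inter> Ob" "q \<in> spacetime" "U q < l (t, x) + k / 2"
      using approx[of "(t, x)" "l (t, x) + k / 2" "T \<inter> Ob"] t k by auto
    have "w q \<le> U q" by (rule max[OF usc_w sub_w _ q(2)]) (use Uw wb in auto)
    moreover have "\<psi> (\<Phi> q) \<le> w q" using q(1) by (simp add: w_def)
    ultimately show False using q T(3) by force
  qed
  then show "\<exists>\<kappa>\<in>\<A>. x \<in> chart_dom \<kappa> \<and>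
     (\<forall>p. C1_subgrad (local_rep \<kappa> l) (t, chart_map \<kappa> x) p \<longrightarrow> blinfun_apply p (1, 0) + H t x (codual \<kappa> x p) \<ge> 0)"
    using \<kappa> x unfolding y0_def by blast
qed

section \<open>Comparison\<close>

text \<open>The covectors \<open>a\<^sub>1\<close> and \<open>- a\<^sub>2\<close> are nearly equal
  with two kinds of error: \<eta> in the chart norm, chosen after the chart, and 2 \<epsilon> in the
  Finsler norm at \<open>x\<close>, the trace of the Ekeland slope. \<open>R\<close> bounds the
  gradient of the locally Lipschitz function.\<close>

definition hamiltonian_close :: "('m, 'x) chart \<Rightarrow> 'm \<Rightarrow> real \<Rightarrow> real \<Rightarrow> real \<Rightarrow> real \<Rightarrow> real \<Rightarrow> real \<Rightarrow> bool" where
  "hamiltonian_close \<kappa> x t R \<theta> \<epsilon> \<eta> r \<longleftrightarrow>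
     (\<forall>y\<^sub>1 y\<^sub>2 a\<^sub>1 a\<^sub>2. norm (y\<^sub>1 - (t, chart_map \<kappa> x)) < r \<longrightarrow> norm (y\<^sub>2 - (t, chart_map \<kappa> x)) < r \<longrightarrow>
       (\<forall>v. \<bar>blinfun_apply (a\<^sub>1 + a\<^sub>2) (0, v)\<bar> \<le> \<eta> * norm v + 2 * \<epsilon> * cnorm \<kappa> x v) \<longrightarrow> norm a\<^sub>2 \<le> R \<longrightarrow>
       0 < fst y\<^sub>1 \<and> 0 < fst y\<^sub>2 \<and> snd y\<^sub>1 \<in> chart_map \<kappa> ` chart_dom \<kappa> \<and> snd y\<^sub>2 \<in> chart_map \<kappa> ` chart_dom \<kappa> \<and>
       \<bar>H (fst y\<^sub>1) (chart_inv \<kappa> (snd y\<^sub>1)) (codual \<kappa> (chart_inv \<kappa> (snd y\<^sub>1)) a\<^sub>1) -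
        H (fst y\<^sub>2) (chart_inv \<kappa> (snd y\<^sub>2)) (codual \<kappa> (chart_inv \<kappa> (snd y\<^sub>2)) a\<^sub>2)\<bar> \<le> \<theta>)"

text \<open>The order of the quantifiers is the point: \<epsilon> depends on \<theta> and
  \<open>H\<close> only, \<eta> also on the chart, and \<open>r\<close> on everything including
  \<open>R\<close>. This is possible because an error 2 \<epsilon> in the Finsler norm changes dual
  norms at \<open>x\<close> by 2 \<epsilon> whatever the chart, while the term of (A) that grows
  with the gradients is multiplied by a distance controlled by \<open>r\<close>.\<close>

lemma hamiltonian_gap:
  assumes A: "condition_A \<A> N H" and \<theta>: "\<theta> > 0"
  shows "\<exists>\<epsilon>>0. \<epsilon> \<le> \<theta> \<and> (\<forall>\<kappa>\<in>\<A>. \<forall>x\<in>chart_dom \<kappa>. \<forall>t>0. \<forall>R\<ge>0. \<exists>\<eta>>0. \<eta> \<le> \<theta> \<and> (\<exists>r>0. hamiltonian_close \<kappa> x t R \<theta> \<epsilon> \<eta> r))"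
proof -
  obtain C \<omega> where C: "C \<ge> 0" and \<omega>: "continuous_on ({0..} \<times> UNIV) (\<omega> :: real \<times> real \<times> real \<Rightarrow> real)" "\<omega> (0, 0, 0) = 0"
    and HA0: "\<forall>t\<^sub>1\<ge>0. \<forall>t\<^sub>2\<ge>0. \<forall>x\<^sub>1 x\<^sub>2 r\<^sub>1 r\<^sub>2. \<bar>H t\<^sub>1 x\<^sub>1 r\<^sub>1 - H t\<^sub>2 x\<^sub>2 r\<^sub>2\<bar> \<le>
          \<omega> (\<bar>t\<^sub>1 - t\<^sub>2\<bar>, fdist x\<^sub>1 x\<^sub>2, r\<^sub>1 - r\<^sub>2) + C * max \<bar>r\<^sub>1\<bar> \<bar>r\<^sub>2\<bar> * (\<bar>t\<^sub>1 - t\<^sub>2\<bar> + fdist x\<^sub>1 x\<^sub>2)"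
    using A unfolding condition_A_def by (elim exE conjE) (rule that)
  note HA = HA0[rule_format]
  obtain e where e: "e > 0" "\<And>w. w \<in> {0..} \<times> UNIV \<Longrightarrow> dist w (0,0,0) < e \<Longrightarrow> dist (\<omega> w) (\<omega> (0,0,0)) < \<theta> / 2"
    using \<omega>(1)[unfolded continuous_on_iff, rule_format, of "(0,0,0)" "\<theta> / 2"] \<theta> by auto
  define e1 where "e1 = e / 3"
  have e1: "e1 > 0" using e by (simp add: e1_def)
  have om: "\<omega> (s, d, \<rho>) < \<theta> / 2" if "0 \<le> s" "s < e1" "\<bar>d\<bar> < e1" "\<bar>\<rho>\<bar> < e1" for s d \<rho>
  proof -
    have "dist (s, d, \<rho>) (0, 0, 0) \<le> \<bar>s\<bar> + (\<bar>d\<bar> + \<bar>\<rho>\<bar>)"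
      using norm_Pair_le[of s "(d, \<rho>)"] norm_Pair_le[of d \<rho>] by (simp add: dist_norm)
    also have "\<dots> < e" using that by (simp add: e1_def)
    finally have "dist (\<omega> (s, d, \<rho>)) (\<omega> (0,0,0)) < \<theta> / 2" using that by (intro e(2)) auto
    then show ?thesis using \<omega>(2) by (simp add: dist_real_def abs_less_iff)
  qed
  define \<epsilon> where "\<epsilon> = min \<theta> (e1 / 8)"
  have \<epsilon>: "\<epsilon> > 0" "\<epsilon> \<le> \<theta>" "\<epsilon> \<le> e1 / 8" unfolding \<epsilon>_def using \<theta> e1 by (simp, intro min.cobounded1, intro min.cobounded2)
  show ?thesis
  proof (rule exI[of _ \<epsilon>], intro conjI ballI allI impI)
    fix \<kappa> x and t R :: real assume \<kappa>: "\<kappa> \<in> \<A>" and x: "x \<in> chart_dom \<kappa>" and t: "t > 0" and R: "R \<ge> 0"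
    obtain \<alpha> b where ab: "\<alpha> > 0" "b > 0" "\<And>v. \<alpha> * norm v \<le> cnorm \<kappa> x v" "\<And>v. cnorm \<kappa> x v \<le> b * norm v"
      using cnorm_equiv[OF \<kappa> x] by blast
    define \<eta> where "\<eta> = min \<theta> (\<alpha> * (e1 / 8))"
    have \<eta>: "\<eta> > 0" "\<eta> \<le> \<theta>" "\<eta> \<le> \<alpha> * (e1 / 8)" unfolding \<eta>_def using \<theta> e1 ab(1) by (simp, intro min.cobounded1, intro min.cobounded2)
    \<comment> \<open>Bounds the dual norms at \<open>x\<close> of both covectors: R/\<alpha> for
      the second by the chart constant, and \<open>e1\<close> for the discrepancy with the
      first.\<close>
    define R1 where "R1 = R / \<alpha> + e1"
    have R1: "R1 > 0" using R ab(1) e1 by (simp add: R1_def add_nonneg_pos)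
    \<comment> \<open>Moving the base point from \<open>x\<close> to the two contact points then
      changes a dual norm of size at most \<open>R1\<close> by at most e1/8.\<close>
    define \<epsilon>2 where "\<epsilon>2 = min 1 (e1 / (16 * R1))"
    have \<epsilon>2: "\<epsilon>2 > 0" "\<epsilon>2 \<le> 1" "\<epsilon>2 \<le> e1 / (16 * R1)" unfolding \<epsilon>2_def using e1 R1 by (simp, intro min.cobounded1, intro min.cobounded2)
    have \<epsilon>2R: "\<epsilon>2 * R1 \<le> e1 / 16"
    proof -
      have "\<epsilon>2 * R1 \<le> e1 / (16 * R1) * R1" using \<epsilon>2(3) R1 by (intro mult_right_mono) auto
      also have "\<dots> = e1 / 16" using R1 by simp
      finally show ?thesis .
    qed
    obtain W where W: "open W" "x \<in> W" "\<And>y v. y \<in> W \<Longrightarrow> cnorm \<kappa> x v \<le> (1 + \<epsilon>2) * cnorm \<kappa> y v \<and> cnorm \<kappa> y v \<le> (1 + \<epsilon>2) * cnorm \<kappa> x v"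
      using cnorm_compare[OF \<kappa> x \<epsilon>2(1)] by blast
    obtain rW where rW: "rW > 0" "ball (chart_map \<kappa> x) rW \<subseteq> chart_map \<kappa> ` chart_dom \<kappa>" "\<forall>y\<in>ball (chart_map \<kappa> x) rW. chart_inv \<kappa> y \<in> W"
      using chart_ball_in[OF \<kappa> x W(1,2)] by blast
    obtain rd where rd: "rd > 0" "\<forall>y\<in>ball (chart_map \<kappa> x) rd. \<forall>y'\<in>ball (chart_map \<kappa> x) rd.
        fdist (chart_inv \<kappa> y) (chart_inv \<kappa> y') \<le> (1 + 1) * cnorm \<kappa> x (y' - y)"
      using fdist_chart[OF \<kappa> x, of 1] by auto
    define D where "D = (C + 1) * R1"
    have D: "D > 0" using C R1 by (simp add: D_def add_nonneg_pos)
    \<comment> \<open>\<open>s\<close> will bound the space-time distance of the two contact points: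
      below e1/2 for the modulus \<omega>, and so small that C times the gradient bound times
      \<open>s\<close> is at most \<theta>/4. Using C + 1 in \<open>D\<close> keeps the denominator
      positive.\<close>
    define s where "s = min (e1 / 2) (\<theta> / (8 * D))"
    have s: "s > 0" "s \<le> e1 / 2" "s \<le> \<theta> / (8 * D)" unfolding s_def using e1 \<theta> D
      by (simp, intro min.cobounded1, intro min.cobounded2)
    define r where "r = min (min rW rd) (min t (s / (2 + 4 * b)))"
    have "0 < s / (2 + 4 * b)" using s(1) ab(2) by simp
    then have r: "r > 0" "r \<le> rW" "r \<le> rd" "r \<le> t" "r \<le> s / (2 + 4 * b)"
      using rW(1) rd(1) t unfolding r_def by (simp, (meson min.cobounded1 min.cobounded2 order_trans)+)
    have rs: "2 * r + 4 * b * r \<le> s"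
    proof -
      have "r * (2 + 4 * b) \<le> s" using r(5) ab(2) by (simp add: pos_le_divide_eq)
      then show ?thesis by (simp add: algebra_simps)
    qed
    let ?y0 = "(t, chart_map \<kappa> x)"
    show "\<exists>\<eta>>0. \<eta> \<le> \<theta> \<and> (\<exists>r>0. hamiltonian_close \<kappa> x t R \<theta> \<epsilon> \<eta> r)"
    proof (rule exI[of _ \<eta>], intro conjI \<eta>(1,2), rule exI[of _ r], rule conjI[OF r(1)], unfold hamiltonian_close_def, intro allI impI)
      fix y1 y2 and a1 a2 :: "(real \<times> 'x) \<Rightarrow>\<^sub>L real"
      assume y: "norm (y1 - ?y0) < r" "norm (y2 - ?y0) < r"
        and a: "\<forall>v. \<bar>blinfun_apply (a1 + a2) (0, v)\<bar> \<le> \<eta> * norm v + 2 * \<epsilon> * cnorm \<kappa> x v" and a2: "norm a2 \<le> R"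
      have comp: "\<bar>fst y - t\<bar> < r" "norm (snd y - chart_map \<kappa> x) < r" if "norm (y - ?y0) < r" for y
      proof -
        have eq: "y - ?y0 = (fst y - t, snd y - chart_map \<kappa> x)" by (simp add: prod_eq_iff)
        show "\<bar>fst y - t\<bar> < r" using norm_fst_le[of "fst y - t" "snd y - chart_map \<kappa> x"] that unfolding eq by simp
        show "norm (snd y - chart_map \<kappa> x) < r" using norm_snd_le[where x = "fst y - t" and y = "snd y - chart_map \<kappa> x"] that unfolding eq by simp
      qed
      let ?x1 = "chart_inv \<kappa> (snd y1)" and ?x2 = "chart_inv \<kappa> (snd y2)"
      have ball: "snd y1 \<in> ball (chart_map \<kappa> x) rW" "snd y2 \<in> ball (chart_map \<kappa> x) rW"
         "snd y1 \<in> ball (chart_map \<kappa> x) rd" "snd y2 \<in> ball (chart_map \<kappa> x) rd"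
        using comp(2)[OF y(1)] comp(2)[OF y(2)] r by (auto simp: dist_norm norm_minus_commute)
      have img: "snd y1 \<in> chart_map \<kappa> ` chart_dom \<kappa>" "snd y2 \<in> chart_map \<kappa> ` chart_dom \<kappa>" using ball(1,2) rW(2) by blast+
      have xd: "?x1 \<in> chart_dom \<kappa>" "?x2 \<in> chart_dom \<kappa>" using chart_inv_dom[OF \<kappa>] img by auto
      have tpos: "0 < fst y1" "0 < fst y2" using comp(1)[OF y(1)] comp(1)[OF y(2)] r(4) by linarith+
      have dle: "fdist ?x1 ?x2 \<le> 4 * b * r"
      proof -
        have "norm (snd y2 - snd y1) \<le> norm (snd y2 - chart_map \<kappa> x) + norm (snd y1 - chart_map \<kappa> x)"
          using norm_triangle_ineq4[of "snd y2 - chart_map \<kappa> x" "snd y1 - chart_map \<kappa> x"] by simp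
        then have n: "norm (snd y2 - snd y1) \<le> 2 * r" using comp(2)[OF y(1)] comp(2)[OF y(2)] by linarith
        have "fdist ?x1 ?x2 \<le> (1 + 1) * cnorm \<kappa> x (snd y2 - snd y1)" using rd(2) ball(3,4) by blast
        also have "\<dots> \<le> (1 + 1) * (b * norm (snd y2 - snd y1))" using ab(4) by (intro mult_left_mono) auto
        also have "\<dots> \<le> (1 + 1) * (b * (2 * r))" using n ab(2) by (intro mult_left_mono) auto
        finally show ?thesis by simp
      qed
      have tle: "\<bar>fst y1 - fst y2\<bar> \<le> 2 * r" using comp(1)[OF y(1)] comp(1)[OF y(2)] by linarith
      let ?c1 = "codual \<kappa> x a1" and ?c2 = "codual \<kappa> x a2"
      have diff: "\<bar>blinfun_apply (a1 + a2) (0, v)\<bar> \<le> (e1 / 8 + 2 * \<epsilon>) * cnorm \<kappa> x v" for v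
      proof -
        have "\<eta> * norm v \<le> \<alpha> * (e1 / 8) * norm v" using \<eta>(3) by (intro mult_right_mono) auto
        also have "\<dots> = (e1 / 8) * (\<alpha> * norm v)" by simp
        also have "\<dots> \<le> (e1 / 8) * cnorm \<kappa> x v" using ab(3) e1 by (intro mult_left_mono) auto
        finally show ?thesis using a[rule_format, of v] by (simp add: distrib_right)
      qed
      have c12: "?c1 \<le> ?c2 + (e1 / 8 + 2 * \<epsilon>)"
      proof -
        have "?c1 \<le> codual \<kappa> x (- a2) + (e1 / 8 + 2 * \<epsilon>)"
          by (rule codual_triangle[OF \<kappa> x]) (use diff e1 \<epsilon>(1) in auto)
        then show ?thesis by (simp add: codual_minus[OF \<kappa> x])
      qed
      have c21: "?c2 \<le> ?c1 + (e1 / 8 + 2 * \<epsilon>)"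
      proof -
        have "?c2 \<le> codual \<kappa> x (- a1) + (e1 / 8 + 2 * \<epsilon>)"
          by (rule codual_triangle[OF \<kappa> x]) (use diff e1 \<epsilon>(1) in \<open>auto simp: add.commute\<close>)
        then show ?thesis by (simp add: codual_minus[OF \<kappa> x])
      qed
      have c2R: "?c2 \<le> R / \<alpha>"
      proof (rule codual_le[OF \<kappa> x])
        show "0 \<le> R / \<alpha>" using R ab(1) by simp
        fix v
        have "\<bar>blinfun_apply a2 (0, v)\<bar> \<le> norm a2 * norm v" by (rule abs_blinfun_snd_le)
        also have "\<dots> \<le> R * norm v" using a2 by (intro mult_right_mono) auto
        also have "\<dots> = R / \<alpha> * (\<alpha> * norm v)" using ab(1) by simp
        also have "\<dots> \<le> R / \<alpha> * cnorm \<kappa> x v" using ab R by (intro mult_left_mono) auto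
        finally show "\<bar>blinfun_apply a2 (0, v)\<bar> \<le> R / \<alpha> * cnorm \<kappa> x v" .
      qed
      have cR: "?c1 \<le> R1" "?c2 \<le> R1" using c12 c2R \<epsilon>(3) e1 by (auto simp: R1_def)
      let ?r1 = "codual \<kappa> ?x1 a1" and ?r2 = "codual \<kappa> ?x2 a2"
      have rc: "\<bar>?r1 - ?c1\<bar> \<le> e1 / 8" "\<bar>?r2 - ?c2\<bar> \<le> e1 / 8"
      proof -
        have xW: "?x1 \<in> W" "?x2 \<in> W" using rW(3) ball(1,2) by auto
        have "\<epsilon>2 * ?c1 \<le> \<epsilon>2 * R1" "\<epsilon>2 * ?c2 \<le> \<epsilon>2 * R1" using cR \<epsilon>2(1) by (auto intro: mult_left_mono)
        moreover have "\<bar>?r1 - ?c1\<bar> \<le> 2 * \<epsilon>2 * ?c1" by (rule codual_compare[OF \<kappa> x xd(1) \<epsilon>2(1,2) W(3)[OF xW(1)]])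
        moreover have "\<bar>?r2 - ?c2\<bar> \<le> 2 * \<epsilon>2 * ?c2" by (rule codual_compare[OF \<kappa> x xd(2) \<epsilon>2(1,2) W(3)[OF xW(2)]])
        ultimately show "\<bar>?r1 - ?c1\<bar> \<le> e1 / 8" "\<bar>?r2 - ?c2\<bar> \<le> e1 / 8" using \<epsilon>2R by linarith+
      qed
      have r12: "\<bar>?r1 - ?r2\<bar> < e1" using rc c12 c21 \<epsilon>(3) e1 by linarith
      have rmax: "max \<bar>?r1\<bar> \<bar>?r2\<bar> \<le> 2 * R1"
      proof -
        have "e1 \<le> R1" using R ab(1) by (simp add: R1_def)
        then have "?r1 \<le> 2 * R1" "?r2 \<le> 2 * R1" using rc cR e1 by linarith+
        then show ?thesis using codual_nonneg[OF \<kappa> xd(1), of a1] codual_nonneg[OF \<kappa> xd(2), of a2] by simp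
      qed
      have om1: "\<omega> (\<bar>fst y1 - fst y2\<bar>, fdist ?x1 ?x2, ?r1 - ?r2) < \<theta> / 2"
        using tle dle rs s(2) e1 r12 fdist_nonneg[of ?x1 ?x2] ab(2) r(1)
        by (intro om) (auto simp: abs_of_nonneg intro: le_less_trans[of _ s])
      have "C * max \<bar>?r1\<bar> \<bar>?r2\<bar> * (\<bar>fst y1 - fst y2\<bar> + fdist ?x1 ?x2) \<le> C * (2 * R1) * s"
        using C rmax tle dle rs R1 fdist_nonneg[of ?x1 ?x2] by (intro mult_mono) auto
      also have "\<dots> \<le> (2 * D) * (\<theta> / (8 * D))"
      proof (rule mult_mono)
        show "C * (2 * R1) \<le> 2 * D" using R1 by (simp add: D_def algebra_simps)
      qed (use s D in auto)
      also have "\<dots> = \<theta> / 4" using D by simp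
      finally have "C * max \<bar>?r1\<bar> \<bar>?r2\<bar> * (\<bar>fst y1 - fst y2\<bar> + fdist ?x1 ?x2) \<le> \<theta> / 4" .
      then have "\<bar>H (fst y1) ?x1 ?r1 - H (fst y2) ?x2 ?r2\<bar> \<le> \<theta>"
        using HA[of "fst y1" "fst y2" ?x1 ?r1 ?x2 ?r2] tpos om1 \<theta> by linarith
      then show "0 < fst y1 \<and> 0 < fst y2 \<and> snd y1 \<in> chart_map \<kappa> ` chart_dom \<kappa> \<and> snd y2 \<in> chart_map \<kappa> ` chart_dom \<kappa> \<and>
        \<bar>H (fst y1) ?x1 ?r1 - H (fst y2) ?x2 ?r2\<bar> \<le> \<theta>" using tpos img by blast
    qed
  qed (use \<epsilon> in auto)
qed

text \<open>The penalty \<open>Q\<close> keeps the almost minimum of \<open>v - u + Q\<close> provided by Ekeland's principle away from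
  both ends of the time interval and has a derivative that is bounded below; the fuzzy sum rule then
  yields nearly opposite gradients for \<open>v\<close> and \<open>-u\<close>.\<close>

lemma comparison:
  assumes complete: "Metric_space.mcomplete UNIV fdist" and A: "condition_A \<A> N H"
    and u: "usc_on spacetime u" "sub_ineq u" and v: "lsc_on spacetime v" "super_ineq v"
    and init: "\<And>x. u (0, x) \<le> v (0, x)" and bd: "bounded_on_strips u" "bounded_on_strips v"
    and lip: "locally_lipschitz \<A> N u \<or> locally_lipschitz \<A> N v" and q: "q \<in> spacetime"
  shows "u q \<le> v q"
proof (rule ccontr)
  assume neg: "\<not> u q \<le> v q"
  define a where "a = u q - v q"
  have a: "a > 0" using neg by (simp add: a_def)
  define t1 where "t1 = fst q"
  have "t1 \<noteq> 0" using init[of "snd q"] a by (cases q) (auto simp: a_def t1_def)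
  then have t1: "t1 > 0" using q by (auto simp: t1_def mem_Times_iff)
  define T where "T = t1 + 1"
  have T: "T > 0" using t1 by (simp add: T_def)
  obtain M1 where M1: "\<And>p. p \<in> {0..<T + 1} \<times> UNIV \<Longrightarrow> \<bar>u p\<bar> \<le> M1"
    using bd(1) T unfolding bounded_on_strips_def bounded_iff by (metis add_pos_pos image_eqI real_norm_def zero_less_one)
  obtain M2 where M2: "\<And>p. p \<in> {0..<T + 1} \<times> UNIV \<Longrightarrow> \<bar>v p\<bar> \<le> M2"
    using bd(2) T unfolding bounded_on_strips_def bounded_iff by (metis add_pos_pos image_eqI real_norm_def zero_less_one)
  define M where "M = \<bar>M1\<bar> + \<bar>M2\<bar>"
  let ?S = "{0..T} \<times> (UNIV :: 'm set)"
  have M: "- M \<le> v p - u p" if "p \<in> ?S" for p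
  proof -
    have "p \<in> {0..<T + 1} \<times> UNIV" using that by auto
    from M1[OF this] M2[OF this] show ?thesis by (simp add: M_def abs_le_iff)
  qed
  have M0: "0 \<le> M" by (simp add: M_def)
  \<comment> \<open>The exponential \<open>Q\<close> equals a/2 at the time \<open>t1\<close> of the
    violation, so \<open>F q\<close> is -a/2. The rate makes Q T at least M + a, where
    \<open>M\<close> bounds u - v on the strip. A negative value of \<open>F\<close> is thus
    excluded at time T by this, and at time 0 by the initial inequality.\<close>
  define lm where "lm = 2 * M / a + 1"
  have lm: "lm > 0" using M0 a by (simp add: lm_def add_nonneg_pos)
  define Q where "Q t = a / 2 * exp (lm * (t - t1))" for t
  have Qpos: "Q t > 0" for t using a by (simp add: Q_def)
  have QT: "Q T > M"
  proof -
    have "M < a / 2 * (1 + lm)" using a by (simp add: lm_def field_simps)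
    also have "\<dots> \<le> a / 2 * exp lm" using a exp_ge_add_one_self[of lm] by (intro mult_left_mono) auto
    finally show ?thesis by (simp add: Q_def T_def)
  qed
  have Qd: "(Q has_real_derivative lm * Q t) (at t)" for t
    unfolding Q_def[abs_def] by (auto intro!: derivative_eq_intros)
  \<comment> \<open>The derivative of \<open>Q\<close> at time 0, hence its minimum over nonnegative
    times; this is the strictness that drives the contradiction.\<close>
  define \<delta> where "\<delta> = lm * (a / 2 * exp (- (lm * t1)))"
  have \<delta>: "\<delta> > 0" using a lm by (simp add: \<delta>_def)
  have Qlow: "\<delta> \<le> lm * Q t" if "0 \<le> t" for t
  proof -
    have "- (lm * t1) \<le> lm * (t - t1)" using that lm by (simp add: algebra_simps)
    then show ?thesis using a lm by (simp add: \<delta>_def Q_def)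
  qed
  have Qcont: "continuous_on UNIV Q" unfolding Q_def[abs_def] by (intro continuous_intros)
  \<comment> \<open>Three errors of at most \<theta> occur in the end: \<eta>, the slope \<epsilon>
    and the difference of the two Hamiltonians. A quarter of \<delta> leaves a margin.\<close>
  define \<theta> where "\<theta> = \<delta> / 4"
  have \<theta>: "\<theta> > 0" using \<delta> by (simp add: \<theta>_def)
  obtain \<epsilon> where \<epsilon>: "\<epsilon> > 0" "\<epsilon> \<le> \<theta>" and gap: "\<forall>\<kappa>\<in>\<A>. \<forall>x\<in>chart_dom \<kappa>. \<forall>t>0. \<forall>R\<ge>0. \<exists>\<eta>>0. \<eta> \<le> \<theta> \<and> (\<exists>r>0. hamiltonian_close \<kappa> x t R \<theta> \<epsilon> \<eta> r)"
    using hamiltonian_gap[OF A \<theta>] by (elim exE conjE) (rule that)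
  define F where "F p = v p + - u p + Q (fst p)" for p
  have lscF: "lsc_on ?S F" unfolding F_def[abs_def]
  proof (intro lsc_on_add)
    show "lsc_on ?S v" by (rule lsc_on_subset[OF v(1)]) auto
    show "lsc_on ?S (\<lambda>p. - u p)" by (rule lsc_on_subset[OF iffD1[OF usc_on_iff_lsc_on_minus u(1)]]) auto
    show "lsc_on ?S (\<lambda>p. Q (fst p))"
      by (intro continuous_imp_usc_lsc(2) continuous_on_compose2[OF Qcont] continuous_intros) auto
  qed
  have "\<exists>z\<in>?S. F z \<le> F q \<and> (\<forall>y\<in>?S. F z \<le> F y + \<epsilon> * spacetime_dist \<A> N z y)"
  proof (rule ekeland)
    show "0 \<le> spacetime_dist \<A> N x y" for x y by (simp add: spacetime_dist_def fdist_nonneg)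
    show "spacetime_dist \<A> N x x = 0" for x by (simp add: spacetime_dist_def fdist_refl)
    show "spacetime_dist \<A> N x z \<le> spacetime_dist \<A> N x y + spacetime_dist \<A> N y z" for x y z
      using fdist_triangle[of "snd x" "snd z" "snd y"] by (simp add: spacetime_dist_def)
    show "\<exists>z\<in>?S. (\<lambda>n. spacetime_dist \<A> N (\<sigma> n) z) \<longlonglongrightarrow> 0" if "\<And>n. \<sigma> n \<in> ?S"
      "\<forall>e>0. \<exists>k. \<forall>m\<ge>k. \<forall>n\<ge>m. spacetime_dist \<A> N (\<sigma> m) (\<sigma> n) < e" for \<sigma>
      by (rule spacetime_complete[OF complete that])
    show "F x \<le> l" if "\<And>n. \<sigma> n \<in> ?S" "x \<in> ?S" "(\<lambda>n. spacetime_dist \<A> N (\<sigma> n) x) \<longlonglongrightarrow> 0" "(\<lambda>n. F (\<sigma> n)) \<longlonglongrightarrow> l" for \<sigma> x l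
      by (rule lsc_on_sequentially[OF lscF that(1,2) spacetime_dist_tendsto[OF that(3)] that(4)]) simp
    show "- M \<le> F p" if "p \<in> ?S" for p using M[OF that] Qpos[of "fst p"] by (simp add: F_def)
    show "q \<in> ?S" using t1 by (auto simp: mem_Times_iff t1_def T_def)
  qed (rule \<epsilon>(1))
  then obtain z0 where z0: "z0 \<in> ?S" "F z0 \<le> F q" "\<And>y. y \<in> ?S \<Longrightarrow> F z0 \<le> F y + \<epsilon> * spacetime_dist \<A> N z0 y" by blast
  have "Q (fst q) = a / 2" by (simp add: Q_def t1_def)
  then have "F q = - a / 2" unfolding F_def using a_def by linarith
  then have Fneg: "F z0 < 0" using z0(2) a by simp
  define t0 where "t0 = fst z0"
  define x0 where "x0 = snd z0"
  have z0_eq: "z0 = (t0, x0)" by (simp add: t0_def x0_def)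
  have t0: "0 < t0" "t0 < T"
  proof -
    have "t0 \<noteq> 0" using Fneg init[of x0] Qpos[of t0] by (auto simp: F_def z0_eq)
    moreover have "t0 \<noteq> T" using Fneg M[OF z0(1)] QT by (auto simp: F_def z0_eq)
    ultimately show "0 < t0" "t0 < T" using z0(1) by (auto simp: z0_eq)
  qed
  obtain \<kappa> where \<kappa>: "\<kappa> \<in> \<A>" and x: "x0 \<in> chart_dom \<kappa>" using chart_exists by blast
  define y0 where "y0 = (t0, chart_map \<kappa> x0)"
  obtain b where b: "b > 0" "\<And>v. cnorm \<kappa> x0 v \<le> b * norm v" using cnorm_equiv[OF \<kappa> x] by blast
  \<comment> \<open>A chart majorant of the Ekeland term \<epsilon> times the distance to
    \<open>z0\<close>. The factor 2 comes from comparing the distance with the norm at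
    \<open>x0\<close>; keeping \<open>cnorm\<close> here preserves a slope independent of the
    chart.\<close>
  define e where "e y = \<epsilon> * \<bar>fst y - t0\<bar> + 2 * \<epsilon> * cnorm \<kappa> x0 (snd y - chart_map \<kappa> x0)" for y
  have "open {y :: real \<times> 'x. fst y < T}" by (intro open_Collect_less continuous_intros)
  then obtain ra where ra: "ra > 0" "\<forall>y\<in>cball y0 ra. y \<in> {y. fst y < T} \<and> 0 < fst y \<and> snd y \<in> chart_map \<kappa> ` chart_dom \<kappa>"
    using chart_cball[OF \<kappa> x t0(1), of "{y. fst y < T}"] t0(2) unfolding y0_def by auto
  obtain rd where rd: "rd > 0" "\<forall>y\<in>ball (chart_map \<kappa> x0) rd. \<forall>y'\<in>ball (chart_map \<kappa> x0) rd.
        fdist (chart_inv \<kappa> y) (chart_inv \<kappa> y') \<le> (1 + 1) * cnorm \<kappa> x0 (y' - y)"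
    using fdist_chart[OF \<kappa> x, of 1] by auto
  define r0 where "r0 = min ra (rd / 2)"
  have r0: "r0 > 0" using ra(1) rd(1) by (simp add: r0_def)
  have C: "0 < fst y" "fst y < T" "snd y \<in> chart_map \<kappa> ` chart_dom \<kappa>" "snd y \<in> ball (chart_map \<kappa> x0) rd" if "y \<in> cball y0 r0" for y
  proof -
    have "y \<in> cball y0 ra" using that by (auto simp: r0_def)
    then show "0 < fst y" "fst y < T" "snd y \<in> chart_map \<kappa> ` chart_dom \<kappa>" using ra(2) by auto
    have "dist (chart_map \<kappa> x0) (snd y) \<le> dist y0 y" using dist_snd_le[of y0 y] by (simp add: y0_def)
    then show "snd y \<in> ball (chart_map \<kappa> x0) rd" using that rd(1) by (auto simp: r0_def)
  qed
  let ?v = "local_rep \<kappa> v" and ?u = "local_rep \<kappa> u"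
  have e0: "e y0 = 0" by (simp add: e_def y0_def cnorm_zero[OF \<kappa> x])
  have min0: "?v y0 + - ?u y0 + Q (fst y0) + e y0 \<le> ?v y + - ?u y + Q (fst y) + e y" if y: "y \<in> cball y0 r0" for y
  proof -
    let ?p = "(fst y, chart_inv \<kappa> (snd y))"
    have "?p \<in> ?S" using C[OF y] by auto
    from z0(3)[OF this] have "F z0 \<le> F ?p + \<epsilon> * spacetime_dist \<A> N z0 ?p" .
    also have "spacetime_dist \<A> N z0 ?p \<le> \<bar>fst y - t0\<bar> + 2 * cnorm \<kappa> x0 (snd y - chart_map \<kappa> x0)"
    proof -
      have "chart_map \<kappa> x0 \<in> ball (chart_map \<kappa> x0) rd" using rd(1) by simp
      then have "fdist (chart_inv \<kappa> (chart_map \<kappa> x0)) (chart_inv \<kappa> (snd y)) \<le> (1 + 1) * cnorm \<kappa> x0 (snd y - chart_map \<kappa> x0)"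
        using rd(2) C(4)[OF y] by blast
      then show ?thesis by (simp add: spacetime_dist_def z0_eq chart_inv_map[OF \<kappa> x] abs_minus_commute)
    qed
    finally have "F z0 \<le> F ?p + e y" using \<epsilon>(1) by (simp add: e_def algebra_simps)
    then show ?thesis using e0 by (simp add: F_def local_rep_pair y0_def z0_eq chart_inv_map[OF \<kappa> x])
  qed
  have e_diff: "e y - e y' \<le> \<epsilon> * \<bar>fst (y - y')\<bar> + 2 * \<epsilon> * cnorm \<kappa> x0 (snd (y - y'))" for y y'
  proof -
    have "cnorm \<kappa> x0 (snd y - chart_map \<kappa> x0) \<le> cnorm \<kappa> x0 (snd y' - chart_map \<kappa> x0) + cnorm \<kappa> x0 (snd (y - y'))"
      using cnorm_triangle[OF \<kappa> x, of "snd y' - chart_map \<kappa> x0" "snd (y - y')"] by simp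
    then have "2 * \<epsilon> * cnorm \<kappa> x0 (snd y - chart_map \<kappa> x0) \<le> 2 * \<epsilon> * (cnorm \<kappa> x0 (snd y' - chart_map \<kappa> x0) + cnorm \<kappa> x0 (snd (y - y')))"
      using \<epsilon>(1) by (intro mult_left_mono) auto
    moreover have "\<epsilon> * \<bar>fst y - t0\<bar> \<le> \<epsilon> * (\<bar>fst y' - t0\<bar> + \<bar>fst (y - y')\<bar>)" using \<epsilon>(1) by (intro mult_left_mono) auto
    ultimately show ?thesis by (simp add: e_def distrib_left)
  qed
  have e_lip1: "e y - e y' \<le> (\<epsilon> + 2 * \<epsilon> * b) * norm (y - y')" for y y'
  proof -
    have "\<bar>fst (y - y')\<bar> \<le> norm (y - y')" using norm_fst_le[of "fst (y - y')" "snd (y - y')", unfolded prod.collapse real_norm_def] .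
    then have 1: "\<epsilon> * \<bar>fst (y - y')\<bar> \<le> \<epsilon> * norm (y - y')" using \<epsilon>(1) by (intro mult_left_mono) auto
    have "norm (snd (y - y')) \<le> norm (y - y')" using norm_snd_le[where x = "fst (y - y')" and y = "snd (y - y')", unfolded prod.collapse] .
    then have "cnorm \<kappa> x0 (snd (y - y')) \<le> b * norm (y - y')" using b(2)[of "snd (y - y')"] b(1) by (meson mult_left_mono less_imp_le order_trans)
    then have "2 * \<epsilon> * cnorm \<kappa> x0 (snd (y - y')) \<le> 2 * \<epsilon> * (b * norm (y - y'))" using \<epsilon>(1) by (intro mult_left_mono) auto
    then show ?thesis using e_diff[of y y'] 1 by (simp add: distrib_right mult.assoc)
  qed
  have e_lip: "\<bar>e y - e y'\<bar> \<le> (\<epsilon> + 2 * \<epsilon> * b) * norm (y - y')" for y y'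
    using e_lip1[of y y'] e_lip1[of y' y] by (simp add: abs_le_iff norm_minus_commute)
  have fst_C1: "C1d UNIV (\<lambda>y :: real \<times> 'x. fst y) (\<lambda>y. Blinfun fst)"
    using C1d_blinfun_affine[of UNIV 0 "Blinfun fst :: (real \<times> 'x) \<Rightarrow>\<^sub>L real" 0]
    by (simp add: bounded_linear_Blinfun_apply bounded_linear_fst)
  define Q' where "Q' y = (lm * Q (fst y)) *\<^sub>R (Blinfun fst :: (real \<times> 'x) \<Rightarrow>\<^sub>L real)" for y :: "real \<times> 'x"
  have QC1: "C1d UNIV (\<lambda>y :: real \<times> 'x. Q (fst y)) Q'" unfolding Q'_def[abs_def]
    by (rule C1d_real_compose[OF Qd _ fst_C1]) (intro continuous_intros continuous_on_compose2[OF Qcont]; simp)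
  have Q'v: "blinfun_apply (Q' y) w = lm * Q (fst y) * fst w" for y w
    by (simp add: Q'_def scaleR_blinfun.rep_eq bounded_linear_Blinfun_apply bounded_linear_fst)
  \<comment> \<open>\<open>F1\<close> and \<open>F2\<close> stand for \<open>v\<close> and
    \<open>- u\<close> in either order, the locally Lipschitz one being \<open>F2\<close>. The three
    functions in the sum rule are \<open>F1\<close> plus the penalty, \<open>F2\<close> and the
    slope term; the gradient of the penalty is known and moved to the other side.\<close>
  have double: "\<exists>y1 y2 a1 a2. norm (y1 - y0) < r \<and> norm (y2 - y0) < r \<and> C1_subgrad F1 y1 a1 \<and> C1_subgrad F2 y2 a2 \<and> norm a2 \<le> R \<and>
      blinfun_apply (a1 + a2) (1, 0) \<le> \<eta> + \<epsilon> - \<delta> \<and>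
      (\<forall>v. \<bar>blinfun_apply (a1 + a2) (0, v)\<bar> \<le> \<eta> * norm v + 2 * \<epsilon> * cnorm \<kappa> x0 v)"
    if F12: "\<And>y. F1 y + F2 y = ?v y + - ?u y" and lscF1: "lsc_on (cball y0 r0) F1" and R: "R \<ge> 0" and rR: "rR > 0"
      and lipF2: "\<And>y y'. y \<in> cball y0 rR \<Longrightarrow> y' \<in> cball y0 rR \<Longrightarrow> \<bar>F2 y - F2 y'\<bar> \<le> R * norm (y - y')"
      and \<eta>: "\<eta> > 0" and r: "r > 0" for F1 F2 R rR \<eta> r
  proof -
    define s where "s = min r0 (min rR r)"
    have s: "s > 0" using r0 rR r by (simp add: s_def)
    have sub: "cball y0 s \<subseteq> cball y0 r0" "cball y0 s \<subseteq> cball y0 rR" by (auto simp: s_def)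
    have 1: "lsc_on (cball y0 s) (\<lambda>y. F1 y + Q (fst y))"
      by (intro lsc_on_add_continuous lsc_on_subset[OF lscF1 sub(1)] continuous_on_subset[OF C1d_continuous_on[OF QC1]]) simp
    have 2: "\<bar>F2 y - F2 y'\<bar> \<le> R * norm (y - y')" if "y \<in> cball y0 s" "y' \<in> cball y0 s" for y y' using lipF2 that sub(2) by blast
    have 3: "F1 y0 + Q (fst y0) + F2 y0 + e y0 \<le> F1 y + Q (fst y) + F2 y + e y" if "y \<in> cball y0 s" for y
    proof -
      have "y \<in> cball y0 r0" using that sub(1) by blast
      from min0[OF this] show ?thesis unfolding F12[symmetric] by linarith
    qed
    have R3: "0 \<le> \<epsilon> + 2 * \<epsilon> * b" using \<epsilon>(1) b(1) by simp
    obtain y1 y2 y3 p1 p2 p3 where y: "norm (y1 - y0) < s" "norm (y2 - y0) < s" "C1_subgrad (\<lambda>y. F1 y + Q (fst y)) y1 p1"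
       "C1_subgrad F2 y2 p2" "C1_subgrad e y3 p3" "norm (p1 + p2 + p3) < \<eta>"
      using fuzzy_sum_rule_3[OF bump s 1 R R3 2 e_lip 3 \<eta>] by blast
    define a1 where "a1 = p1 - Q' y1"
    have b1: "C1_subgrad F1 y1 a1" unfolding a1_def by (rule C1_subgrad_add_C1[OF y(3) QC1]) auto
    have n2: "norm p2 \<le> R"
    proof (rule C1_subgrad_lipschitz[OF y(4) open_ball[of y0 s] _ R])
      show y2: "y2 \<in> ball y0 s" using y(2) by (simp add: dist_norm norm_minus_commute)
      fix z assume "z \<in> ball y0 s"
      then show "F2 z - F2 y2 \<le> R * norm (z - y2)" using 2[of z y2] y2 by (auto simp: abs_le_iff)
    qed
    have p3: "blinfun_apply p3 w \<le> \<epsilon> * \<bar>fst w\<bar> + 2 * \<epsilon> * cnorm \<kappa> x0 (snd w)" for w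
    proof (rule C1_subgrad_directional[OF y(5)])
      show "\<forall>\<^sub>F s in at_right 0. e (y3 + s *\<^sub>R w) - e y3 \<le> s * (\<epsilon> * \<bar>fst w\<bar> + 2 * \<epsilon> * cnorm \<kappa> x0 (snd w))"
        using eventually_at_right_less[of 0]
      proof eventually_elim
        case (elim s)
        then show ?case using e_diff[of "y3 + s *\<^sub>R w" y3] by (simp add: cnorm_scaleR[OF \<kappa> x] abs_mult algebra_simps)
      qed
    qed
    have y1pos: "0 \<le> fst y1" using C(1)[of y1] y(1) sub(1) by (force simp: dist_norm norm_minus_commute subset_eq)
    have sum: "a1 + p2 = (p1 + p2 + p3) - p3 - Q' y1" by (simp add: a1_def)
    have err: "\<bar>blinfun_apply (p1 + p2 + p3) w\<bar> \<le> \<eta> * norm w" for w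
    proof -
      have "\<bar>blinfun_apply (p1 + p2 + p3) w\<bar> \<le> norm (p1 + p2 + p3) * norm w" using norm_blinfun[of "p1 + p2 + p3" w] by simp
      also have "\<dots> \<le> \<eta> * norm w" using y(6) by (intro mult_right_mono) auto
      finally show ?thesis .
    qed
    have minus: "blinfun_apply p3 (- w) = - blinfun_apply p3 w" for w by (rule blinfun.minus_right)
    have "blinfun_apply (a1 + p2) (1, 0) \<le> \<eta> + \<epsilon> - \<delta>"
    proof -
      have "blinfun_apply (a1 + p2) (1, 0) = blinfun_apply (p1 + p2 + p3) (1, 0) - blinfun_apply p3 (1, 0) - lm * Q (fst y1)"
        unfolding sum by (simp only: minus_blinfun.rep_eq Q'v) simp
      moreover have "- blinfun_apply p3 (1, 0) \<le> \<epsilon>" using p3[of "- (1, 0)"] unfolding minus by (simp add: cnorm_zero[OF \<kappa> x])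
      moreover have "blinfun_apply (p1 + p2 + p3) (1, 0) \<le> \<eta>" using err[of "(1, 0)"] by (simp add: norm_Pair abs_le_iff)
      ultimately show ?thesis using Qlow[OF y1pos] by linarith
    qed
    moreover have "\<bar>blinfun_apply (a1 + p2) (0, v)\<bar> \<le> \<eta> * norm v + 2 * \<epsilon> * cnorm \<kappa> x0 v" for v
    proof -
      have "blinfun_apply (a1 + p2) (0, v) = blinfun_apply (p1 + p2 + p3) (0, v) - blinfun_apply p3 (0, v)"
        unfolding sum by (simp only: minus_blinfun.rep_eq Q'v) simp
      moreover have "\<bar>blinfun_apply p3 (0, v)\<bar> \<le> 2 * \<epsilon> * cnorm \<kappa> x0 v"
        using p3[of "(0, v)"] p3[of "- (0, v)"] unfolding minus by (simp add: cnorm_minus[OF \<kappa> x] abs_le_iff)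
      moreover have "\<bar>blinfun_apply (p1 + p2 + p3) (0, v)\<bar> \<le> \<eta> * norm v" using err[of "(0, v)"] by (simp add: norm_Pair)
      ultimately show ?thesis by linarith
    qed
    moreover have "norm (y1 - y0) < r" "norm (y2 - y0) < r" using y(1,2) by (auto simp: s_def)
    ultimately show ?thesis using b1 y(4) n2 by blast
  qed
  have lscv: "lsc_on (cball y0 r0) ?v"
    by (rule lsc_on_subset[OF lsc_local_rep[OF \<kappa> v(1)]]) (use C(1,3) in \<open>auto simp: mem_Times_iff less_imp_le simp del: mem_cball\<close>)
  have "lsc_on (cball y0 r0) (local_rep \<kappa> (\<lambda>p. - u p))"
    by (rule lsc_on_subset[OF lsc_local_rep[OF \<kappa> iffD1[OF usc_on_iff_lsc_on_minus u(1)]]])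
       (use C(1,3) in \<open>auto simp: mem_Times_iff less_imp_le simp del: mem_cball\<close>)
  then have lscu: "lsc_on (cball y0 r0) (\<lambda>y. - ?u y)" by (simp add: local_rep_def case_prod_unfold)
  have super: "blinfun_apply p (1, 0) + H (fst y) (chart_inv \<kappa> (snd y)) (codual \<kappa> (chart_inv \<kappa> (snd y)) p) \<ge> 0"
    if "C1_subgrad ?v y p" "0 < fst y" "snd y \<in> chart_map \<kappa> ` chart_dom \<kappa>" for y p
    by (rule super_ineqD[OF v(2) \<kappa> chart_inv_dom[OF \<kappa> that(3)] that(2)]) (use that chart_map_inv[OF \<kappa> that(3)] in simp)
  have sub: "- blinfun_apply p (1, 0) + H (fst y) (chart_inv \<kappa> (snd y)) (codual \<kappa> (chart_inv \<kappa> (snd y)) p) \<le> 0"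
    if "C1_subgrad (\<lambda>y. - ?u y) y p" "0 < fst y" "snd y \<in> chart_map \<kappa> ` chart_dom \<kappa>" for y p
    by (rule sub_ineqD[OF u(2) \<kappa> chart_inv_dom[OF \<kappa> that(3)] that(2)]) (use that chart_map_inv[OF \<kappa> that(3)] in simp)
  show False
  proof (cases "locally_lipschitz \<A> N u")
    case True
    obtain R rR where R: "R \<ge> 0" "rR > 0" "\<forall>y\<in>cball y0 rR. \<forall>y'\<in>cball y0 rR. \<bar>?u y - ?u y'\<bar> \<le> R * norm (y - y')"
      using lipschitz_local_rep[OF True \<kappa> x t0(1)] unfolding y0_def by blast
    have lip2: "\<bar>- ?u y - - ?u y'\<bar> \<le> R * norm (y - y')" if "y \<in> cball y0 rR" "y' \<in> cball y0 rR" for y y'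
      using bspec[OF bspec[OF R(3) that(1)] that(2)] by (simp add: abs_minus_commute)
    obtain \<eta> r where \<eta>: "\<eta> > 0" "\<eta> \<le> \<theta>" "r > 0" and g: "hamiltonian_close \<kappa> x0 t0 R \<theta> \<epsilon> \<eta> r"
      using gap[rule_format, OF \<kappa> x t0(1) R(1)] by (elim exE conjE) (rule that)
    obtain y1 y2 a1 a2 where y: "norm (y1 - y0) < r" "norm (y2 - y0) < r" "C1_subgrad ?v y1 a1" "C1_subgrad (\<lambda>y. - ?u y) y2 a2" "norm a2 \<le> R"
      "blinfun_apply (a1 + a2) (1, 0) \<le> \<eta> + \<epsilon> - \<delta>" "\<forall>v. \<bar>blinfun_apply (a1 + a2) (0, v)\<bar> \<le> \<eta> * norm v + 2 * \<epsilon> * cnorm \<kappa> x0 v"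
      using double[OF _ lscv R(1,2) lip2 \<eta>(1,3)] by blast
    \<comment> \<open>The super- and subsolution inequalities bound the time component of a1 + a2
      below by minus the Hamiltonian gap, that is by -\<theta>, while the penalty makes it at most
      \<eta> + \<epsilon> - \<delta>, hence at most -2 \<theta>.\<close>
    note G = g[unfolded hamiltonian_close_def, folded y0_def, rule_format, OF y(1,2) y(7)[rule_format] y(5)]
    have "blinfun_apply (a1 + a2) (1, 0) = blinfun_apply a1 (1, 0) + blinfun_apply a2 (1, 0)" by (simp add: plus_blinfun.rep_eq)
    then show False using super[OF y(3)] sub[OF y(4)] G y(6) \<eta>(2) \<epsilon>(2) \<delta> unfolding \<theta>_def by linarith
  next
    case False
    then have lv: "locally_lipschitz \<A> N v" using lip by blast
    obtain R rR where R: "R \<ge> 0" "rR > 0" "\<forall>y\<in>cball y0 rR. \<forall>y'\<in>cball y0 rR. \<bar>?v y - ?v y'\<bar> \<le> R * norm (y - y')"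
      using lipschitz_local_rep[OF lv \<kappa> x t0(1)] unfolding y0_def by blast
    obtain \<eta> r where \<eta>: "\<eta> > 0" "\<eta> \<le> \<theta>" "r > 0" and g: "hamiltonian_close \<kappa> x0 t0 R \<theta> \<epsilon> \<eta> r"
      using gap[rule_format, OF \<kappa> x t0(1) R(1)] by (elim exE conjE) (rule that)
    obtain y1 y2 a1 a2 where y: "norm (y1 - y0) < r" "norm (y2 - y0) < r" "C1_subgrad (\<lambda>y. - ?u y) y1 a1" "C1_subgrad ?v y2 a2" "norm a2 \<le> R"
      "blinfun_apply (a1 + a2) (1, 0) \<le> \<eta> + \<epsilon> - \<delta>" "\<forall>v. \<bar>blinfun_apply (a1 + a2) (0, v)\<bar> \<le> \<eta> * norm v + 2 * \<epsilon> * cnorm \<kappa> x0 v"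
      using double[OF add.commute lscu R(1,2) R(3)[rule_format] \<eta>(1,3)] by blast
    note G = g[unfolded hamiltonian_close_def, folded y0_def, rule_format, OF y(1,2) y(7)[rule_format] y(5)]
    have "blinfun_apply (a1 + a2) (1, 0) = blinfun_apply a1 (1, 0) + blinfun_apply a2 (1, 0)" by (simp add: plus_blinfun.rep_eq)
    then show False using sub[OF y(3)] super[OF y(4)] G y(6) \<eta>(2) \<epsilon>(2) \<delta> unfolding \<theta>_def by linarith
  qed
qed

text \<open>Local extrema refer to neighbourhoods in the whole type, including negative times where
  values are arbitrary; a small neighbourhood of a point of positive time avoids these.\<close>

lemma super_ineq_cong:
  assumes u: "super_ineq u" and eq: "\<And>q. q \<in> spacetime \<Longrightarrow> u q = v q" shows "super_ineq v"
proof (rule super_ineqI)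
  fix t :: real and x assume t: "t > 0"
  obtain \<kappa> where k: "\<kappa> \<in> \<A>" "x \<in> chart_dom \<kappa>" using chart_exists by blast
  have ev: "\<forall>\<^sub>F y in nhds (t, chart_map \<kappa> x). local_rep \<kappa> v y = local_rep \<kappa> u y"
    using eventually_positive_time[OF t] by eventually_elim (simp add: local_rep_pair eq mem_Times_iff)
  have "blinfun_apply p (1, 0) + H t x (codual \<kappa> x p) \<ge> 0" if "C1_subgrad (local_rep \<kappa> v) (t, chart_map \<kappa> x) p" for p
    by (rule super_ineqD[OF u k t C1_subgrad_cong_nhds[OF ev that]])
  then show "\<exists>\<kappa>\<in>\<A>. x \<in> chart_dom \<kappa> \<and> (\<forall>p. C1_subgrad (local_rep \<kappa> v) (t, chart_map \<kappa> x) p \<longrightarrow>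
      blinfun_apply p (1, 0) + H t x (codual \<kappa> x p) \<ge> 0)" using k by blast
qed

lemma viscosity_subsolution_iff: "viscosity_subsolution \<A> N H h w \<longleftrightarrow> usc_on spacetime w \<and> sub_ineq w \<and> (\<forall>x. w (0, x) \<le> h x)"
  by (simp add: viscosity_subsolution_def sub_ineq_def)

lemma viscosity_supersolution_iff: "viscosity_supersolution \<A> N H h w \<longleftrightarrow> lsc_on spacetime w \<and> super_ineq w \<and> (\<forall>x. h x \<le> w (0, x))"
  by (simp add: viscosity_supersolution_def super_ineq_def)

end

theorem corollary5p8:
  fixes \<A> :: "('m::t2_space, 'x::banach) chart set"
    and N :: "'m \<Rightarrow> ('m, 'x) tvec \<Rightarrow> real"
    and H :: "real \<Rightarrow> 'm \<Rightarrow> real \<Rightarrow> real"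
    and h :: "'m \<Rightarrow> real"
    and L K\<^sub>0 K\<^sub>1 :: real
    and \<F> :: "(real \<times> 'm \<Rightarrow> real) set"
    and u u_up u_up_low :: "real \<times> 'm \<Rightarrow> real"
  assumes M: "complete_finsler_manifold \<A> N"
    and bump: "\<exists>b :: 'x \<Rightarrow> real. C1_lipschitz_bump b"
    and H_cont: "continuous_on ({0..} \<times> UNIV \<times> UNIV) (\<lambda>(t, x, r). H t x r)"
    and H_A: "condition_A \<A> N H"
    and L: "L \<ge> 0"
    and h_lipschitz: "\<forall>x y. \<bar>h x - h y\<bar> \<le> L * finsler_dist \<A> N x y"
    and h_bounded: "bounded (range h)"
    and K0: "ereal K\<^sub>0 = Inf {ereal (H t x m) | t x m. t > 0 \<and> \<bar>m\<bar> \<le> L}"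
    and K1: "ereal K\<^sub>1 = Sup {ereal (H t x m) | t x m. t > 0 \<and> \<bar>m\<bar> \<le> L}"
    and F: "\<F> = {w. viscosity_subsolution \<A> N H h w \<and>
                 (\<forall>t>0. \<forall>x. - K\<^sub>1 * t + h x \<le> w (t, x) \<and> w (t, x) \<le> - K\<^sub>0 * t + h x)}"
    and u: "u = (\<lambda>p. SUP w\<in>\<F>. w p)"
    and u_up: "u_up = upper_envelope \<A> N u"
    and u_up_low: "u_up_low = lower_envelope \<A> N u_up"
  shows "viscosity_subsolution \<A> N H h u_up \<and>
         viscosity_supersolution \<A> N H h u_up_low \<and>
         (continuous_on spacetime u_up \<longrightarrow>
            (\<forall>p\<in>spacetime. u_up p = u_up_low p) \<and> viscosity_solution \<A> N H h u_up) \<and>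
         (locally_lipschitz \<A> N u_up \<longrightarrow>
            viscosity_solution \<A> N H h u_up \<and> bounded_on_strips u_up \<and>
            (\<forall>v. viscosity_solution \<A> N H h v \<and> bounded_on_strips v \<longrightarrow>
                 (\<forall>p\<in>spacetime. v p = u_up p)))"
proof -
  have fin: "finsler_manifold \<A> N" and complete: "Metric_space.mcomplete UNIV (finsler_dist \<A> N)"
    using M by (auto simp: complete_finsler_manifold_def)
  obtain b :: "'x \<Rightarrow> real" where "C1_lipschitz_bump b" using bump by blast
  then obtain \<beta>x :: "'x \<Rightarrow> real" and \<beta>x' Kx where bx: "smooth_bump \<beta>x \<beta>x' Kx" using smooth_bump_of_C1_lipschitz_bump by blast
  obtain \<beta>t :: "real \<Rightarrow> real" and \<beta>t' Kt where bt: "smooth_bump \<beta>t \<beta>t' Kt" using smooth_bump_real by blast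
  obtain \<beta> :: "real \<times> 'x \<Rightarrow> real" and \<beta>' K\<^sub>\<beta> where b: "smooth_bump \<beta> \<beta>' K\<^sub>\<beta>" using smooth_bump_prod[OF bt bx] by blast
  have Hb: "K\<^sub>0 \<le> H t x m \<and> H t x m \<le> K\<^sub>1" if "t > 0" "\<bar>m\<bar> \<le> L" for t x m
  proof -
    have "ereal (H t x m) \<in> {ereal (H t x m) | t x m. t > 0 \<and> \<bar>m\<bar> \<le> L}" using that by blast
    then have "ereal K\<^sub>0 \<le> ereal (H t x m)" "ereal (H t x m) \<le> ereal K\<^sub>1" unfolding K0 K1 by (auto intro: Inf_lower Sup_upper)
    then show ?thesis by simp
  qed
  interpret hamilton_jacobi \<A> N \<beta> \<beta>' K\<^sub>\<beta> H h L K\<^sub>0 K\<^sub>1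
    by unfold_locales (use fin b H_cont L h_lipschitz Hb in auto)
  have K01: "K\<^sub>0 \<le> K\<^sub>1" using Hb[of 1 0 undefined] L by simp
  have b01: "barrier K\<^sub>1 q \<le> barrier K\<^sub>0 q" if "q \<in> spacetime" for q
    using that K01 by (auto simp: barrier_def mem_Times_iff intro: mult_right_mono)
  \<comment> \<open>At time 0 the upper barrier is \<open>h\<close>, so the initial condition and
    the upper bound merge into a single bound on all of space-time. The lower bound is imposed at
    positive times only.\<close>
  have F_iff: "w \<in> \<F> \<longleftrightarrow> usc_on spacetime w \<and> sub_ineq w \<and> (\<forall>q\<in>spacetime. w q \<le> barrier K\<^sub>0 q) \<and>
      (\<forall>t>0. \<forall>x. barrier K\<^sub>1 (t, x) \<le> w (t, x))" for w
  proof -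
    have "(\<forall>q\<in>spacetime. w q \<le> barrier K\<^sub>0 q) \<longleftrightarrow> (\<forall>x. w (0, x) \<le> h x) \<and> (\<forall>t>0. \<forall>x. w (t, x) \<le> - K\<^sub>0 * t + h x)"
      (is "?l \<longleftrightarrow> ?r")
    proof
      assume ?l then show ?r by (force simp: barrier_def)
    next
      assume r: ?r
      show ?l
      proof
        fix q :: "real \<times> 'm" assume q: "q \<in> spacetime"
        show "w q \<le> barrier K\<^sub>0 q" using r q by (cases q; cases "fst q = 0") (auto simp: barrier_def less_le)
      qed
    qed
    then show ?thesis unfolding F viscosity_subsolution_iff by (auto simp: barrier_def)
  qed
  have b1F: "barrier K\<^sub>1 \<in> \<F>" unfolding F_iff
    using continuous_imp_usc_lsc(1)[OF barrier_continuous] barrier_sub_ineq b01 by auto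
  have wb: "w q \<le> barrier K\<^sub>0 q" if "w \<in> \<F>" "q \<in> spacetime" for w q using that unfolding F_iff by blast
  have bdd: "bdd_above ((\<lambda>w. w q) ` \<F>)" if "q \<in> spacetime" for q
    using that wb by (intro bdd_aboveI2[of _ _ "barrier K\<^sub>0 q"]) blast
  have wu: "w q \<le> u q" if "w \<in> \<F>" "q \<in> spacetime" for w q
    unfolding u by (rule cSUP_upper[OF that(1) bdd[OF that(2)]])
  have ub: "u q \<le> barrier K\<^sub>0 q" if "q \<in> spacetime" for q
    unfolding u using that b1F wb by (intro cSUP_least) blast+
  have bc: "usc_on spacetime (barrier K)" "lsc_on spacetime (barrier K)" for K
    using continuous_imp_usc_lsc[OF barrier_continuous] by auto
  have u_bd: "\<exists>r>0. \<exists>Mx. \<forall>q\<in>sball p r. u q \<le> Mx" if p: "p \<in> spacetime" for p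
  proof -
    have "\<forall>\<^sub>F q in nhds p. q \<in> spacetime \<longrightarrow> barrier K\<^sub>0 q < barrier K\<^sub>0 p + 1" by (rule usc_on_nhds[OF bc(1) p]) simp
    from nhds_sball[OF this] obtain r where r: "r > 0" "\<forall>q\<in>sball p r. q \<in> spacetime \<longrightarrow> barrier K\<^sub>0 q < barrier K\<^sub>0 p + 1" by blast
    have "u q \<le> barrier K\<^sub>0 p + 1" if "q \<in> sball p r" for q
    proof -
      have "q \<in> spacetime" using that by (auto simp: sball_simps mem_Times_iff)
      then show ?thesis using ub[of q] r(2) that by force
    qed
    then show ?thesis using r(1) by blast
  qed
  have up_usc: "usc_on spacetime u_up" unfolding u_up by (rule usc_upper_envelope[OF u_bd])
  have u_le_up: "u p \<le> u_up p" if p: "p \<in> spacetime" for p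
  proof -
    obtain r Mx where "r > 0" "\<forall>q\<in>sball p r. u q \<le> Mx" using u_bd[OF p] by blast
    then show ?thesis unfolding u_up using upper_envelope_ge[OF p, of r u Mx] by blast
  qed
  have up_le: "u_up p \<le> barrier K\<^sub>0 p" if p: "p \<in> spacetime" for p
    unfolding u_up by (rule upper_envelope_le[OF p bc(1) ub])
  have up_ge: "barrier K\<^sub>1 p \<le> u_up p" if p: "p \<in> spacetime" for p
    using wu[OF b1F p] u_le_up[OF p] by simp
  have in_V: "\<exists>r>0. sball p r \<subseteq> V" if "open V" "p \<in> V" for V p
    using nhds_sball[OF eventually_nhds_in_open[OF that]] by blast
  have up_sub: "sub_ineq u_up"
  proof (rule perron_sub_ineq)
    show "usc_on spacetime w \<and> sub_ineq w" if "w \<in> \<F>" for w using that by (simp add: F_iff)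
    show "w q \<le> u_up q" if "w \<in> \<F>" "q \<in> spacetime" for w q using wu[OF that] u_le_up[OF that(2)] by simp
    fix p c V assume p: "p \<in> spacetime" and c: "c < u_up p" and V: "open V" "p \<in> V"
    obtain r where r: "r > 0" "sball p r \<subseteq> V" using in_V[OF V] by blast
    obtain r0 Mx where r0: "r0 > 0" "\<And>q. q \<in> sball p r0 \<Longrightarrow> u q \<le> Mx" using u_bd[OF p] by blast
    obtain q where q: "q \<in> sball p r" "c < u q" using upper_envelope_char(3)[OF p r0 c[unfolded u_up] r(1)] by blast
    have qs: "q \<in> spacetime" using q(1) by (auto simp: sball_simps mem_Times_iff)
    have "\<F> \<noteq> {}" using b1F by blast
    from less_cSUP_iff[OF this bdd[OF qs], of c] obtain w where "w \<in> \<F>" "c < w q" using q(2) unfolding u by blast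
    then show "\<exists>q\<in>V \<inter> spacetime. \<exists>w\<in>\<F>. c < w q" using q(1) qs r(2) by blast
  qed
  have sub: "viscosity_subsolution \<A> N H h u_up" unfolding viscosity_subsolution_iff
    using up_usc up_sub up_le by (force simp: barrier_def)
  have nu_le: "- u_up q \<le> - barrier K\<^sub>1 q" if "q \<in> spacetime" for q using up_ge[OF that] by simp
  have nb_usc: "usc_on spacetime (\<lambda>q. - barrier K\<^sub>1 q)" using bc(2)[of K\<^sub>1] by (simp add: usc_on_iff_lsc_on_minus)
  have nu_bd: "\<exists>r>0. \<exists>Mx. \<forall>q\<in>sball p r. - u_up q \<le> Mx" if p: "p \<in> spacetime" for p
  proof -
    have "\<forall>\<^sub>F q in nhds p. q \<in> spacetime \<longrightarrow> - barrier K\<^sub>1 q < - barrier K\<^sub>1 p + 1" by (rule usc_on_nhds[OF nb_usc p]) simp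
    from nhds_sball[OF this] obtain r where r: "r > 0" "\<forall>q\<in>sball p r. q \<in> spacetime \<longrightarrow> - barrier K\<^sub>1 q < - barrier K\<^sub>1 p + 1" by blast
    have "- u_up q \<le> - barrier K\<^sub>1 p + 1" if "q \<in> sball p r" for q
    proof -
      have "q \<in> spacetime" using that by (auto simp: sball_simps mem_Times_iff)
      then show ?thesis using nu_le[of q] r(2) that by force
    qed
    then show ?thesis using r(1) by blast
  qed
  \<comment> \<open>The lower envelope is read as minus an upper envelope, so that one set of
    envelope facts serves both; the lower barrier provides the local bounds needed for this.\<close>
  let ?E = "upper_envelope \<A> N (\<lambda>q. - u_up q)"
  have low_eq: "u_up_low p = - ?E p" if p: "p \<in> spacetime" for p
  proof -
    obtain r Mx where r: "r > 0" "\<And>q. q \<in> sball p r \<Longrightarrow> - u_up q \<le> Mx" using nu_bd[OF p] by blast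
    have "- Mx \<le> u_up q" if "q \<in> sball p r" for q using r(2)[OF that] by simp
    then show ?thesis unfolding u_up_low by (rule lower_envelope_uminus[OF p r(1)])
  qed
  have low_lsc: "lsc_on spacetime u_up_low"
  proof (rule lsc_on_cong)
    show "lsc_on spacetime (\<lambda>q. - ?E q)" using usc_upper_envelope[OF nu_bd] by (simp add: usc_on_iff_lsc_on_minus)
  qed (simp add: low_eq)
  have low_le: "u_up_low p \<le> u_up p" if p: "p \<in> spacetime" for p
  proof -
    obtain r Mx where "r > 0" "\<forall>q\<in>sball p r. - u_up q \<le> Mx" using nu_bd[OF p] by blast
    then have "- u_up p \<le> ?E p" using upper_envelope_ge[OF p, of r "\<lambda>q. - u_up q" Mx] by blast
    then show ?thesis using low_eq[OF p] by simp
  qed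
  \<comment> \<open>A continuous lower bound passes to the lower envelope, and at time 0 it reads
    \<open>h\<close>; this is the initial condition for the supersolution.\<close>
  have low_ge: "barrier K\<^sub>1 p \<le> u_up_low p" if p: "p \<in> spacetime" for p
    using upper_envelope_le[OF p nb_usc nu_le] low_eq[OF p] by simp
  have low_super: "super_ineq u_up_low"
  proof (rule perron_super_ineq[OF up_usc up_sub low_le up_le])
    fix p c V assume p: "p \<in> spacetime" and c: "u_up_low p < c" and V: "open V" "p \<in> V"
    obtain r where r: "r > 0" "sball p r \<subseteq> V" using in_V[OF V] by blast
    obtain r0 Mx where r0: "r0 > 0" "\<And>q. q \<in> sball p r0 \<Longrightarrow> - u_up q \<le> Mx" using nu_bd[OF p] by blast
    have "- c < ?E p" using c low_eq[OF p] by simp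
    from upper_envelope_char(3)[OF p r0 this r(1)] obtain q where q: "q \<in> sball p r" "- c < - u_up q" by blast
    have qs: "q \<in> spacetime" using q(1) by (auto simp: sball_simps mem_Times_iff)
    show "\<exists>q\<in>V \<inter> spacetime. u_up q < c" using q qs r(2) by auto
  next
    fix w and q :: "real \<times> 'm" assume w: "usc_on spacetime w" "sub_ineq w" "\<And>q :: real \<times> 'm. q \<in> spacetime \<Longrightarrow> u_up q \<le> w q \<and> w q \<le> barrier K\<^sub>0 q"
      and q: "q \<in> spacetime"
    \<comment> \<open>A competitor above \<open>u_up\<close> inherits the lower barrier, so it
      belongs to the family and lies below its supremum, hence below \<open>u_up\<close>.\<close>
    have "barrier K\<^sub>1 (t, x) \<le> w (t, x)" if "t > 0" for t x using up_ge[of "(t, x)"] w(3)[of "(t, x)"] that by simp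
    then have "w \<in> \<F>" unfolding F_iff using w by blast
    then show "w q \<le> u_up q" using wu[of w q] u_le_up[OF q] q by simp
  qed
  have super: "viscosity_supersolution \<A> N H h u_up_low" unfolding viscosity_supersolution_iff
    using low_lsc low_super low_ge by (force simp: barrier_def)
  have cont: "(\<forall>p\<in>spacetime. u_up p = u_up_low p) \<and> viscosity_solution \<A> N H h u_up" if c: "continuous_on spacetime u_up"
  proof -
    have "usc_on spacetime (\<lambda>q. - u_up q)" using continuous_imp_usc_lsc(2)[OF c] by (simp add: usc_on_iff_lsc_on_minus)
    then have "?E p \<le> - u_up p" if "p \<in> spacetime" for p by (rule upper_envelope_le[OF that]) simp
    from this low_eq low_le have eq: "u_up_low p = u_up p" if "p \<in> spacetime" for p using that by (smt (verit))
    have "viscosity_supersolution \<A> N H h u_up" unfolding viscosity_supersolution_iff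
      using continuous_imp_usc_lsc(2)[OF c] super_ineq_cong[OF low_super eq] up_ge by (force simp: barrier_def)
    then show ?thesis using eq sub by (simp add: viscosity_solution_def)
  qed
  have unique: "viscosity_solution \<A> N H h u_up \<and> bounded_on_strips u_up \<and>
      (\<forall>v. viscosity_solution \<A> N H h v \<and> bounded_on_strips v \<longrightarrow> (\<forall>p\<in>spacetime. v p = u_up p))"
    if lip: "locally_lipschitz \<A> N u_up"
  proof -
    have sol: "viscosity_solution \<A> N H h u_up" using cont[OF locally_lipschitz_continuous[OF lip]] by blast
    obtain B where B: "\<And>x. \<bar>h x\<bar> \<le> B" using h_bounded by (auto simp: bounded_iff)
    have bs: "bounded_on_strips u_up" unfolding bounded_on_strips_def
    proof (intro allI impI)
      fix T :: real assume "T > 0"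
      have "\<bar>u_up q\<bar> \<le> (\<bar>K\<^sub>0\<bar> + \<bar>K\<^sub>1\<bar>) * T + B" if q: "q \<in> {0..<T} \<times> UNIV" for q
      proof -
        have qs: "q \<in> spacetime" and t: "0 \<le> fst q" "fst q \<le> T" using q by (auto simp: mem_Times_iff)
        have K: "\<bar>K * fst q\<bar> \<le> \<bar>K\<bar> * T" for K using t by (simp add: abs_mult mult_left_mono)
        have "0 \<le> \<bar>K\<^sub>0\<bar> * T" "0 \<le> \<bar>K\<^sub>1\<bar> * T" using \<open>T > 0\<close> by auto
        moreover have "u_up q \<le> - (K\<^sub>0 * fst q) + h (snd q)" "- (K\<^sub>1 * fst q) + h (snd q) \<le> u_up q"
          using up_le[OF qs] up_ge[OF qs] by (simp_all add: barrier_def)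
        ultimately show ?thesis using K[of K\<^sub>0] K[of K\<^sub>1] B[of "snd q"] unfolding distrib_right by linarith
      qed
      then show "bounded (u_up ` ({0..<T} \<times> UNIV))" unfolding bounded_iff by (metis (no_types, lifting) imageE real_norm_def)
    qed
    \<comment> \<open>In one comparison the locally Lipschitz function \<open>u_up\<close> is the
      supersolution, in the other the subsolution; \<open>v\<close> has no regularity beyond
      semicontinuity on the side used, which is why the comparison asks for one Lipschitz function
      on either side.\<close>
    have "v p = u_up p" if v: "viscosity_solution \<A> N H h v" "bounded_on_strips v" and p: "p \<in> spacetime" for v p
    proof (rule order_antisym)
      have vv: "usc_on spacetime v" "sub_ineq v" "\<And>x. v (0, x) \<le> h x" "lsc_on spacetime v" "super_ineq v" "\<And>x. h x \<le> v (0, x)"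
        and uu: "lsc_on spacetime u_up" "super_ineq u_up" "\<And>x. h x \<le> u_up (0, x)" "\<And>x. u_up (0, x) \<le> h x"
        using v(1) sol unfolding viscosity_solution_def viscosity_subsolution_iff viscosity_supersolution_iff by auto
      show "v p \<le> u_up p"
        by (rule comparison[OF complete H_A vv(1,2) uu(1,2) order_trans[OF vv(3) uu(3)] v(2) bs disjI2[OF lip] p])
      show "u_up p \<le> v p"
        by (rule comparison[OF complete H_A up_usc up_sub vv(4,5) order_trans[OF uu(4) vv(6)] bs v(2) disjI1[OF lip] p])
    qed
    then show ?thesis using sol bs by blast
  qed
  show ?thesis using sub super cont unique by blast
qed

end
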